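(* Let $k>0$, $R_0>0$, $N\in\mathbb{N}$ and $R_*>R_0$ be fixed, and let $$f(\omega)=\sum_{n=-N}^{N} f_n e^{in\omega},\qquad \omega\in[0,2\pi],$$ with complex coefficients $f_n$, be regarded as a function on $\partial B_{R_0}$. Let $\psi$ be the outgoing solution of the exterior Helmholtz problem in $\mathbb{R}^2\setminus\overline{B}_{R_0}$ with Dirichlet datum $f$, and, for $R>R_0$, let $u_{\mathcal{A}_R}$ be the minimizer of $$J_R(u)=\int_{\mathcal{A}_R}\Big|\nabla u-iku\frac{x}{|x|}\Big|^2dx$$ among all $u\in H^1(\mathcal{A}_R)$ satisfying $\Delta u+k^2u=0$ in $\mathcal{A}_R$ and $u=f$ on $\partial B_{R_0}$. Then $$\|\psi-u_{\mathcal{A}_R}\|_{H^1(\mathcal{A}_{R_*})}=O(R^{-1})\quad\text{and}\quad \|\psi-u_{\mathcal{A}_R}\|_{H^1(\mathcal{A}_{R})}=O(R^{-1/2}),\qquad\text{as } R\to+\infty.$$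
   Context: $B_R\subset\mathbb{R}^2$ is the open disc of radius $R$ centered at the origin and $\mathcal{A}_R:=B_R\setminus\overline{B}_{R_0}$ for $R>R_0$. Polar coordinates are $x=r(\cos\omega,\sin\omega)$, $r=|x|$. All functions are complex-valued. No condition is imposed on $\partial B_R$ in the minimization problem; for each $R>R_0$ the minimizer $u_{\mathcal{A}_R}$ exists and is unique (known result). The outgoing solution $\psi$ is the unique solution of $$\Delta\psi+k^2\psi=0\ \text{ in }\mathbb{R}^2\setminus\overline{B}_{R_0},\qquad \psi=f\ \text{ on }\partial B_{R_0},\qquad \lim_{r\to+\infty}r^{1/2}\Big(\frac{\partial\psi}{\partial r}-ik\psi\Big)=0 .$$ *)

theory Defs
  imports "HOL-Analysis.Analysis" "HOL-Library.Landau_Symbols"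
begin

definition partial_deriv :: "'n::finite \<Rightarrow> (real^'n \<Rightarrow> complex) \<Rightarrow> real^'n \<Rightarrow> complex" where
  "partial_deriv i g x = frechet_derivative g (at x) (axis i 1)"

definition laplacian :: "(real^'n::finite \<Rightarrow> complex) \<Rightarrow> real^'n \<Rightarrow> complex" where
  "laplacian g x = (\<Sum>i\<in>UNIV. partial_deriv i (partial_deriv i g) x)"

text \<open>The class \<open>C\<^sup>m(U)\<close>, meant for open \<open>U\<close> (the derivatives are two-sided).\<close>

primrec Ck_on :: "nat \<Rightarrow> (real^'n::finite) set \<Rightarrow> (real^'n \<Rightarrow> complex) \<Rightarrow> bool" where
  "Ck_on 0 U g \<longleftrightarrow> continuous_on U g"
| "Ck_on (Suc m) U g \<longleftrightarrow>
     (\<forall>x\<in>U. g differentiable at x) \<and> (\<forall>i. Ck_on m U (partial_deriv i g))"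

definition smooth_on_open :: "(real^'n::finite) set \<Rightarrow> (real^'n \<Rightarrow> complex) \<Rightarrow> bool" where
  "smooth_on_open U g \<longleftrightarrow> open U \<and> (\<forall>m. Ck_on m U g)"

definition test_functions :: "(real^'n::finite) set \<Rightarrow> (real^'n \<Rightarrow> complex) set" where
  "test_functions \<Omega> =
     {\<phi>. smooth_on_open UNIV \<phi> \<and>
         compact (closure {x. \<phi> x \<noteq> 0}) \<and> closure {x. \<phi> x \<noteq> 0} \<subseteq> \<Omega>}"

text \<open>
  Elements of the function spaces below are total functions representing their class modulo
  equality almost everywhere on \<open>\<Omega>\<close>; the values outside \<open>\<Omega>\<close> play no role.
\<close>

definition L2 :: "(real^'n::finite) set \<Rightarrow> (real^'n \<Rightarrow> complex) set" where
  "L2 \<Omega> = {u \<in> borel_measurable (lebesgue_on \<Omega>).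
             integrable (lebesgue_on \<Omega>) (\<lambda>x. (norm (u x))\<^sup>2)}"

definition L1_loc :: "(real^'n::finite) set \<Rightarrow> (real^'n \<Rightarrow> complex) set" where
  "L1_loc \<Omega> = {u. \<forall>K. compact K \<and> K \<subseteq> \<Omega> \<longrightarrow> integrable (lebesgue_on K) u}"

definition has_weak_grad ::
    "(real^'n::finite) set \<Rightarrow> (real^'n \<Rightarrow> complex) \<Rightarrow> (real^'n \<Rightarrow> complex^'n) \<Rightarrow> bool" where
  "has_weak_grad \<Omega> u G \<longleftrightarrow>
     u \<in> L1_loc \<Omega> \<and>
     (\<forall>i. (\<lambda>x. G x $ i) \<in> L1_loc \<Omega> \<and>
          (\<forall>\<phi>\<in>test_functions \<Omega>.
             (LINT x|lebesgue_on \<Omega>. u x * partial_deriv i \<phi> x)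
               = - (LINT x|lebesgue_on \<Omega>. G x $ i * \<phi> x)))"

text \<open>The weak gradient is unique up to null sets, so the choice below is immaterial.\<close>

definition weak_grad ::
    "(real^'n::finite) set \<Rightarrow> (real^'n \<Rightarrow> complex) \<Rightarrow> real^'n \<Rightarrow> complex^'n" where
  "weak_grad \<Omega> u = (SOME G. has_weak_grad \<Omega> u G)"

definition H1 :: "(real^'n::finite) set \<Rightarrow> (real^'n \<Rightarrow> complex) set" where
  "H1 \<Omega> = {u \<in> L2 \<Omega>. \<exists>G. has_weak_grad \<Omega> u G \<and> (\<forall>i. (\<lambda>x. G x $ i) \<in> L2 \<Omega>)}"

text \<open>Only meaningful for \<open>u \<in> H1 \<Omega>\<close>.\<close>

definition H1_norm :: "(real^'n::finite) set \<Rightarrow> (real^'n \<Rightarrow> complex) \<Rightarrow> real" where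
  "H1_norm \<Omega> u =
     sqrt ((LINT x|lebesgue_on \<Omega>. (norm (u x))\<^sup>2)
         + (LINT x|lebesgue_on \<Omega>. (norm (weak_grad \<Omega> u x))\<^sup>2))"

text \<open>\<open>\<Delta>u + k\<^sup>2u = 0\<close> in \<open>\<Omega>\<close> in the sense of distributions.\<close>

definition weak_helmholtz :: "real \<Rightarrow> (real^'n::finite) set \<Rightarrow> (real^'n \<Rightarrow> complex) \<Rightarrow> bool" where
  "weak_helmholtz k \<Omega> u \<longleftrightarrow>
     u \<in> L1_loc \<Omega> \<and>
     (\<forall>\<phi>\<in>test_functions \<Omega>.
        (LINT x|lebesgue_on \<Omega>. u x * (laplacian \<phi> x + (of_real k)\<^sup>2 * \<phi> x)) = 0)"

definition polar :: "real \<Rightarrow> real \<Rightarrow> real^2" where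
  "polar r \<omega> = vector [r * cos \<omega>, r * sin \<omega>]"

definition annulus :: "real \<Rightarrow> real \<Rightarrow> (real^2) set" where
  "annulus R0 R = ball 0 R - cball 0 R0"

text \<open>
  The trace of \<open>u \<in> H1 \<Omega>\<close> on the circle of radius \<open>r\<close>, a component of the boundary of \<open>\<Omega>\<close>, is
  given by \<open>g\<close>, a function of the polar angle. As usual the trace operator is the extension by
  continuity, from \<open>H1 \<Omega>\<close> to \<open>L\<^sup>2\<close> of the circle, of the restriction map on functions that are
  smooth up to the boundary.
\<close>

definition has_trace_on_circle ::
    "(real^2) set \<Rightarrow> real \<Rightarrow> (real^2 \<Rightarrow> complex) \<Rightarrow> (real \<Rightarrow> complex) \<Rightarrow> bool" where
  "has_trace_on_circle \<Omega> r u g \<longleftrightarrow>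
     (\<exists>v :: nat \<Rightarrow> real^2 \<Rightarrow> complex.
        (\<forall>j. v j \<in> H1 \<Omega> \<and> (\<exists>U. closure \<Omega> \<subseteq> U \<and> smooth_on_open U (v j))) \<and>
        (\<lambda>j. H1_norm \<Omega> (\<lambda>x. v j x - u x)) \<longlonglongrightarrow> 0 \<and>
        (\<lambda>j. LINT \<omega>|lebesgue_on {0..2*pi}. (norm (v j (polar r \<omega>) - g \<omega>))\<^sup>2) \<longlonglongrightarrow> 0)"

definition admissible ::
    "real \<Rightarrow> real \<Rightarrow> real \<Rightarrow> (real \<Rightarrow> complex) \<Rightarrow> (real^2 \<Rightarrow> complex) set" where
  "admissible k R0 R f =
     {u \<in> H1 (annulus R0 R).
        weak_helmholtz k (annulus R0 R) u \<and> has_trace_on_circle (annulus R0 R) R0 u f}"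

definition J :: "real \<Rightarrow> real \<Rightarrow> real \<Rightarrow> (real^2 \<Rightarrow> complex) \<Rightarrow> real" where
  "J k R0 R u =
     (LINT x|lebesgue_on (annulus R0 R).
        (norm (\<chi> i. weak_grad (annulus R0 R) u x $ i
                    - \<i> * of_real k * u x * of_real (x $ i / norm x)))\<^sup>2)"

definition is_minimizer ::
    "real \<Rightarrow> real \<Rightarrow> real \<Rightarrow> (real \<Rightarrow> complex) \<Rightarrow> (real^2 \<Rightarrow> complex) \<Rightarrow> bool" where
  "is_minimizer k R0 R f u \<longleftrightarrow>
     u \<in> admissible k R0 R f \<and> (\<forall>v\<in>admissible k R0 R f. J k R0 R u \<le> J k R0 R v)"

text \<open>
  Classical solutions; the radiation condition holds uniformly with respect to the direction.
\<close>

definition outgoing_solution ::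
    "real \<Rightarrow> real \<Rightarrow> (real \<Rightarrow> complex) \<Rightarrow> (real^2 \<Rightarrow> complex) \<Rightarrow> bool" where
  "outgoing_solution k R0 f \<psi> \<longleftrightarrow>
     Ck_on 2 (- cball 0 R0) \<psi> \<and> continuous_on (- ball 0 R0) \<psi> \<and>
     (\<forall>x\<in>- cball 0 R0. laplacian \<psi> x + (of_real k)\<^sup>2 * \<psi> x = 0) \<and>
     (\<forall>\<omega>\<in>{0..2*pi}. \<psi> (polar R0 \<omega>) = f \<omega>) \<and>
     uniform_limit {0..2*pi}
       (\<lambda>r \<omega>. of_real (sqrt r) *
          (vector_derivative (\<lambda>s. \<psi> (polar s \<omega>)) (at r) - \<i> * of_real k * \<psi> (polar r \<omega>)))
       (\<lambda>\<omega>. 0) at_top"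

definition trig_poly :: "nat \<Rightarrow> (int \<Rightarrow> complex) \<Rightarrow> real \<Rightarrow> complex" where
  "trig_poly N c \<omega> = (\<Sum>n = - int N..int N. c n * exp (\<i> * of_int n * of_real \<omega>))"

end

theory Submission imports Defs begin

text \<open>
  Both functions are finite sums of angular modes, and the comparison is made mode by mode. The
  outgoing solution is \<open>\<psi> = \<Sum> x\<^sub>n(r) e\<^sup>i\<^sup>n\<^sup>\<omega>\<close> with radial coefficients solving Bessel's equation
  (\<open>outgoing_solution_expansion\<close>). What matters about \<open>x\<^sub>n\<close> follows
  from energy and flux arguments: it is \<open>O(r\<^sup>-\<^sup>1\<^sup>/\<^sup>2)\<close> (\<open>bessel_sol_bounded\<close>), it vanishes if its flux does
  (\<open>outgoing_zero_flux_imp_zero\<close>), and \<open>x\<^sub>n' - i k x\<^sub>n\<close> is \<open>O(r\<^sup>-\<^sup>3\<^sup>/\<^sup>2)\<close> (\<open>outgoing_decay\<close>).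

  The minimizer on the annulus of radius \<open>R\<close> is guessed in the form \<open>v = \<Sum> (x\<^sub>n - a\<^sub>n f\<^sub>n) e\<^sup>i\<^sup>n\<^sup>\<omega>\<close>, where \<open>f\<^sub>n\<close> is a
  real-valued solution of the radial equation with \<open>f\<^sub>n(R0) = 0\<close>. Criticality of \<open>v\<close> asks for the solvability of
  an adjoint radial problem, which has one boundary condition too many. Its general solution is
  explicit, so solvability becomes a single linear equation for \<open>a\<^sub>n\<close>, with bounded right-hand side and a
  coefficient that grows like \<open>R\<close>. Hence \<open>a\<^sub>n = O(1/R)\<close> (\<open>corrector_exists\<close>).

  That \<open>v\<close> agrees with the minimizer \<open>u\<close> is seen directly (\<open>minimizer_eq_modes\<close>). For \<open>h = u - v\<close> the
  flux fields \<open>\<nabla>h - i k h x/\<bar>x\<bar>\<close> and \<open>\<nabla>v - i k v x/\<bar>x\<bar>\<close> are orthogonal (\<open>matched_mode_orthogonal\<close>), so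
  \<open>J u\<close> is \<open>J v\<close> plus the squared norm of the former; by minimality \<open>\<nabla>h = i k h x/\<bar>x\<bar>\<close>, and the Helmholtz
  equation then forces \<open>h = 0\<close> (\<open>outgoing_gradient_imp_zero\<close>).

  Consequently \<open>\<psi> - u = \<Sum> a\<^sub>n f\<^sub>n e\<^sup>i\<^sup>n\<^sup>\<omega>\<close>. With \<open>f\<^sub>n\<close> and its derivative of size \<open>r\<^sup>-\<^sup>1\<^sup>/\<^sup>2\<close>, the \<open>H\<^sup>1\<close> norm on the
  annulus of outer radius \<open>R'\<close> is \<open>O(R'\<^sup>1\<^sup>/\<^sup>2 / R)\<close> (\<open>modes_estimate\<close>), which gives the two rates for fixed
  \<open>R'\<close> and for \<open>R' = R\<close>.\<close>

section \<open>Calculus of continuously differentiable functions\<close>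

lemma partial_deriv_eqI:
  assumes "(g has_derivative g') (at x)"
  shows "partial_deriv i g x = g' (axis i 1)"
  using frechet_derivative_at[OF assms] by (simp add: partial_deriv_def)

lemma partial_deriv_cong:
  assumes "open U" "x \<in> U" "\<And>y. y \<in> U \<Longrightarrow> f y = g y"
  shows "partial_deriv i f x = partial_deriv i g x"
proof -
  have "(f has_derivative D) (at x) \<longleftrightarrow> (g has_derivative D) (at x)" for D
    using has_derivative_transform_within_open[OF _ assms(1,2), of f D UNIV g]
      has_derivative_transform_within_open[OF _ assms(1,2), of g D UNIV f] assms(3) by auto
  then show ?thesis by (simp add: partial_deriv_def frechet_derivative_def)
qed

lemma differentiable_cong_open:
  assumes "open U" "x \<in> U" "\<And>y. y \<in> U \<Longrightarrow> f y = g y"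
  shows "f differentiable (at x) \<longleftrightarrow> g differentiable (at x)"
  unfolding differentiable_def
  using assms by (metis has_derivative_transform_within_open)

lemma partial_deriv_add:
  assumes "f differentiable (at x)" "g differentiable (at x)"
  shows "partial_deriv i (\<lambda>x. f x + g x) x = partial_deriv i f x + partial_deriv i g x"
  using partial_deriv_eqI[OF has_derivative_add[OF assms[unfolded frechet_derivative_works]]]
  by (simp add: partial_deriv_def)

lemma partial_deriv_mult:
  assumes "f differentiable (at x)" "g differentiable (at x)"
  shows "partial_deriv i (\<lambda>x. f x * g x) x = f x * partial_deriv i g x + partial_deriv i f x * g x"
  using partial_deriv_eqI[OF has_derivative_mult[OF assms[unfolded frechet_derivative_works]]]
  by (simp add: partial_deriv_def)

lemma partial_deriv_const [simp]: "partial_deriv i (\<lambda>_. c) x = 0"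
  using partial_deriv_eqI[of "\<lambda>_. c" "\<lambda>_. 0"] by simp

lemma Ck_on_cong:
  assumes "open U" "\<And>x. x \<in> U \<Longrightarrow> f x = g x"
  shows "Ck_on m U f \<longleftrightarrow> Ck_on m U g"
  using assms(2)
proof (induction m arbitrary: f g)
  case 0
  then show ?case by (auto cong: continuous_on_cong)
next
  case (Suc m)
  have "Ck_on m U (partial_deriv i f) \<longleftrightarrow> Ck_on m U (partial_deriv i g)" for i
    using partial_deriv_cong[OF assms(1) _ Suc.prems] by (intro Suc.IH)
  moreover have "f differentiable (at x) \<longleftrightarrow> g differentiable (at x)" if "x \<in> U" for x
    using differentiable_cong_open[OF assms(1) that Suc.prems] .
  ultimately show ?case by simp
qed

lemma Ck_on_SucD: "Ck_on (Suc m) U g \<Longrightarrow> Ck_on m U g"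
proof (induction m arbitrary: g)
  case 0
  then show ?case
    by (simp add: differentiable_imp_continuous_on differentiable_on_def differentiable_at_withinI)
next
  case (Suc m)
  then show ?case by simp
qed

lemma Ck_on_le: "Ck_on m U g \<Longrightarrow> j \<le> m \<Longrightarrow> Ck_on j U g"
  by (induction m) (auto simp del: Ck_on.simps simp: le_Suc_eq dest: Ck_on_SucD)

lemma Ck_on_continuous: "Ck_on m U g \<Longrightarrow> continuous_on U g"
  using Ck_on_le[of m U g 0] by simp

lemma Ck_on_subset: "Ck_on m U g \<Longrightarrow> V \<subseteq> U \<Longrightarrow> Ck_on m V g"
  by (induction m arbitrary: g) (auto intro: continuous_on_subset)

lemma Ck_on_Un:
  assumes "open U" "open V"
  shows "Ck_on m U g \<Longrightarrow> Ck_on m V g \<Longrightarrow> Ck_on m (U \<union> V) g"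
  using assms by (induction m arbitrary: g) (auto intro: continuous_on_open_Un)

lemma Ck_on_const: "Ck_on m U (\<lambda>_. c)"
proof (induction m arbitrary: c)
  case (Suc m)
  have *: "partial_deriv i (\<lambda>_. c) = (\<lambda>_. 0)" for i :: 'a by (rule ext) simp
  show ?case using Suc by (simp add: *)
qed simp

lemma Ck_on_add:
  assumes "open U"
  shows "Ck_on m U f \<Longrightarrow> Ck_on m U g \<Longrightarrow> Ck_on m U (\<lambda>x. f x + g x)"
proof (induction m arbitrary: f g)
  case 0
  then show ?case by (auto intro: continuous_on_add)
next
  case (Suc m)
  have "Ck_on m U (partial_deriv i (\<lambda>x. f x + g x))" for i
    using Suc Ck_on_cong[OF assms, of "partial_deriv i (\<lambda>x. f x + g x)" "\<lambda>x. partial_deriv i f x + partial_deriv i g x" m]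
    by (simp add: partial_deriv_add)
  with Suc.prems show ?case by auto
qed

lemma Ck_on_mult:
  assumes "open U"
  shows "Ck_on m U f \<Longrightarrow> Ck_on m U g \<Longrightarrow> Ck_on m U (\<lambda>x. f x * g x)"
proof (induction m arbitrary: f g)
  case 0
  then show ?case by (auto intro: continuous_on_mult)
next
  case (Suc m)
  have "Ck_on m U f" "Ck_on m U g" using Suc.prems by (blast dest: Ck_on_SucD)+
  then have "Ck_on m U (\<lambda>x. f x * partial_deriv i g x + partial_deriv i f x * g x)" for i
    using Suc by (intro Ck_on_add[OF assms]) auto
  then have "Ck_on m U (partial_deriv i (\<lambda>x. f x * g x))" for i
    using Suc.prems Ck_on_cong[OF assms, of "partial_deriv i (\<lambda>x. f x * g x)" "\<lambda>x. f x * partial_deriv i g x + partial_deriv i f x * g x" m]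
    by (simp add: partial_deriv_mult)
  with Suc.prems show ?case by auto
qed

lemma Ck_on_minus:
  assumes "open U" "Ck_on m U f" shows "Ck_on m U (\<lambda>x. - f x)"
  using Ck_on_mult[OF assms(1) Ck_on_const[of m U "-1"] assms(2)] by simp

lemma Ck_on_diff:
  assumes "open U" "Ck_on m U f" "Ck_on m U g" shows "Ck_on m U (\<lambda>x. f x - g x)"
  using Ck_on_add[OF assms(1,2) Ck_on_minus[OF assms(1,3)]] by simp

lemma Ck_on_sum:
  assumes "open U" "\<And>a. a \<in> A \<Longrightarrow> Ck_on m U (f a)"
  shows "Ck_on m U (\<lambda>x. \<Sum>a\<in>A. f a x)"
proof (cases "finite A")
  case True
  then show ?thesis using assms(2)
    by (induction A rule: finite_induct) (auto intro!: Ck_on_add[OF assms(1)] Ck_on_const)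
qed (simp add: Ck_on_const)

text \<open>The radial coefficient functions live on an interval, where the multivariate class has no
  direct counterpart; this is the class that products with \<open>e\<^sup>i\<^sup>n\<^sup>\<omega>\<close> turn into functions of the plane.\<close>

primrec Ck_line :: "nat \<Rightarrow> real set \<Rightarrow> (real \<Rightarrow> complex) \<Rightarrow> bool" where
  "Ck_line 0 S p \<longleftrightarrow> continuous_on S p"
| "Ck_line (Suc m) S p \<longleftrightarrow>
     (\<exists>p'. (\<forall>r\<in>S. (p has_vector_derivative p' r) (at r)) \<and> Ck_line m S p')"

lemma Ck_line_SucD: "Ck_line (Suc m) S p \<Longrightarrow> Ck_line m S p"
proof (induction m arbitrary: p)
  case 0
  then show ?case
    by (auto intro!: continuous_at_imp_continuous_on dest: has_vector_derivative_continuous)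
next
  case (Suc m)
  then show ?case by (metis Ck_line.simps(2))
qed

lemma Ck_line_subset: "Ck_line m S p \<Longrightarrow> T \<subseteq> S \<Longrightarrow> Ck_line m T p"
proof (induction m arbitrary: p)
  case 0 then show ?case by (auto intro: continuous_on_subset)
next
  case (Suc m)
  then obtain p' where "\<forall>r\<in>S. (p has_vector_derivative p' r) (at r)" "Ck_line m S p'" by auto
  with Suc show ?case by (auto intro!: exI[of _ p'])
qed

lemma Ck_line_const: "Ck_line m S (\<lambda>_. c)"
  by (induction m arbitrary: c) (auto intro!: exI[of _ "\<lambda>_. 0"])

lemma Ck_line_add: "Ck_line m S p \<Longrightarrow> Ck_line m S q \<Longrightarrow> Ck_line m S (\<lambda>r. p r + q r)"
proof (induction m arbitrary: p q)
  case 0 then show ?case by (auto intro: continuous_on_add)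
next
  case (Suc m)
  then obtain p' q' where "\<forall>r\<in>S. (p has_vector_derivative p' r) (at r)" "Ck_line m S p'"
    "\<forall>r\<in>S. (q has_vector_derivative q' r) (at r)" "Ck_line m S q'" by auto
  then show ?case using Suc.IH by (auto intro!: exI[of _ "\<lambda>r. p' r + q' r"] has_vector_derivative_add)
qed

lemma Ck_line_mult: "Ck_line m S p \<Longrightarrow> Ck_line m S q \<Longrightarrow> Ck_line m S (\<lambda>r. p r * q r)"
proof (induction m arbitrary: p q)
  case 0 then show ?case by (auto intro: continuous_on_mult)
next
  case (Suc m)
  then obtain p' q' where *: "\<forall>r\<in>S. (p has_vector_derivative p' r) (at r)" "Ck_line m S p'"
    "\<forall>r\<in>S. (q has_vector_derivative q' r) (at r)" "Ck_line m S q'" by auto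
  moreover have "Ck_line m S p" "Ck_line m S q" using Suc.prems by (blast dest: Ck_line_SucD)+
  ultimately have "Ck_line m S (\<lambda>r. p r * q' r + p' r * q r)" using Suc.IH by (intro Ck_line_add) auto
  with * show ?case
    by (auto intro!: exI[of _ "\<lambda>r. p r * q' r + p' r * q r"] has_vector_derivative_mult)
qed

lemma Ck_line_minus: "Ck_line m S p \<Longrightarrow> Ck_line m S (\<lambda>r. - p r)"
  using Ck_line_mult[OF Ck_line_const[of m S "-1"], of p] by simp

lemma Ck_line_diff: "Ck_line m S p \<Longrightarrow> Ck_line m S q \<Longrightarrow> Ck_line m S (\<lambda>r. p r - q r)"
  using Ck_line_add[OF _ Ck_line_minus, of m S p q] by simp

lemma Ck_line_power: "Ck_line m S p \<Longrightarrow> Ck_line m S (\<lambda>r. p r ^ j)"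
  by (induction j) (auto intro!: Ck_line_mult Ck_line_const)

lemma Ck_line_affine:
  "Ck_line m S p \<Longrightarrow> Ck_line m {r. a * r + b \<in> S} (\<lambda>r. p (a * r + b))"
proof (induction m arbitrary: p)
  case 0 then show ?case
    by (auto intro!: continuous_on_compose2[of S p] continuous_intros)
next
  case (Suc m)
  then obtain p' where *: "\<And>r. r\<in>S \<Longrightarrow> (p has_vector_derivative p' r) (at r)" "Ck_line m S p'" by auto
  have "((\<lambda>r. p (a * r + b)) has_vector_derivative (of_real a * p' (a * r + b))) (at r)"
    if "a * r + b \<in> S" for r
  proof -
    have "((\<lambda>r. a * r + b) has_vector_derivative a) (at r)"
      by (auto simp: has_real_derivative_iff_has_vector_derivative[symmetric] intro!: derivative_eq_intros)
    from vector_diff_chain_at[OF this *(1)[OF that]] show ?thesis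
      by (simp add: o_def scaleR_conv_of_real)
  qed
  moreover have "Ck_line m {r. a * r + b \<in> S} (\<lambda>r. of_real a * p' (a * r + b))"
    using Suc.IH[OF *(2)] by (intro Ck_line_mult Ck_line_const)
  ultimately show ?case by (auto intro!: exI[of _ "\<lambda>r. of_real a * p' (a * r + b)"])
qed

lemma Ck_line_of_real: "Ck_line m S (\<lambda>r. of_real r)"
proof (cases m)
  case 0 then show ?thesis by (auto intro: continuous_intros)
next
  case (Suc j)
  have "((\<lambda>r. complex_of_real r) has_vector_derivative 1) (at r)" for r
    using has_vector_derivative_of_real[of "\<lambda>x. x" 1 "at r"] by simp
  with Suc show ?thesis by (auto intro!: exI[of _ "\<lambda>_. 1"] Ck_line_const)
qed

lemma Ck_line_inverse:
  assumes "0 \<notin> S"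
  shows "Ck_line m S (\<lambda>r. inverse (of_real r))"
proof (induction m)
  case 0 then show ?case using assms by (auto intro!: continuous_intros)
next
  case (Suc m)
  have "((\<lambda>r. inverse (complex_of_real r)) has_vector_derivative
          - (inverse (of_real r) * inverse (of_real r))) (at r)" if "r \<in> S" for r
  proof -
    have r: "r \<noteq> 0" using that assms by blast
    have "((\<lambda>r. inverse r) has_real_derivative - (inverse r * inverse r)) (at r)"
      using r DERIV_inverse[of r UNIV] by (simp add: power2_eq_square)
    from has_vector_derivative_of_real[OF this, where 'a=complex] show ?thesis by simp
  qed
  then show ?case using Suc
    by (auto intro!: exI[of _ "\<lambda>r. - (inverse (of_real r) * inverse (of_real r))"]
        Ck_line_minus Ck_line_mult)
qed

lemma partial_deriv_coordinate:
  assumes "(q has_vector_derivative d) (at (x $ i))"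
  shows "(\<lambda>x. q (x $ i)) differentiable (at x)"
    and "partial_deriv j (\<lambda>x. q (x $ i)) x = (if j = i then d else 0)"
proof -
  have "((\<lambda>x. x $ i) has_derivative (\<lambda>y. y $ i)) (at x)"
    by (rule bounded_linear_imp_has_derivative) (rule bounded_linear_vec_nth)
  from has_derivative_compose[OF this assms[unfolded has_vector_derivative_def]]
  have *: "((\<lambda>x. q (x $ i)) has_derivative (\<lambda>y. (y $ i) *\<^sub>R d)) (at x)" .
  then show "(\<lambda>x. q (x $ i)) differentiable (at x)" by (auto simp: differentiable_def)
  show "partial_deriv j (\<lambda>x. q (x $ i)) x = (if j = i then d else 0)"
    by (subst partial_deriv_eqI[OF *]) (auto simp: axis_def)
qed

lemma open_coordinate: "open S \<Longrightarrow> open {x :: real^'n::finite. x $ i \<in> S}"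
proof -
  assume "open S"
  moreover have "continuous_on UNIV (\<lambda>x :: real^'n. x $ i)" by (intro continuous_intros)
  ultimately show ?thesis using open_vimage[of S "\<lambda>x :: real^'n. x $ i"] by (simp add: vimage_def)
qed

lemma Ck_on_coordinate_compose:
  assumes "open S"
  shows "Ck_line m S q \<Longrightarrow> Ck_on m {x :: real^'n::finite. x $ i \<in> S} (\<lambda>x. q (x $ i))"
proof (induction m arbitrary: q)
  case 0 then show ?case
    by (auto intro!: continuous_on_compose2[of S q] continuous_intros)
next
  case (Suc m)
  then obtain q' where *: "\<And>r. r\<in>S \<Longrightarrow> (q has_vector_derivative q' r) (at r)" "Ck_line m S q'" by auto
  have "Ck_on m {x. x $ i \<in> S} (partial_deriv j (\<lambda>x :: real^'n. q (x $ i)))" for j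
  proof -
    have "Ck_on m {x. x $ i \<in> S} (\<lambda>x :: real^'n. if j = i then q' (x $ i) else 0)"
      using Suc.IH[OF *(2)] Ck_on_const[of m _ 0] by (cases "j = i") simp_all
    then show ?thesis
      by (subst Ck_on_cong[OF open_coordinate[OF assms]])
         (auto simp: partial_deriv_coordinate(2)[OF *(1)])
  qed
  then show ?case using *(1) by (auto intro: partial_deriv_coordinate(1))
qed

lemma Ck_on_coordinate: "Ck_on m U (\<lambda>x :: real^'n::finite. complex_of_real (x $ i))"
  using Ck_on_subset[OF Ck_on_coordinate_compose[OF open_UNIV Ck_line_of_real], of U] by simp

lemma partial_deriv_radial:
  fixes x :: "real^'n::finite"
  assumes "(q has_vector_derivative d) (at (norm x))" "x \<noteq> 0"
  shows "(\<lambda>x. q (norm x)) differentiable (at x)"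
    and "partial_deriv j (\<lambda>x. q (norm x)) x = d * of_real (x $ j) * inverse (of_real (norm x))"
proof -
  have "((\<lambda>x. norm x) has_derivative (\<lambda>y. y \<bullet> sgn x)) (at x)"
    using has_derivative_norm[OF assms(2)] by (simp add: inner_commute)
  from has_derivative_compose[OF this assms(1)[unfolded has_vector_derivative_def]]
  have *: "((\<lambda>x. q (norm x)) has_derivative (\<lambda>y. (y \<bullet> sgn x) *\<^sub>R d)) (at x)" .
  then show "(\<lambda>x. q (norm x)) differentiable (at x)" by (auto simp: differentiable_def)
  have "axis j 1 \<bullet> sgn x = x $ j / norm x"
    by (simp add: inner_axis' sgn_div_norm divide_inverse)
  then show "partial_deriv j (\<lambda>x. q (norm x)) x = d * of_real (x $ j) * inverse (of_real (norm x))"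
    by (subst partial_deriv_eqI[OF *]) (simp add: scaleR_conv_of_real divide_inverse)
qed

lemma open_radial: "open S \<Longrightarrow> open {x :: real^'n::finite. norm x \<in> S}"
  using open_vimage[of S "norm :: real^'n \<Rightarrow> real"] by (simp add: vimage_def continuous_on_norm_id)

lemma Ck_on_radial:
  assumes "open S" "S \<subseteq> {0<..}"
  shows "Ck_line m S q \<Longrightarrow> Ck_on m {x :: real^'n::finite. norm x \<in> S} (\<lambda>x. q (norm x))"
proof (induction m arbitrary: q)
  case 0 then show ?case
    by (auto intro!: continuous_on_compose2[of S q] continuous_intros)
next
  case (Suc m)
  note U = open_radial[OF assms(1), where 'n='n]
  from Suc obtain q' where *: "\<And>r. r\<in>S \<Longrightarrow> (q has_vector_derivative q' r) (at r)" "Ck_line m S q'" by auto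
  have ne: "x \<noteq> 0" if "norm x \<in> S" for x :: "real^'n" using that assms(2) by auto
  have "Ck_line m S (\<lambda>r. q' r * inverse (of_real r))"
    using * assms by (intro Ck_line_mult Ck_line_inverse) auto
  then have "Ck_on m {x. norm x \<in> S} (\<lambda>x :: real^'n. (q' (norm x) * inverse (of_real (norm x))) * of_real (x $ j))" for j
    by (intro Ck_on_mult[OF U] Ck_on_coordinate Suc.IH)
  then have "Ck_on m {x. norm x \<in> S} (partial_deriv j (\<lambda>x :: real^'n. q (norm x)))" for j
    by (subst Ck_on_cong[OF U, of _ "\<lambda>x. (q' (norm x) * inverse (of_real (norm x))) * of_real (x $ j)"])
       (auto simp: partial_deriv_radial(2)[OF *(1)] ne)
  moreover have "(\<lambda>x. q (norm x)) differentiable (at x)" if "norm x \<in> S" for x :: "real^'n"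
    using partial_deriv_radial(1)[OF *(1)[OF that] ne[OF that]] .
  ultimately show ?case by simp
qed

section \<open>Test functions\<close>

lemma test_functionsI:
  assumes U: "open U" "U \<subseteq> \<Omega>" and sm: "smooth_on_open U g"
    and K: "compact K" "K \<subseteq> U" and z: "\<And>x. x \<notin> K \<Longrightarrow> g x = 0"
  shows "g \<in> test_functions \<Omega>"
proof -
  have oK: "open (- K)" using K(1) compact_imp_closed by blast
  have "Ck_on m (- K) g" for m
    using Ck_on_cong[OF oK, of g "\<lambda>_. 0" m] z by (auto simp: Ck_on_const)
  then have "Ck_on m (U \<union> - K) g" for m
    using sm by (intro Ck_on_Un U oK) (auto simp: smooth_on_open_def)
  moreover have "U \<union> - K = UNIV" using K by auto
  ultimately have 1: "smooth_on_open UNIV g" by (auto simp: smooth_on_open_def)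
  have "closure {x. g x \<noteq> 0} \<subseteq> K"
    using z K(1) by (intro closure_minimal compact_imp_closed) auto
  then show ?thesis
    using 1 K U compact_Int_closed[OF K(1), of "closure {x. g x \<noteq> 0}"]
    by (auto simp: test_functions_def Int_absorb1)
qed

lemma test_functions_Ck: "\<phi> \<in> test_functions \<Omega> \<Longrightarrow> Ck_on m UNIV \<phi>"
  by (auto simp: test_functions_def smooth_on_open_def)

lemma test_functions_compact_support:
  assumes "\<phi> \<in> test_functions \<Omega>"
  obtains K where "compact K" "K \<subseteq> \<Omega>" "\<And>x. x \<notin> K \<Longrightarrow> \<phi> x = 0"
    "\<And>x i. x \<notin> K \<Longrightarrow> partial_deriv i \<phi> x = 0"
proof
  let ?K = "closure {x. \<phi> x \<noteq> 0}"
  show c: "compact ?K" "?K \<subseteq> \<Omega>" using assms by (auto simp: test_functions_def)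
  show z: "\<phi> x = 0" if "x \<notin> ?K" for x using that closure_subset[of "{x. \<phi> x \<noteq> 0}"] by blast
  have "open (- ?K)" by (rule open_Compl) (rule closed_closure)
  then have "partial_deriv i \<phi> x = partial_deriv i (\<lambda>_. 0) x" if "x \<notin> ?K" for x i
    by (rule partial_deriv_cong) (use that z in blast)+
  then show "partial_deriv i \<phi> x = 0" if "x \<notin> ?K" for x i
    using that by simp
qed

lemma test_functions_mult_smooth:
  assumes "open \<Omega>" "smooth_on_open \<Omega> w" "\<phi> \<in> test_functions \<Omega>"
  shows "(\<lambda>x. w x * \<phi> x) \<in> test_functions \<Omega>"
proof -
  obtain K where K: "compact K" "K \<subseteq> \<Omega>" "\<And>x. x \<notin> K \<Longrightarrow> \<phi> x = 0"
    using test_functions_compact_support[OF assms(3)] by metis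
  have "Ck_on m \<Omega> \<phi>" for m using Ck_on_subset[OF test_functions_Ck[OF assms(3)]] by blast
  then have "smooth_on_open \<Omega> (\<lambda>x. w x * \<phi> x)"
    using assms by (auto simp: smooth_on_open_def intro: Ck_on_mult)
  then show ?thesis using K assms by (intro test_functionsI[of \<Omega>]) auto
qed

lemma test_functions_partial_deriv:
  assumes "\<phi> \<in> test_functions \<Omega>" "open \<Omega>"
  shows "partial_deriv i \<phi> \<in> test_functions \<Omega>"
proof -
  obtain K where K: "compact K" "K \<subseteq> \<Omega>" "\<And>x. x \<notin> K \<Longrightarrow> partial_deriv i \<phi> x = 0"
    using test_functions_compact_support[OF assms(1)] by metis
  have "Ck_on (Suc m) UNIV \<phi>" for m using test_functions_Ck[OF assms(1)] .
  then have "Ck_on m \<Omega> (partial_deriv i \<phi>)" for m by (auto intro: Ck_on_subset)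
  then show ?thesis using K assms(2) by (intro test_functionsI[of \<Omega> \<Omega> _ K]) (auto simp: smooth_on_open_def)
qed

text \<open>With the factor \<open>t\<^sup>-\<^sup>m\<close> in front of the classical \<open>e\<^sup>-\<^sup>1\<^sup>/\<^sup>t\<close> the family is closed under
  differentiation up to linear combinations, so smoothness at the origin follows by one induction.\<close>

definition flat :: "nat \<Rightarrow> real \<Rightarrow> real" where
  "flat m t = (if t \<le> 0 then 0 else inverse t ^ m * exp (- inverse t))"

lemma flat_tendsto_0: "((\<lambda>t. flat m t / t) \<longlongrightarrow> 0) (at_right 0)"
proof -
  have "((\<lambda>x::real. x ^ Suc m / exp x) \<longlongrightarrow> 0) at_top" by (rule tendsto_power_div_exp_0)
  then have "((\<lambda>t::real. inverse t ^ Suc m / exp (inverse t)) \<longlongrightarrow> 0) (at_right 0)"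
    by (rule filterlim_compose[OF _ filterlim_inverse_at_top_right])
  then show ?thesis
  proof (rule Lim_transform_eventually)
    show "\<forall>\<^sub>F t in at_right 0. inverse t ^ Suc m / exp (inverse t) = flat m t / t"
      using eventually_at_right_less[of 0]
      by eventually_elim (auto simp: flat_def exp_minus divide_inverse)
  qed
qed

lemma flat_deriv: "(flat m has_real_derivative flat (m + 2) t - of_nat m * flat (m + 1) t) (at t)"
proof -
  consider "t < 0" | "t = 0" | "t > 0" by linarith
  then show ?thesis
  proof cases
    case 1
    have "((\<lambda>_. 0) has_real_derivative 0) (at t)" by simp
    moreover have "open {..<0::real}" "t \<in> {..<0}" using 1 by auto
    ultimately have "(flat m has_real_derivative 0) (at t)"
      by (rule has_field_derivative_transform_within_open) (auto simp: flat_def)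
    then show ?thesis using 1 by (simp add: flat_def)
  next
    case 2
    have "((\<lambda>t. flat m t / t) \<longlongrightarrow> 0) (at 0)"
    proof (rule filterlim_split_at)
      have "((\<lambda>_::real. 0::real) \<longlongrightarrow> 0) (at_left 0)" by simp
      then show "((\<lambda>t. flat m t / t) \<longlongrightarrow> 0) (at_left 0)"
      proof (rule Lim_transform_eventually)
        show "\<forall>\<^sub>F t in at_left (0::real). 0 = flat m t / t"
          by (auto simp: eventually_at_filter flat_def)
      qed
      show "((\<lambda>t. flat m t / t) \<longlongrightarrow> 0) (at_right 0)" by (rule flat_tendsto_0)
    qed
    then have "((\<lambda>h. (flat m (0 + h) - flat m 0) / h) \<longlongrightarrow> 0) (at 0)" by (simp add: flat_def)
    then show ?thesis using 2 by (simp add: DERIV_def flat_def)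
  next
    case 3
    have inv: "(inverse has_real_derivative - (inverse t ^ 2)) (at t)"
      unfolding numeral_2_eq_2 by (rule DERIV_inverse) (use 3 in simp)
    have "((\<lambda>t. inverse t ^ m * exp (- inverse t)) has_real_derivative
        of_nat m * (- (inverse t ^ 2) * inverse t ^ (m - Suc 0)) * exp (- inverse t)
        + exp (- inverse t) * - (- (inverse t ^ 2)) * inverse t ^ m) (at t)"
      by (intro DERIV_mult DERIV_power DERIV_fun_exp DERIV_minus inv)
    moreover have "of_nat m * (- (inverse t ^ 2) * inverse t ^ (m - Suc 0)) * exp (- inverse t)
        + exp (- inverse t) * - (- (inverse t ^ 2)) * inverse t ^ m
        = flat (m + 2) t - of_nat m * flat (m + 1) t"
      using 3 by (cases m) (simp_all add: flat_def power2_eq_square algebra_simps)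
    ultimately have "((\<lambda>t. inverse t ^ m * exp (- inverse t)) has_real_derivative
           flat (m + 2) t - of_nat m * flat (m + 1) t) (at t)"
      by (rule DERIV_cong)
    moreover have "open {0::real<..}" "t \<in> {0<..}" using 3 by auto
    ultimately show ?thesis
      by (rule has_field_derivative_transform_within_open) (auto simp: flat_def)
  qed
qed

lemma flat_nonneg: "flat m t \<ge> 0" by (auto simp: flat_def)
lemma flat_le_1: "flat 0 t \<le> 1" by (auto simp: flat_def)

lemma Ck_line_flat: "Ck_line j S (\<lambda>t. of_real (flat m t))"
proof (induction j arbitrary: m)
  case 0
  have "continuous_on S (flat m)"
    by (intro continuous_at_imp_continuous_on ballI DERIV_isCont[OF flat_deriv])
  then show ?case by (auto intro: continuous_intros)
next
  case (Suc j)
  have "Ck_line j S (\<lambda>t. of_real (flat (m + 2) t) - of_nat m * of_real (flat (m + 1) t))"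
    using Suc[of "m+2"] Suc[of "m+1"] by (intro Ck_line_diff Ck_line_mult Ck_line_const)
  moreover have "((\<lambda>t. complex_of_real (flat m t)) has_vector_derivative
       (of_real (flat (m + 2) t) - of_nat m * of_real (flat (m + 1) t))) (at t)" for t
    using has_vector_derivative_of_real[OF flat_deriv[of m t], where 'a=complex] by simp
  ultimately show ?case unfolding Ck_line.simps
    by (intro exI[of _ "\<lambda>t. of_real (flat (m + 2) t) - of_nat m * of_real (flat (m + 1) t)"]) blast
qed

text \<open>For \<open>j \<rightarrow> \<infinity>\<close> these functions tend to the indicator of \<open>{a<..<b}\<close>, each having compact support in
  that interval. A product of them over the coordinates approximates the indicator of a box; in the
  radial variable they cut off at the boundary circles of an annulus.\<close>

definition cutoff :: "real \<Rightarrow> real \<Rightarrow> nat \<Rightarrow> real \<Rightarrow> real" where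
  "cutoff a b j t = flat 0 (of_nat j * (t - a) - 1) * flat 0 (of_nat j * (b - t) - 1)"

lemma cutoff_zero: "t \<notin> {a + 1 / real j..b - 1 / real j} \<or> j = 0 \<Longrightarrow> cutoff a b j t = 0"
proof -
  assume "t \<notin> {a + 1 / real j..b - 1 / real j} \<or> j = 0"
  then consider "j = 0" | "j > 0" "t < a + 1 / real j" | "j > 0" "t > b - 1 / real j" by fastforce
  then show ?thesis
  proof cases
    case 2
    then have "real j * (t - a) - 1 \<le> 0" by (simp add: field_simps)
    then show ?thesis by (simp add: cutoff_def flat_def)
  next
    case 3
    then have "real j * (b - t) - 1 \<le> 0" by (simp add: field_simps)
    then show ?thesis by (simp add: cutoff_def flat_def)
  qed (simp add: cutoff_def flat_def)
qed

lemma cutoff_bounds: "0 \<le> cutoff a b j t" "cutoff a b j t \<le> 1"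
  using flat_nonneg flat_le_1 by (auto simp: cutoff_def intro: mult_le_one)

lemma filterlim_const_mult_nat_at_top:
  assumes "c > 0" shows "filterlim (\<lambda>j. real j * c - 1) at_top sequentially"
proof -
  have "filterlim (\<lambda>j. c * real j) at_top sequentially"
    using filterlim_tendsto_pos_mult_at_top[OF tendsto_const assms filterlim_real_sequentially] .
  then have "filterlim (\<lambda>j. -1 + c * real j) at_top sequentially"
    by (rule filterlim_tendsto_add_at_top[OF tendsto_const])
  then show ?thesis by (simp add: mult.commute)
qed

lemma flat_tendsto_1: "(flat 0 \<longlongrightarrow> 1) at_top"
proof -
  have "((\<lambda>t::real. exp (- inverse t)) \<longlongrightarrow> exp (- 0)) at_top"
    by (intro tendsto_intros tendsto_inverse_0_at_top filterlim_ident)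
  then have "((\<lambda>t::real. exp (- inverse t)) \<longlongrightarrow> 1) at_top" by simp
  then show ?thesis
    by (rule Lim_transform_eventually)
       (use eventually_gt_at_top[of 0] in eventually_elim, simp add: flat_def)
qed

lemma cutoff_tendsto:
  shows "(\<lambda>j. cutoff a b j t) \<longlonglongrightarrow> (if a < t \<and> t < b then 1 else 0)"
proof (cases "a < t \<and> t < b")
  case True
  then have "(\<lambda>j. cutoff a b j t) \<longlonglongrightarrow> 1 * 1"
    unfolding cutoff_def
    by (intro tendsto_mult filterlim_compose[OF flat_tendsto_1] filterlim_const_mult_nat_at_top) auto
  then show ?thesis using True by simp
next
  case False
  have "cutoff a b j t = 0" for j
  proof (rule cutoff_zero)
    have "1 / real j > 0" if "j \<noteq> 0" using that by simp
    then show "t \<notin> {a + 1 / real j..b - 1 / real j} \<or> j = 0"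
      using False unfolding atLeastAtMost_iff by linarith
  qed
  then show ?thesis using False by auto
qed

lemma Ck_line_cutoff: "Ck_line m S (\<lambda>t. of_real (cutoff a b j t))"
proof -
  have "Ck_line m {r. real j * r + c \<in> UNIV} (\<lambda>t. of_real (flat 0 (real j * t + c)))" for c
    using Ck_line_affine[OF Ck_line_flat[of m UNIV 0]] .
  from this[of "- real j * a - 1"]
  have 1: "Ck_line m UNIV (\<lambda>t. of_real (flat 0 (real j * (t - a) - 1)))" by (simp add: algebra_simps)
  have "Ck_line m {r. - real j * r + c \<in> UNIV} (\<lambda>t. of_real (flat 0 (- real j * t + c)))" for c
    using Ck_line_affine[OF Ck_line_flat[of m UNIV 0]] .
  from this[of "real j * b - 1"]
  have 2: "Ck_line m UNIV (\<lambda>t. of_real (flat 0 (real j * (b - t) - 1)))" by (simp add: algebra_simps)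
  show ?thesis
    using Ck_line_subset[OF Ck_line_mult[OF 1 2], of S] by (simp add: cutoff_def)
qed

lemma box_cutoff_test_function:
  fixes a b :: "real^'n::finite"
  assumes "cbox a b \<subseteq> \<Omega>" "open \<Omega>"
  shows "(\<lambda>x. \<Prod>i\<in>UNIV. complex_of_real (cutoff (a $ i) (b $ i) j (x $ i))) \<in> test_functions \<Omega>"
proof -
  let ?g = "\<lambda>x :: real^'n. \<Prod>i\<in>UNIV. complex_of_real (cutoff (a $ i) (b $ i) j (x $ i))"
  have "Ck_on m UNIV (\<lambda>x :: real^'n. \<Prod>i\<in>A. complex_of_real (cutoff (a $ i) (b $ i) j (x $ i)))"
    if "finite A" for A m using that
  proof (induction A)
    case (insert i A)
    have "Ck_on m {x::real^'n. x $ i \<in> UNIV} (\<lambda>x. complex_of_real (cutoff (a $ i) (b $ i) j (x $ i)))"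
      by (rule Ck_on_coordinate_compose[OF open_UNIV Ck_line_cutoff])
    then show ?case using insert by (auto intro!: Ck_on_mult)
  qed (auto intro: Ck_on_const)
  from this[of UNIV] have "smooth_on_open \<Omega> ?g"
    using assms by (auto simp: smooth_on_open_def intro: Ck_on_subset)
  moreover have "?g x = 0" if x: "x \<notin> cbox a b" for x
  proof -
    obtain i where "x $ i \<notin> {a $ i..b $ i}" using x by (auto simp: mem_box_cart)
    moreover have "1 / real j > 0" if "j \<noteq> 0" using that by simp
    ultimately have "cutoff (a $ i) (b $ i) j (x $ i) = 0"
      by (intro cutoff_zero, unfold atLeastAtMost_iff) linarith
    then show ?thesis by (intro prod_zero) auto
  qed
  ultimately show ?thesis using assms by (intro test_functionsI[of \<Omega> \<Omega> _ "cbox a b"]) auto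
qed

section \<open>The fundamental lemma of the calculus of variations\<close>

lemma integrable_mult_bounded:
  fixes h f :: "'a \<Rightarrow> complex"
  assumes "integrable M h" "f \<in> borel_measurable M" "\<And>x. x \<in> space M \<Longrightarrow> norm (f x) \<le> C"
  shows "integrable M (\<lambda>x. h x * f x)"
proof (rule Bochner_Integration.integrable_bound[of M "\<lambda>x. C * norm (h x)"])
  show "integrable M (\<lambda>x. C * norm (h x))" using assms(1) by auto
  show "(\<lambda>x. h x * f x) \<in> borel_measurable M" using assms(1,2) by auto
  show "AE x in M. norm (h x * f x) \<le> norm (C * norm (h x))"
  proof (rule AE_I2)
    fix x assume "x \<in> space M"
    then have "norm (f x) \<le> C" by (rule assms(3))
    moreover from this have "C \<ge> 0" by (rule order_trans[OF norm_ge_zero])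
    ultimately show "norm (h x * f x) \<le> norm (C * norm (h x))"
      using mult_left_mono[of "norm (f x)" C "norm (h x)"]
      by (simp add: norm_mult abs_mult mult.commute)
  qed
qed

lemma sigma_finite_lebesgue: "sigma_finite_measure (lebesgue :: 'a::euclidean_space measure)"
proof
  obtain A :: "'a set set" where A: "countable A" "A \<subseteq> sets lborel" "\<Union>A = space lborel" "\<forall>a\<in>A. emeasure lborel a \<noteq> \<infinity>"
    using lborel.sigma_finite_countable by auto
  then have "A \<subseteq> sets lebesgue \<and> \<Union>A = space lebesgue \<and> (\<forall>a\<in>A. emeasure lebesgue a \<noteq> \<infinity>)"
    by (auto simp: emeasure_completion)
  with A(1) show "\<exists>A :: 'a set set. countable A \<and> A \<subseteq> sets lebesgue \<and> \<Union>A = space lebesgue \<and> (\<forall>a\<in>A. emeasure lebesgue a \<noteq> \<infinity>)"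
    by blast
qed

lemma integral_boxes_zero_imp_AE_zero:
  fixes f :: "'a::euclidean_space \<Rightarrow> 'b::{second_countable_topology, banach}"
  assumes f: "integrable lebesgue f"
    and 0: "\<And>a b. (LINT x:box a b|lebesgue. f x) = 0"
  shows "AE x in lebesgue. f x = 0"
proof (rule sigma_finite_measure.density_zero[OF sigma_finite_lebesgue f])
  have setint: "set_integrable lebesgue A f" if "A \<in> sets lebesgue" for A
    using integrable_mult_indicator[OF that f] by (simp add: set_integrable_def)
  have UN: "(\<Union>i::nat. box (- real i *\<^sub>R One) (real i *\<^sub>R One)) = (UNIV :: 'a set)"
  proof -
    have "\<exists>i::nat. x \<in> box (- real i *\<^sub>R One) (real i *\<^sub>R One)" for x :: 'a
    proof -
      obtain i :: nat where "norm x < real i" using reals_Archimedean2 by blast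
      then have "x \<in> box (- real i *\<^sub>R One) (real i *\<^sub>R One)"
        using Basis_le_norm[of _ x] by (force simp: mem_box abs_le_iff)
      then show ?thesis ..
    qed
    then show ?thesis by blast
  qed
  have "(\<lambda>i::nat. LINT x:box (- real i *\<^sub>R One) (real i *\<^sub>R One)|lebesgue. f x)
      \<longlonglongrightarrow> (LINT x:(\<Union>i::nat. box (- real i *\<^sub>R One) (real i *\<^sub>R One))|lebesgue. f x)"
  proof (rule set_integral_cont_up)
    show "incseq (\<lambda>i::nat. box (- real i *\<^sub>R One) (real i *\<^sub>R One :: 'a))"
      by (force simp: incseq_def mem_box)
  qed (auto intro!: setint)
  then have tot: "(LINT x:UNIV|lebesgue. f x) = 0"
    unfolding UN 0 by (rule LIMSEQ_unique[OF _ tendsto_const])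
  fix A :: "'a set" assume "A \<in> sets lebesgue"
  then obtain S N N' where A: "A = S \<union> N" "N \<subseteq> N'" "N' \<in> null_sets lborel" "S \<in> sets lborel"
    by (rule sets_completionE)
  have N': "N' \<in> null_sets lebesgue" using A(3) by (rule null_sets_completionI)
  have eq: "(LINT x:A|lebesgue. f x) = (LINT x:S|lebesgue. f x)"
    unfolding set_lebesgue_integral_def
  proof (rule integral_cong_AE)
    show "(\<lambda>x. indicat_real A x *\<^sub>R f x) \<in> borel_measurable lebesgue"
         "(\<lambda>x. indicat_real S x *\<^sub>R f x) \<in> borel_measurable lebesgue"
      using f \<open>A \<in> sets lebesgue\<close> A(4) by (auto intro!: borel_measurable_scaleR borel_measurable_indicator)
    show "AE x in lebesgue. indicat_real A x *\<^sub>R f x = indicat_real S x *\<^sub>R f x"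
      using AE_not_in[OF N'] by eventually_elim (use A in \<open>auto simp: indicator_def\<close>)
  qed
  have borel: "sigma_sets UNIV (range (\<lambda>(a, b). box a b :: 'a set)) = sets borel"
    unfolding borel_eq_box by (rule sets_measure_of[symmetric]) simp
  have "Int_stable (range (\<lambda>(a, b). box a b :: 'a set))"
    by (auto simp: Int_stable_def box_Int_box)
  moreover have "range (\<lambda>(a, b). box a b :: 'a set) \<subseteq> Pow UNIV" by simp
  moreover have "S \<in> sigma_sets UNIV (range (\<lambda>(a, b). box a b :: 'a set))"
    using A(4) borel by simp
  ultimately have "(LINT x:S|lebesgue. f x) = 0"
  proof (induction rule: sigma_sets_induct_disjoint)
    case (basic A) then show ?case using 0 by auto
  next
    case (compl A)
    then have A: "A \<in> sets lebesgue"
      unfolding borel by simp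
    have "(LINT x:UNIV - A|lebesgue. f x) = (LINT x:UNIV|lebesgue. f x) - (LINT x:A|lebesgue. f x)"
      unfolding set_lebesgue_integral_def
      by (subst Bochner_Integration.integral_diff[symmetric, OF integrable_mult_indicator[OF _ f] integrable_mult_indicator[OF A f]])
         (auto intro!: Bochner_Integration.integral_cong simp: indicator_def)
    then show ?case using compl tot by simp
  next
    case (union F)
    then have F: "F i \<in> sets lebesgue" for i
      unfolding borel by (auto simp: image_subset_iff)
    have "(LINT x:(\<Union>i. F i)|lebesgue. f x) = (\<Sum>i. LINT x:F i|lebesgue. f x)"
      using union(1) F by (intro lebesgue_integral_countable_add setint) (auto simp: disjoint_family_on_def)
    then show ?case using union by simp
  qed (simp add: set_lebesgue_integral_def)
  then show "(LINT x:A|lebesgue. f x) = 0" using eq by simp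
qed

lemma integrable_lebesgue_on_iff:
  fixes f :: "'a::euclidean_space \<Rightarrow> 'b::{banach, second_countable_topology}"
  assumes "S \<in> sets lebesgue"
  shows "integrable (lebesgue_on S) f \<longleftrightarrow> integrable lebesgue (\<lambda>x. indicator S x *\<^sub>R f x)"
  using assms by (intro integrable_restrict_space) simp

lemma integral_lebesgue_on_eq:
  fixes f :: "'a::euclidean_space \<Rightarrow> 'b::{banach, second_countable_topology}"
  assumes "S \<in> sets lebesgue"
  shows "integral\<^sup>L (lebesgue_on S) f = (LINT x:S|lebesgue. f x)"
  unfolding set_lebesgue_integral_def using assms by (intro integral_restrict_space) simp

lemma AE_lebesgue_on_iff:
  assumes "S \<in> sets lebesgue"
  shows "(AE x in lebesgue_on S. P x) \<longleftrightarrow> (AE x in lebesgue. x \<in> S \<longrightarrow> P x)"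
  using assms by (intro AE_restrict_space_iff) simp

lemma L1_loc_mult_compact_support:
  fixes h f :: "real^'n::finite \<Rightarrow> complex"
  assumes "h \<in> L1_loc \<Omega>" "open \<Omega>" "compact K" "K \<subseteq> \<Omega>" "continuous_on UNIV f"
    and z: "\<And>x. x \<notin> K \<Longrightarrow> f x = 0"
  shows "integrable (lebesgue_on \<Omega>) (\<lambda>x. h x * f x)"
    and "(LINT x|lebesgue_on \<Omega>. h x * f x) = (LINT x|lebesgue_on K. h x * f x)"
proof -
  have K: "K \<in> sets lebesgue" and O: "\<Omega> \<in> sets lebesgue"
    using assms by (auto intro: lmeasurable_compact fmeasurableD)
  have *: "indicat_real \<Omega> x *\<^sub>R (h x * f x) = indicat_real K x *\<^sub>R (h x * f x)" for x
    using z assms(4) by (auto simp: indicator_def)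
  have "integrable (lebesgue_on K) h" using assms by (auto simp: L1_loc_def)
  moreover have "f \<in> borel_measurable (lebesgue_on K)"
    using continuous_imp_measurable_on_sets_lebesgue[OF continuous_on_subset[OF assms(5)] K] by simp
  moreover have "bounded (f ` K)"
    using assms by (intro compact_imp_bounded compact_continuous_image) (auto intro: continuous_on_subset)
  then obtain C where "\<And>x. x \<in> K \<Longrightarrow> norm (f x) \<le> C" by (auto simp: bounded_iff)
  ultimately have "integrable (lebesgue_on K) (\<lambda>x. h x * f x)"
    by (intro integrable_mult_bounded[where C=C]) auto
  then show "integrable (lebesgue_on \<Omega>) (\<lambda>x. h x * f x)"
    by (simp add: integrable_lebesgue_on_iff K O *)
  show "(LINT x|lebesgue_on \<Omega>. h x * f x) = (LINT x|lebesgue_on K. h x * f x)"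
    by (simp add: integral_lebesgue_on_eq K O set_lebesgue_integral_def *)
qed

lemma continuous_test_function: "\<phi> \<in> test_functions \<Omega> \<Longrightarrow> continuous_on UNIV \<phi>"
  using Ck_on_continuous[OF test_functions_Ck[of \<phi> \<Omega> 0]] by simp

lemma integrable_L1_loc_mult_test:
  assumes "h \<in> L1_loc \<Omega>" "open \<Omega>" "\<phi> \<in> test_functions \<Omega>"
  shows "integrable (lebesgue_on \<Omega>) (\<lambda>x. h x * \<phi> x)"
proof -
  obtain K where "compact K" "K \<subseteq> \<Omega>" "\<And>x. x \<notin> K \<Longrightarrow> \<phi> x = 0"
    using test_functions_compact_support[OF assms(3)] by metis
  then show ?thesis
    using L1_loc_mult_compact_support(1)[OF assms(1,2)] continuous_test_function[OF assms(3)] by blast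
qed

text \<open>On a closed box inside the open set the function is integrable, and testing with cutoffs gives,
  by dominated convergence, that its integral over every smaller box is zero. Boxes generate the Borel
  sets, so the function vanishes almost everywhere in the large box; countably many boxes cover the set.\<close>

lemma fundamental_lemma_calculus_of_variations:
  fixes h :: "real^'n::finite \<Rightarrow> complex"
  assumes h: "h \<in> L1_loc \<Omega>" and O: "open \<Omega>"
    and 0: "\<And>\<phi>. \<phi> \<in> test_functions \<Omega> \<Longrightarrow> (LINT x|lebesgue_on \<Omega>. h x * \<phi> x) = 0"
  shows "AE x in lebesgue_on \<Omega>. h x = 0"
proof -
  have box0: "(LINT x:box a b|lebesgue. h x) = 0" if ab: "cbox a b \<subseteq> \<Omega>" for a b
  proof -
    let ?\<phi> = "\<lambda>j x. \<Prod>i\<in>UNIV. complex_of_real (cutoff (a $ i) (b $ i) j (x $ i))"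
    have hK: "integrable (lebesgue_on (cbox a b)) h" using h ab by (auto simp: L1_loc_def)
    have test: "?\<phi> j \<in> test_functions \<Omega>" for j by (rule box_cutoff_test_function[OF ab O])
    have z: "?\<phi> j x = 0" if "x \<notin> cbox a b" for j x
    proof -
      obtain i where i: "x $ i \<notin> {a $ i..b $ i}" using \<open>x \<notin> cbox a b\<close> by (auto simp: mem_box_cart)
      moreover have "1 / real j > 0" if "j \<noteq> 0" using that by simp
      ultimately have "cutoff (a $ i) (b $ i) j (x $ i) = 0"
        by (intro cutoff_zero, unfold atLeastAtMost_iff) linarith
      then show ?thesis by (intro prod_zero) auto
    qed
    have "(\<lambda>j. LINT x|lebesgue_on (cbox a b). h x * ?\<phi> j x)
            \<longlonglongrightarrow> (LINT x|lebesgue_on (cbox a b). indicator (box a b) x *\<^sub>R h x)"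
    proof (rule integral_dominated_convergence[where w="\<lambda>x. norm (h x)"])
      show "(\<lambda>x. h x * ?\<phi> j x) \<in> borel_measurable (lebesgue_on (cbox a b))" for j
        using hK continuous_imp_measurable_on_sets_lebesgue[OF continuous_on_subset[OF continuous_test_function[OF test[of j]] subset_UNIV], of "cbox a b"]
        by (intro borel_measurable_times) auto
      show "(\<lambda>x. indicat_real (box a b) x *\<^sub>R h x) \<in> borel_measurable (lebesgue_on (cbox a b))"
      proof (intro borel_measurable_scaleR borel_measurable_indicator)
        show "box a b \<in> sets (lebesgue_on (cbox a b))"
          using box_subset_cbox[of a b] by (auto simp: sets_restrict_space_iff)
      qed (use hK in auto)
      show "integrable (lebesgue_on (cbox a b)) (\<lambda>x. norm (h x))" using hK by auto
      show "AE x in lebesgue_on (cbox a b). norm (h x * ?\<phi> j x) \<le> norm (h x)" for j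
      proof (rule AE_I2)
        fix x
        have "norm (?\<phi> j x) \<le> 1"
          unfolding prod_norm[symmetric] by (rule prod_le_1) (simp add: cutoff_bounds)
        then show "norm (h x * ?\<phi> j x) \<le> norm (h x)"
          by (simp add: norm_mult mult_left_le)
      qed
      show "AE x in lebesgue_on (cbox a b). (\<lambda>j. h x * ?\<phi> j x) \<longlonglongrightarrow> indicat_real (box a b) x *\<^sub>R h x"
      proof (rule AE_I2)
        fix x
        have "(\<lambda>j. ?\<phi> j x) \<longlonglongrightarrow> (\<Prod>i\<in>UNIV. complex_of_real (if a $ i < x $ i \<and> x $ i < b $ i then 1 else 0))"
          by (intro tendsto_prod tendsto_of_real cutoff_tendsto)
        also have "(\<Prod>i\<in>UNIV. complex_of_real (if a $ i < x $ i \<and> x $ i < b $ i then 1 else 0)) = of_real (indicator (box a b) x)"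
          by (cases "x \<in> box a b") (auto simp: mem_box_cart indicator_def intro!: prod_zero split: if_splits)
        finally have "(\<lambda>j. h x * ?\<phi> j x) \<longlonglongrightarrow> h x * of_real (indicator (box a b) x)"
          by (intro tendsto_mult tendsto_const)
        then show "(\<lambda>j. h x * ?\<phi> j x) \<longlonglongrightarrow> indicat_real (box a b) x *\<^sub>R h x"
          by (simp add: scaleR_conv_of_real mult.commute)
      qed
    qed
    moreover have "(LINT x|lebesgue_on (cbox a b). h x * ?\<phi> j x) = 0" for j
      using 0[OF test[of j]] L1_loc_mult_compact_support(2)[OF h O compact_cbox ab continuous_test_function[OF test] z, of j]
      by simp
    ultimately have "(LINT x|lebesgue_on (cbox a b). indicator (box a b) x *\<^sub>R h x) = 0"
      using LIMSEQ_unique[OF _ tendsto_const] by simp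
    moreover have "(\<lambda>x. indicat_real (cbox a b) x *\<^sub>R indicat_real (box a b) x *\<^sub>R h x) = (\<lambda>x. indicator (box a b) x *\<^sub>R h x)"
      using box_subset_cbox[of a b, THEN subsetD] by (intro ext) (auto simp: indicator_def)
    moreover have "cbox a b \<in> sets lebesgue" by auto
    ultimately show ?thesis
      by (simp only: integral_lebesgue_on_eq set_lebesgue_integral_def)
  qed
  have cbox: "AE x in lebesgue. x \<in> cbox c d \<longrightarrow> h x = 0" if cd: "cbox c d \<subseteq> \<Omega>" for c d
  proof -
    have "integrable (lebesgue_on (cbox c d)) h" using h cd by (auto simp: L1_loc_def)
    then have "integrable lebesgue (\<lambda>x. indicat_real (cbox c d) x *\<^sub>R h x)"
      by (simp add: integrable_lebesgue_on_iff)
    from integrable_mult_indicator[OF _ this, of "box c d"]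
    have "integrable lebesgue (\<lambda>x. indicat_real (box c d) x *\<^sub>R indicat_real (cbox c d) x *\<^sub>R h x)" by auto
    also have "(\<lambda>x. indicat_real (box c d) x *\<^sub>R indicat_real (cbox c d) x *\<^sub>R h x) = (\<lambda>x. indicat_real (box c d) x *\<^sub>R h x)"
      using box_subset_cbox[of c d, THEN subsetD] by (intro ext) (auto simp: indicator_def)
    finally have i: "integrable lebesgue (\<lambda>x. indicat_real (box c d) x *\<^sub>R h x)" .
    have "AE x in lebesgue. indicat_real (box c d) x *\<^sub>R h x = 0"
    proof (rule integral_boxes_zero_imp_AE_zero[OF i])
      fix a b
      define a' b' :: "real^'n" where "a' = (\<chi> i. max (a $ i) (c $ i))" and "b' = (\<chi> i. min (b $ i) (d $ i))"
      have "cbox a' b' \<subseteq> cbox c d"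
        by (intro subsetI) (simp add: a'_def b'_def mem_box_cart)
      then have "(LINT x:box a' b'|lebesgue. h x) = 0" using cd by (intro box0) auto
      moreover have "(\<lambda>x. indicat_real (box a b) x *\<^sub>R indicat_real (box c d) x *\<^sub>R h x) = (\<lambda>x. indicat_real (box a' b') x *\<^sub>R h x)"
      proof (rule ext)
        fix x
        have "x \<in> box a' b' \<longleftrightarrow> x \<in> box a b \<and> x \<in> box c d"
          by (intro iffI; simp add: a'_def b'_def mem_box_cart)
        then show "indicat_real (box a b) x *\<^sub>R indicat_real (box c d) x *\<^sub>R h x = indicat_real (box a' b') x *\<^sub>R h x"
          by (simp add: indicator_def)
      qed
      ultimately show "(LINT x:box a b|lebesgue. indicat_real (box c d) x *\<^sub>R h x) = 0"
        by (simp only: set_lebesgue_integral_def)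
    qed
    moreover have "AE x in lebesgue. x \<notin> cbox c d - box c d"
    proof (rule AE_not_in)
      have "cbox c d - box c d = frontier (cbox c d)" by (auto simp: frontier_def)
      then show "cbox c d - box c d \<in> null_sets lebesgue"
        using negligible_frontier_interval[of c d] negligible_iff_null_sets by auto
    qed
    ultimately show ?thesis by eventually_elim (auto simp: indicator_def split: if_splits)
  qed
  obtain \<D> where D: "countable \<D>" "\<D> \<subseteq> Pow \<Omega>" "\<And>X. X \<in> \<D> \<Longrightarrow> \<exists>a b. X = cbox a b" "\<Union>\<D> = \<Omega>"
    by (rule open_countable_Union_open_cbox[OF O]) blast
  have "AE x in lebesgue. \<forall>X\<in>\<D>. x \<in> X \<longrightarrow> h x = 0"
  proof (subst AE_ball_countable[OF D(1)], intro ballI)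
    fix X assume X: "X \<in> \<D>"
    from D(3)[OF X] obtain a b where "X = cbox a b" by blast
    then show "AE x in lebesgue. x \<in> X \<longrightarrow> h x = 0" using cbox D(2) X by blast
  qed
  then have "AE x in lebesgue. x \<in> \<Omega> \<longrightarrow> h x = 0"
    by eventually_elim (use D(4) in blast)
  then show ?thesis using O by (subst AE_lebesgue_on_iff) auto
qed

section \<open>Weak gradients\<close>

lemma vector_derivative_bound:
  fixes f :: "real \<Rightarrow> 'a::real_normed_vector"
  assumes "a \<le> b" "continuous_on {a..b} f"
    and "\<And>t. a < t \<Longrightarrow> t < b \<Longrightarrow> (f has_vector_derivative f' t) (at t)"
    and "\<And>t. a < t \<Longrightarrow> t < b \<Longrightarrow> norm (f' t) \<le> B"
  shows "norm (f b - f a) \<le> B * (b - a)"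
proof (cases "a = b")
  case False
  with assms(1) have "a < b" by simp
  then have "norm (f b - f a) \<le> B * b - B * a"
  proof (rule differentiable_bound_general[where \<phi>="\<lambda>t. B * t" and \<phi>'="\<lambda>_. B" and f'=f'])
    show "continuous_on {a..b} ((*) B)" by (intro continuous_intros)
    show "((*) B has_vector_derivative B) (at x)" for x
      by (auto simp: has_real_derivative_iff_has_vector_derivative[symmetric] intro!: derivative_eq_intros)
  qed (use assms in auto)
  then show ?thesis by (simp add: algebra_simps)
qed simp

lemma has_vector_derivative_along_line:
  fixes F :: "real^'n::finite \<Rightarrow> complex"
  assumes "F differentiable (at (x + t *\<^sub>R axis i 1))"
  shows "((\<lambda>s. F (x + s *\<^sub>R axis i 1)) has_vector_derivative partial_deriv i F (x + t *\<^sub>R axis i 1)) (at t)"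
proof -
  let ?D = "frechet_derivative F (at (x + t *\<^sub>R axis i 1))"
  have "(F has_derivative ?D) (at (x + t *\<^sub>R axis i 1))" using assms frechet_derivative_works by blast
  moreover have "((\<lambda>s. x + s *\<^sub>R axis i 1) has_derivative (\<lambda>s. s *\<^sub>R axis i 1)) (at t)"
    by (auto intro!: derivative_eq_intros)
  ultimately have "((\<lambda>s. F (x + s *\<^sub>R axis i 1)) has_derivative (\<lambda>s. ?D (s *\<^sub>R axis i 1))) (at t)"
    by (rule has_derivative_compose[rotated])
  moreover have "?D (s *\<^sub>R axis i 1) = s *\<^sub>R ?D (axis i 1)" for s
    using linear_frechet_derivative[OF assms] by (rule linear_cmul)
  ultimately show ?thesis by (simp add: has_vector_derivative_def partial_deriv_def)
qed

lemma integral_lborel_translate: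
  fixes F :: "'a::euclidean_space \<Rightarrow> 'b::{banach, second_countable_topology}"
  assumes "integrable lborel F"
  shows "integrable lborel (\<lambda>x. F (c + x))" "(LINT x|lborel. F (c + x)) = (LINT x|lborel. F x)"
proof -
  have m: "F \<in> borel_measurable borel" using borel_measurable_integrable[OF assms] by simp
  have F: "integrable (distr lborel borel ((+) c)) F" using assms by (simp add: lborel_distr_plus)
  then show "integrable lborel (\<lambda>x. F (c + x))" by (subst (asm) integrable_distr_eq) (auto simp: m)
  have "(LINT x|lborel. F (c + x)) = (LINT x|distr lborel borel ((+) c). F x)"
    by (intro integral_distr[symmetric]) (auto simp: m)
  then show "(LINT x|lborel. F (c + x)) = (LINT x|lborel. F x)" by (simp add: lborel_distr_plus)
qed

lemma integrable_continuous_compact_support: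
  fixes F :: "'a::euclidean_space \<Rightarrow> complex"
  assumes "continuous_on UNIV F" "compact K" "\<And>x. x \<notin> K \<Longrightarrow> F x = 0"
  shows "integrable lborel F"
proof -
  have "integrable lborel (\<lambda>x. indicator K x *\<^sub>R F x)"
    using assms by (intro borel_integrable_compact) (auto intro: continuous_on_subset)
  moreover have "(\<lambda>x. indicator K x *\<^sub>R F x) = F" using assms(3) by (auto simp: indicator_def)
  ultimately show ?thesis by simp
qed

lemma bounded_continuous_compact_support:
  fixes F :: "'a::euclidean_space \<Rightarrow> complex"
  assumes "continuous_on UNIV F" "compact K" "\<And>x. x \<notin> K \<Longrightarrow> F x = 0"
  obtains C where "\<And>x. norm (F x) \<le> C"
proof -
  have "compact (F ` K)" using assms by (intro compact_continuous_image) (auto intro: continuous_on_subset)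
  then obtain C where C: "\<And>x. x \<in> K \<Longrightarrow> norm (F x) \<le> C" using compact_imp_bounded by (force simp: bounded_iff)
  have "norm (F x) \<le> max C 0" for x using C[of x] assms(3)[of x] by (cases "x \<in> K") auto
  then show ?thesis using that by blast
qed

text \<open>By translation invariance of Lebesgue measure all difference
  quotients have integral zero, and they converge boundedly to the partial derivative.\<close>

lemma integral_partial_deriv_compact_support:
  fixes F :: "real^'n::finite \<Rightarrow> complex"
  assumes F: "Ck_on 1 UNIV F" and K: "compact K" and z: "\<And>x. x \<notin> K \<Longrightarrow> F x = 0"
  shows "integrable lborel (partial_deriv i F)" "(LINT x|lborel. partial_deriv i F x) = 0"
proof -
  have diff: "F differentiable (at x)" for x using F by simp
  have cont: "continuous_on UNIV F" using Ck_on_continuous[OF F] .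
  have contd: "continuous_on UNIV (partial_deriv i F)" using F by simp
  have oK: "open (- K)" using K compact_imp_closed by blast
  have zd: "partial_deriv i F x = 0" if "x \<notin> K" for x
  proof -
    have "partial_deriv i F x = partial_deriv i (\<lambda>_. 0) x"
      by (rule partial_deriv_cong[OF oK]) (use that z in auto)
    then show ?thesis by simp
  qed
  obtain C where C: "\<And>x. norm (partial_deriv i F x) \<le> C"
    using bounded_continuous_compact_support[OF contd K zd] by blast
  then have C0: "C \<ge> 0" by (rule order_trans[OF norm_ge_zero])
  show int: "integrable lborel (partial_deriv i F)"
    by (rule integrable_continuous_compact_support[OF contd K zd])
  have intF: "integrable lborel F" by (rule integrable_continuous_compact_support[OF cont K z])
  obtain B where B: "\<And>x. x \<in> K \<Longrightarrow> norm x \<le> B" using compact_imp_bounded[OF K] by (auto simp: bounded_iff)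
  define e :: "nat \<Rightarrow> real^'n" where "e j = inverse (real (Suc j)) *\<^sub>R axis i 1" for j
  have ne: "norm (e j) = inverse (real (Suc j))" for j by (simp add: e_def)
  let ?D = "\<lambda>j x. (F (e j + x) - F x) /\<^sub>R inverse (real (Suc j))"
  have bound: "norm (F (e j + x) - F x) \<le> C * inverse (real (Suc j))" for j x
  proof -
    have "norm (F (x + inverse (real (Suc j)) *\<^sub>R axis i 1) - F (x + 0 *\<^sub>R axis i 1)) \<le> C * (inverse (real (Suc j)) - 0)"
    proof (rule vector_derivative_bound)
      show "continuous_on {0..inverse (real (Suc j))} (\<lambda>t. F (x + t *\<^sub>R axis i 1))"
        by (intro continuous_on_compose2[OF cont] continuous_intros) auto
      show "((\<lambda>t. F (x + t *\<^sub>R axis i 1)) has_vector_derivative partial_deriv i F (x + t *\<^sub>R axis i 1)) (at t)" for t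
        by (rule has_vector_derivative_along_line[OF diff])
    qed (use C in auto)
    then show ?thesis by (simp add: e_def add.commute)
  qed
  have "(\<lambda>j. LINT x|lborel. ?D j x) \<longlonglongrightarrow> (LINT x|lborel. partial_deriv i F x)"
  proof (rule integral_dominated_convergence[where w="\<lambda>x. indicator (cball 0 (B + 1)) x *\<^sub>R C"])
    show "partial_deriv i F \<in> borel_measurable lborel" using int by auto
    show "?D j \<in> borel_measurable lborel" for j
      using integral_lborel_translate(1)[OF intF, of "e j"] intF by (intro borel_measurable_scaleR borel_measurable_diff) auto
    show "integrable lborel (\<lambda>x::real^'n. indicat_real (cball 0 (B + 1)) x *\<^sub>R C)"
      by (rule borel_integrable_compact) auto
    show "AE x in lborel. norm (?D j x) \<le> indicat_real (cball 0 (B + 1)) x *\<^sub>R C" for j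
    proof (rule AE_I2)
      fix x :: "real^'n"
      show "norm (?D j x) \<le> indicat_real (cball 0 (B + 1)) x *\<^sub>R C"
      proof (cases "x \<in> cball 0 (B + 1)")
        case True
        have "norm (?D j x) = norm (F (e j + x) - F x) * real (Suc j)" by (simp add: mult.commute)
        also have "\<dots> \<le> C * inverse (real (Suc j)) * real (Suc j)" by (intro mult_right_mono bound) auto
        also have "\<dots> = C" by simp
        finally show ?thesis using True by simp
      next
        case False
        have "inverse (real (Suc j)) \<le> 1" by (simp add: field_simps)
        then have "norm (e j + x) > B" "norm x > B"
          using False norm_triangle_ineq4[of "e j + x" "e j"] ne[of j] by (auto simp: dist_norm)
        then have "e j + x \<notin> K" "x \<notin> K" using B by force+
        then show ?thesis using False by (simp add: z)
      qed
    qed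
    show "AE x in lborel. (\<lambda>j. ?D j x) \<longlonglongrightarrow> partial_deriv i F x"
    proof (rule AE_I2)
      fix x
      let ?d = "frechet_derivative F (at x)"
      have "(F has_derivative ?d) (at x)" using diff frechet_derivative_works by blast
      then have "((\<lambda>h. norm (F (x + h) - F x - ?d h) / norm h) \<longlongrightarrow> 0) (at 0)" by (simp add: has_derivative_at)
      moreover have "filterlim e (at 0) sequentially"
      proof (rule filterlim_atI)
        show "e \<longlonglongrightarrow> 0"
          using tendsto_scaleR[OF LIMSEQ_inverse_real_of_nat tendsto_const[of "axis i 1 :: real^'n"]] by (simp add: e_def[abs_def])
        show "\<forall>\<^sub>F j in sequentially. e j \<noteq> 0" by (auto simp: e_def axis_eq_0_iff)
      qed
      ultimately have "(\<lambda>j. norm (F (x + e j) - F x - ?d (e j)) / norm (e j)) \<longlonglongrightarrow> 0"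
        by (rule filterlim_compose)
      moreover have "norm (F (x + e j) - F x - ?d (e j)) / norm (e j) = norm (?D j x - partial_deriv i F x)" for j
      proof -
        have "?d (e j) = inverse (real (Suc j)) *\<^sub>R partial_deriv i F x"
          unfolding e_def partial_deriv_def using linear_frechet_derivative[OF diff[of x]] by (rule linear_cmul)
        then have "?D j x - partial_deriv i F x = (F (x + e j) - F x - ?d (e j)) /\<^sub>R inverse (real (Suc j))"
          by (simp add: scaleR_diff_right add.commute del: of_nat_Suc)
        then show ?thesis by (simp add: ne divide_inverse mult.commute)
      qed
      ultimately have "(\<lambda>j. norm (?D j x - partial_deriv i F x)) \<longlonglongrightarrow> 0" by simp
      then show "(\<lambda>j. ?D j x) \<longlonglongrightarrow> partial_deriv i F x"
        by (rule LIM_zero_cancel[OF tendsto_norm_zero_cancel])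
    qed
  qed
  moreover have "(LINT x|lborel. ?D j x) = 0" for j
    using integral_lborel_translate[OF intF, of "e j"] intF by simp
  ultimately show "(LINT x|lborel. partial_deriv i F x) = 0"
    using LIMSEQ_unique[OF _ tendsto_const] by simp
qed

lemma integrable_lebesgue_on_compact:
  fixes f :: "'a::euclidean_space \<Rightarrow> complex"
  assumes "compact K" "continuous_on K f"
  shows "integrable (lebesgue_on K) f"
proof -
  have K: "K \<in> sets lebesgue" using assms(1) by (auto intro: lmeasurable_compact fmeasurableD)
  have i: "integrable lborel (\<lambda>x. indicator K x *\<^sub>R f x)" by (rule borel_integrable_compact[OF assms])
  then have "(\<lambda>x. indicat_real K x *\<^sub>R f x) \<in> borel_measurable lborel" by auto
  from integrable_completion[OF this] i show ?thesis by (simp add: integrable_lebesgue_on_iff[OF K])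
qed

lemma continuous_imp_L1_loc: "continuous_on \<Omega> g \<Longrightarrow> g \<in> L1_loc \<Omega>"
  by (auto simp: L1_loc_def intro!: integrable_lebesgue_on_compact intro: continuous_on_subset)

lemma integration_by_parts_test:
  assumes O: "open \<Omega>" and g: "Ck_on 1 \<Omega> g" and \<phi>: "\<phi> \<in> test_functions \<Omega>"
  shows "(LINT x|lebesgue_on \<Omega>. g x * partial_deriv i \<phi> x) = - (LINT x|lebesgue_on \<Omega>. partial_deriv i g x * \<phi> x)"
proof -
  obtain K where K: "compact K" "K \<subseteq> \<Omega>" and z: "\<And>x. x \<notin> K \<Longrightarrow> \<phi> x = 0" "\<And>x. x \<notin> K \<Longrightarrow> partial_deriv i \<phi> x = 0"
    using test_functions_compact_support[OF \<phi>] by metis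
  have oK: "open (- K)" using K compact_imp_closed by blast
  have OS: "\<Omega> \<in> sets lebesgue" using O by auto
  define F where "F x = (if x \<in> \<Omega> then g x * \<phi> x else 0)" for x
  have \<phi>1: "Ck_on 1 UNIV \<phi>" by (rule test_functions_Ck[OF \<phi>])
  have "Ck_on 1 \<Omega> (\<lambda>x. g x * \<phi> x)" by (intro Ck_on_mult O g Ck_on_subset[OF \<phi>1]) auto
  moreover have "Ck_on 1 \<Omega> F \<longleftrightarrow> Ck_on 1 \<Omega> (\<lambda>x. g x * \<phi> x)" by (rule Ck_on_cong[OF O]) (simp add: F_def)
  ultimately have 1: "Ck_on 1 \<Omega> F" by blast
  have "Ck_on 1 (- K) F \<longleftrightarrow> Ck_on 1 (- K) (\<lambda>_. 0)" by (rule Ck_on_cong[OF oK]) (simp add: F_def z)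
  then have "Ck_on 1 (- K) F" using Ck_on_const by blast
  with 1 have "Ck_on 1 (\<Omega> \<union> - K) F" by (intro Ck_on_Un O oK)
  moreover have "\<Omega> \<union> - K = UNIV" using K by auto
  ultimately have F1: "Ck_on 1 UNIV F" by simp
  have zF: "F x = 0" if "x \<notin> K" for x using that z by (simp add: F_def)
  have i: "integrable lborel (partial_deriv i F)" and 0: "(LINT x|lborel. partial_deriv i F x) = 0"
    using integral_partial_deriv_compact_support[OF F1 K(1) zF] by auto
  have "(LINT x|lebesgue. partial_deriv i F x) = 0" using 0 i by (subst integral_completion) auto
  moreover have "partial_deriv i F x = indicator \<Omega> x *\<^sub>R (g x * partial_deriv i \<phi> x + partial_deriv i g x * \<phi> x)" for x
  proof (cases "x \<in> \<Omega>")
    case True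
    then have "partial_deriv i F x = partial_deriv i (\<lambda>x. g x * \<phi> x) x"
      by (intro partial_deriv_cong[OF O]) (auto simp: F_def)
    also have "\<dots> = g x * partial_deriv i \<phi> x + partial_deriv i g x * \<phi> x"
      using g \<phi>1 True by (intro partial_deriv_mult) auto
    finally show ?thesis using True by simp
  next
    case False
    then have "x \<in> - K" using K by auto
    then have "partial_deriv i F x = partial_deriv i (\<lambda>_. 0) x"
      by (intro partial_deriv_cong[OF oK]) (auto simp: F_def z)
    then show ?thesis using False by simp
  qed
  ultimately have "(LINT x|lebesgue_on \<Omega>. g x * partial_deriv i \<phi> x + partial_deriv i g x * \<phi> x) = 0"
    by (simp add: integral_lebesgue_on_eq[OF OS] set_lebesgue_integral_def)
  moreover have "g \<in> L1_loc \<Omega>" "partial_deriv i g \<in> L1_loc \<Omega>"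
    using g by (auto intro!: continuous_imp_L1_loc Ck_on_continuous[OF g])
  ultimately show ?thesis
    using integrable_L1_loc_mult_test[OF _ O \<phi>, of "partial_deriv i g"]
      integrable_L1_loc_mult_test[OF _ O test_functions_partial_deriv[OF \<phi> O], of g i]
    by (simp add: eq_neg_iff_add_eq_0)
qed

lemma has_weak_grad_classical:
  assumes "open \<Omega>" "Ck_on 1 \<Omega> g"
  shows "has_weak_grad \<Omega> g (\<lambda>x. \<chi> i. partial_deriv i g x)"
  using assms integration_by_parts_test[OF assms] Ck_on_continuous[OF assms(2)]
  by (auto simp: has_weak_grad_def intro!: continuous_imp_L1_loc)

lemma lebesgue_on_cong_AE:
  fixes f g :: "'a::euclidean_space \<Rightarrow> 'b::euclidean_space"
  assumes S: "S \<in> sets lebesgue" and ae: "AE x in lebesgue_on S. f x = g x"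
  shows "integrable (lebesgue_on S) f \<longleftrightarrow> integrable (lebesgue_on S) g" (is ?I)
    and "integral\<^sup>L (lebesgue_on S) f = integral\<^sup>L (lebesgue_on S) g"
proof -
  have "AE x in lebesgue. x \<in> S \<longrightarrow> f x = g x" using ae by (simp add: AE_lebesgue_on_iff[OF S])
  then obtain N where N: "{x \<in> space lebesgue. \<not> (x \<in> S \<longrightarrow> f x = g x)} \<subseteq> N" "N \<in> null_sets lebesgue"
    by (auto elim!: AE_E simp: null_sets_def)
  have neg: "negligible N" using N(2) by (simp add: negligible_iff_null_sets)
  have eq: "integrable (lebesgue_on S) h \<longleftrightarrow> h absolutely_integrable_on S" for h :: "'a \<Rightarrow> 'b"
    unfolding integrable_lebesgue_on_iff[OF S] set_integrable_def ..
  show I: ?I unfolding eq by (rule absolutely_integrable_spike_eq[OF neg]) (use N in auto)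
  show "integral\<^sup>L (lebesgue_on S) f = integral\<^sup>L (lebesgue_on S) g"
  proof (cases "integrable (lebesgue_on S) f")
    case True
    then show ?thesis using I ae by (intro integral_cong_AE) auto
  next
    case False
    then show ?thesis using I by (simp add: not_integrable_integral_eq)
  qed
qed

lemma AE_lebesgue_on_subset:
  assumes "AE x in lebesgue_on S. P x" "T \<subseteq> S" "S \<in> sets lebesgue" "T \<in> sets lebesgue"
  shows "AE x in lebesgue_on T. P x"
proof -
  have "AE x in lebesgue. x \<in> S \<longrightarrow> P x" using assms by (simp add: AE_lebesgue_on_iff)
  then have "AE x in lebesgue. x \<in> T \<longrightarrow> P x" by eventually_elim (use assms(2) in auto)
  then show ?thesis using assms by (simp add: AE_lebesgue_on_iff)
qed

lemma L1_loc_cong_AE: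
  assumes "AE x in lebesgue_on \<Omega>. u x = w x" "\<Omega> \<in> sets lebesgue" "w \<in> L1_loc \<Omega>"
  shows "u \<in> L1_loc \<Omega>"
  unfolding L1_loc_def
proof (intro CollectI allI impI)
  fix K assume K: "compact K \<and> K \<subseteq> \<Omega>"
  then have KS: "K \<in> sets lebesgue" by (auto intro: lmeasurable_compact fmeasurableD)
  have "AE x in lebesgue_on K. u x = w x" by (rule AE_lebesgue_on_subset[OF assms(1)]) (use K KS assms in auto)
  from lebesgue_on_cong_AE(1)[OF KS this] show "integrable (lebesgue_on K) u"
    using assms(3) K by (auto simp: L1_loc_def)
qed

lemma has_weak_grad_cong_AE:
  assumes ae: "AE x in lebesgue_on \<Omega>. u x = w x" and S: "\<Omega> \<in> sets lebesgue" and w: "has_weak_grad \<Omega> w G"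
  shows "has_weak_grad \<Omega> u G"
proof -
  have "(LINT x|lebesgue_on \<Omega>. u x * f x) = (LINT x|lebesgue_on \<Omega>. w x * f x)" for f
    by (rule lebesgue_on_cong_AE(2)[OF S]) (use ae in \<open>eventually_elim, simp\<close>)
  then show ?thesis using w L1_loc_cong_AE[OF ae S] by (auto simp: has_weak_grad_def)
qed

lemma L1_loc_diff: "u \<in> L1_loc \<Omega> \<Longrightarrow> w \<in> L1_loc \<Omega> \<Longrightarrow> (\<lambda>x. u x - w x) \<in> L1_loc \<Omega>"
  by (auto simp: L1_loc_def)

lemma has_weak_grad_unique:
  assumes O: "open \<Omega>" and G: "has_weak_grad \<Omega> u G" and H: "has_weak_grad \<Omega> u H"
  shows "AE x in lebesgue_on \<Omega>. G x = H x"
proof -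
  have "AE x in lebesgue_on \<Omega>. G x $ i - H x $ i = 0" for i
  proof (rule fundamental_lemma_calculus_of_variations[OF _ O])
    show l: "(\<lambda>x. G x $ i - H x $ i) \<in> L1_loc \<Omega>" using G H by (auto simp: has_weak_grad_def intro: L1_loc_diff)
    fix \<phi> assume \<phi>: "\<phi> \<in> test_functions \<Omega>"
    have "integrable (lebesgue_on \<Omega>) (\<lambda>x. G x $ i * \<phi> x)" "integrable (lebesgue_on \<Omega>) (\<lambda>x. H x $ i * \<phi> x)"
      using G H by (auto simp: has_weak_grad_def intro!: integrable_L1_loc_mult_test[OF _ O \<phi>])
    moreover have "(LINT x|lebesgue_on \<Omega>. G x $ i * \<phi> x) = (LINT x|lebesgue_on \<Omega>. H x $ i * \<phi> x)"
      using G H \<phi> by (auto simp: has_weak_grad_def)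
    ultimately show "(LINT x|lebesgue_on \<Omega>. (G x $ i - H x $ i) * \<phi> x) = 0"
      by (simp add: left_diff_distrib)
  qed
  then have "AE x in lebesgue_on \<Omega>. \<forall>i\<in>UNIV. G x $ i - H x $ i = 0"
    by (intro AE_finite_allI) auto
  then show ?thesis by eventually_elim (simp add: vec_eq_iff)
qed

lemma weak_grad_AE_eq:
  assumes "open \<Omega>" "has_weak_grad \<Omega> u G"
  shows "AE x in lebesgue_on \<Omega>. weak_grad \<Omega> u x = G x"
  unfolding weak_grad_def
  by (rule has_weak_grad_unique[OF assms(1) _ assms(2)]) (rule someI[where P="has_weak_grad \<Omega> u", OF assms(2)])

lemma norm_vec_power2: "(norm (v :: complex^'n::finite))\<^sup>2 = (\<Sum>i\<in>UNIV. (norm (v $ i))\<^sup>2)"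
  by (simp add: norm_vec_def L2_set_def sum_nonneg)

lemma H1_norm_eq:
  assumes O: "open \<Omega>" and G: "has_weak_grad \<Omega> u G"
  shows "H1_norm \<Omega> u = sqrt ((LINT x|lebesgue_on \<Omega>. (norm (u x))\<^sup>2) + (LINT x|lebesgue_on \<Omega>. (norm (G x))\<^sup>2))"
proof -
  have "(LINT x|lebesgue_on \<Omega>. (norm (weak_grad \<Omega> u x))\<^sup>2) = (LINT x|lebesgue_on \<Omega>. (norm (G x))\<^sup>2)"
  proof (rule lebesgue_on_cong_AE(2))
    show "AE x in lebesgue_on \<Omega>. (norm (weak_grad \<Omega> u x))\<^sup>2 = (norm (G x))\<^sup>2"
      using weak_grad_AE_eq[OF assms] by eventually_elim simp
  qed (use O in auto)
  then show ?thesis by (simp add: H1_norm_def)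
qed

lemma has_weak_grad_diff:
  assumes O: "open \<Omega>" and G: "has_weak_grad \<Omega> u G" and H: "has_weak_grad \<Omega> w H"
  shows "has_weak_grad \<Omega> (\<lambda>x. u x - w x) (\<lambda>x. G x - H x)"
  unfolding has_weak_grad_def
proof (intro conjI allI ballI)
  show "(\<lambda>x. u x - w x) \<in> L1_loc \<Omega>" "(\<lambda>x. (G x - H x) $ i) \<in> L1_loc \<Omega>" for i
    using G H by (auto simp: has_weak_grad_def intro: L1_loc_diff)
  fix i \<phi> assume \<phi>: "\<phi> \<in> test_functions \<Omega>"
  have "integrable (lebesgue_on \<Omega>) (\<lambda>x. G x $ i * \<phi> x)" "integrable (lebesgue_on \<Omega>) (\<lambda>x. H x $ i * \<phi> x)"
    "integrable (lebesgue_on \<Omega>) (\<lambda>x. u x * partial_deriv i \<phi> x)" "integrable (lebesgue_on \<Omega>) (\<lambda>x. w x * partial_deriv i \<phi> x)"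
    using G H test_functions_partial_deriv[OF \<phi> O]
    by (auto simp: has_weak_grad_def intro!: integrable_L1_loc_mult_test[OF _ O] \<phi>)
  then show "(LINT x|lebesgue_on \<Omega>. (u x - w x) * partial_deriv i \<phi> x) = - (LINT x|lebesgue_on \<Omega>. (G x - H x) $ i * \<phi> x)"
    using G H \<phi> by (simp add: has_weak_grad_def left_diff_distrib)
qed

lemma L2_diff:
  assumes "u \<in> L2 \<Omega>" "w \<in> L2 \<Omega>"
  shows "(\<lambda>x. u x - w x) \<in> L2 \<Omega>"
proof -
  have m[measurable]: "u \<in> borel_measurable (lebesgue_on \<Omega>)" "w \<in> borel_measurable (lebesgue_on \<Omega>)"
    and i: "integrable (lebesgue_on \<Omega>) (\<lambda>x. (norm (u x))\<^sup>2)" "integrable (lebesgue_on \<Omega>) (\<lambda>x. (norm (w x))\<^sup>2)"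
    using assms by (auto simp: L2_def)
  have "(norm (a - b))\<^sup>2 \<le> 2 * (norm a)\<^sup>2 + 2 * (norm b)\<^sup>2" for a b :: complex
  proof -
    have "(norm (a - b))\<^sup>2 \<le> (norm a + norm b)\<^sup>2" by (intro power_mono norm_triangle_ineq4) auto
    also have "\<dots> \<le> 2 * (norm a)\<^sup>2 + 2 * (norm b)\<^sup>2"
      using sum_squares_bound[of "norm a" "norm b"] by (simp add: power2_sum)
    finally show ?thesis .
  qed
  note bd = this
  have "integrable (lebesgue_on \<Omega>) (\<lambda>x. (norm (u x - w x))\<^sup>2)"
  proof (rule Bochner_Integration.integrable_bound)
    show "integrable (lebesgue_on \<Omega>) (\<lambda>x. 2 * (norm (u x))\<^sup>2 + 2 * (norm (w x))\<^sup>2)"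
      using i by (intro Bochner_Integration.integrable_add integrable_mult_right)
    show "(\<lambda>x. (norm (u x - w x))\<^sup>2) \<in> borel_measurable (lebesgue_on \<Omega>)" by measurable
    show "AE x in lebesgue_on \<Omega>. norm ((norm (u x - w x))\<^sup>2) \<le> norm (2 * (norm (u x))\<^sup>2 + 2 * (norm (w x))\<^sup>2)"
      by (rule AE_I2) (simp only: real_norm_def abs_power2, rule order_trans[OF bd abs_ge_self])
  qed
  then show ?thesis by (auto simp: L2_def)
qed

lemma H1_diff:
  assumes "open \<Omega>" "u \<in> H1 \<Omega>" "w \<in> H1 \<Omega>"
  shows "(\<lambda>x. u x - w x) \<in> H1 \<Omega>"
proof -
  obtain G H where G: "has_weak_grad \<Omega> u G" "\<And>i. (\<lambda>x. G x $ i) \<in> L2 \<Omega>"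
    and H: "has_weak_grad \<Omega> w H" "\<And>i. (\<lambda>x. H x $ i) \<in> L2 \<Omega>"
    using assms by (auto simp: H1_def)
  have "(\<lambda>x. u x - w x) \<in> L2 \<Omega>" using assms by (intro L2_diff) (auto simp: H1_def)
  moreover have "(\<lambda>x. (G x - H x) $ i) \<in> L2 \<Omega>" for i using L2_diff[OF G(2) H(2)] by simp
  ultimately show ?thesis
    unfolding H1_def using has_weak_grad_diff[OF assms(1) G(1) H(1)] by blast
qed

lemma L2_imp_integrable:
  assumes "u \<in> L2 \<Omega>" "\<Omega> \<in> lmeasurable"
  shows "integrable (lebesgue_on \<Omega>) u"
proof (rule Bochner_Integration.integrable_bound[of _ "\<lambda>x. 1 + (norm (u x))\<^sup>2"])
  have "integrable (lebesgue_on \<Omega>) (\<lambda>x. 1 :: real)"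
    using assms(2) by (intro integrable_const_ivl finite_measure.integrable_const finite_measure_lebesgue_on)
  then show "integrable (lebesgue_on \<Omega>) (\<lambda>x. 1 + (norm (u x))\<^sup>2)" using assms by (auto simp: L2_def)
  have "t \<le> 1 + t\<^sup>2" for t :: real using sum_squares_bound[of t 1] zero_le_power2[of t] by (simp add: power2_eq_square) (smt (verit) zero_le_square)
  then show "AE x in lebesgue_on \<Omega>. norm (u x) \<le> norm (1 + (norm (u x))\<^sup>2)" by (intro AE_I2) simp
qed (use assms in \<open>auto simp: L2_def\<close>)

section \<open>Polar coordinates\<close>

lemma polar_nth [simp]: "polar r \<omega> $ 1 = r * cos \<omega>" "polar r \<omega> $ 2 = r * sin \<omega>"
  by (simp_all add: polar_def)

lemma vec2_eq_iff: "(x :: 'a^2) = y \<longleftrightarrow> x $ 1 = y $ 1 \<and> x $ 2 = y $ 2"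
  by (simp add: vec_eq_iff forall_2)

lemma polar_eq_axis: "polar r \<omega> = (r * cos \<omega>) *\<^sub>R axis 1 1 + (r * sin \<omega>) *\<^sub>R axis 2 1"
  by (simp add: vec2_eq_iff axis_def)

lemma norm_vec2: "norm (x :: real^2) = sqrt ((x $ 1)\<^sup>2 + (x $ 2)\<^sup>2)"
  by (simp add: norm_vec_def L2_set_def sum_2)

lemma norm_polar [simp]: "norm (polar r \<omega>) = \<bar>r\<bar>"
proof -
  have "(r * cos \<omega>)\<^sup>2 + (r * sin \<omega>)\<^sup>2 = r\<^sup>2"
    unfolding power_mult_distrib distrib_left[symmetric] by simp
  then show ?thesis by (simp add: norm_vec2)
qed

lemma continuous_on_polar [continuous_intros]:
  fixes f g :: "'a::t2_space \<Rightarrow> real"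
  assumes "continuous_on S f" "continuous_on S g"
  shows "continuous_on S (\<lambda>x. polar (f x) (g x))"
  unfolding polar_eq_axis by (intro continuous_intros assms)

lemma polar_surj:
  fixes x :: "real^2"
  obtains \<omega> where "0 \<le> \<omega>" "\<omega> < 2 * pi" "x = polar (norm x) \<omega>"
proof (cases "x = 0")
  case True
  then show ?thesis using that[of 0] by (auto simp: vec2_eq_iff)
next
  case False
  have "(x $ 1 / norm x)\<^sup>2 + (x $ 2 / norm x)\<^sup>2 = ((x $ 1)\<^sup>2 + (x $ 2)\<^sup>2) / (norm x)\<^sup>2"
    by (simp add: power_divide add_divide_distrib)
  also have "(x $ 1)\<^sup>2 + (x $ 2)\<^sup>2 = (norm x)\<^sup>2" by (simp add: norm_vec2)
  finally have "(x $ 1 / norm x)\<^sup>2 + (x $ 2 / norm x)\<^sup>2 = 1" using False by simp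
  then obtain t where "0 \<le> t" "t < 2 * pi" "x $ 1 / norm x = cos t" "x $ 2 / norm x = sin t"
    by (rule sincos_total_2pi)
  then have "x $ 1 = norm x * cos t" "x $ 2 = norm x * sin t" using False by (simp_all add: field_simps)
  then have "x = polar (norm x) t" unfolding vec2_eq_iff polar_nth by blast
  then show ?thesis using that[of t] \<open>0 \<le> t\<close> \<open>t < 2 * pi\<close> by blast
qed

lemma frechet_derivative_vec2:
  fixes f :: "real^2 \<Rightarrow> complex"
  assumes "f differentiable (at x)"
  shows "frechet_derivative f (at x) (a *\<^sub>R axis 1 1 + b *\<^sub>R axis 2 1)
    = of_real a * partial_deriv 1 f x + of_real b * partial_deriv 2 f x"
  unfolding partial_deriv_def linear_add[OF linear_frechet_derivative[OF assms]]
    linear_cmul[OF linear_frechet_derivative[OF assms]]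
  by (simp add: scaleR_conv_of_real)

lemma has_vector_derivative_polar_radial:
  fixes f :: "real^2 \<Rightarrow> complex"
  assumes "f differentiable (at (polar r \<omega>))"
  shows "((\<lambda>s. f (polar s \<omega>)) has_vector_derivative
    (of_real (cos \<omega>) * partial_deriv 1 f (polar r \<omega>) + of_real (sin \<omega>) * partial_deriv 2 f (polar r \<omega>))) (at r)"
proof -
  let ?D = "frechet_derivative f (at (polar r \<omega>))"
  have "(f has_derivative ?D) (at (polar r \<omega>))" using assms frechet_derivative_works by blast
  moreover have "((\<lambda>s. polar s \<omega>) has_derivative (\<lambda>h. (h * cos \<omega>) *\<^sub>R axis 1 1 + (h * sin \<omega>) *\<^sub>R axis 2 1)) (at r)"
    unfolding polar_eq_axis by (auto intro!: derivative_eq_intros)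
  ultimately have "((\<lambda>s. f (polar s \<omega>)) has_derivative
      (\<lambda>h. ?D ((h * cos \<omega>) *\<^sub>R axis 1 1 + (h * sin \<omega>) *\<^sub>R axis 2 1))) (at r)"
    by (rule has_derivative_compose[rotated])
  then show ?thesis
    unfolding frechet_derivative_vec2[OF assms] has_vector_derivative_def
    by (simp add: scaleR_conv_of_real algebra_simps)
qed

lemma has_vector_derivative_polar_angular:
  fixes f :: "real^2 \<Rightarrow> complex"
  assumes "f differentiable (at (polar r \<omega>))"
  shows "((\<lambda>t. f (polar r t)) has_vector_derivative
    (of_real (- r * sin \<omega>) * partial_deriv 1 f (polar r \<omega>) + of_real (r * cos \<omega>) * partial_deriv 2 f (polar r \<omega>))) (at \<omega>)"
proof -
  let ?D = "frechet_derivative f (at (polar r \<omega>))"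
  have "(f has_derivative ?D) (at (polar r \<omega>))" using assms frechet_derivative_works by blast
  moreover have "((\<lambda>t. polar r t) has_derivative (\<lambda>h. (h * (- r * sin \<omega>)) *\<^sub>R axis 1 1 + (h * (r * cos \<omega>)) *\<^sub>R axis 2 1)) (at \<omega>)"
    unfolding polar_eq_axis by (auto intro!: derivative_eq_intros simp: algebra_simps)
  ultimately have "((\<lambda>t. f (polar r t)) has_derivative
      (\<lambda>h. ?D ((h * (- r * sin \<omega>)) *\<^sub>R axis 1 1 + (h * (r * cos \<omega>)) *\<^sub>R axis 2 1))) (at \<omega>)"
    by (rule has_derivative_compose[rotated])
  then show ?thesis
    unfolding frechet_derivative_vec2[OF assms] has_vector_derivative_def
    by (simp add: scaleR_conv_of_real algebra_simps)
qed

definition closed_annulus :: "real \<Rightarrow> real \<Rightarrow> (real^2) set" where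
  "closed_annulus R0 R = {x. R0 \<le> norm x \<and> norm x \<le> R}"

lemma mem_annulus [simp]: "x \<in> annulus R0 R \<longleftrightarrow> R0 < norm x \<and> norm x < R"
  by (auto simp: annulus_def)

lemma open_annulus: "open (annulus R0 R)"
  by (simp add: annulus_def open_Diff)

lemma annulus_lmeasurable: "annulus R0 R \<in> lmeasurable"
  unfolding annulus_def by (intro fmeasurable.Diff) (auto intro: lmeasurable_open lmeasurable_compact)

lemma annulus_sets: "annulus R0 R \<in> sets lebesgue"
  using open_annulus by auto

lemma compact_closed_annulus: "compact (closed_annulus R0 R)"
proof -
  have "closed_annulus R0 R = cball 0 R - ball 0 R0" by (auto simp: closed_annulus_def)
  then show ?thesis by (simp add: compact_diff)
qed

lemma annulus_subset_closed_annulus: "annulus R0 R \<subseteq> closed_annulus R0 R"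
  by (auto simp: closed_annulus_def)

lemma polar_image:
  assumes "0 < R0"
  shows "(\<lambda>y :: real^2. polar (y $ 1) (y $ 2)) ` box (vector [R0, 0]) (vector [R, 2 * pi])
    = annulus R0 R - {x. x $ 2 = 0 \<and> x $ 1 \<ge> 0}" (is "?g ` ?S = _")
proof (intro equalityI subsetI)
  fix x assume "x \<in> ?g ` ?S"
  then obtain y :: "real^2" where y: "R0 < y $ 1" "y $ 1 < R" "0 < y $ 2" "y $ 2 < 2 * pi" "x = polar (y $ 1) (y $ 2)"
    by (auto simp: mem_box_cart forall_2)
  moreover have False if "sin (y $ 2) = 0" "cos (y $ 2) \<ge> 0"
  proof -
    have "y $ 2 = pi"
    proof (rule ccontr)
      assume "y $ 2 \<noteq> pi"
      then consider "y $ 2 < pi" | "pi < y $ 2" by linarith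
      then show False
      proof cases
        case 1 then show False using sin_gt_zero[of "y $ 2"] y that by auto
      next
        case 2 then show False using sin_lt_zero[of "y $ 2"] y that by auto
      qed
    qed
    then show False using that by simp
  qed
  ultimately show "x \<in> annulus R0 R - {x. x $ 2 = 0 \<and> x $ 1 \<ge> 0}"
    using assms by (auto simp: zero_le_mult_iff)
next
  fix x assume x: "x \<in> annulus R0 R - {x. x $ 2 = 0 \<and> x $ 1 \<ge> 0}"
  obtain \<omega> where w: "0 \<le> \<omega>" "\<omega> < 2 * pi" "x = polar (norm x) \<omega>" by (rule polar_surj)
  have "\<omega> \<noteq> 0"
  proof
    assume "\<omega> = 0"
    then have "x = polar (norm x) 0" using w(3) by simp
    then have "x $ 1 = norm x * cos 0" "x $ 2 = norm x * sin 0" by (metis polar_nth)+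
    then show False using x by auto
  qed
  then have "vector [norm x, \<omega>] \<in> ?S" using w x by (auto simp: mem_box_cart forall_2)
  moreover have "x = ?g (vector [norm x, \<omega>])" unfolding vector_2 by (rule w(3))
  ultimately show "x \<in> ?g ` ?S" by (rule image_eqI[rotated])
qed

lemma polar_inj:
  assumes "0 < R0"
  shows "inj_on (\<lambda>y :: real^2. polar (y $ 1) (y $ 2)) (box (vector [R0, 0]) (vector [R, 2 * pi]))"
proof (rule inj_onI)
  fix x y :: "real^2"
  assume "x \<in> box (vector [R0, 0]) (vector [R, 2 * pi])" "y \<in> box (vector [R0, 0]) (vector [R, 2 * pi])"
    and eq: "polar (x $ 1) (x $ 2) = polar (y $ 1) (y $ 2)"
  then have b: "R0 < x $ 1" "R0 < y $ 1" "0 < x $ 2" "x $ 2 < 2 * pi" "0 < y $ 2" "y $ 2 < 2 * pi"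
    by (auto simp: mem_box_cart forall_2)
  from arg_cong[OF eq, of norm] have 1: "x $ 1 = y $ 1" using b assms by simp
  have "x $ 1 * cos (x $ 2) = y $ 1 * cos (y $ 2)" "x $ 1 * sin (x $ 2) = y $ 1 * sin (y $ 2)"
    using eq polar_nth by metis+
  then have "cos (x $ 2) = cos (y $ 2)" "sin (x $ 2) = sin (y $ 2)" using 1 b assms by auto
  then obtain n :: int where n: "x $ 2 = y $ 2 + 2 * pi * of_int n" using sin_cos_eq_iff by metis
  have "\<bar>2 * pi * of_int n\<bar> < 2 * pi * 1" using n b by linarith
  then have "2 * pi * \<bar>of_int n\<bar> < 2 * pi * 1" by (simp add: abs_mult)
  then have "\<bar>of_int n :: real\<bar> < 1" using pi_gt_zero by (simp only: mult_less_cancel_left_pos mult_pos_pos zero_less_numeral)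
  then have "n = 0" by linarith
  then show "x = y" using 1 n by (simp add: vec2_eq_iff)
qed

lemma polar_change_of_variables:
  fixes F :: "real^2 \<Rightarrow> complex"
  assumes R0: "0 < R0" and F: "F absolutely_integrable_on (annulus R0 R)"
  shows "integral (annulus R0 R) F
     = integral (box (vector [R0, 0]) (vector [R, 2 * pi])) (\<lambda>y :: real^2. y $ 1 *\<^sub>R F (polar (y $ 1) (y $ 2)))"
proof -
  let ?g = "\<lambda>y :: real^2. polar (y $ 1) (y $ 2)"
  let ?S = "box (vector [R0, 0]) (vector [R, 2 * pi]) :: (real^2) set"
  define L :: "complex \<Rightarrow> real^2" where "L z = Re z *\<^sub>R axis 1 1 + Im z *\<^sub>R axis 2 1" for z
  define M :: "real^2 \<Rightarrow> complex" where "M v = of_real (v $ 1) + \<i> * of_real (v $ 2)" for v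
  have bL: "bounded_linear L" unfolding L_def
    by (intro bounded_linear_add bounded_linear_scaleR_left bounded_linear_Re bounded_linear_Im
        bounded_linear_compose[OF bounded_linear_scaleR_left bounded_linear_Re]
        bounded_linear_compose[OF bounded_linear_scaleR_left bounded_linear_Im])
  have bM: "bounded_linear M" unfolding M_def
    by (intro bounded_linear_add bounded_linear_mult_const bounded_linear_const_mult
        bounded_linear_compose[OF bounded_linear_of_real bounded_linear_vec_nth])
  have M_L: "M (L z) = z" for z by (simp add: L_def M_def axis_def complex_eq_iff)
  define g' where "g' y = (\<lambda>h :: real^2. (h $ 1 * cos (y $ 2) - y $ 1 * sin (y $ 2) * h $ 2) *\<^sub>R axis 1 1
       + (h $ 1 * sin (y $ 2) + y $ 1 * cos (y $ 2) * h $ 2) *\<^sub>R (axis 2 1 :: real^2))" for y :: "real^2"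
  have nth: "((\<lambda>y. y $ i) has_derivative (\<lambda>h. h $ i)) (at y within T)" for i :: 2 and y :: "real^2" and T
    by (rule bounded_linear_imp_has_derivative[OF bounded_linear_vec_nth])
  have der: "(?g has_derivative g' y) (at y within ?S)" for y
    unfolding polar_eq_axis g'_def
    by (rule derivative_eq_intros nth refl | simp add: algebra_simps fun_eq_iff)+
  have det: "det (matrix (g' y)) = y $ 1" for y
  proof -
    have "y $ 1 * (cos (y $ 2))\<^sup>2 + y $ 1 * (sin (y $ 2))\<^sup>2 = y $ 1"
      by (metis distrib_left mult.right_neutral sin_cos_squared_add2)
    then show ?thesis
      by (simp add: det_2 matrix_def g'_def axis_def power2_eq_square algebra_simps)
  qed
  have gS: "?g ` ?S = annulus R0 R - {x. x $ 2 = 0 \<and> x $ 1 \<ge> 0}" by (rule polar_image[OF R0])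
  have neg: "negligible {x :: real^2. x $ 2 = 0 \<and> x $ 1 \<ge> 0}"
    by (rule negligible_subset[OF negligible_standard_hyperplane_cart]) auto
  have n1: "negligible {x \<in> ?g ` ?S - annulus R0 R. F x \<noteq> 0}" "negligible {x \<in> annulus R0 R - ?g ` ?S. F x \<noteq> 0}"
    unfolding gS by (auto intro: negligible_subset[OF neg])
  have Fg: "F absolutely_integrable_on ?g ` ?S"
    using absolutely_integrable_spike_set_eq[OF n1] F by blast
  have "integral (?g ` ?S) (L \<circ> F) = integral ?S (\<lambda>y. \<bar>det (matrix (g' y))\<bar> *\<^sub>R (L \<circ> F) (?g y))"
  proof (rule integral_change_of_variables)
    show "inj_on ?g ?S" by (rule polar_inj[OF R0])
    show "L \<circ> F absolutely_integrable_on ?g ` ?S \<or> (\<lambda>y. \<bar>det (matrix (g' y))\<bar> *\<^sub>R (L \<circ> F) (?g y)) absolutely_integrable_on ?S"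
      using absolutely_integrable_linear[OF Fg bL] by blast
  qed (use der in auto)
  moreover have ai: "(\<lambda>y. \<bar>det (matrix (g' y))\<bar> *\<^sub>R (L \<circ> F) (?g y)) absolutely_integrable_on ?S"
    by (subst absolutely_integrable_change_of_variables[symmetric])
       (use der polar_inj[OF R0] absolutely_integrable_linear[OF Fg bL] in auto)
  ultimately have "M (integral (?g ` ?S) (L \<circ> F)) = integral ?S (M \<circ> (\<lambda>y. \<bar>det (matrix (g' y))\<bar> *\<^sub>R (L \<circ> F) (?g y)))"
    using integral_linear[OF set_lebesgue_integral_eq_integral(1)[OF ai] bM] by simp
  also have "M (integral (?g ` ?S) (L \<circ> F)) = integral (?g ` ?S) F"
    using integral_linear[OF set_lebesgue_integral_eq_integral(1)[OF Fg] bL] M_L by (simp add: o_def)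
  also have "integral (?g ` ?S) F = integral (annulus R0 R) F"
    by (rule integral_spike_set[OF n1])
  also have "integral ?S (M \<circ> (\<lambda>y. \<bar>det (matrix (g' y))\<bar> *\<^sub>R (L \<circ> F) (?g y))) = integral ?S (\<lambda>y. y $ 1 *\<^sub>R F (?g y))"
  proof (rule integral_cong)
    fix y assume "y \<in> ?S"
    then have "y $ 1 > 0" using R0 by (auto simp: mem_box_cart forall_2 intro: less_trans)
    then show "(M \<circ> (\<lambda>y. \<bar>det (matrix (g' y))\<bar> *\<^sub>R (L \<circ> F) (?g y))) y = y $ 1 *\<^sub>R F (?g y)"
      using bM by (simp add: det linear_cmul[OF bounded_linear.linear] M_L)
  qed
  finally show ?thesis .
qed

lemma integral_vec2_eq_integral_pair:
  fixes f :: "real \<times> real \<Rightarrow> complex"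
  assumes "f integrable_on cbox (a, c) (b, d)"
  shows "integral (cbox (vector [a, c]) (vector [b, d])) (\<lambda>y :: real^2. f (y $ 1, y $ 2)) = integral (cbox (a, c) (b, d)) f"
proof -
  let ?g = "\<lambda>y :: real^2. (y $ 1, y $ 2)" and ?h = "\<lambda>p :: real \<times> real. vector [fst p, snd p] :: real^2"
  have gi: "?g ` cbox u v = cbox (u $ 1, u $ 2) (v $ 1, v $ 2)" for u v
  proof -
    have "p \<in> ?g ` cbox u v" if "p \<in> cbox (u $ 1, u $ 2) (v $ 1, v $ 2)" for p
      using that by (intro image_eqI[of _ _ "?h p"]) (auto simp: mem_box_cart forall_2 cbox_Pair_eq)
    then show ?thesis by (auto simp: mem_box_cart forall_2 cbox_Pair_eq)
  qed
  have hi: "?h ` cbox u v = cbox (vector [fst u, snd u]) (vector [fst v, snd v])" for u v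
  proof -
    have "p \<in> ?h ` cbox u v" if "p \<in> cbox (vector [fst u, snd u]) (vector [fst v, snd v])" for p
      using that by (intro image_eqI[of _ _ "?g p"])
         (auto simp: mem_box_cart forall_2 vec2_eq_iff, cases u, cases v, auto simp: cbox_Pair_eq)
    then show ?thesis
      by (auto simp: mem_box_cart forall_2) (cases u, cases v, auto simp: cbox_Pair_eq)+
  qed
  have "((\<lambda>y. f (?g y)) has_integral (1 / 1) *\<^sub>R integral (cbox (a, c) (b, d)) f) (?h ` cbox (a, c) (b, d))"
  proof (rule has_integral_twiddle)
    show "continuous (at x) ?g" for x by (intro continuous_intros)
    show "measure lborel (?g ` cbox u v) = 1 * measure lborel (cbox u v)" for u v :: "real^2"
    proof (cases "cbox u v = {}")
      case False
      then have "u $ 1 \<le> v $ 1" "u $ 2 \<le> v $ 2" by (auto simp: interval_ne_empty_cart forall_2 simp flip: not_less)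
      moreover have "measure lborel (cbox u v) = (\<Prod>i\<in>UNIV. v $ i - u $ i)" by (rule content_cbox_cart[OF False])
      ultimately show ?thesis unfolding gi by (simp add: content_Pair UNIV_2)
    qed simp
    show "\<exists>w z. ?g ` cbox u v = cbox w z" for u v using gi by blast
    show "\<exists>w z. ?h ` cbox u v = cbox w z" for u v using hi by blast
    show "(f has_integral integral (cbox (a, c) (b, d)) f) (cbox (a, c) (b, d))"
      using assms by (rule integrable_integral)
  qed (auto simp: vec2_eq_iff)
  then show ?thesis unfolding hi by (simp add: integral_unique)
qed

lemma integral_annulus_polar:
  fixes F :: "real^2 \<Rightarrow> complex"
  assumes R0: "0 < R0" and F: "continuous_on (closed_annulus R0 R) F"
  shows "integrable (lebesgue_on (annulus R0 R)) F"
    and "(LINT x|lebesgue_on (annulus R0 R). F x)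
       = integral {R0..R} (\<lambda>r. integral {0..2 * pi} (\<lambda>\<omega>. of_real r * F (polar r \<omega>)))"
proof -
  have C: "closed_annulus R0 R \<in> sets lebesgue"
    using compact_closed_annulus by (auto intro: lmeasurable_compact fmeasurableD)
  have "integrable (lebesgue_on (closed_annulus R0 R)) F"
    by (rule integrable_lebesgue_on_compact[OF compact_closed_annulus F])
  then have "F absolutely_integrable_on closed_annulus R0 R"
    by (simp add: integrable_lebesgue_on_iff[OF C] set_integrable_def)
  from set_integrable_subset[OF this annulus_sets annulus_subset_closed_annulus]
  have ai: "F absolutely_integrable_on annulus R0 R" .
  then show i: "integrable (lebesgue_on (annulus R0 R)) F"
    by (simp add: integrable_lebesgue_on_iff[OF annulus_sets] set_integrable_def)
  let ?f = "\<lambda>(r, \<omega>). of_real r * F (polar r \<omega>)"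
  have cont: "continuous_on (cbox (R0, 0) (R, 2 * pi)) ?f"
    unfolding split_beta using R0
    by (intro continuous_intros continuous_on_compose2[OF F])
       (auto simp: closed_annulus_def cbox_Pair_eq)
  have "(LINT x|lebesgue_on (annulus R0 R). F x) = integral (annulus R0 R) F"
    by (rule lebesgue_integral_eq_integral[OF i annulus_sets])
  also have "\<dots> = integral (box (vector [R0, 0]) (vector [R, 2 * pi])) (\<lambda>y :: real^2. y $ 1 *\<^sub>R F (polar (y $ 1) (y $ 2)))"
    by (rule polar_change_of_variables[OF R0 ai])
  also have "\<dots> = integral (cbox (vector [R0, 0]) (vector [R, 2 * pi])) (\<lambda>y :: real^2. ?f (y $ 1, y $ 2))"
    by (simp add: integral_open_interval scaleR_conv_of_real)
  also have "\<dots> = integral (cbox (R0, 0) (R, 2 * pi)) ?f"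
    by (rule integral_vec2_eq_integral_pair[OF integrable_continuous[OF cont]])
  also have "\<dots> = integral {R0..R} (\<lambda>r. integral {0..2 * pi} (\<lambda>\<omega>. of_real r * F (polar r \<omega>)))"
    using integral_prod_continuous[OF cont] by simp
  finally show "(LINT x|lebesgue_on (annulus R0 R). F x)
       = integral {R0..R} (\<lambda>r. integral {0..2 * pi} (\<lambda>\<omega>. of_real r * F (polar r \<omega>)))" .
qed

section \<open>The radial Helmholtz equation\<close>

text \<open>Solving Bessel's equation \<open>p'' + p'/r + (k\<^sup>2 - n\<^sup>2/r\<^sup>2) p = 0\<close> for the second derivative.\<close>

definition bessel_rhs :: "real \<Rightarrow> int \<Rightarrow> (real \<Rightarrow> complex) \<Rightarrow> (real \<Rightarrow> complex) \<Rightarrow> real \<Rightarrow> complex" where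
  "bessel_rhs k n p p' r = - (p' r / of_real r) - (of_real k ^ 2 - of_int n ^ 2 / of_real r ^ 2) * p r"

text \<open>A solution is carried together with its derivative: at the endpoint \<open>R0\<close> only the continuous
  extension of the derivative is available, and boundary fluxes are expressed through it.\<close>

definition bessel_sol :: "real \<Rightarrow> real \<Rightarrow> int \<Rightarrow> (real \<Rightarrow> complex) \<Rightarrow> (real \<Rightarrow> complex) \<Rightarrow> bool" where
  "bessel_sol k R0 n p p' \<longleftrightarrow>
     continuous_on {R0..} p \<and> continuous_on {R0..} p' \<and>
     (\<forall>r>R0. (p has_vector_derivative p' r) (at r) \<and>
             (p' has_vector_derivative bessel_rhs k n p p' r) (at r))"

lemma bessel_solD:
  assumes "bessel_sol k R0 n p p'"
  shows "continuous_on {R0..} p" "continuous_on {R0..} p'"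
    "\<And>r. r > R0 \<Longrightarrow> (p has_vector_derivative p' r) (at r)"
    "\<And>r. r > R0 \<Longrightarrow> (p' has_vector_derivative bessel_rhs k n p p' r) (at r)"
  using assms by (auto simp: bessel_sol_def)

lemma bessel_sol_zero: "bessel_sol k R0 n (\<lambda>_. 0) (\<lambda>_. 0)"
  by (auto simp: bessel_sol_def bessel_rhs_def)

lemma bessel_rhs_linear:
  "bessel_rhs k n (\<lambda>r. a * p r + b * q r) (\<lambda>r. a * p' r + b * q' r) r
   = a * bessel_rhs k n p p' r + b * bessel_rhs k n q q' r"
  by (simp add: bessel_rhs_def algebra_simps add_divide_distrib)

lemma bessel_sol_linear:
  assumes "bessel_sol k R0 n p p'" "bessel_sol k R0 n q q'"
  shows "bessel_sol k R0 n (\<lambda>r. a * p r + b * q r) (\<lambda>r. a * p' r + b * q' r)"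
  using assms unfolding bessel_sol_def bessel_rhs_linear
  by (auto intro!: continuous_intros has_vector_derivative_add has_vector_derivative_mult_right)

lemma bessel_rhs_cnj:
  "bessel_rhs k n (\<lambda>r. cnj (p r)) (\<lambda>r. cnj (p' r)) r = cnj (bessel_rhs k n p p' r)"
  by (simp add: bessel_rhs_def)

lemma bessel_sol_cnj:
  assumes "bessel_sol k R0 n p p'"
  shows "bessel_sol k R0 n (\<lambda>r. cnj (p r)) (\<lambda>r. cnj (p' r))"
  using assms unfolding bessel_sol_def bessel_rhs_cnj
  by (auto intro!: continuous_intros has_vector_derivative_cnj)

lemma has_vector_derivative_complex_of_real: "((\<lambda>r. complex_of_real r) has_vector_derivative 1) (at r)"
  using has_vector_derivative_of_real[of "\<lambda>x. x" 1 "at r", where 'a=complex] by simp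

lemma bessel_wronskian:
  assumes p: "bessel_sol k R0 n p p'" and q: "bessel_sol k R0 n q q'" and R0: "0 < R0" and r: "R0 \<le> r"
  shows "of_real r * (p' r * q r - p r * q' r) = of_real R0 * (p' R0 * q R0 - p R0 * q' R0)"
proof -
  let ?W = "\<lambda>r. of_real r * (p' r * q r - p r * q' r)"
  note pD = bessel_solD[OF p] and qD = bessel_solD[OF q]
  have "norm (?W r - ?W R0) \<le> 0 * (r - R0)"
  proof (rule vector_derivative_bound[OF r])
    have "continuous_on {R0..} ?W" by (intro continuous_intros pD qD)
    then show "continuous_on {R0..r} ?W" by (rule continuous_on_subset) auto
    fix t assume t: "R0 < t" "t < r"
    show "(?W has_vector_derivative (of_real t * ((p' t * q' t + bessel_rhs k n p p' t * q t)
        - (p t * bessel_rhs k n q q' t + p' t * q' t)) + 1 * (p' t * q t - p t * q' t))) (at t)"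
      by (intro has_vector_derivative_mult has_vector_derivative_diff has_vector_derivative_complex_of_real pD qD t)
    show "norm (of_real t * ((p' t * q' t + bessel_rhs k n p p' t * q t)
        - (p t * bessel_rhs k n q q' t + p' t * q' t)) + 1 * (p' t * q t - p t * q' t)) \<le> 0"
      using t R0 by (simp add: bessel_rhs_def field_simps)
  qed
  then show ?thesis by simp
qed

lemma has_real_derivative_cmod_power2:
  assumes "(f has_vector_derivative f') (at r)"
  shows "((\<lambda>r. (cmod (f r))\<^sup>2) has_real_derivative 2 * Re (cnj (f r) * f')) (at r)"
proof -
  have re: "((\<lambda>r. Re (f r)) has_real_derivative Re f') (at r)"
    using bounded_linear.has_vector_derivative[OF bounded_linear_Re assms]
    by (simp add: has_real_derivative_iff_has_vector_derivative)
  have im: "((\<lambda>r. Im (f r)) has_real_derivative Im f') (at r)"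
    using bounded_linear.has_vector_derivative[OF bounded_linear_Im assms]
    by (simp add: has_real_derivative_iff_has_vector_derivative)
  have "((\<lambda>r. Re (f r) * Re (f r) + Im (f r) * Im (f r)) has_real_derivative
      (Re f' * Re (f r) + Re f' * Re (f r)) + (Im f' * Im (f r) + Im f' * Im (f r))) (at r)"
    by (intro DERIV_add DERIV_mult re im)
  then show ?thesis unfolding cmod_power2
    by (simp add: power2_eq_square algebra_simps)
qed

text \<open>With \<open>P = \<surd>r p\<close> Bessel's equation becomes \<open>P'' + (k\<^sup>2 - (n\<^sup>2 - 1/4)/r\<^sup>2) P = 0\<close>, and the energy is
  \<open>\<bar>P'\<bar>\<^sup>2 + k\<^sup>2 \<bar>P\<bar>\<^sup>2\<close>, which an oscillator of constant frequency would conserve. The perturbation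
  \<open>(n\<^sup>2 - 1/4)/r\<^sup>2\<close> is integrable at infinity, so the energy stays within a constant factor. Bounds
  from both sides for the solutions at large radii follow.\<close>

definition bessel_energy :: "real \<Rightarrow> (real \<Rightarrow> complex) \<Rightarrow> (real \<Rightarrow> complex) \<Rightarrow> real \<Rightarrow> real" where
  "bessel_energy k p p' r = r * ((cmod (p' r + p r / of_real (2 * r)))\<^sup>2 + k\<^sup>2 * (cmod (p r))\<^sup>2)"

lemma bessel_shifted_derivative:
  assumes p: "bessel_sol k R0 n p p'" and R0: "0 < R0" and r: "R0 < r"
  defines "q \<equiv> \<lambda>r. p' r + p r / of_real (2 * r)"
  shows "(q has_vector_derivative
     (- q r / of_real (2 * r) - of_real k ^ 2 * p r + (of_int n ^ 2 - 1 / 4) * p r / of_real r ^ 2)) (at r)"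
proof -
  note pD = bessel_solD[OF p]
  have r0: "r \<noteq> 0" "complex_of_real r \<noteq> 0" using R0 r by auto
  have i: "((\<lambda>r. 1 / (2 * r)) has_real_derivative - (1 / (2 * r^2))) (at r)"
    using r0 by (auto intro!: derivative_eq_intros simp: power2_eq_square)
  have iv: "((\<lambda>r. complex_of_real (1 / (2 * r))) has_vector_derivative of_real (- (1 / (2 * r^2)))) (at r)"
    by (rule has_vector_derivative_of_real[OF i])
  have "((\<lambda>r. p' r + p r * of_real (1 / (2 * r))) has_vector_derivative
      bessel_rhs k n p p' r + (p r * of_real (- (1 / (2 * r^2))) + p' r * of_real (1 / (2 * r)))) (at r)"
    by (intro has_vector_derivative_add has_vector_derivative_mult iv pD r)
  moreover have "bessel_rhs k n p p' r + (p r * of_real (- (1 / (2 * r^2))) + p' r * of_real (1 / (2 * r)))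
    = - q r / of_real (2 * r) - of_real k ^ 2 * p r + (of_int n ^ 2 - 1 / 4) * p r / of_real r ^ 2"
    using r0 by (simp add: bessel_rhs_def q_def divide_simps power2_eq_square) (simp add: algebra_simps)
  moreover have "(\<lambda>r. p' r + p r * of_real (1 / (2 * r))) = q" by (simp add: q_def fun_eq_iff)
  ultimately show ?thesis by simp
qed

lemma bessel_energy_derivative:
  assumes p: "bessel_sol k R0 n p p'" and R0: "0 < R0" and r: "R0 < r" and k: "0 < k"
  obtains E' where "(bessel_energy k p p' has_real_derivative E') (at r)"
    "\<bar>E'\<bar> \<le> \<bar>of_int n ^ 2 - 1 / 4\<bar> / k / r\<^sup>2 * bessel_energy k p p' r"
proof -
  define q where "q \<equiv> \<lambda>r. p' r + p r / of_real (2 * r)"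
  define m :: real where "m = of_int n ^ 2 - 1 / 4"
  have r0: "r > 0" using R0 r by simp
  have dq: "(q has_vector_derivative
     (- q r / of_real (2 * r) - of_real k ^ 2 * p r + of_real m * p r / of_real r ^ 2)) (at r)"
    using bessel_shifted_derivative[OF p R0 r] by (simp add: q_def m_def)
  have dp: "(p has_vector_derivative (q r - p r / of_real (2 * r))) (at r)"
    using bessel_solD(3)[OF p r] by (simp add: q_def)
  let ?dq = "- q r / of_real (2 * r) - of_real k ^ 2 * p r + of_real m * p r / of_real r ^ 2"
  have "((\<lambda>r. r * ((cmod (q r))\<^sup>2 + k\<^sup>2 * (cmod (p r))\<^sup>2)) has_real_derivative
    1 * ((cmod (q r))\<^sup>2 + k\<^sup>2 * (cmod (p r))\<^sup>2)
    + (2 * Re (cnj (q r) * ?dq) + k\<^sup>2 * (2 * Re (cnj (p r) * (q r - p r / of_real (2 * r))))) * r) (at r)"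
    by (intro DERIV_mult DERIV_add DERIV_ident DERIV_cmult
        has_real_derivative_cmod_power2[OF dq] has_real_derivative_cmod_power2[OF dp])
  moreover have "1 * ((cmod (q r))\<^sup>2 + k\<^sup>2 * (cmod (p r))\<^sup>2)
    + (2 * Re (cnj (q r) * ?dq) + k\<^sup>2 * (2 * Re (cnj (p r) * (q r - p r / of_real (2 * r))))) * r
    = 2 * m * Re (cnj (q r) * p r) / r"
  proof -
    have "?dq = of_real (- 1 / (2 * r)) * q r + of_real (m / r^2 - k^2) * p r"
      using r0 by (simp add: field_simps)
    then have "Re (cnj (q r) * ?dq) = (- 1 / (2 * r)) * (cmod (q r))\<^sup>2 + (m / r^2 - k^2) * Re (cnj (q r) * p r)"
      unfolding cmod_power2 by (simp add: power2_eq_square algebra_simps add_divide_distrib)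
    moreover have "q r - p r / of_real (2 * r) = q r + of_real (- 1 / (2 * r)) * p r" by simp
    then have "Re (cnj (p r) * (q r - p r / of_real (2 * r))) = Re (cnj (q r) * p r) + (- 1 / (2 * r)) * (cmod (p r))\<^sup>2"
      unfolding cmod_power2 by (simp add: power2_eq_square algebra_simps add_divide_distrib)
    ultimately show ?thesis using r0 by (simp add: field_simps power2_eq_square)
  qed
  moreover have "(\<lambda>r. r * ((cmod (q r))\<^sup>2 + k\<^sup>2 * (cmod (p r))\<^sup>2)) = bessel_energy k p p'"
    by (simp add: bessel_energy_def q_def fun_eq_iff)
  ultimately have D: "(bessel_energy k p p' has_real_derivative 2 * m * Re (cnj (q r) * p r) / r) (at r)" by simp
  have "2 * k * \<bar>Re (cnj (q r) * p r)\<bar> \<le> 2 * k * (cmod (q r) * cmod (p r))"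
    using abs_Re_le_cmod[of "cnj (q r) * p r"] k unfolding norm_mult complex_mod_cnj
    by (intro mult_left_mono) auto
  also have "\<dots> = 2 * cmod (q r) * (k * cmod (p r))" by (simp only: mult_ac)
  also have "\<dots> \<le> (cmod (q r))\<^sup>2 + (k * cmod (p r))\<^sup>2" by (rule sum_squares_bound)
  also have "\<dots> = (cmod (q r))\<^sup>2 + k\<^sup>2 * (cmod (p r))\<^sup>2" by (simp add: power_mult_distrib)
  also have "\<dots> = bessel_energy k p p' r / r" using r0 by (simp add: bessel_energy_def q_def)
  finally have "\<bar>m\<bar> / (k * r) * (2 * k * \<bar>Re (cnj (q r) * p r)\<bar>) \<le> \<bar>m\<bar> / (k * r) * (bessel_energy k p p' r / r)"
    using k r0 by (intro mult_left_mono) auto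
  moreover have "\<bar>m\<bar> / (k * r) * (2 * k * \<bar>Re (cnj (q r) * p r)\<bar>) = \<bar>2 * m * Re (cnj (q r) * p r) / r\<bar>"
    using k r0 by (simp add: abs_mult)
  moreover have "\<bar>m\<bar> / (k * r) * (bessel_energy k p p' r / r) = \<bar>m\<bar> / k / r\<^sup>2 * bessel_energy k p p' r"
    by (simp add: power2_eq_square)
  ultimately have "\<bar>2 * m * Re (cnj (q r) * p r) / r\<bar> \<le> \<bar>m\<bar> / k / r\<^sup>2 * bessel_energy k p p' r"
    by (simp only:)
  then show ?thesis using that[OF D] unfolding m_def by blast
qed

lemma bessel_energy_nonneg: "0 \<le> r \<Longrightarrow> 0 \<le> bessel_energy k p p' r"
  by (simp add: bessel_energy_def)

lemma bessel_energy_continuous: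
  assumes p: "bessel_sol k R0 n p p'" and R0: "0 < R0"
  shows "continuous_on {R0..} (bessel_energy k p p')"
  unfolding bessel_energy_def using R0 by (intro continuous_intros bessel_solD[OF p]) auto

text \<open>Gronwall's argument: the logarithmic derivative of the energy is bounded by \<open>M/r\<^sup>2\<close>, whose integral
  over \<open>{R0..}\<close> is \<open>M/R0\<close>.\<close>

lemma bessel_energy_comparable:
  assumes p: "bessel_sol k R0 n p p'" and R0: "0 < R0" and k: "0 < k" and r: "R0 \<le> r" and s: "R0 \<le> s"
  shows "bessel_energy k p p' r \<le> exp (\<bar>of_int n ^ 2 - 1 / 4\<bar> / k / R0) * bessel_energy k p p' s"
proof -
  define M where "M = \<bar>of_int n ^ 2 - 1 / 4\<bar> / k"
  let ?E = "bessel_energy k p p'"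
  have M: "M \<ge> 0" using k by (simp add: M_def)
  have key: "?E a \<le> exp (M / a - M / b) * ?E b \<and> ?E b \<le> exp (M / a - M / b) * ?E a" if ab: "R0 \<le> a" "a \<le> b" for a b
  proof -
    have cont: "continuous_on {a..b} ?E"
      using bessel_energy_continuous[OF p R0] by (rule continuous_on_subset) (use ab in auto)
    have c2: "continuous_on {a..b} (\<lambda>t. exp (c / t))" for c :: real
      using ab R0 by (intro continuous_intros) auto
    have dexp: "((\<lambda>t. exp (c / t)) has_real_derivative - c / t\<^sup>2 * exp (c / t)) (at t)" if "t > 0" for c t :: real
      using that by (auto intro!: derivative_eq_intros simp: power2_eq_square)
    have 1: "?E a * exp (- M / a) \<le> ?E b * exp (- M / b)"
    proof (rule DERIV_nonneg_imp_increasing_open[OF ab(2)])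
      fix t assume t: "a < t" "t < b"
      then have t0: "R0 < t" "t > 0" using ab R0 by auto
      obtain E' where E': "(?E has_real_derivative E') (at t)" "\<bar>E'\<bar> \<le> M / t\<^sup>2 * ?E t"
        using bessel_energy_derivative[OF p R0 t0(1) k] unfolding M_def by blast
      have "((\<lambda>t. ?E t * exp (- M / t)) has_real_derivative E' * exp (- M / t) + - (- M) / t\<^sup>2 * exp (- M / t) * ?E t) (at t)"
        by (intro DERIV_mult E'(1) dexp t0)
      moreover have "E' * exp (- M / t) + - (- M) / t\<^sup>2 * exp (- M / t) * ?E t = (E' + M / t\<^sup>2 * ?E t) * exp (- M / t)"
        by (simp add: algebra_simps)
      moreover have "\<dots> \<ge> 0" using E'(2) by (intro mult_nonneg_nonneg) auto
      ultimately show "\<exists>y. ((\<lambda>t. ?E t * exp (- M / t)) has_real_derivative y) (at t) \<and> 0 \<le> y" by metis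
    qed (intro continuous_on_mult cont c2)
    have 2: "?E a * exp (M / a) \<ge> ?E b * exp (M / b)"
    proof (rule DERIV_nonpos_imp_decreasing_open[OF ab(2)])
      fix t assume t: "a < t" "t < b"
      then have t0: "R0 < t" "t > 0" using ab R0 by auto
      obtain E' where E': "(?E has_real_derivative E') (at t)" "\<bar>E'\<bar> \<le> M / t\<^sup>2 * ?E t"
        using bessel_energy_derivative[OF p R0 t0(1) k] unfolding M_def by blast
      have "((\<lambda>t. ?E t * exp (M / t)) has_real_derivative E' * exp (M / t) + - M / t\<^sup>2 * exp (M / t) * ?E t) (at t)"
        by (intro DERIV_mult E'(1) dexp t0)
      moreover have "E' * exp (M / t) + - M / t\<^sup>2 * exp (M / t) * ?E t = - ((M / t\<^sup>2 * ?E t - E') * exp (M / t))"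
        by (simp add: algebra_simps)
      moreover have "\<dots> \<le> 0" using E'(2) by auto
      ultimately show "\<exists>y. ((\<lambda>t. ?E t * exp (M / t)) has_real_derivative y) (at t) \<and> y \<le> 0" by metis
    qed (intro continuous_on_mult cont c2)
    show ?thesis using 1 2 by (simp add: exp_diff exp_minus field_simps)
  qed
  have le: "exp (M / a - M / b) * ?E c \<le> exp (M / R0) * ?E c" if "R0 \<le> a" "a \<le> b" "R0 \<le> c" for a b c
  proof (intro mult_right_mono bessel_energy_nonneg)
    have "M / a \<le> M / R0" using that R0 M by (intro divide_left_mono) auto
    moreover have "M / b \<ge> 0" using that R0 M by auto
    ultimately show "exp (M / a - M / b) \<le> exp (M / R0)" by simp
  qed (use that R0 in auto)
  have "?E r \<le> exp (M / R0) * ?E s"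
  proof (cases "r \<le> s")
    case True
    then show ?thesis using key[OF r True] le[OF r True s] by linarith
  next
    case False
    then have "s \<le> r" by simp
    then show ?thesis using key[OF s] le[OF s _ s, of r] by force
  qed
  then show ?thesis by (simp add: M_def)
qed

lemma bessel_sol_bounded:
  assumes p: "bessel_sol k R0 n p p'" and R0: "0 < R0" and k: "0 < k"
  obtains C where "C > 0" "\<And>r. R0 \<le> r \<Longrightarrow> sqrt r * cmod (p r) \<le> C" "\<And>r. R0 \<le> r \<Longrightarrow> sqrt r * cmod (p' r) \<le> C"
proof -
  define B where "B = exp (\<bar>of_int n ^ 2 - 1 / 4\<bar> / k / R0) * bessel_energy k p p' R0"
  have B: "bessel_energy k p p' r \<le> B" if "R0 \<le> r" for r
    unfolding B_def by (rule bessel_energy_comparable[OF p R0 k that order_refl])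
  define q where "q \<equiv> \<lambda>r. p' r + p r / of_real (2 * r)"
  define C where "C = sqrt B / k + (sqrt B + sqrt B / k / (2 * R0)) + 1"
  have B0: "B \<ge> 0" using B[OF order_refl] bessel_energy_nonneg[of R0] R0 by (meson less_imp_le order_trans)
  have *: "sqrt r * cmod (p r) \<le> sqrt B / k" "sqrt r * cmod (q r) \<le> sqrt B" if r: "R0 \<le> r" for r
  proof -
    have r0: "r > 0" using R0 r by simp
    have E: "r * (cmod (q r))\<^sup>2 + r * (k\<^sup>2 * (cmod (p r))\<^sup>2) \<le> B"
      using B[OF r] by (simp add: bessel_energy_def q_def algebra_simps)
    have "0 \<le> r * (cmod (q r))\<^sup>2" "0 \<le> r * (k\<^sup>2 * (cmod (p r))\<^sup>2)" using r0 by auto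
    with E have "r * (k\<^sup>2 * (cmod (p r))\<^sup>2) \<le> B" "r * (cmod (q r))\<^sup>2 \<le> B" by linarith+
    then have "(sqrt r * cmod (p r) * k)\<^sup>2 \<le> B" "(sqrt r * cmod (q r))\<^sup>2 \<le> B"
      using r0 by (simp_all add: power_mult_distrib mult_ac)
    then have "sqrt r * cmod (p r) * k \<le> sqrt B" "sqrt r * cmod (q r) \<le> sqrt B" by (simp_all add: real_le_rsqrt)
    then show "sqrt r * cmod (p r) \<le> sqrt B / k" "sqrt r * cmod (q r) \<le> sqrt B"
      using k by (simp_all add: field_simps)
  qed
  have "C > 0" unfolding C_def using B0 k R0 by (intro add_nonneg_pos add_nonneg_nonneg) auto
  moreover have "sqrt r * cmod (p r) \<le> C" if r: "R0 \<le> r" for r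
  proof -
    have "0 \<le> sqrt B + sqrt B / k / (2 * R0) + 1" using B0 k R0 by simp
    then show ?thesis using *(1)[OF r] unfolding C_def by linarith
  qed
  moreover have "sqrt r * cmod (p' r) \<le> C" if r: "R0 \<le> r" for r
  proof -
    have r0: "r > 0" using R0 r by simp
    have "p' r = q r - p r / of_real (2 * r)" by (simp add: q_def)
    then have "cmod (p' r) \<le> cmod (q r) + cmod (p r) / (2 * r)"
      using norm_triangle_ineq4[of "q r" "p r / of_real (2 * r)"] r0 by (simp add: norm_divide norm_mult)
    then have "sqrt r * cmod (p' r) \<le> sqrt r * (cmod (q r) + cmod (p r) / (2 * r))"
      using r0 by (intro mult_left_mono) auto
    also have "\<dots> = sqrt r * cmod (q r) + sqrt r * cmod (p r) / (2 * r)" by (simp add: algebra_simps)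
    also have "\<dots> \<le> sqrt B + sqrt B / k / (2 * R0)"
      using *[OF r] r R0 k B0 by (intro add_mono frac_le) auto
    also have "\<dots> \<le> C" using B0 k by (simp add: C_def)
    finally show ?thesis .
  qed
  ultimately show ?thesis by (rule that)
qed

section \<open>Outgoing radial solutions and their correctors\<close>

definition outgoing :: "real \<Rightarrow> (real \<Rightarrow> complex) \<Rightarrow> (real \<Rightarrow> complex) \<Rightarrow> bool" where
  "outgoing k p p' \<longleftrightarrow> ((\<lambda>r. of_real (sqrt r) * (p' r - \<i> * of_real k * p r)) \<longlongrightarrow> 0) at_top"

lemma cmod_diff_i_times_power2:
  "(cmod (a - \<i> * of_real k * b))\<^sup>2 = (cmod a)\<^sup>2 + k\<^sup>2 * (cmod b)\<^sup>2 - 2 * k * Im (a * cnj b)"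
  unfolding cmod_power2 by (simp add: power2_eq_square algebra_simps)

text \<open>The Wronskian of \<open>p\<close> and its conjugate makes \<open>r Im (p' cnj p)\<close> constant. If it is zero, the cross
  term in \<open>\<bar>p' - i k p\<bar>\<^sup>2\<close> disappears, so the radiation condition forces the energy to tend to zero,
  which for a comparable energy means that it is zero.\<close>

lemma outgoing_zero_flux_imp_zero:
  assumes p: "bessel_sol k R0 n p p'" and R0: "0 < R0" and k: "0 < k" and out: "outgoing k p p'"
    and flux: "Im (p' R0 * cnj (p R0)) = 0" and r: "R0 \<le> r"
  shows "p r = 0"
proof -
  let ?E = "bessel_energy k p p'"
  have fl: "Im (p' s * cnj (p s)) = 0" if s: "R0 \<le> s" for s
  proof -
    have "z - cnj z = 2 * \<i> * of_real (Im z)" for z by (simp add: complex_eq_iff)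
    from this[of "p' t * cnj (p t)" for t]
    have id: "p' t * cnj (p t) - p t * cnj (p' t) = 2 * \<i> * of_real (Im (p' t * cnj (p t)))" for t
      by (simp add: mult.commute)
    have "of_real s * (2 * \<i> * of_real (Im (p' s * cnj (p s)))) = 0"
      using bessel_wronskian[OF p bessel_sol_cnj[OF p] R0 s] unfolding id flux by simp
    then have "complex_of_real (Im (p' s * cnj (p s))) = 0"
      using s R0 by (simp only: mult_eq_0_iff) auto
    then show ?thesis by (simp only: of_real_eq_0_iff)
  qed
  have lim: "((\<lambda>s. (cmod (of_real (sqrt s) * (p' s - \<i> * of_real k * p s)))\<^sup>2) \<longlongrightarrow> 0) at_top"
    using tendsto_power[OF tendsto_norm[OF out[unfolded outgoing_def]], of 2] by simp
  have bound: "?E r \<le> exp (\<bar>of_int n ^ 2 - 1 / 4\<bar> / k / R0) * ((2 + 1 / (k\<^sup>2 * R0\<^sup>2)) * (cmod (of_real (sqrt s) * (p' s - \<i> * of_real k * p s)))\<^sup>2)"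
    if s: "R0 \<le> s" for s
  proof -
    have s0: "s > 0" using s R0 by simp
    let ?T = "s * (cmod (p' s))\<^sup>2 + s * (k\<^sup>2 * (cmod (p s))\<^sup>2)"
    have T: "(cmod (of_real (sqrt s) * (p' s - \<i> * of_real k * p s)))\<^sup>2 = ?T"
    proof -
      have sq: "(cmod (of_real (sqrt s) * z))\<^sup>2 = s * (cmod z)\<^sup>2" for z
        unfolding norm_mult power_mult_distrib using s0 by simp
      show ?thesis unfolding sq cmod_diff_i_times_power2 fl[OF s] by (simp add: algebra_simps)
    qed
    have "(cmod (p' s + p s / of_real (2 * s)))\<^sup>2 \<le> (cmod (p' s) + cmod (p s) / (2 * s))\<^sup>2"
      using norm_triangle_ineq[of "p' s" "p s / of_real (2 * s)"] s0 by (intro power_mono) (auto simp: norm_divide norm_mult)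
    also have "\<dots> \<le> 2 * (cmod (p' s))\<^sup>2 + 2 * (cmod (p s) / (2 * s))\<^sup>2"
      using sum_squares_bound[of "cmod (p' s)" "cmod (p s) / (2 * s)"] by (simp add: power2_sum)
    also have "2 * (cmod (p s) / (2 * s))\<^sup>2 \<le> (cmod (p s))\<^sup>2 / R0\<^sup>2"
    proof -
      have "cmod (p s) / s \<le> cmod (p s) / R0" using s R0 by (intro divide_left_mono) auto
      then have "(cmod (p s) / s)\<^sup>2 \<le> (cmod (p s) / R0)\<^sup>2" using s0 by (intro power_mono) auto
      moreover have "2 * (cmod (p s) / (2 * s))\<^sup>2 = (cmod (p s) / s)\<^sup>2 / 2" by (simp add: power_divide power_mult_distrib)
      moreover have "(cmod (p s) / R0)\<^sup>2 = (cmod (p s))\<^sup>2 / R0\<^sup>2" by (simp add: power_divide)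
      ultimately show ?thesis using zero_le_power2[of "cmod (p s) / s"] by linarith
    qed
    finally have "s * (cmod (p' s + p s / of_real (2 * s)))\<^sup>2 \<le> s * (2 * (cmod (p' s))\<^sup>2 + (cmod (p s))\<^sup>2 / R0\<^sup>2)"
      using s0 by (intro mult_left_mono) auto
    then have "?E s \<le> s * (2 * (cmod (p' s))\<^sup>2 + (cmod (p s))\<^sup>2 / R0\<^sup>2) + s * (k\<^sup>2 * (cmod (p s))\<^sup>2)"
      by (simp add: bessel_energy_def algebra_simps)
    also have "\<dots> \<le> (2 + 1 / (k\<^sup>2 * R0\<^sup>2)) * ?T"
    proof -
      have "(2 + 1 / (k\<^sup>2 * R0\<^sup>2)) * ?T = s * (2 * (cmod (p' s))\<^sup>2 + (cmod (p s))\<^sup>2 / R0\<^sup>2) + s * (k\<^sup>2 * (cmod (p s))\<^sup>2)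
          + (s * (k\<^sup>2 * (cmod (p s))\<^sup>2) + s * (cmod (p' s))\<^sup>2 / (k\<^sup>2 * R0\<^sup>2))"
        using k R0 by (simp add: field_simps)
      moreover have "0 \<le> s * (k\<^sup>2 * (cmod (p s))\<^sup>2) + s * (cmod (p' s))\<^sup>2 / (k\<^sup>2 * R0\<^sup>2)" using s0 by simp
      ultimately show ?thesis by linarith
    qed
    finally have "?E s \<le> (2 + 1 / (k\<^sup>2 * R0\<^sup>2)) * ?T" .
    then have "exp (\<bar>of_int n ^ 2 - 1 / 4\<bar> / k / R0) * ?E s \<le> exp (\<bar>of_int n ^ 2 - 1 / 4\<bar> / k / R0) * ((2 + 1 / (k\<^sup>2 * R0\<^sup>2)) * ?T)"
      by (intro mult_left_mono) auto
    with bessel_energy_comparable[OF p R0 k r s] show ?thesis unfolding T by linarith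
  qed
  have "?E r \<le> exp (\<bar>of_int n ^ 2 - 1 / 4\<bar> / k / R0) * ((2 + 1 / (k\<^sup>2 * R0\<^sup>2)) * 0)"
  proof (rule tendsto_lowerbound)
    show "((\<lambda>s. exp (\<bar>of_int n ^ 2 - 1 / 4\<bar> / k / R0) * ((2 + 1 / (k\<^sup>2 * R0\<^sup>2)) * (cmod (of_real (sqrt s) * (p' s - \<i> * of_real k * p s)))\<^sup>2))
       \<longlongrightarrow> exp (\<bar>of_int n ^ 2 - 1 / 4\<bar> / k / R0) * ((2 + 1 / (k\<^sup>2 * R0\<^sup>2)) * 0)) at_top"
      by (intro tendsto_mult tendsto_const lim)
    show "\<forall>\<^sub>F s in at_top. ?E r \<le> exp (\<bar>of_int n ^ 2 - 1 / 4\<bar> / k / R0) * ((2 + 1 / (k\<^sup>2 * R0\<^sup>2)) * (cmod (of_real (sqrt s) * (p' s - \<i> * of_real k * p s)))\<^sup>2)"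
      using eventually_ge_at_top[of R0] by eventually_elim (rule bound)
  qed simp
  then have "?E r \<le> 0" by simp
  moreover have "r * (k\<^sup>2 * (cmod (p r))\<^sup>2) \<le> ?E r" using r R0 by (simp add: bessel_energy_def algebra_simps)
  ultimately have "r * (k\<^sup>2 * (cmod (p r))\<^sup>2) \<le> 0" by linarith
  then show ?thesis using r R0 k by (auto simp: mult_le_0_iff)
qed

text \<open>The radiation condition only says that \<open>\<surd>r (p' - i k p)\<close> tends to zero; the equation improves this to
  the rate \<open>1/r\<close>. In terms of \<open>P = \<surd>r p\<close> the function \<open>w = e\<^sup>i\<^sup>k\<^sup>r (P' - i k P)\<close> has the derivative
  \<open>(n\<^sup>2 - 1/4) e\<^sup>i\<^sup>k\<^sup>r P / r\<^sup>2\<close>, and \<open>P\<close> is bounded; integrating from \<open>r\<close> to infinity, where \<open>w\<close> vanishes,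
  gives \<open>w = O(1/r)\<close>.\<close>

lemma outgoing_decay:
  assumes p: "bessel_sol k R0 n p p'" and R0: "0 < R0" and k: "0 < k" and out: "outgoing k p p'"
  obtains C where "C > 0" "\<And>r. R0 \<le> r \<Longrightarrow> r * sqrt r * cmod (p' r - \<i> * of_real k * p r) \<le> C"
    "\<And>r. R0 \<le> r \<Longrightarrow> r * sqrt r * cmod (bessel_rhs k n p p' r - \<i> * of_real k * p' r) \<le> C"
proof -
  obtain B where B: "B > 0" "\<And>r. R0 \<le> r \<Longrightarrow> sqrt r * cmod (p r) \<le> B" "\<And>r. R0 \<le> r \<Longrightarrow> sqrt r * cmod (p' r) \<le> B"
    using bessel_sol_bounded[OF p R0 k] by blast
  define q where "q \<equiv> \<lambda>r. p' r + p r / of_real (2 * r)"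
  define m :: real where "m = of_int n ^ 2 - 1 / 4"
  define w where "w = (\<lambda>r. exp (\<i> * of_real (k * r)) * (of_real (sqrt r) * (q r - \<i> * of_real k * p r)))"
  define w' where "w' = (\<lambda>r. exp (\<i> * of_real (k * r)) * (of_real (sqrt r) * (of_real m * p r / of_real r ^ 2)))"
  have dw: "(w has_vector_derivative w' r) (at r)" if r: "R0 < r" for r
  proof -
    have r0: "r > 0" using r R0 by simp
    let ?dq = "- q r / of_real (2 * r) - of_real k ^ 2 * p r + of_real m * p r / of_real r ^ 2"
    have dq: "(q has_vector_derivative ?dq) (at r)"
      using bessel_shifted_derivative[OF p R0 r] by (simp add: q_def m_def)
    have dp: "(p has_vector_derivative p' r) (at r)" by (rule bessel_solD(3)[OF p r])
    have "(sqrt has_real_derivative inverse (sqrt r) / 2) (at r)" using DERIV_real_sqrt[OF r0] .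
    then have ds: "((\<lambda>r. complex_of_real (sqrt r)) has_vector_derivative of_real (inverse (sqrt r) / 2)) (at r)"
      by (rule has_vector_derivative_of_real)
    have "((\<lambda>z. exp (\<i> * of_real k * z)) has_field_derivative exp (\<i> * of_real k * of_real r) * (\<i> * of_real k)) (at (of_real r))"
      by (auto intro!: derivative_eq_intros)
    from has_vector_derivative_real_field[OF this]
    have de: "((\<lambda>r. exp (\<i> * of_real (k * r))) has_vector_derivative exp (\<i> * of_real (k * r)) * (\<i> * of_real k)) (at r)"
      by (simp add: mult.assoc)
    have "(w has_vector_derivative (exp (\<i> * of_real (k * r)) * (of_real (sqrt r) * (?dq - \<i> * of_real k * p' r)
          + of_real (inverse (sqrt r) / 2) * (q r - \<i> * of_real k * p r))
        + exp (\<i> * of_real (k * r)) * (\<i> * of_real k) * (of_real (sqrt r) * (q r - \<i> * of_real k * p r)))) (at r)"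
      unfolding w_def
      by (intro has_vector_derivative_mult has_vector_derivative_diff has_vector_derivative_mult_right dq dp ds de)
    moreover have "exp (\<i> * of_real (k * r)) * (of_real (sqrt r) * (?dq - \<i> * of_real k * p' r)
          + of_real (inverse (sqrt r) / 2) * (q r - \<i> * of_real k * p r))
        + exp (\<i> * of_real (k * r)) * (\<i> * of_real k) * (of_real (sqrt r) * (q r - \<i> * of_real k * p r)) = w' r"
    proof -
      have "inverse (sqrt r) = sqrt r / r" using r0 by (simp add: field_simps)
      then have isq: "complex_of_real (inverse (sqrt r) / 2) = of_real (sqrt r) * (1 / of_real (2 * r))" by simp
      have pq: "p' r = q r - p r / of_real (2 * r)" by (simp add: q_def)
      have "(?dq - \<i> * of_real k * p' r) + 1 / of_real (2 * r) * (q r - \<i> * of_real k * p r) + \<i> * of_real k * (q r - \<i> * of_real k * p r)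
          = of_real m * p r / of_real r ^ 2"
        unfolding pq by (simp add: algebra_simps power2_eq_square)
      note eq = this
      have ring: "e * (s * A + s * b * Q) + e * c * (s * Q) = e * (s * (A + b * Q + c * Q))" for e s A b Q c :: complex
        by (simp add: algebra_simps)
      show ?thesis unfolding isq ring w'_def eq ..
    qed
    ultimately show ?thesis by simp
  qed
  have nexp: "cmod (exp (\<i> * of_real (k * r))) = 1" for r using norm_exp_i_times[of "k * r"] by simp
  have nw: "cmod (w r) = sqrt r * cmod (q r - \<i> * of_real k * p r)" if "r \<ge> 0" for r
    using that by (simp add: w_def norm_mult nexp)
  have w0: "((\<lambda>r. cmod (w r)) \<longlongrightarrow> 0) at_top"
  proof (rule tendsto_sandwich)
    show "((\<lambda>r. 0) \<longlongrightarrow> 0) at_top" by simp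
    have "((\<lambda>r. B / 2 * inverse r) \<longlongrightarrow> B / 2 * 0) at_top"
      by (intro tendsto_mult tendsto_const tendsto_inverse_0_at_top filterlim_ident)
    from tendsto_add[OF tendsto_norm[OF out[unfolded outgoing_def]] this]
    show "((\<lambda>r. cmod (of_real (sqrt r) * (p' r - \<i> * of_real k * p r)) + B / 2 * inverse r) \<longlongrightarrow> 0) at_top" by simp
    show "\<forall>\<^sub>F r in at_top. 0 \<le> cmod (w r)" by simp
    show "\<forall>\<^sub>F r in at_top. cmod (w r) \<le> cmod (of_real (sqrt r) * (p' r - \<i> * of_real k * p r)) + B / 2 * inverse r"
      using eventually_ge_at_top[of R0]
    proof eventually_elim
      case (elim r)
      then have r0: "r > 0" using R0 by simp
      have qe: "q r - \<i> * of_real k * p r = (p' r - \<i> * of_real k * p r) + p r / of_real (2 * r)" by (simp add: q_def)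
      have "cmod (q r - \<i> * of_real k * p r) \<le> cmod (p' r - \<i> * of_real k * p r) + cmod (p r) / (2 * r)"
        unfolding qe using norm_triangle_ineq[of "p' r - \<i> * of_real k * p r" "p r / of_real (2 * r)"] r0 by (simp add: norm_divide norm_mult)
      then have "cmod (w r) \<le> sqrt r * (cmod (p' r - \<i> * of_real k * p r) + cmod (p r) / (2 * r))"
        using r0 nw[of r] by (simp add: mult_left_mono)
      also have "\<dots> = sqrt r * cmod (p' r - \<i> * of_real k * p r) + (sqrt r * cmod (p r)) * (inverse r / 2)"
        using r0 by (simp add: field_simps)
      also have "\<dots> \<le> sqrt r * cmod (p' r - \<i> * of_real k * p r) + B * (inverse r / 2)"
        using B(2)[OF elim] r0 by (intro add_left_mono mult_right_mono) auto
      finally show ?case using r0 by (simp add: norm_mult)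
    qed
  qed
  have wb: "cmod (w r) \<le> \<bar>m\<bar> * B / r" if r: "R0 \<le> r" for r
  proof -
    have r0: "r > 0" using r R0 by simp
    have contw: "continuous_on {R0..} w"
      unfolding w_def q_def using R0 by (intro continuous_intros bessel_solD[OF p]) auto
    have "cmod (w r) \<le> cmod (w s) + \<bar>m\<bar> * B / r" if s: "r < s" for s
    proof -
      have "cmod (w s - w r) \<le> - (\<bar>m\<bar> * B) / s - (- (\<bar>m\<bar> * B) / r)"
      proof (rule differentiable_bound_general[OF s, where f'=w' and \<phi>="\<lambda>t. - (\<bar>m\<bar> * B) / t" and \<phi>'="\<lambda>t. \<bar>m\<bar> * B / t\<^sup>2"])
        show "continuous_on {r..s} w" by (rule continuous_on_subset[OF contw]) (use r in auto)
        show "continuous_on {r..s} (\<lambda>t. - (\<bar>m\<bar> * B) / t)" using r0 by (intro continuous_intros) auto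
        fix t assume t: "r < t" "t < s"
        then have t0: "t > 0" "R0 < t" using r0 r by auto
        show "(w has_vector_derivative w' t) (at t)" by (rule dw[OF t0(2)])
        have "((\<lambda>t. - (\<bar>m\<bar> * B) / t) has_real_derivative \<bar>m\<bar> * B / t\<^sup>2) (at t)"
          using t0 by (auto intro!: derivative_eq_intros simp: power2_eq_square)
        then show "((\<lambda>t. - (\<bar>m\<bar> * B) / t) has_vector_derivative \<bar>m\<bar> * B / t\<^sup>2) (at t)"
          by (simp add: has_real_derivative_iff_has_vector_derivative)
        have "cmod (w' t) = \<bar>m\<bar> * (sqrt t * cmod (p t)) / t\<^sup>2"
          using t0 by (simp add: w'_def norm_mult norm_divide nexp norm_power)
        also have "\<dots> \<le> \<bar>m\<bar> * B / t\<^sup>2"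
          using B(2)[of t] t0 by (intro divide_right_mono mult_left_mono) auto
        finally show "cmod (w' t) \<le> \<bar>m\<bar> * B / t\<^sup>2" .
      qed
      moreover have "\<bar>m\<bar> * B / s \<ge> 0" using B(1) s r0 by simp
      ultimately have "cmod (w s - w r) \<le> \<bar>m\<bar> * B / r" by simp
      then show ?thesis using norm_triangle_ineq3[of "w s" "w r"] by linarith
    qed
    then have ev: "\<forall>\<^sub>F s in at_top. cmod (w r) \<le> cmod (w s) + \<bar>m\<bar> * B / r"
      by (intro eventually_mono[OF eventually_gt_at_top[of r]])
    have "cmod (w r) \<le> 0 + \<bar>m\<bar> * B / r"
      by (rule tendsto_lowerbound[OF tendsto_add[OF w0 tendsto_const] ev]) simp
    then show ?thesis by simp
  qed
  define C1 where "C1 = \<bar>m\<bar> * B + B / 2"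
  have C1: "C1 > 0" using B(1) by (simp add: C1_def add_nonneg_pos)
  have D1: "r * sqrt r * cmod (p' r - \<i> * of_real k * p r) \<le> C1" if r: "R0 \<le> r" for r
  proof -
    have r0: "r > 0" using r R0 by simp
    have pe: "p' r - \<i> * of_real k * p r = (q r - \<i> * of_real k * p r) - p r / of_real (2 * r)" by (simp add: q_def)
    have "cmod (p' r - \<i> * of_real k * p r) \<le> cmod (q r - \<i> * of_real k * p r) + cmod (p r) / (2 * r)"
      unfolding pe using norm_triangle_ineq4[of "q r - \<i> * of_real k * p r" "p r / of_real (2 * r)"] r0 by (simp add: norm_divide norm_mult)
    then have "r * sqrt r * cmod (p' r - \<i> * of_real k * p r) \<le> r * sqrt r * (cmod (q r - \<i> * of_real k * p r) + cmod (p r) / (2 * r))"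
      using r0 by (intro mult_left_mono) auto
    also have "\<dots> = r * cmod (w r) + (sqrt r * cmod (p r)) / 2"
      using r0 nw[of r] by (simp add: field_simps)
    also have "\<dots> \<le> r * (\<bar>m\<bar> * B / r) + B / 2"
      using wb[OF r] B(2)[OF r] r0 by (intro add_mono mult_left_mono) auto
    also have "\<dots> = C1" using r0 by (simp add: C1_def)
    finally show ?thesis .
  qed
  define C2 where "C2 = B + of_int n ^ 2 * B / R0 + k * C1"
  have D2: "r * sqrt r * cmod (bessel_rhs k n p p' r - \<i> * of_real k * p' r) \<le> C2" if r: "R0 \<le> r" for r
  proof -
    have r0: "r > 0" using r R0 by simp
    have "bessel_rhs k n p p' r - \<i> * of_real k * p' r
        = - (p' r / of_real r) + of_real (of_int n ^ 2 / r ^ 2) * p r - \<i> * of_real k * (p' r - \<i> * of_real k * p r)"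
      by (simp add: bessel_rhs_def algebra_simps power2_eq_square)
    also have "cmod \<dots> \<le> cmod (p' r) / r + of_int n ^ 2 / r ^ 2 * cmod (p r) + k * cmod (p' r - \<i> * of_real k * p r)"
    proof -
      have e1: "cmod (- (p' r / of_real r)) = cmod (p' r) / r" using r0 by (simp add: norm_divide)
      have e2: "cmod (of_real (of_int n ^ 2 / r ^ 2) * p r) = of_int n ^ 2 / r ^ 2 * cmod (p r)"
        by (simp only: norm_mult norm_of_real) simp
      have e3: "cmod (\<i> * of_real k * (p' r - \<i> * of_real k * p r)) = k * cmod (p' r - \<i> * of_real k * p r)"
        using k unfolding norm_mult norm_of_real by simp
      have tri: "cmod (a + b - c) \<le> cmod a + cmod b + cmod c" for a b c
        by (rule order_trans[OF norm_triangle_ineq4 add_right_mono[OF norm_triangle_ineq]])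
      show ?thesis by (rule order_trans[OF tri]) (simp only: e1 e2 e3 order_refl)
    qed
    finally have "r * sqrt r * cmod (bessel_rhs k n p p' r - \<i> * of_real k * p' r)
       \<le> r * sqrt r * (cmod (p' r) / r + of_int n ^ 2 / r ^ 2 * cmod (p r) + k * cmod (p' r - \<i> * of_real k * p r))"
      using r0 by (intro mult_left_mono) auto
    also have "\<dots> = sqrt r * cmod (p' r) + of_int n ^ 2 * (sqrt r * cmod (p r)) / r + k * (r * sqrt r * cmod (p' r - \<i> * of_real k * p r))"
      using r0 by (simp add: field_simps power2_eq_square)
    also have "\<dots> \<le> C2" unfolding C2_def
      using B(2,3)[OF r] D1[OF r] k r R0 B(1) by (intro add_mono mult_left_mono frac_le) auto
    finally show ?thesis .
  qed
  show ?thesis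
  proof (rule that[of "max C1 C2"])
    show "max C1 C2 > 0" using C1 by simp
  qed (use D1 D2 in \<open>fastforce simp: max_def\<close>)+
qed

text \<open>A solution with nonzero flux and its conjugate are linearly independent, hence a fundamental
  system: their combinations realize all Cauchy data at any radius.\<close>

lemma bessel_initial_value:
  assumes p: "bessel_sol k R0 n p p'" and R0: "0 < R0" and W: "Im (p' R0 * cnj (p R0)) \<noteq> 0" and R: "R0 \<le> R"
  obtains z z' where "bessel_sol k R0 n z z'" "z R = A" "z' R = B"
proof -
  have id: "z - cnj z = 2 * \<i> * of_real (Im z)" for z by (simp add: complex_eq_iff)
  define D where "D = p' R * cnj (p R) - p R * cnj (p' R)"
  have "of_real R * D = of_real R0 * (p' R0 * cnj (p R0) - p R0 * cnj (p' R0))"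
    unfolding D_def by (rule bessel_wronskian[OF p bessel_sol_cnj[OF p] R0 R])
  moreover have "p' R0 * cnj (p R0) - p R0 * cnj (p' R0) = 2 * \<i> * of_real (Im (p' R0 * cnj (p R0)))"
    using id[of "p' R0 * cnj (p R0)"] by (simp add: mult.commute)
  ultimately have "of_real R * D = of_real R0 * (2 * \<i> * of_real (Im (p' R0 * cnj (p R0))))" by (simp only:)
  also have "\<dots> \<noteq> 0" using W R0 by (simp only: mult_eq_0_iff of_real_eq_0_iff) auto
  finally have "of_real R * D \<noteq> 0" .
  then have D: "D \<noteq> 0" by auto
  define a where "a = (B * cnj (p R) - A * cnj (p' R)) / D"
  define b where "b = (A * p' R - B * p R) / D"
  have "a * p R + b * cnj (p R) = A * D / D" "a * p' R + b * cnj (p' R) = B * D / D"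
    unfolding a_def b_def D_def by (simp_all add: add_divide_distrib[symmetric] algebra_simps)
  then have "a * p R + b * cnj (p R) = A" "a * p' R + b * cnj (p' R) = B" using D by simp_all
  with bessel_sol_linear[OF p bessel_sol_cnj[OF p], of a b] show ?thesis using that by blast
qed

text \<open>Write \<open>g = cnj (p' - i k p)\<close>. The mode of \<open>p\<close> is critical for the functional if an adjoint radial
  problem is solvable whose right-hand side is built from \<open>g\<close>. Since \<open>r g\<close> is a particular solution of
  that inhomogeneous equation, the general solution is \<open>e = r g + z\<close> with \<open>z\<close> solving Bessel's equation.
  The three conditions say that \<open>e\<close> vanishes at both ends and that \<open>e' = g\<close> at \<open>R\<close>; the last is the natural
  boundary condition of the free outer circle.\<close>

definition adjoint_matched :: "real \<Rightarrow> real \<Rightarrow> real \<Rightarrow> int \<Rightarrow> (real \<Rightarrow> complex) \<Rightarrow> (real \<Rightarrow> complex) \<Rightarrow> (real \<Rightarrow> complex) \<Rightarrow> (real \<Rightarrow> complex) \<Rightarrow> bool" where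
  "adjoint_matched k R0 R n p p' z z' \<longleftrightarrow>
     z R = - of_real R * cnj (p' R - \<i> * of_real k * p R) \<and>
     z' R = - of_real R * cnj (bessel_rhs k n p p' R - \<i> * of_real k * p' R) \<and>
     z R0 = - of_real R0 * cnj (p' R0 - \<i> * of_real k * p R0)"

text \<open>The real-valued solution \<open>f = Im (x / x R0)\<close> vanishes at \<open>R0\<close>, so subtracting multiples of it from \<open>x\<close>
  keeps the Dirichlet datum. For given \<open>a\<close> the two conditions at \<open>R\<close> fix the Cauchy data of \<open>z\<close>, and the
  Wronskian of \<open>z\<close> and \<open>f\<close> carries them to \<open>R0\<close>, where the remaining condition becomes one linear equation
  \<open>cnj a * den = num\<close>. Here \<open>num\<close> is bounded because \<open>x\<close> is outgoing, while \<open>den\<close> is \<open>- R\<close> times the energy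
  of \<open>f\<close> up to a bounded term, so \<open>a = O(1/R)\<close>. If the flux of \<open>x\<close> is zero, then \<open>x\<close> itself is zero and
  \<open>a = 0\<close> satisfies all conditions.\<close>

lemma corrector_exists:
  assumes x: "bessel_sol k R0 n x x'" and R0: "0 < R0" and k: "0 < k" and out: "outgoing k x x'"
  obtains f f' C R1 where "bessel_sol k R0 n f f'" "f R0 = 0" "R1 \<ge> R0" "C > 0"
    "\<And>r. R0 \<le> r \<Longrightarrow> sqrt r * cmod (f r) \<le> C" "\<And>r. R0 \<le> r \<Longrightarrow> sqrt r * cmod (f' r) \<le> C"
    "\<And>R. R1 \<le> R \<Longrightarrow> \<exists>a z z'. cmod a \<le> C / R \<and> bessel_sol k R0 n z z' \<and>
        adjoint_matched k R0 R n (\<lambda>r. x r - a * f r) (\<lambda>r. x' r - a * f' r) z z'"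
proof (cases "Im (x' R0 * cnj (x R0)) = 0")
  case True
  have x0: "x r = 0" if "R0 \<le> r" for r by (rule outgoing_zero_flux_imp_zero[OF x R0 k out True that])
  have x'0: "x' r = 0" if r: "R0 \<le> r" for r
  proof -
    have gt: "x' s = 0" if s: "R0 < s" for s
    proof -
      have "((\<lambda>_. 0) has_vector_derivative (0 :: complex)) (at s)" by simp
      then have "(x has_vector_derivative 0) (at s)"
        by (rule has_vector_derivative_transform_within_open[of _ _ _ "{R0<..}"]) (use x0 s in auto)
      then show ?thesis using bessel_solD(3)[OF x s] vector_derivative_unique_at by blast
    qed
    have "continuous_on {R0..R0 + 1} x'" by (rule continuous_on_subset[OF bessel_solD(2)[OF x]]) auto
    then have 1: "(x' \<longlongrightarrow> x' R0) (at_right R0)" by (rule continuous_on_Icc_at_rightD) simp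
    have ev: "\<forall>\<^sub>F s in at_right R0. 0 = x' s"
      by (rule eventually_mono[OF eventually_at_right_less[of R0]]) (simp add: gt)
    have "(x' \<longlongrightarrow> 0) (at_right R0)" by (rule Lim_transform_eventually[OF tendsto_const ev])
    then have "x' R0 = 0" using tendsto_unique[OF trivial_limit_at_right_real 1] by blast
    then show ?thesis using gt r by (cases "r = R0") auto
  qed
  have "adjoint_matched k R0 R n (\<lambda>r. x r - 0 * 0) (\<lambda>r. x' r - 0 * 0) (\<lambda>_. 0) (\<lambda>_. 0)" if "R0 \<le> R" for R
    using x0 x'0 that by (simp add: adjoint_matched_def bessel_rhs_def)
  then have ex: "\<exists>a z z'. cmod a \<le> 1 / R \<and> bessel_sol k R0 n z z' \<and>
      adjoint_matched k R0 R n (\<lambda>r. x r - a * 0) (\<lambda>r. x' r - a * 0) z z'" if "R0 \<le> R" for R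
    using that R0 bessel_sol_zero[of k R0 n]
    by (intro exI[of _ 0] exI[of _ "\<lambda>_. 0"]) auto
  show ?thesis
    by (rule that[OF bessel_sol_zero _ _ _ _ _ ex]) (use R0 in auto)
next
  case False
  then have xn: "x R0 \<noteq> 0" by auto
  define X X' where "X = (\<lambda>r. inverse (x R0) * x r + 0 * x r)" and "X' = (\<lambda>r. inverse (x R0) * x' r + 0 * x' r)"
  have X: "bessel_sol k R0 n X X'" unfolding X_def X'_def by (rule bessel_sol_linear[OF x x])
  define f f' where "f = (\<lambda>r. (1 / (2 * \<i>)) * X r + (- 1 / (2 * \<i>)) * cnj (X r))"
    and "f' = (\<lambda>r. (1 / (2 * \<i>)) * X' r + (- 1 / (2 * \<i>)) * cnj (X' r))"
  have f: "bessel_sol k R0 n f f'" unfolding f_def f'_def by (rule bessel_sol_linear[OF X bessel_sol_cnj[OF X]])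
  have fr: "f r = of_real (Im (X r))" "f' r = of_real (Im (X' r))" for r
    by (auto simp: f_def f'_def complex_eq_iff Re_divide Im_divide)
  have f0: "f R0 = 0" using xn by (simp add: fr X_def)
  have f'0: "f' R0 \<noteq> 0"
  proof -
    have "X' R0 = x' R0 * cnj (x R0) / (x R0 * cnj (x R0))" using xn by (simp add: X'_def field_simps)
    also have "x R0 * cnj (x R0) = of_real ((cmod (x R0))\<^sup>2)" by (rule complex_norm_square[symmetric])
    finally have "Im (X' R0) = Im (x' R0 * cnj (x R0)) / (cmod (x R0))\<^sup>2" by (simp only: Im_divide_of_real)
    then have "Im (X' R0) \<noteq> 0" using False xn by simp
    then show ?thesis unfolding fr of_real_eq_0_iff .
  qed
  obtain C1 where C1: "C1 > 0" "\<And>r. R0 \<le> r \<Longrightarrow> sqrt r * cmod (f r) \<le> C1" "\<And>r. R0 \<le> r \<Longrightarrow> sqrt r * cmod (f' r) \<le> C1"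
    using bessel_sol_bounded[OF f R0 k] by blast
  obtain C2 where C2: "C2 > 0" "\<And>r. R0 \<le> r \<Longrightarrow> r * sqrt r * cmod (x' r - \<i> * of_real k * x r) \<le> C2"
    "\<And>r. R0 \<le> r \<Longrightarrow> r * sqrt r * cmod (bessel_rhs k n x x' r - \<i> * of_real k * x' r) \<le> C2"
    using outgoing_decay[OF x R0 k out] by blast
  define e0 where "e0 = bessel_energy k f f' R0 / exp (\<bar>of_int n ^ 2 - 1 / 4\<bar> / k / R0)"
  have e0: "e0 > 0" using R0 f'0 by (simp add: e0_def bessel_energy_def f0)
  have E: "bessel_energy k f f' R \<ge> e0" if "R0 \<le> R" for R
    using bessel_energy_comparable[OF f R0 k order_refl that] by (simp add: e0_def field_simps)
  define g where "g = (\<lambda>r. cnj (x' r - \<i> * of_real k * x r))"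
  define dg where "dg = (\<lambda>r. cnj (bessel_rhs k n x x' r - \<i> * of_real k * x' r))"
  define num where "num R = of_real (R\<^sup>2) * (dg R * f R - g R * f' R) + of_real (R0\<^sup>2) * g R0 * f' R0" for R
  define den where "den R = of_real (R\<^sup>2) * ((bessel_rhs k n f f' R + \<i> * of_real k * f' R) * f R
      - (f' R + \<i> * of_real k * f R) * f' R) + of_real (R0\<^sup>2) * (f' R0 + \<i> * of_real k * f R0) * f' R0" for R
  define c3 where "c3 = ((of_int n)\<^sup>2 + 1 / 4) * C1\<^sup>2 / R0 + R0\<^sup>2 * (cmod (f' R0))\<^sup>2"
  have den: "cmod (den R) \<ge> R * e0 - c3" if R: "R0 \<le> R" for R
  proof -
    have Rp: "R > 0" using R R0 by simp
    have "den R = of_real (- R * bessel_energy k f f' R + ((of_int n)\<^sup>2 + 1 / 4) * (cmod (f R))\<^sup>2 + R0\<^sup>2 * (cmod (f' R0))\<^sup>2)"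
    proof -
      have "of_real (Im (X' R)) + of_real (Im (X R)) / of_real (2 * R) = complex_of_real (Im (X' R) + Im (X R) / (2 * R))" by simp
      then have "bessel_energy k f f' R = R * ((Im (X' R) + Im (X R) / (2 * R))\<^sup>2 + k\<^sup>2 * (Im (X R))\<^sup>2)"
        unfolding bessel_energy_def fr by (simp only: norm_of_real power2_abs)
      then show ?thesis using Rp f0[unfolded fr]
        unfolding den_def bessel_rhs_def fr
        by (simp add: complex_eq_iff power2_eq_square field_simps)
    qed
    then have "cmod (den R) = \<bar>- R * bessel_energy k f f' R + ((of_int n)\<^sup>2 + 1 / 4) * (cmod (f R))\<^sup>2 + R0\<^sup>2 * (cmod (f' R0))\<^sup>2\<bar>"
      by (simp only: norm_of_real)
    moreover have "((of_int n)\<^sup>2 + 1 / 4) * (cmod (f R))\<^sup>2 \<le> ((of_int n)\<^sup>2 + 1 / 4) * C1\<^sup>2 / R0"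
    proof -
      have "(sqrt R * cmod (f R))\<^sup>2 \<le> C1\<^sup>2" using C1(2)[OF R] Rp by (intro power_mono) auto
      then have "R * (cmod (f R))\<^sup>2 \<le> C1\<^sup>2" using Rp by (simp add: power_mult_distrib)
      moreover have "R0 * (cmod (f R))\<^sup>2 \<le> R * (cmod (f R))\<^sup>2" using R by (intro mult_right_mono) auto
      ultimately have "(cmod (f R))\<^sup>2 \<le> C1\<^sup>2 / R0" using R0 by (simp add: field_simps)
      then have "((of_int n)\<^sup>2 + 1 / 4) * (cmod (f R))\<^sup>2 \<le> ((of_int n)\<^sup>2 + 1 / 4) * (C1\<^sup>2 / R0)"
        by (intro mult_left_mono) auto
      then show ?thesis by simp
    qed
    moreover have "R * e0 \<le> R * bessel_energy k f f' R" using E[OF R] Rp by (intro mult_left_mono) auto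
    ultimately show ?thesis unfolding c3_def by linarith
  qed
  define c4 where "c4 = 2 * C1 * C2 + cmod (of_real (R0\<^sup>2) * g R0 * f' R0)"
  have c4: "c4 \<ge> 0" using C1(1) C2(1) by (simp add: c4_def)
  have num: "cmod (num R) \<le> c4" if R: "R0 \<le> R" for R
  proof -
    have Rp: "R > 0" using R R0 by simp
    have ng: "R * sqrt R * cmod (g R) \<le> C2" "R * sqrt R * cmod (dg R) \<le> C2"
      using C2(2,3)[OF R] by (simp_all only: g_def dg_def complex_mod_cnj)
    have "cmod (of_real (R\<^sup>2) * (dg R * f R - g R * f' R)) \<le> R\<^sup>2 * (cmod (dg R) * cmod (f R) + cmod (g R) * cmod (f' R))"
      unfolding norm_mult norm_of_real using norm_triangle_ineq4[of "dg R * f R" "g R * f' R"]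
      by (simp add: norm_mult mult_left_mono)
    also have "\<dots> = (R * sqrt R * cmod (dg R)) * (sqrt R * cmod (f R)) + (R * sqrt R * cmod (g R)) * (sqrt R * cmod (f' R))"
    proof -
      have sq: "R\<^sup>2 = R * sqrt R * sqrt R" using Rp by (simp add: power2_eq_square)
      show ?thesis unfolding sq by (simp only: algebra_simps)
    qed
    also have "\<dots> \<le> C2 * C1 + C2 * C1"
      using ng C1(2,3)[OF R] C1(1) C2(1) Rp by (intro add_mono mult_mono) auto
    finally have "cmod (of_real (R\<^sup>2) * (dg R * f R - g R * f' R)) \<le> 2 * C1 * C2" by simp
    then show ?thesis unfolding num_def c4_def
      using norm_triangle_ineq[of "of_real (R\<^sup>2) * (dg R * f R - g R * f' R)" "of_real (R0\<^sup>2) * g R0 * f' R0"] by linarith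
  qed
  \<comment> \<open>beyond this radius the energy term dominates the bounded part of the denominator\<close>
  define R1 where "R1 = max R0 (2 * c3 / e0)"
  have den2: "cmod (den R) \<ge> R * e0 / 2" if R: "R1 \<le> R" for R
  proof -
    have "R0 \<le> R" "2 * c3 / e0 \<le> R" using R by (auto simp: R1_def)
    then have "c3 \<le> R * e0 / 2" using e0 by (simp add: field_simps)
    then show ?thesis using den[OF \<open>R0 \<le> R\<close>] by linarith
  qed
  define C where "C = C1 + 2 * c4 / e0"
  have C: "C > 0" "C1 \<le> C" "2 * c4 / e0 \<le> C" using C1(1) c4 e0 by (auto simp: C_def add_pos_nonneg)
  have main: "\<exists>a z z'. cmod a \<le> C / R \<and> bessel_sol k R0 n z z' \<and>
        adjoint_matched k R0 R n (\<lambda>r. x r - a * f r) (\<lambda>r. x' r - a * f' r) z z'" if R1: "R1 \<le> R" for R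
  proof -
    have R: "R0 \<le> R" using R1 by (simp add: R1_def)
    then have Rp: "R > 0" using R0 by simp
    have "R * e0 / 2 > 0" using Rp e0 by simp
    then have dn: "den R \<noteq> 0" "cmod (den R) > 0" using den2[OF R1] by auto
    define a where "a = cnj (num R / den R)"
    have "cmod a \<le> c4 / (R * e0 / 2)"
      unfolding a_def complex_mod_cnj norm_divide
      using num[OF R] den2[OF R1] \<open>R * e0 / 2 > 0\<close> c4 by (intro frac_le) auto
    also have "\<dots> = 2 * c4 / e0 / R" by (simp add: field_simps)
    also have "\<dots> \<le> C / R" using C Rp by (intro divide_right_mono) auto
    finally have aC: "cmod a \<le> C / R" .
    define p where "p = (\<lambda>r. x r - a * f r)"
    define p' where "p' = (\<lambda>r. x' r - a * f' r)"
    have rhs: "bessel_rhs k n p p' r = bessel_rhs k n x x' r - a * bessel_rhs k n f f' r" for r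
      using bessel_rhs_linear[of k n 1 x "- a" f x' f' r] by (simp add: p_def p'_def)
    let ?G = "\<lambda>r. cnj (p' r - \<i> * of_real k * p r)" and ?dG = "\<lambda>r. cnj (bessel_rhs k n p p' r - \<i> * of_real k * p' r)"
    have cf: "cnj (f r) = f r" "cnj (f' r) = f' r" "cnj (bessel_rhs k n f f' r) = bessel_rhs k n f f' r" for r
      by (simp_all add: fr bessel_rhs_def)
    have G: "?G r = g r - cnj a * (f' r + \<i> * of_real k * f r)" for r
      by (simp add: p_def p'_def g_def cf algebra_simps)
    have dG: "?dG r = dg r - cnj a * (bessel_rhs k n f f' r + \<i> * of_real k * f' r)" for r
      unfolding rhs by (simp add: p_def p'_def dg_def cf algebra_simps)
    have an: "cnj a * den R = num R" using dn by (simp add: a_def)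
    obtain z z' where z: "bessel_sol k R0 n z z'" "z R = - of_real R * ?G R" "z' R = - of_real R * ?dG R"
      using bessel_initial_value[OF x R0 False R] by blast
    have cond: "of_real (R\<^sup>2) * (?dG R * f R - ?G R * f' R) + of_real (R0\<^sup>2) * ?G R0 * f' R0 = num R - cnj a * den R"
      unfolding G dG num_def den_def by (simp add: algebra_simps)
    have "of_real R * (z' R * f R - z R * f' R) = of_real R0 * (z' R0 * f R0 - z R0 * f' R0)"
      by (rule bessel_wronskian[OF z(1) f R0 R])
    then have "- (of_real (R\<^sup>2) * (?dG R * f R - ?G R * f' R)) = - of_real R0 * z R0 * f' R0"
      unfolding z(2,3) f0 by (simp add: power2_eq_square algebra_simps)
    then have "of_real (R0\<^sup>2) * ?G R0 * f' R0 = - of_real R0 * z R0 * f' R0"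
      using cond an by (simp add: add_eq_0_iff)
    then have "f' R0 * (of_real R0 * (of_real R0 * ?G R0 + z R0)) = 0"
      by (simp add: power2_eq_square algebra_simps)
    then have "of_real R0 * ?G R0 + z R0 = 0" using f'0 R0 by (simp only: mult_eq_0_iff of_real_eq_0_iff) auto
    from minus_unique[OF this, symmetric] have "z R0 = - (of_real R0 * ?G R0)" .
    then have z0: "z R0 = - of_real R0 * ?G R0" by (simp only: mult_minus_left)
    have "adjoint_matched k R0 R n p p' z z'"
      unfolding adjoint_matched_def by (intro conjI z(2) z(3) z0)
    then show ?thesis using aC z(1) unfolding p_def p'_def by blast
  qed
  show ?thesis
  proof (rule that[OF f f0 _ C(1) _ _ main])
    show "R0 \<le> R1" by (simp add: R1_def)
    show "sqrt r * cmod (f r) \<le> C" "sqrt r * cmod (f' r) \<le> C" if "R0 \<le> r" for r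
      using C1(2,3)[OF that] C(2) by linarith+
  qed
qed

section \<open>Fourier expansion of the outgoing solution\<close>

definition emode :: "int \<Rightarrow> real^2 \<Rightarrow> complex" where
  "emode n x = ((of_real (x $ 1) + \<i> * of_real (x $ 2)) / of_real (norm x)) powi n"

lemma emode_polar: "0 < r \<Longrightarrow> emode n (polar r \<omega>) = exp (\<i> * of_int n * of_real \<omega>)"
proof -
  assume r: "0 < r"
  have "(of_real (polar r \<omega> $ 1) + \<i> * of_real (polar r \<omega> $ 2)) / of_real (norm (polar r \<omega>)) = exp (\<i> * of_real \<omega>)"
    using r by (simp add: exp_Euler field_simps cos_of_real sin_of_real)
  then show ?thesis unfolding emode_def
    by (simp add: exp_power_int mult_ac)
qed

lemma continuous_on_emode: "0 \<notin> S \<Longrightarrow> continuous_on S (emode n)"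
proof -
  assume S: "0 \<notin> S"
  have nz: "of_real (x $ 1) + \<i> * of_real (x $ 2) \<noteq> (0::complex)" if "x \<in> S" for x
  proof -
    have "x \<noteq> 0" using S that by auto
    then have "x $ 1 \<noteq> 0 \<or> x $ 2 \<noteq> 0" by (auto simp: vec2_eq_iff)
    then show ?thesis by (auto simp: complex_eq_iff)
  qed
  have "norm x \<noteq> 0" if "x \<in> S" for x using S that by auto
  then show ?thesis unfolding emode_def
    by (intro continuous_intros ballI) (use nz in auto)
qed

lemma integral_exp_mode:
  "integral {0..2 * pi} (\<lambda>\<omega>. exp (\<i> * of_int n * of_real \<omega>)) = (if n = 0 then of_real (2 * pi) else 0)"
proof (cases "n = 0")
  case True
  then show ?thesis by (simp add: scaleR_conv_of_real)
next
  case False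
  have "((\<lambda>\<omega>. exp (\<i> * of_int n * of_real \<omega>)) has_integral
      exp (\<i> * of_int n * of_real (2 * pi)) / (\<i> * of_int n) - exp (\<i> * of_int n * of_real 0) / (\<i> * of_int n)) {0..2 * pi}"
  proof (rule fundamental_theorem_of_calculus)
    fix x :: real
    have "((\<lambda>z. exp (\<i> * of_int n * z) / (\<i> * of_int n)) has_field_derivative exp (\<i> * of_int n * of_real x)) (at (of_real x))"
      using False by (auto intro!: derivative_eq_intros)
    from has_vector_derivative_real_field[OF this]
    show "((\<lambda>\<omega>. exp (\<i> * of_int n * of_real \<omega>) / (\<i> * of_int n)) has_vector_derivative exp (\<i> * of_int n * of_real x)) (at x within {0..2 * pi})"
      by (rule has_vector_derivative_at_within)
  qed simp
  moreover have "exp (\<i> * of_int n * of_real (2 * pi)) = 1"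
    using exp_integer_2pi[of "of_int n"] by (simp add: mult_ac)
  ultimately have "((\<lambda>\<omega>. exp (\<i> * of_int n * of_real \<omega>)) has_integral 0) {0..2 * pi}" by simp
  then show ?thesis using False by (simp add: integral_unique)
qed

lemma exp_mode_add: "exp (\<i> * of_int (m + n) * of_real \<omega>) = exp (\<i> * of_int m * of_real \<omega>) * exp (\<i> * of_int n * of_real \<omega>)"
  by (simp add: exp_add[symmetric] algebra_simps)

lemma fourier_coeff_trig_poly:
  "integral {0..2 * pi} (\<lambda>\<omega>. trig_poly N c \<omega> * exp (\<i> * of_int (- n) * of_real \<omega>))
    = (if \<bar>n\<bar> \<le> int N then of_real (2 * pi) * c n else 0)"
proof -
  have "integral {0..2 * pi} (\<lambda>\<omega>. trig_poly N c \<omega> * exp (\<i> * of_int (- n) * of_real \<omega>))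
     = integral {0..2 * pi} (\<lambda>\<omega>. \<Sum>j = - int N..int N. c j * exp (\<i> * of_int (j + - n) * of_real \<omega>))"
    unfolding trig_poly_def sum_distrib_right exp_mode_add by (simp only: mult.assoc)
  also have "\<dots> = (\<Sum>j = - int N..int N. integral {0..2 * pi} (\<lambda>\<omega>. c j * exp (\<i> * of_int (j + - n) * of_real \<omega>)))"
    by (intro integral_sum integrable_continuous_real continuous_intros) auto
  also have "\<dots> = (\<Sum>j = - int N..int N. if j = n then of_real (2 * pi) * c n else 0)"
    by (intro sum.cong refl) (simp only: integral_mult_right integral_exp_mode, auto)
  also have "\<dots> = (if \<bar>n\<bar> \<le> int N then of_real (2 * pi) * c n else 0)"
    by (simp add: sum.delta abs_le_iff)
  finally show ?thesis .
qed

text \<open>Restricted to the unit circle, polynomials are trigonometric polynomials, so \<open>H\<close> is orthogonal to all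
  of them; the Stone-Weierstrass theorem approximates the real part of \<open>H\<close> uniformly by polynomials.\<close>

lemma fourier_uniqueness_Re:
  fixes H :: "real^2 \<Rightarrow> complex"
  assumes H: "continuous_on (sphere 0 1) H"
    and 0: "\<And>n. integral {0..2 * pi} (\<lambda>\<omega>. H (polar 1 \<omega>) * exp (\<i> * of_int n * of_real \<omega>)) = 0"
    and x: "x \<in> sphere 0 1"
  shows "Re (H x) = 0"
proof -
  define h where "h = (\<lambda>\<omega>. H (polar 1 \<omega>))"
  have h: "continuous_on S h" for S unfolding h_def
    by (intro continuous_on_compose2[OF H] continuous_intros) auto
  have P: "(\<forall>G. continuous_on UNIV G \<longrightarrow> (\<forall>n. integral {0..2 * pi} (\<lambda>\<omega>. h \<omega> * G \<omega> * exp (\<i> * of_int n * of_real \<omega>)) = 0)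
          \<longrightarrow> (\<forall>n. integral {0..2 * pi} (\<lambda>\<omega>. h \<omega> * (G \<omega> * of_real (p (polar 1 \<omega>))) * exp (\<i> * of_int n * of_real \<omega>)) = 0))
        \<and> continuous_on UNIV p"
    if "real_polynomial_function p" for p :: "real^2 \<Rightarrow> real" using that
  proof (induction rule: real_polynomial_function.induct)
    case (linear f)
    then have fl: "linear f" by (rule bounded_linear.linear)
    have fp: "complex_of_real (f (polar 1 \<omega>)) = of_real (f (axis 1 1)) * cos (of_real \<omega>) + of_real (f (axis 2 1)) * sin (of_real \<omega>)" for \<omega>
      unfolding polar_eq_axis linear_add[OF fl] linear_cmul[OF fl] by (simp add: cos_of_real sin_of_real)
    define a b where "a = (of_real (f (axis 1 1)) - \<i> * of_real (f (axis 2 1))) / (2 :: complex)"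
      and "b = (of_real (f (axis 1 1)) + \<i> * of_real (f (axis 2 1))) / (2 :: complex)"
    have fe: "complex_of_real (f (polar 1 \<omega>)) = a * exp (\<i> * of_int 1 * of_real \<omega>) + b * exp (\<i> * of_int (-1) * of_real \<omega>)" for \<omega>
      unfolding fp a_def b_def cos_exp_eq sin_exp_eq by (simp add: field_simps)
    show ?case
    proof (intro conjI allI impI)
      fix G n assume G: "continuous_on UNIV G" "\<forall>n. integral {0..2 * pi} (\<lambda>\<omega>. h \<omega> * G \<omega> * exp (\<i> * of_int n * of_real \<omega>)) = 0"
      have c: "continuous_on {0..2*pi} G" using G(1) by (rule continuous_on_subset) auto
      have "integral {0..2 * pi} (\<lambda>\<omega>. h \<omega> * (G \<omega> * of_real (f (polar 1 \<omega>))) * exp (\<i> * of_int n * of_real \<omega>))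
         = integral {0..2 * pi} (\<lambda>\<omega>. a * (h \<omega> * G \<omega> * exp (\<i> * of_int (1 + n) * of_real \<omega>)) + b * (h \<omega> * G \<omega> * exp (\<i> * of_int (-1 + n) * of_real \<omega>)))"
        unfolding fe exp_mode_add by (simp only: algebra_simps)
      also have "\<dots> = integral {0..2 * pi} (\<lambda>\<omega>. a * (h \<omega> * G \<omega> * exp (\<i> * of_int (1 + n) * of_real \<omega>)))
          + integral {0..2 * pi} (\<lambda>\<omega>. b * (h \<omega> * G \<omega> * exp (\<i> * of_int (-1 + n) * of_real \<omega>)))"
        by (intro Henstock_Kurzweil_Integration.integral_add integrable_continuous_real continuous_intros h c)
      also have "\<dots> = 0" using G(2) by (simp only: integral_mult_right) simp
      finally show "integral {0..2 * pi} (\<lambda>\<omega>. h \<omega> * (G \<omega> * of_real (f (polar 1 \<omega>))) * exp (\<i> * of_int n * of_real \<omega>)) = 0" .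
    qed (use linear in \<open>auto intro: linear_continuous_on\<close>)
  next
    case (const c)
    show ?case
    proof (intro conjI allI impI)
      fix G n assume G: "continuous_on UNIV G" "\<forall>n. integral {0..2 * pi} (\<lambda>\<omega>. h \<omega> * G \<omega> * exp (\<i> * of_int n * of_real \<omega>)) = 0"
      have "(\<lambda>\<omega>. h \<omega> * (G \<omega> * of_real c) * exp (\<i> * of_int n * of_real \<omega>)) = (\<lambda>\<omega>. of_real c * (h \<omega> * G \<omega> * exp (\<i> * of_int n * of_real \<omega>)))"
        by (simp only: mult_ac)
      then show "integral {0..2 * pi} (\<lambda>\<omega>. h \<omega> * (G \<omega> * of_real c) * exp (\<i> * of_int n * of_real \<omega>)) = 0"
        using G(2) by (simp only: integral_mult_right) simp
    qed auto
  next
    case (add f g)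
    show ?case
    proof (intro conjI allI impI)
      fix G n assume G: "continuous_on UNIV G" "\<forall>n. integral {0..2 * pi} (\<lambda>\<omega>. h \<omega> * G \<omega> * exp (\<i> * of_int n * of_real \<omega>)) = 0"
      have c: "continuous_on {0..2*pi} G" using G(1) by (rule continuous_on_subset) auto
      have cf: "continuous_on {0..2*pi} (\<lambda>\<omega>. f (polar 1 \<omega>))" "continuous_on {0..2*pi} (\<lambda>\<omega>. g (polar 1 \<omega>))"
        by (intro continuous_on_compose2[OF conjunct2[OF add.IH(1)]] continuous_on_compose2[OF conjunct2[OF add.IH(2)]] continuous_intros; simp)+
      have "integral {0..2 * pi} (\<lambda>\<omega>. h \<omega> * (G \<omega> * of_real (f (polar 1 \<omega>) + g (polar 1 \<omega>))) * exp (\<i> * of_int n * of_real \<omega>))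
        = integral {0..2 * pi} (\<lambda>\<omega>. h \<omega> * (G \<omega> * of_real (f (polar 1 \<omega>))) * exp (\<i> * of_int n * of_real \<omega>) + h \<omega> * (G \<omega> * of_real (g (polar 1 \<omega>))) * exp (\<i> * of_int n * of_real \<omega>))"
        by (simp only: of_real_add distrib_left distrib_right)
      also have "\<dots> = integral {0..2 * pi} (\<lambda>\<omega>. h \<omega> * (G \<omega> * of_real (f (polar 1 \<omega>))) * exp (\<i> * of_int n * of_real \<omega>))
         + integral {0..2 * pi} (\<lambda>\<omega>. h \<omega> * (G \<omega> * of_real (g (polar 1 \<omega>))) * exp (\<i> * of_int n * of_real \<omega>))"
        by (intro Henstock_Kurzweil_Integration.integral_add integrable_continuous_real continuous_intros h c cf)
      also have "\<dots> = 0" using add.IH G by simp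
      finally show "integral {0..2 * pi} (\<lambda>\<omega>. h \<omega> * (G \<omega> * of_real (f (polar 1 \<omega>) + g (polar 1 \<omega>))) * exp (\<i> * of_int n * of_real \<omega>)) = 0" .
    qed (use add.IH in \<open>auto intro: continuous_on_add\<close>)
  next
    case (mult f g)
    show ?case
    proof (intro conjI allI impI)
      fix G n assume G: "continuous_on UNIV G" "\<forall>n. integral {0..2 * pi} (\<lambda>\<omega>. h \<omega> * G \<omega> * exp (\<i> * of_int n * of_real \<omega>)) = 0"
      have cf: "continuous_on UNIV (\<lambda>\<omega>. f (polar 1 \<omega>))"
        by (intro continuous_on_compose2[OF conjunct2[OF mult.IH(1)]] continuous_intros; simp)
      have 1: "continuous_on UNIV (\<lambda>\<omega>. G \<omega> * of_real (f (polar 1 \<omega>)))" by (intro continuous_intros G cf)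
      have 2: "\<forall>n. integral {0..2 * pi} (\<lambda>\<omega>. h \<omega> * (G \<omega> * of_real (f (polar 1 \<omega>))) * exp (\<i> * of_int n * of_real \<omega>)) = 0"
        using mult.IH(1) G by blast
      have "integral {0..2 * pi} (\<lambda>\<omega>. h \<omega> * (G \<omega> * of_real (f (polar 1 \<omega>)) * of_real (g (polar 1 \<omega>))) * exp (\<i> * of_int n * of_real \<omega>)) = 0"
        using conjunct1[OF mult.IH(2), rule_format, OF 1] 2 by blast
      then show "integral {0..2 * pi} (\<lambda>\<omega>. h \<omega> * (G \<omega> * of_real (f (polar 1 \<omega>) * g (polar 1 \<omega>))) * exp (\<i> * of_int n * of_real \<omega>)) = 0"
        by (simp only: of_real_mult mult.assoc)
    qed (use mult.IH in \<open>auto intro: continuous_on_mult\<close>)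
  qed
  have hp0: "integral {0..2 * pi} (\<lambda>\<omega>. Re (h \<omega>) * p (polar 1 \<omega>)) = 0" if p: "real_polynomial_function p" for p
  proof -
    have c: "continuous_on {0..2*pi} (\<lambda>\<omega>. p (polar 1 \<omega>))"
      by (intro continuous_on_compose2[OF conjunct2[OF P[OF p]]] continuous_intros; simp)
    have "integral {0..2 * pi} (\<lambda>\<omega>. h \<omega> * (1 * of_real (p (polar 1 \<omega>))) * exp (\<i> * of_int 0 * of_real \<omega>)) = 0"
      using conjunct1[OF P[OF p], rule_format, of "\<lambda>_. 1" 0] 0 by (simp add: h_def)
    then have z: "integral {0..2 * pi} (\<lambda>\<omega>. h \<omega> * of_real (p (polar 1 \<omega>))) = 0" by simp
    have "(\<lambda>\<omega>. h \<omega> * of_real (p (polar 1 \<omega>))) integrable_on {0..2*pi}"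
      by (intro integrable_continuous_real continuous_intros h c)
    from integral_linear[OF this bounded_linear_Re] z show ?thesis by (simp add: o_def)
  qed
  let ?A = "\<lambda>\<omega>. Re (h \<omega>)"
  have A: "continuous_on {0..2 * pi} ?A" by (intro continuous_intros h)
  define K where "K = integral {0..2 * pi} (\<lambda>\<omega>. \<bar>?A \<omega>\<bar>)"
  have iA: "(\<lambda>\<omega>. \<bar>?A \<omega>\<bar>) integrable_on {0..2*pi}" by (intro integrable_continuous_real continuous_intros A)
  have K: "K \<ge> 0" unfolding K_def by (rule integral_nonneg[OF iA]) auto
  have bnd: "integral {0..2 * pi} (\<lambda>\<omega>. ?A \<omega> * ?A \<omega>) \<le> e * K" if e: "e > 0" for e
  proof -
    have "continuous_on (sphere (0::real^2) 1) (\<lambda>x. Re (H x))" by (intro continuous_intros H)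
    then obtain p where p: "real_polynomial_function p" "\<And>x. x \<in> sphere 0 1 \<Longrightarrow> \<bar>Re (H x) - p x\<bar> < e"
      using Stone_Weierstrass_real_polynomial_function[OF compact_sphere _ e] by blast
    have c: "continuous_on {0..2*pi} (\<lambda>\<omega>. p (polar 1 \<omega>))"
      by (intro continuous_on_compose2[OF conjunct2[OF P[OF p(1)]]] continuous_intros; simp)
    have "integral {0..2 * pi} (\<lambda>\<omega>. ?A \<omega> * ?A \<omega>) = integral {0..2 * pi} (\<lambda>\<omega>. ?A \<omega> * ?A \<omega> - ?A \<omega> * p (polar 1 \<omega>))"
      using hp0[OF p(1)]
      by (subst Henstock_Kurzweil_Integration.integral_diff) (auto intro!: integrable_continuous_real continuous_intros A c)
    also have "\<dots> \<le> integral {0..2 * pi} (\<lambda>\<omega>. e * \<bar>?A \<omega>\<bar>)"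
    proof (rule integral_le)
      show "(\<lambda>\<omega>. ?A \<omega> * ?A \<omega> - ?A \<omega> * p (polar 1 \<omega>)) integrable_on {0..2*pi}" "(\<lambda>\<omega>. e * \<bar>?A \<omega>\<bar>) integrable_on {0..2*pi}"
        by (intro integrable_continuous_real continuous_intros A c)+
      fix \<omega> :: real
      have "\<bar>?A \<omega> - p (polar 1 \<omega>)\<bar> < e" using p(2)[of "polar 1 \<omega>"] by (simp add: h_def)
      then have "\<bar>?A \<omega>\<bar> * \<bar>?A \<omega> - p (polar 1 \<omega>)\<bar> \<le> \<bar>?A \<omega>\<bar> * e" by (intro mult_left_mono) auto
      then have "\<bar>?A \<omega> * (?A \<omega> - p (polar 1 \<omega>))\<bar> \<le> e * \<bar>?A \<omega>\<bar>" by (simp only: abs_mult mult.commute)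
      then show "?A \<omega> * ?A \<omega> - ?A \<omega> * p (polar 1 \<omega>) \<le> e * \<bar>?A \<omega>\<bar>" unfolding right_diff_distrib by linarith
    qed
    also have "\<dots> = e * K" by (simp add: K_def)
    finally show ?thesis .
  qed
  have "integral {0..2 * pi} (\<lambda>\<omega>. ?A \<omega> * ?A \<omega>) \<le> 0"
  proof (rule field_le_epsilon)
    fix e :: real assume "e > 0"
    then have "integral {0..2 * pi} (\<lambda>\<omega>. ?A \<omega> * ?A \<omega>) \<le> e / (K + 1) * K" using K by (intro bnd) simp
    also have "\<dots> \<le> 0 + e" using K \<open>e > 0\<close> by (simp add: field_simps)
    finally show "integral {0..2 * pi} (\<lambda>\<omega>. ?A \<omega> * ?A \<omega>) \<le> 0 + e" .
  qed
  moreover have "integral {0..2 * pi} (\<lambda>\<omega>. ?A \<omega> * ?A \<omega>) \<ge> 0"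
    by (intro integral_nonneg integrable_continuous_real continuous_intros A) auto
  ultimately have "integral {0..2 * pi} (\<lambda>\<omega>. ?A \<omega> * ?A \<omega>) = 0" by linarith
  then have z: "\<forall>\<omega>\<in>{0..2 * pi}. ?A \<omega> * ?A \<omega> = 0"
    by (subst (asm) integral_eq_0_iff) (auto intro!: continuous_intros A)
  obtain \<omega> where w: "0 \<le> \<omega>" "\<omega> < 2 * pi" "x = polar (norm x) \<omega>" by (rule polar_surj)
  have "x = polar 1 \<omega>" using w(3) x by simp
  then show ?thesis using z w by (simp add: h_def)
qed

lemma fourier_uniqueness:
  fixes H :: "real^2 \<Rightarrow> complex"
  assumes H: "continuous_on (sphere 0 1) H"
    and 0: "\<And>n. integral {0..2 * pi} (\<lambda>\<omega>. H (polar 1 \<omega>) * exp (\<i> * of_int n * of_real \<omega>)) = 0"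
    and x: "x \<in> sphere 0 1"
  shows "H x = 0"
proof -
  have "Re (H x) = 0" by (rule fourier_uniqueness_Re[OF H 0 x])
  moreover have "Re (\<i> * H x) = 0"
  proof (rule fourier_uniqueness_Re[of "\<lambda>x. \<i> * H x", OF _ _ x])
    show "continuous_on (sphere 0 1) (\<lambda>x. \<i> * H x)" by (intro continuous_intros H)
    show "integral {0..2 * pi} (\<lambda>\<omega>. \<i> * H (polar 1 \<omega>) * exp (\<i> * of_int n * of_real \<omega>)) = 0" for n
      unfolding mult.assoc[of \<i> "H _"] integral_mult_right 0 by simp
  qed
  ultimately show ?thesis by (simp add: complex_eq_iff)
qed

text \<open>The equation reads \<open>(r p')' = - r (k\<^sup>2 - n\<^sup>2/r\<^sup>2) p\<close>, whose right-hand side is continuous up to \<open>R0\<close>;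
  hence so is \<open>r p'\<close>. Continuity of \<open>p\<close> at the boundary is therefore enough to have a boundary flux.\<close>

lemma continuous_derivative_extends_to_endpoint:
  assumes p: "continuous_on {R0..} p" and R0: "0 < R0"
    and d1: "\<And>r. R0 < r \<Longrightarrow> (p has_vector_derivative p' r) (at r)"
    and d2: "\<And>r. R0 < r \<Longrightarrow> (p' has_vector_derivative bessel_rhs k n p p' r) (at r)"
  obtains q where "bessel_sol k R0 n p q" "\<And>r. R0 < r \<Longrightarrow> q r = p' r"
proof -
  define h where "h = (\<lambda>r. - of_real r * ((of_real k ^ 2 - of_int n ^ 2 / of_real r ^ 2) * p r))"
  have h: "continuous_on {R0..} h" unfolding h_def using R0 by (intro continuous_intros p) auto
  define G where "G r = integral {R0..r} h" for r
  have Gd: "(G has_vector_derivative h r) (at r within {R0..b})" if "R0 \<le> r" "r \<le> b" for r b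
    unfolding G_def using that by (intro integral_has_vector_derivative continuous_on_subset[OF h]) auto
  have Gd': "(G has_vector_derivative h r) (at r)" if r: "R0 < r" for r
    using Gd[of r "r + 1"] r by (simp add: at_within_Icc_at)
  have Gc: "continuous_on {R0..b} G" for b
    by (rule continuous_on_vector_derivative) (rule Gd, auto)
  have Gcont: "continuous_on {R0..} G"
    unfolding continuous_on_eq_continuous_within
  proof
    fix r assume r: "r \<in> {R0..}"
    have "continuous (at r within {R0..r + 1}) G" using Gc[of "r + 1"] r by (simp add: continuous_on_eq_continuous_within)
    moreover have "at r within {R0..r + 1} = at r within {R0..}"
      by (rule at_within_nhd[of r "{..<r + 1}"]) auto
    ultimately show "continuous (at r within {R0..}) G" by simp
  qed
  have rp: "((\<lambda>r. of_real r * p' r) has_vector_derivative h r) (at r)" if r: "R0 < r" for r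
  proof -
    have "((\<lambda>r. of_real r * p' r) has_vector_derivative of_real r * bessel_rhs k n p p' r + 1 * p' r) (at r)"
      by (intro has_vector_derivative_mult has_vector_derivative_complex_of_real d2 r)
    moreover have "of_real r * bessel_rhs k n p p' r + 1 * p' r = h r"
      using r R0 by (simp add: bessel_rhs_def h_def field_simps)
    ultimately show ?thesis by simp
  qed
  define c where "c = of_real (R0 + 1) * p' (R0 + 1) - G (R0 + 1)"
  have const: "of_real r * p' r - G r = c" if r: "R0 < r" for r
  proof -
    have eq: "of_real b * p' b - G b = of_real a * p' a - G a" if ab: "R0 < a" "a \<le> b" for a b
    proof -
      let ?F = "\<lambda>r. of_real r * p' r - G r"
      have "(?F has_vector_derivative h r - h r) (at r)" if "R0 < r" for r
        by (intro has_vector_derivative_diff rp Gd' that)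
      then have D: "(?F has_vector_derivative 0) (at r)" if "R0 < r" for r using that by simp
      have "norm (?F b - ?F a) \<le> 0 * (b - a)"
      proof (rule vector_derivative_bound[OF ab(2)])
        show "continuous_on {a..b} ?F"
          by (rule continuous_on_vector_derivative, rule has_vector_derivative_at_within, rule D) (use ab in auto)
      qed (use D ab in auto)
      then show ?thesis by simp
    qed
    show ?thesis unfolding c_def
      using eq[of r "R0 + 1"] eq[of "R0 + 1" r] r by (cases "r \<le> R0 + 1") auto
  qed
  define q where "q r = (c + G r) / of_real r" for r
  have qp: "q r = p' r" if r: "R0 < r" for r
    using const[OF r] r R0 by (simp add: q_def field_simps) (simp add: algebra_simps)?
  have "continuous_on {R0..} q" unfolding q_def using R0 by (intro continuous_intros Gcont) auto
  moreover have "(q has_vector_derivative bessel_rhs k n p q r) (at r)" if r: "R0 < r" for r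
  proof -
    have "(q has_vector_derivative bessel_rhs k n p p' r) (at r)"
      by (rule has_vector_derivative_transform_within_open[OF d2[OF r], of "{R0<..}"]) (use r qp in auto)
    then show ?thesis using qp[OF r] by (simp add: bessel_rhs_def)
  qed
  moreover have "(p has_vector_derivative q r) (at r)" if r: "R0 < r" for r using d1[OF r] qp[OF r] by simp
  ultimately have "bessel_sol k R0 n p q" using p by (simp add: bessel_sol_def)
  then show ?thesis using that qp by blast
qed

definition angular_mean :: "int \<Rightarrow> (real \<Rightarrow> complex) \<Rightarrow> complex" where
  "angular_mean n h = integral {0..2 * pi} (\<lambda>\<omega>. h \<omega> * exp (\<i> * of_int (- n) * of_real \<omega>)) / of_real (2 * pi)"

lemma angular_mean_has_vector_derivative:
  fixes F F' :: "real \<Rightarrow> real \<Rightarrow> complex"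
  assumes d: "\<And>r \<omega>. R0 < r \<Longrightarrow> ((\<lambda>s. F s \<omega>) has_vector_derivative F' r \<omega>) (at r)"
    and c: "\<And>r. R0 < r \<Longrightarrow> continuous_on {0..2 * pi} (F r)"
    and c': "continuous_on ({R0<..} \<times> {0..2 * pi}) (\<lambda>(r, \<omega>). F' r \<omega>)"
    and r: "R0 < r"
  shows "((\<lambda>r. angular_mean n (F r)) has_vector_derivative angular_mean n (F' r)) (at r)"
proof -
  have e: "continuous_on S (\<lambda>x. exp (\<i> * of_int (- n) * of_real (g x)))" if "continuous_on S g" for S and g :: "'z::topological_space \<Rightarrow> real"
    by (intro continuous_intros that)
  have "((\<lambda>r. integral (cbox 0 (2 * pi)) (\<lambda>\<omega>. F r \<omega> * exp (\<i> * of_int (- n) * of_real \<omega>))) has_vector_derivative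
      integral (cbox 0 (2 * pi)) (\<lambda>\<omega>. F' r \<omega> * exp (\<i> * of_int (- n) * of_real \<omega>))) (at r within {R0<..})"
  proof (rule leibniz_rule_vector_derivative[where U="{R0<..}"
        and f="\<lambda>r \<omega>. F r \<omega> * exp (\<i> * of_int (- n) * of_real \<omega>)"
        and fx="\<lambda>r \<omega>. F' r \<omega> * exp (\<i> * of_int (- n) * of_real \<omega>)"])
    show "((\<lambda>r. F r t * exp (\<i> * of_int (- n) * of_real t)) has_vector_derivative F' x t * exp (\<i> * of_int (- n) * of_real t)) (at x within {R0<..})"
      if "x \<in> {R0<..}" for x t
      by (rule has_vector_derivative_at_within[OF has_vector_derivative_mult_left[OF d]]) (use that in auto)
    show "(\<lambda>\<omega>. F x \<omega> * exp (\<i> * of_int (- n) * of_real \<omega>)) integrable_on cbox 0 (2 * pi)" if "x \<in> {R0<..}" for x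
      using that c[of x] by (intro integrable_continuous continuous_on_mult e) auto
    show "continuous_on ({R0<..} \<times> cbox 0 (2 * pi)) (\<lambda>(x, t). F' x t * exp (\<i> * of_int (- n) * of_real t))"
      unfolding split_beta using c'[unfolded split_beta]
      by (intro continuous_on_mult e continuous_on_snd continuous_on_id) simp
  qed (use r in auto)
  then have "((\<lambda>r. integral {0..2 * pi} (\<lambda>\<omega>. F r \<omega> * exp (\<i> * of_int (- n) * of_real \<omega>))) has_vector_derivative
      integral {0..2 * pi} (\<lambda>\<omega>. F' r \<omega> * exp (\<i> * of_int (- n) * of_real \<omega>))) (at r)"
    unfolding box_real(2) has_vector_derivative_within_open[OF r[folded greaterThan_iff] open_greaterThan] .
  from has_vector_derivative_divide[OF this, of "of_real (2 * pi)"]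
  show ?thesis by (simp add: angular_mean_def)
qed

lemma angular_mean_linear:
  assumes "continuous_on {0..2 * pi} f" "continuous_on {0..2 * pi} g"
  shows "angular_mean n (\<lambda>\<omega>. a * f \<omega> + b * g \<omega>) = a * angular_mean n f + b * angular_mean n g"
proof -
  have "integral {0..2 * pi} (\<lambda>\<omega>. (a * f \<omega> + b * g \<omega>) * exp (\<i> * of_int (- n) * of_real \<omega>))
    = integral {0..2 * pi} (\<lambda>\<omega>. a * (f \<omega> * exp (\<i> * of_int (- n) * of_real \<omega>)) + b * (g \<omega> * exp (\<i> * of_int (- n) * of_real \<omega>)))"
    by (simp only: distrib_right mult.assoc)
  also have "\<dots> = integral {0..2 * pi} (\<lambda>\<omega>. a * (f \<omega> * exp (\<i> * of_int (- n) * of_real \<omega>)))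
     + integral {0..2 * pi} (\<lambda>\<omega>. b * (g \<omega> * exp (\<i> * of_int (- n) * of_real \<omega>)))"
    by (intro Henstock_Kurzweil_Integration.integral_add integrable_continuous_real continuous_intros assms)
  finally show ?thesis by (simp add: angular_mean_def integral_mult_right add_divide_distrib)
qed

lemma angular_mean_bound:
  assumes "continuous_on {0..2 * pi} h" "\<And>\<omega>. \<omega> \<in> {0..2 * pi} \<Longrightarrow> cmod (h \<omega>) \<le> e"
  shows "cmod (angular_mean n h) \<le> e"
proof -
  have ex: "cmod (exp (\<i> * of_int (- n) * of_real \<omega>)) = 1" for \<omega>
    using norm_exp_i_times[of "of_int (- n) * \<omega>"] by (simp add: mult.assoc)
  have e0: "0 \<le> e" using order_trans[OF norm_ge_zero assms(2)[of 0]] by simp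
  have "cmod (integral {0..2 * pi} (\<lambda>\<omega>. h \<omega> * exp (\<i> * of_int (- n) * of_real \<omega>))) \<le> e * (2 * pi - 0)"
  proof (rule integral_bound)
    show "continuous_on {0..2 * pi} (\<lambda>\<omega>. h \<omega> * exp (\<i> * of_int (- n) * of_real \<omega>))" by (intro continuous_intros assms)
    show "cmod (h t * exp (\<i> * of_int (- n) * of_real t)) \<le> e" if "t \<in> {0..2 * pi}" for t
      unfolding norm_mult ex using assms(2)[OF that] by simp
  qed simp
  then show ?thesis by (simp add: angular_mean_def norm_divide norm_mult field_simps)
qed

text \<open>The Fourier coefficients of \<open>\<psi>\<close> on the circle of radius \<open>r\<close> solve the radial equation, the angular
  part of the Laplacian contributing \<open>- n\<^sup>2/r\<^sup>2\<close> after integration by parts over a period, and they inherit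
  the radiation condition. Those with \<open>\<bar>n\<bar> > N\<close> vanish at \<open>R0\<close>, so they have zero flux there and vanish
  identically. Uniqueness of Fourier coefficients turns this into a finite expansion.\<close>

lemma outgoing_solution_expansion:
  assumes R0: "0 < R0" and k: "0 < k" and \<psi>: "outgoing_solution k R0 (trig_poly N c) \<psi>"
  obtains x x' where "\<And>n. bessel_sol k R0 n (x n) (x' n)" "\<And>n. outgoing k (x n) (x' n)"
    "\<And>n. \<bar>n\<bar> \<le> int N \<Longrightarrow> x n R0 = c n"
    "\<And>y. R0 \<le> norm y \<Longrightarrow> \<psi> y = (\<Sum>n = - int N..int N. x n (norm y) * emode n y)"
proof -
  have C2: "Ck_on 2 (- cball 0 R0) \<psi>" and cont: "continuous_on (- ball 0 R0) \<psi>"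
    and pde: "\<And>y. R0 < norm y \<Longrightarrow> laplacian \<psi> y + (of_real k)\<^sup>2 * \<psi> y = 0"
    and bc: "\<And>\<omega>. \<omega> \<in> {0..2 * pi} \<Longrightarrow> \<psi> (polar R0 \<omega>) = trig_poly N c \<omega>"
    and rad: "uniform_limit {0..2*pi}
       (\<lambda>r \<omega>. of_real (sqrt r) * (vector_derivative (\<lambda>s. \<psi> (polar s \<omega>)) (at r) - \<i> * of_real k * \<psi> (polar r \<omega>)))
       (\<lambda>\<omega>. 0) at_top"
    using \<psi> by (auto simp: outgoing_solution_def)
  let ?d = "\<lambda>i. partial_deriv i \<psi>" and ?dd = "\<lambda>i j. partial_deriv i (partial_deriv j \<psi>)"
  have C2': "Ck_on (Suc (Suc 0)) (- cball 0 R0) \<psi>" using C2 by (simp only: numeral_2_eq_2)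
  have df: "\<psi> differentiable (at y)" "?d i differentiable (at y)" if "R0 < norm y" for y i
    using C2' that by auto
  have cd: "continuous_on (- cball 0 R0) (?d i)" "continuous_on (- cball 0 R0) (?dd i j)" for i j
    using C2' Ck_on_continuous[of "Suc 0" "- cball 0 R0" "?d i"] by auto
  have R0w: "R0 < norm (polar r \<omega>)" if "R0 < r" for r \<omega> using that R0 by simp
  have cpol: "continuous_on ({R0<..} \<times> {0..2 * pi}) (\<lambda>z. g (polar (fst z) (snd z)))" "continuous_on S (\<lambda>\<omega>. g (polar r \<omega>))"
    if "continuous_on (- cball 0 R0) g" "R0 < r" for g :: "real^2 \<Rightarrow> complex" and r S
    using that R0 by (auto intro!: continuous_on_compose2[OF that(1)] continuous_intros)
  have c\<psi>: "continuous_on (- cball 0 R0) \<psi>" using cont by (rule continuous_on_subset) auto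
  define F1 where "F1 r \<omega> = of_real (cos \<omega>) * ?d 1 (polar r \<omega>) + of_real (sin \<omega>) * ?d 2 (polar r \<omega>)" for r \<omega>
  define F2 where "F2 r \<omega> = of_real (cos \<omega>) * (of_real (cos \<omega>) * ?dd 1 1 (polar r \<omega>) + of_real (sin \<omega>) * ?dd 2 1 (polar r \<omega>))
      + of_real (sin \<omega>) * (of_real (cos \<omega>) * ?dd 1 2 (polar r \<omega>) + of_real (sin \<omega>) * ?dd 2 2 (polar r \<omega>))" for r \<omega>
  define A1 where "A1 r \<omega> = of_real (- r * sin \<omega>) * ?d 1 (polar r \<omega>) + of_real (r * cos \<omega>) * ?d 2 (polar r \<omega>)" for r \<omega>
  define A2 where "A2 r \<omega> = (of_real (- r * sin \<omega>) * (of_real (- r * sin \<omega>) * ?dd 1 1 (polar r \<omega>) + of_real (r * cos \<omega>) * ?dd 2 1 (polar r \<omega>))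
        + of_real (- r * cos \<omega>) * ?d 1 (polar r \<omega>))
      + (of_real (r * cos \<omega>) * (of_real (- r * sin \<omega>) * ?dd 1 2 (polar r \<omega>) + of_real (r * cos \<omega>) * ?dd 2 2 (polar r \<omega>))
        + of_real (- r * sin \<omega>) * ?d 2 (polar r \<omega>))" for r \<omega>
  have dF: "((\<lambda>s. \<psi> (polar s \<omega>)) has_vector_derivative F1 r \<omega>) (at r)" if "R0 < r" for r \<omega>
    unfolding F1_def by (rule has_vector_derivative_polar_radial[OF df(1)[OF R0w[OF that]]])
  have dF1: "((\<lambda>s. F1 s \<omega>) has_vector_derivative F2 r \<omega>) (at r)" if "R0 < r" for r \<omega>
    unfolding F1_def F2_def
    by (intro has_vector_derivative_add has_vector_derivative_mult_right has_vector_derivative_polar_radial df(2) R0w that)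
  have dA: "((\<lambda>t. \<psi> (polar r t)) has_vector_derivative A1 r \<omega>) (at \<omega>)" if "R0 < r" for r \<omega>
    unfolding A1_def by (rule has_vector_derivative_polar_angular[OF df(1)[OF R0w[OF that]]])
  have dA1: "(A1 r has_vector_derivative A2 r \<omega>) (at \<omega>)" if "R0 < r" for r \<omega>
  proof -
    have s: "((\<lambda>\<omega>. complex_of_real (- r * sin \<omega>)) has_vector_derivative of_real (- r * cos \<omega>)) (at \<omega>)"
      and c: "((\<lambda>\<omega>. complex_of_real (r * cos \<omega>)) has_vector_derivative of_real (- r * sin \<omega>)) (at \<omega>)"
      by (rule has_vector_derivative_of_real, auto intro!: derivative_eq_intros)+
    show ?thesis unfolding A1_def[abs_def] A2_def
      by (intro has_vector_derivative_add has_vector_derivative_mult s c has_vector_derivative_polar_angular df(2) R0w that)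
  qed
  have cF1: "continuous_on ({R0<..} \<times> {0..2 * pi}) (\<lambda>(r, \<omega>). F1 r \<omega>)"
    unfolding F1_def split_beta using R0 by (intro continuous_intros cpol(1)[of _ "R0 + 1"] cd) auto
  have cF2: "continuous_on ({R0<..} \<times> {0..2 * pi}) (\<lambda>(r, \<omega>). F2 r \<omega>)"
    unfolding F2_def split_beta using R0 by (intro continuous_intros cpol(1)[of _ "R0 + 1"] cd) auto
  have cF: "continuous_on {0..2 * pi} (\<lambda>\<omega>. \<psi> (polar r \<omega>))" "continuous_on {0..2 * pi} (F1 r)" "continuous_on {0..2 * pi} (F2 r)"
    "continuous_on {0..2 * pi} (A1 r)" "continuous_on {0..2 * pi} (A2 r)" if "R0 < r" for r
    unfolding F1_def F2_def A1_def A2_def by (intro continuous_intros cpol(2) cd c\<psi> that)+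
  define y where "y n r = angular_mean n (\<lambda>\<omega>. \<psi> (polar r \<omega>))" for n r
  define y' where "y' n r = angular_mean n (F1 r)" for n r
  have dy: "(y n has_vector_derivative y' n r) (at r)" if "R0 < r" for n r
    unfolding y_def[abs_def] y'_def
    by (rule angular_mean_has_vector_derivative[OF _ _ cF1 that, of "\<lambda>r \<omega>. \<psi> (polar r \<omega>)"]) (use dF cF in auto)
  have ang: "angular_mean n (A2 r) = - (of_int n)\<^sup>2 * y n r" if r: "R0 < r" for n r
  proof -
    let ?e = "\<lambda>\<omega>. exp (\<i> * of_int (- n) * of_real \<omega>)"
    have de: "(?e has_vector_derivative ?e \<omega> * (\<i> * of_int (- n))) (at \<omega>)" for \<omega> :: real
    proof -
      have "((\<lambda>z. exp (\<i> * of_int (- n) * z)) has_field_derivative exp (\<i> * of_int (- n) * of_real \<omega>) * (\<i> * of_int (- n))) (at (of_real \<omega>))"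
        by (auto intro!: derivative_eq_intros)
      from has_vector_derivative_real_field[OF this] show ?thesis .
    qed
    let ?\<Phi> = "\<lambda>\<omega>. A1 r \<omega> * ?e \<omega> + \<i> * of_int n * (\<psi> (polar r \<omega>) * ?e \<omega>)"
    have D: "(?\<Phi> has_vector_derivative (A1 r \<omega> * (?e \<omega> * (\<i> * of_int (- n))) + A2 r \<omega> * ?e \<omega>)
        + \<i> * of_int n * (\<psi> (polar r \<omega>) * (?e \<omega> * (\<i> * of_int (- n))) + A1 r \<omega> * ?e \<omega>)) (at \<omega>)" for \<omega>
      by (intro has_vector_derivative_add has_vector_derivative_mult has_vector_derivative_mult_right dA1 dA r de)
    have "(A1 r \<omega> * (?e \<omega> * (\<i> * of_int (- n))) + A2 r \<omega> * ?e \<omega>)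
        + \<i> * of_int n * (\<psi> (polar r \<omega>) * (?e \<omega> * (\<i> * of_int (- n))) + A1 r \<omega> * ?e \<omega>)
        = (1 * A2 r \<omega> + (of_int n)\<^sup>2 * \<psi> (polar r \<omega>)) * ?e \<omega>" for \<omega>
      by (simp add: algebra_simps power2_eq_square)
    then have D2: "(?\<Phi> has_vector_derivative (1 * A2 r \<omega> + (of_int n)\<^sup>2 * \<psi> (polar r \<omega>)) * ?e \<omega>) (at \<omega>)" for \<omega>
      using D[of \<omega>] by simp
    have "((\<lambda>\<omega>. (1 * A2 r \<omega> + (of_int n)\<^sup>2 * \<psi> (polar r \<omega>)) * ?e \<omega>) has_integral ?\<Phi> (2 * pi) - ?\<Phi> 0) {0..2 * pi}"
      by (rule fundamental_theorem_of_calculus[OF _ has_vector_derivative_at_within[OF D2]]) simp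
    moreover have "?\<Phi> (2 * pi) = ?\<Phi> 0"
    proof -
      have "?e (2 * pi) = 1" using exp_integer_2pi[of "of_int (- n)"] by (simp add: mult_ac)
      moreover have "polar r (2 * pi) = polar r 0" by (simp add: vec2_eq_iff)
      moreover from this have "A1 r (2 * pi) = A1 r 0" by (simp add: A1_def)
      ultimately show ?thesis by simp
    qed
    ultimately have "angular_mean n (\<lambda>\<omega>. 1 * A2 r \<omega> + (of_int n)\<^sup>2 * \<psi> (polar r \<omega>)) = 0"
      by (simp add: angular_mean_def integral_unique)
    then have "1 * angular_mean n (A2 r) + (of_int n)\<^sup>2 * y n r = 0"
      unfolding y_def using angular_mean_linear[OF cF(5)[OF r] cF(1)[OF r], of n 1 "(of_int n)\<^sup>2"] by metis
    then show ?thesis by (simp add: eq_neg_iff_add_eq_0)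
  qed
  have dy': "(y' n has_vector_derivative bessel_rhs k n (y n) (y' n) r) (at r)" if r: "R0 < r" for n r
  proof -
    have r0: "r \<noteq> 0" "complex_of_real r \<noteq> 0" using r R0 by auto
    have "(y' n has_vector_derivative angular_mean n (F2 r)) (at r)"
      unfolding y'_def[abs_def]
      by (rule angular_mean_has_vector_derivative[OF _ _ cF2 r]) (use dF1 cF in auto)
    moreover have "angular_mean n (F2 r) = bessel_rhs k n (y n) (y' n) r"
    proof -
      have pt: "F2 r \<omega> = 1 * (- 1 / of_real r * F1 r \<omega> + (- (of_real k)\<^sup>2) * \<psi> (polar r \<omega>)) + (- 1 / of_real r ^ 2) * A2 r \<omega>" for \<omega>
      proof -
        let ?c = "complex_of_real (cos \<omega>)" and ?s = "complex_of_real (sin \<omega>)"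
        have sc: "?s\<^sup>2 = 1 - ?c\<^sup>2"
          by (metis (no_types, opaque_lifting) of_real_1 of_real_diff of_real_power sin_squared_eq)
        have "?dd 1 1 (polar r \<omega>) + ?dd 2 2 (polar r \<omega>) + (of_real k)\<^sup>2 * \<psi> (polar r \<omega>) = 0"
          using pde[OF R0w[OF r]] by (simp add: laplacian_def sum_2)
        then have ps: "(of_real k)\<^sup>2 * \<psi> (polar r \<omega>) = - ?dd 1 1 (polar r \<omega>) - ?dd 2 2 (polar r \<omega>)"
          by (simp add: eq_neg_iff_add_eq_0 algebra_simps)
        have A: "A2 r \<omega> = of_real r ^ 2 * (?s\<^sup>2 * ?dd 1 1 (polar r \<omega>) - ?s * ?c * (?dd 2 1 (polar r \<omega>) + ?dd 1 2 (polar r \<omega>)) + ?c\<^sup>2 * ?dd 2 2 (polar r \<omega>))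
            - of_real r * F1 r \<omega>"
          unfolding A2_def F1_def by (simp add: algebra_simps power2_eq_square)
        have X: "(1 / of_real r ^ 2) * A2 r \<omega> = (?s\<^sup>2 * ?dd 1 1 (polar r \<omega>) - ?s * ?c * (?dd 2 1 (polar r \<omega>) + ?dd 1 2 (polar r \<omega>)) + ?c\<^sup>2 * ?dd 2 2 (polar r \<omega>))
            - F1 r \<omega> / of_real r"
          unfolding A using r0 by (simp add: right_diff_distrib power2_eq_square)
        have F2: "F2 r \<omega> = ?c\<^sup>2 * ?dd 1 1 (polar r \<omega>) + ?s * ?c * (?dd 2 1 (polar r \<omega>) + ?dd 1 2 (polar r \<omega>)) + ?s\<^sup>2 * ?dd 2 2 (polar r \<omega>)"
          unfolding F2_def by (simp add: algebra_simps power2_eq_square)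
        have "1 * (- 1 / of_real r * F1 r \<omega> + (- (of_real k)\<^sup>2) * \<psi> (polar r \<omega>)) + (- 1 / of_real r ^ 2) * A2 r \<omega>
          = - (F1 r \<omega> / of_real r) - (of_real k)\<^sup>2 * \<psi> (polar r \<omega>) - (1 / of_real r ^ 2) * A2 r \<omega>" by simp
        also have "\<dots> = F2 r \<omega>" unfolding X ps F2 sc by (simp add: algebra_simps)
        finally show ?thesis by (rule sym)
      qed
      have "angular_mean n (F2 r) = 1 * angular_mean n (\<lambda>\<omega>. - 1 / of_real r * F1 r \<omega> + (- (of_real k)\<^sup>2) * \<psi> (polar r \<omega>))
          + (- 1 / of_real r ^ 2) * angular_mean n (A2 r)"
        unfolding pt[abs_def] by (intro angular_mean_linear continuous_intros cF r)
      also have "angular_mean n (\<lambda>\<omega>. - 1 / of_real r * F1 r \<omega> + (- (of_real k)\<^sup>2) * \<psi> (polar r \<omega>))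
          = - 1 / of_real r * y' n r + (- (of_real k)\<^sup>2) * y n r"
        unfolding y_def y'_def by (intro angular_mean_linear cF r)
      finally show ?thesis unfolding ang[OF r] bessel_rhs_def by (simp add: algebra_simps)
    qed
    ultimately show ?thesis by simp
  qed
  have ycont: "continuous_on {R0..} (y n)" for n
  proof -
    have "continuous_on ({R0..} \<times> cbox 0 (2 * pi)) (\<lambda>(r, \<omega>). \<psi> (polar r \<omega>) * exp (\<i> * of_int (- n) * of_real \<omega>))"
      unfolding split_beta using R0 by (intro continuous_intros continuous_on_compose2[OF cont]) auto
    from integral_continuous_on_param[OF this] show ?thesis
      unfolding y_def angular_mean_def by (intro continuous_intros) auto
  qed
  have "\<exists>q. bessel_sol k R0 n (y n) q \<and> (\<forall>r>R0. q r = y' n r)" for n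
    using continuous_derivative_extends_to_endpoint[OF ycont R0 dy dy'] by metis
  then obtain x' where x': "\<And>n. bessel_sol k R0 n (y n) (x' n)" "\<And>n r. R0 < r \<Longrightarrow> x' n r = y' n r" by metis
  have out: "outgoing k (y n) (x' n)" for n
    unfolding outgoing_def
  proof (rule tendstoI)
    fix e :: real assume e: "e > 0"
    have "\<forall>\<^sub>F r in at_top. \<forall>\<omega>\<in>{0..2*pi}. dist (of_real (sqrt r) * (vector_derivative (\<lambda>s. \<psi> (polar s \<omega>)) (at r) - \<i> * of_real k * \<psi> (polar r \<omega>))) 0 < e / 2"
      using rad[unfolded uniform_limit_iff] e by (meson half_gt_zero)
    with eventually_gt_at_top[of R0]
    show "\<forall>\<^sub>F r in at_top. dist (of_real (sqrt r) * (x' n r - \<i> * of_real k * y n r)) 0 < e"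
    proof eventually_elim
      case (elim r)
      have vd: "vector_derivative (\<lambda>s. \<psi> (polar s \<omega>)) (at r) = F1 r \<omega>" for \<omega>
        by (rule vector_derivative_at[OF dF[OF elim(1)]])
      have "cmod (angular_mean n (\<lambda>\<omega>. of_real (sqrt r) * F1 r \<omega> + (- of_real (sqrt r) * (\<i> * of_real k)) * \<psi> (polar r \<omega>))) \<le> e / 2"
      proof (rule angular_mean_bound)
        fix \<omega> assume "\<omega> \<in> {0..2 * pi}"
        with elim(2) have "dist (of_real (sqrt r) * (F1 r \<omega> - \<i> * of_real k * \<psi> (polar r \<omega>))) 0 < e / 2" unfolding vd by blast
        then show "cmod (of_real (sqrt r) * F1 r \<omega> + (- of_real (sqrt r) * (\<i> * of_real k)) * \<psi> (polar r \<omega>)) \<le> e / 2"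
          by (simp add: dist_norm algebra_simps)
      qed (intro continuous_intros cF elim)
      also have "angular_mean n (\<lambda>\<omega>. of_real (sqrt r) * F1 r \<omega> + (- of_real (sqrt r) * (\<i> * of_real k)) * \<psi> (polar r \<omega>))
         = of_real (sqrt r) * (x' n r - \<i> * of_real k * y n r)"
        unfolding x'(2)[OF elim(1)] y_def y'_def
        by (subst angular_mean_linear[OF cF(2)[OF elim(1)] cF(1)[OF elim(1)]]) (simp add: algebra_simps)
      finally show ?case using e by (simp add: dist_norm)
    qed
  qed
  have yR0: "y n R0 = (if \<bar>n\<bar> \<le> int N then c n else 0)" for n
  proof -
    have "y n R0 = integral {0..2 * pi} (\<lambda>\<omega>. trig_poly N c \<omega> * exp (\<i> * of_int (- n) * of_real \<omega>)) / of_real (2 * pi)"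
      unfolding y_def angular_mean_def by (intro arg_cong2[where f="(/)"] integral_cong) (auto simp: bc)
    then show ?thesis unfolding fourier_coeff_trig_poly by simp
  qed
  have zero: "y n r = 0" if "\<not> \<bar>n\<bar> \<le> int N" "R0 \<le> r" for n r
    by (rule outgoing_zero_flux_imp_zero[OF x'(1) R0 k out _ that(2)]) (simp add: yR0 that(1))
  have exp: "\<psi> z = (\<Sum>n = - int N..int N. y n (norm z) * emode n z)" if z: "R0 \<le> norm z" for z
  proof -
    define r where "r = norm z"
    have r: "r > 0" "R0 \<le> r" using z R0 by (auto simp: r_def)
    define H where "H v = \<psi> (r *\<^sub>R v) - (\<Sum>j = - int N..int N. y j r * emode j v)" for v
    have pol: "r *\<^sub>R polar 1 \<omega> = polar r \<omega>" for \<omega> by (simp add: vec2_eq_iff)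
    have cp: "continuous_on {0..2 * pi} (\<lambda>\<omega>. \<psi> (polar r \<omega>))"
      using r by (intro continuous_on_compose2[OF cont] continuous_intros) auto
    have "H (z /\<^sub>R r) = 0"
    proof (rule fourier_uniqueness)
      show "continuous_on (sphere 0 1) H" unfolding H_def
        using r by (intro continuous_intros continuous_on_compose2[OF cont] continuous_on_emode) auto
      show "z /\<^sub>R r \<in> sphere 0 1" using r by (simp add: r_def)
      fix m :: int
      define n where "n = - m"
      have m: "m = - n" by (simp add: n_def)
      have tp: "H (polar 1 \<omega>) = \<psi> (polar r \<omega>) - trig_poly N (\<lambda>j. y j r) \<omega>" for \<omega>
        by (simp add: H_def pol trig_poly_def emode_polar)
      have "integral {0..2 * pi} (\<lambda>\<omega>. H (polar 1 \<omega>) * exp (\<i> * of_int m * of_real \<omega>))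
         = integral {0..2 * pi} (\<lambda>\<omega>. \<psi> (polar r \<omega>) * exp (\<i> * of_int (- n) * of_real \<omega>) - trig_poly N (\<lambda>j. y j r) \<omega> * exp (\<i> * of_int (- n) * of_real \<omega>))"
        unfolding tp m left_diff_distrib ..
      also have "\<dots> = integral {0..2 * pi} (\<lambda>\<omega>. \<psi> (polar r \<omega>) * exp (\<i> * of_int (- n) * of_real \<omega>))
          - integral {0..2 * pi} (\<lambda>\<omega>. trig_poly N (\<lambda>j. y j r) \<omega> * exp (\<i> * of_int (- n) * of_real \<omega>))"
        unfolding trig_poly_def
        by (intro Henstock_Kurzweil_Integration.integral_diff integrable_continuous_real continuous_intros cp)
      also have "\<dots> = of_real (2 * pi) * y n r - (if \<bar>n\<bar> \<le> int N then of_real (2 * pi) * y n r else 0)"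
        unfolding fourier_coeff_trig_poly by (simp add: y_def angular_mean_def)
      also have "\<dots> = 0" using zero[of n r] r by auto
      finally show "integral {0..2 * pi} (\<lambda>\<omega>. H (polar 1 \<omega>) * exp (\<i> * of_int m * of_real \<omega>)) = 0" .
    qed
    moreover have "emode j (z /\<^sub>R r) = emode j z" for j
      using r unfolding emode_def by (simp add: r_def field_simps)
    ultimately show ?thesis using r by (simp add: H_def r_def)
  qed
  show ?thesis
    by (rule that[OF x'(1) out _ exp]) (simp_all add: yR0)
qed

section \<open>Angular modes\<close>

definition mode :: "(real \<Rightarrow> complex) \<Rightarrow> int \<Rightarrow> real^2 \<Rightarrow> complex" where
  "mode p n x = p (norm x) * emode n x"

definition rhat :: "2 \<Rightarrow> real^2 \<Rightarrow> complex" where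
  "rhat i x = of_real (x $ i / norm x)"

definition ahat :: "2 \<Rightarrow> real^2 \<Rightarrow> complex" where
  "ahat i x = of_real ((if i = 1 then - (x $ 2) else x $ 1) / norm x)"

text \<open>The vector field with radial component \<open>a(r) e\<^sup>i\<^sup>n\<^sup>\<omega>\<close> and angular component \<open>b(r) e\<^sup>i\<^sup>n\<^sup>\<omega>\<close>, given by its
  Cartesian components; \<open>rhat\<close> and \<open>ahat\<close> are the unit vectors of polar coordinates.\<close>

definition vfield :: "(real \<Rightarrow> complex) \<Rightarrow> (real \<Rightarrow> complex) \<Rightarrow> int \<Rightarrow> 2 \<Rightarrow> real^2 \<Rightarrow> complex" where
  "vfield a b n i x = (a (norm x) * rhat i x + b (norm x) * ahat i x) * emode n x"

lemma rhat_polar: "0 < r \<Longrightarrow> rhat 1 (polar r \<omega>) = of_real (cos \<omega>)" "0 < r \<Longrightarrow> rhat 2 (polar r \<omega>) = of_real (sin \<omega>)"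
  by (simp_all add: rhat_def)

lemma ahat_polar: "0 < r \<Longrightarrow> ahat 1 (polar r \<omega>) = - of_real (sin \<omega>)" "0 < r \<Longrightarrow> ahat 2 (polar r \<omega>) = of_real (cos \<omega>)"
  by (simp_all add: ahat_def)

lemma vec2_power2_sum: "(x $ 1)\<^sup>2 + (x $ 2)\<^sup>2 = (norm (x :: real^2))\<^sup>2"
  by (simp add: norm_vec2)

lemma sum_rhat_ahat:
  assumes "x \<noteq> 0"
  shows "rhat 1 x * rhat 1 x + rhat 2 x * rhat 2 x = 1" "rhat 1 x * ahat 1 x + rhat 2 x * ahat 2 x = 0"
    "ahat 1 x * ahat 1 x + ahat 2 x * ahat 2 x = 1"
proof -
  have n: "norm x \<noteq> 0" using assms by simp
  have "(x $ 1 / norm x) * (x $ 1 / norm x) + (x $ 2 / norm x) * (x $ 2 / norm x) = ((x $ 1)\<^sup>2 + (x $ 2)\<^sup>2) / (norm x)\<^sup>2"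
    by (simp add: power2_eq_square add_divide_distrib)
  also have "\<dots> = 1" unfolding vec2_power2_sum using n by simp
  finally have 1: "(x $ 1 / norm x) * (x $ 1 / norm x) + (x $ 2 / norm x) * (x $ 2 / norm x) = 1" .
  show "rhat 1 x * rhat 1 x + rhat 2 x * rhat 2 x = 1"
    unfolding rhat_def of_real_mult[symmetric] of_real_add[symmetric] 1 by simp
  have "ahat 1 x = of_real (- (x $ 2 / norm x))" "ahat 2 x = of_real (x $ 1 / norm x)" by (simp_all add: ahat_def)
  note t = this
  show "ahat 1 x * ahat 1 x + ahat 2 x * ahat 2 x = 1"
    unfolding t of_real_mult[symmetric] of_real_add[symmetric] using 1 by (simp add: add.commute)
  show "rhat 1 x * ahat 1 x + rhat 2 x * ahat 2 x = 0"
    unfolding t rhat_def by (simp add: mult.commute)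
qed

lemma cnj_rhat [simp]: "cnj (rhat i x) = rhat i x" and cnj_ahat [simp]: "cnj (ahat i x) = ahat i x"
  by (simp_all add: rhat_def ahat_def)

lemma norm_rhat_le: "cmod (rhat i x) \<le> 1"
  using component_le_norm_cart[of x i] by (cases "x = 0") (auto simp: rhat_def norm_divide divide_le_eq_1)

lemma norm_ahat_le: "cmod (ahat i x) \<le> 1"
  using component_le_norm_cart[of x 1] component_le_norm_cart[of x 2]
  by (cases "x = 0") (auto simp: ahat_def norm_divide divide_le_eq_1)

lemma emode_polar_form:
  assumes "x \<noteq> 0"
  obtains \<omega> where "0 \<le> \<omega>" "\<omega> < 2 * pi" "x = polar (norm x) \<omega>" "\<And>n. emode n x = exp (\<i> * of_int n * of_real \<omega>)"
proof -
  obtain \<omega> where w: "0 \<le> \<omega>" "\<omega> < 2 * pi" "x = polar (norm x) \<omega>" by (rule polar_surj)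
  have "emode n x = exp (\<i> * of_int n * of_real \<omega>)" for n
    using emode_polar[of "norm x" n \<omega>] assms w(3) by simp
  with w show ?thesis by (rule that)
qed

lemma norm_emode: "x \<noteq> 0 \<Longrightarrow> cmod (emode n x) = 1"
  by (rule emode_polar_form, assumption) (use norm_exp_i_times[of "of_int n * \<omega>" for \<omega>] in \<open>simp add: mult.assoc\<close>)

lemma cnj_emode: "x \<noteq> 0 \<Longrightarrow> cnj (emode n x) = emode (- n) x"
  by (rule emode_polar_form, assumption) (simp add: exp_cnj)

lemma emode_add: "x \<noteq> 0 \<Longrightarrow> emode (m + n) x = emode m x * emode n x"
  by (rule emode_polar_form, assumption) (simp only: exp_mode_add)

lemma emode_0 [simp]: "emode 0 x = 1" by (simp add: emode_def)

lemma emode_1: "emode 1 x = (of_real (x $ 1) + \<i> * of_real (x $ 2)) * inverse (of_real (norm x))"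
  by (simp add: emode_def divide_inverse)

lemma emode_m1: "x \<noteq> 0 \<Longrightarrow> emode (- 1) x = (of_real (x $ 1) - \<i> * of_real (x $ 2)) * inverse (of_real (norm x))"
  using cnj_emode[of x 1] by (simp add: emode_1)

lemma open_nonzero: "open {x :: real^2. x \<noteq> 0}"
  by (simp add: open_Collect_neq continuous_on_id continuous_on_const)

lemma Ck_on_inverse_norm: "Ck_on m {x :: real^2. x \<noteq> 0} (\<lambda>x. inverse (complex_of_real (norm x)))"
  using Ck_on_radial[OF open_greaterThan[of 0] order_refl Ck_line_inverse, of m, where 'n=2] by simp

lemma Ck_on_rhat: "Ck_on m {x. x \<noteq> 0} (rhat i)"
proof -
  have "Ck_on m {x. x \<noteq> 0} (\<lambda>x. complex_of_real (x $ i) * inverse (complex_of_real (norm x)))"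
    by (intro Ck_on_mult open_nonzero Ck_on_coordinate Ck_on_inverse_norm)
  then show ?thesis by (simp add: rhat_def[abs_def] divide_inverse)
qed

lemma Ck_on_ahat: "Ck_on m {x. x \<noteq> 0} (ahat i)"
proof (cases "i = 1")
  case True
  then have "ahat i = (\<lambda>x. - rhat 2 x)" by (auto simp: ahat_def rhat_def)
  then show ?thesis by (simp add: Ck_on_minus open_nonzero Ck_on_rhat)
next
  case False
  then have "ahat i = rhat 1" by (auto simp: ahat_def rhat_def)
  then show ?thesis by (simp add: Ck_on_rhat)
qed

lemma Ck_on_emode: "Ck_on m {x. x \<noteq> 0} (emode n)"
proof -
  have pos: "Ck_on m {x. x \<noteq> 0} (emode (int j))" for j
  proof (induction j)
    case 0
    have "emode (int 0) = (\<lambda>_. 1)" by (simp add: fun_eq_iff)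
    then show ?case by (simp add: Ck_on_const)
  next
    case (Suc j)
    have "Ck_on m {x. x \<noteq> 0} (\<lambda>x :: real^2. (of_real (x $ 1) + \<i> * of_real (x $ 2)) * inverse (of_real (norm x)))"
      by (intro Ck_on_mult Ck_on_add open_nonzero Ck_on_coordinate Ck_on_inverse_norm Ck_on_const)
    moreover have "emode 1 = (\<lambda>x :: real^2. (of_real (x $ 1) + \<i> * of_real (x $ 2)) * inverse (of_real (norm x)))"
      by (rule ext) (rule emode_1)
    ultimately have "Ck_on m {x. x \<noteq> 0} (emode 1)" by (simp only:)
    then have "Ck_on m {x. x \<noteq> 0} (\<lambda>x. emode (int j) x * emode 1 x)"
      by (intro Ck_on_mult open_nonzero Suc)
    then show ?case
      by (subst Ck_on_cong[OF open_nonzero, of _ "\<lambda>x. emode (int j) x * emode 1 x"])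
         (auto simp: emode_add[symmetric] add.commute)
  qed
  have neg: "Ck_on m {x. x \<noteq> 0} (emode (- int j))" for j
  proof (induction j)
    case 0
    have "emode (- int 0) = (\<lambda>_. 1)" by (simp add: fun_eq_iff)
    then show ?case by (simp add: Ck_on_const)
  next
    case (Suc j)
    have "Ck_on m {x. x \<noteq> 0} (\<lambda>x :: real^2. (of_real (x $ 1) - \<i> * of_real (x $ 2)) * inverse (of_real (norm x)))"
      by (intro Ck_on_mult Ck_on_diff open_nonzero Ck_on_coordinate Ck_on_inverse_norm Ck_on_const)
    then have "Ck_on m {x. x \<noteq> 0} (emode (- 1))"
      by (subst Ck_on_cong[OF open_nonzero]) (auto simp: emode_m1)
    then have "Ck_on m {x. x \<noteq> 0} (\<lambda>x. emode (- int j) x * emode (- 1) x)"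
      by (intro Ck_on_mult open_nonzero Suc)
    then show ?case
      by (subst Ck_on_cong[OF open_nonzero, of _ "\<lambda>x. emode (- int j) x * emode (- 1) x"])
         (auto simp: emode_add[symmetric] add.commute)
  qed
  show ?thesis using pos[of "nat n"] neg[of "nat (- n)"] by (cases "n \<ge> 0") auto
qed

lemma Ck_on_mode:
  assumes "open S" "S \<subseteq> {0<..}" "Ck_line m S p"
  shows "Ck_on m {x. norm x \<in> S} (mode p n)"
proof -
  have "{x :: real^2. norm x \<in> S} \<subseteq> {x. x \<noteq> 0}" using assms(2) by auto
  then show ?thesis unfolding mode_def[abs_def]
    by (intro Ck_on_mult open_radial assms Ck_on_radial Ck_on_subset[OF Ck_on_emode])
qed

lemma partial_deriv_emode:
  assumes "x \<noteq> 0"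
  shows "partial_deriv i (emode n) x = \<i> * of_int n / of_real (norm x) * ahat i x * emode n x"
proof -
  let ?r = "norm x"
  have r: "?r \<noteq> 0" "complex_of_real ?r \<noteq> 0" using assms by auto
  define z where "z = complex_of_real (x $ 1) + \<i> * of_real (x $ 2)"
  have z: "z \<noteq> 0" using assms by (auto simp: z_def complex_eq_iff vec2_eq_iff)
  have nth: "((\<lambda>y. y $ j) has_derivative (\<lambda>h. h $ j)) (at x)" for j :: 2
    by (rule bounded_linear_imp_has_derivative[OF bounded_linear_vec_nth])
  have nr: "((\<lambda>y. norm y) has_derivative (\<lambda>h. (h \<bullet> x) / ?r)) (at x)"
    using has_derivative_norm[OF assms] by (simp add: sgn_div_norm inner_commute divide_inverse mult.commute)
  have dz: "((\<lambda>y. complex_of_real (y $ 1) + \<i> * of_real (y $ 2)) has_derivative (\<lambda>h. of_real (h $ 1) + \<i> * of_real (h $ 2))) (at x)"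
    by (intro has_derivative_add has_derivative_mult_right has_derivative_of_real nth)
  have dw: "((\<lambda>y. (complex_of_real (y $ 1) + \<i> * of_real (y $ 2)) / of_real (norm y)) has_derivative
      (\<lambda>h. ((of_real (h $ 1) + \<i> * of_real (h $ 2)) * of_real ?r - z * of_real ((h \<bullet> x) / ?r)) / (of_real ?r * of_real ?r))) (at x)"
    unfolding z_def by (rule has_derivative_divide'[OF dz has_derivative_of_real[OF nr]]) (use r in simp)
  have "(emode n has_derivative (\<lambda>h. ((of_real (h $ 1) + \<i> * of_real (h $ 2)) * of_real ?r - z * of_real ((h \<bullet> x) / ?r)) / (of_real ?r * of_real ?r)
      * (of_int n * (z / of_real ?r) powi (n - 1)))) (at x)"
    unfolding emode_def[abs_def] using has_derivative_power_int[OF _ dw, of n] r z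
    by (simp add: z_def)
  note D = partial_deriv_eqI[OF this, of i]
  have "(z / of_real ?r) powi (n - 1) = emode n x / (z / of_real ?r)"
    using r z by (simp add: emode_def z_def power_int_diff)
  then have e: "(z / of_real ?r) powi (n - 1) * z = emode n x * of_real ?r" using z r by simp
  have rr: "of_real ?r * of_real ?r = z * cnj z"
    using vec2_power2_sum[of x] unfolding z_def
    by (simp add: complex_eq_iff power2_eq_square)
  have key: "((of_real (axis i 1 $ 1) + \<i> * of_real (axis i 1 $ 2)) * of_real ?r - z * of_real ((axis i 1 \<bullet> x) / ?r))
     = \<i> * z * ahat i x"
  proof -
    have rx: "complex_of_real ?r * of_real ?r = of_real (x $ 1) * of_real (x $ 1) + of_real (x $ 2) * of_real (x $ 2)"
      unfolding of_real_mult[symmetric] of_real_add[symmetric] using vec2_power2_sum[of x] by (simp add: power2_eq_square)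
    have i2: "i = 1 \<or> i = 2" by (rule exhaust_2)
    have ax: "axis 1 1 $ 1 = (1::real)" "axis 1 1 $ (2::2) = (0::real)" "axis (2::2) 1 $ 1 = (0::real)"
      "axis (2::2) 1 $ 2 = (1::real)" "axis j 1 \<bullet> x = x $ j" for j
      by (simp_all add: axis_def) (simp add: axis_def[symmetric] inner_axis')
    have "((of_real (axis i 1 $ 1) + \<i> * of_real (axis i 1 $ 2)) * of_real ?r - z * of_real ((axis i 1 \<bullet> x) / ?r)) * of_real ?r
        = \<i> * z * ahat i x * of_real ?r"
      using i2
    proof
      assume i: "i = 1"
      show ?thesis using r unfolding i by (simp add: ax ahat_def z_def left_diff_distrib rx mult.assoc)
          (simp add: algebra_simps)
    next
      assume i: "i = 2"
      show ?thesis using r unfolding i by (simp add: ax ahat_def z_def left_diff_distrib rx mult.assoc)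
          (simp add: algebra_simps rx)
    qed
    then show ?thesis using r by simp
  qed
  show ?thesis unfolding D key using e r by (simp add: field_simps)
qed

lemma partial_deriv_mode:
  assumes p: "(p has_vector_derivative p') (at (norm x))" and x: "x \<noteq> 0"
  shows "mode p n differentiable (at x)"
    and "partial_deriv i (mode p n) x = (p' * rhat i x + \<i> * of_int n * p (norm x) / of_real (norm x) * ahat i x) * emode n x"
proof -
  have d1: "(\<lambda>x. p (norm x)) differentiable (at x)" by (rule partial_deriv_radial(1)[OF p x])
  have "Ck_on (Suc 0) {x. x \<noteq> 0} (emode n)" by (rule Ck_on_emode)
  then have d2: "emode n differentiable (at x)" using x by simp
  show "mode p n differentiable (at x)" unfolding mode_def[abs_def] using d1 d2 by (rule differentiable_mult)
  show "partial_deriv i (mode p n) x = (p' * rhat i x + \<i> * of_int n * p (norm x) / of_real (norm x) * ahat i x) * emode n x"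
    unfolding mode_def[abs_def] partial_deriv_mult[OF d1 d2] partial_deriv_emode[OF x] partial_deriv_radial(2)[OF p x]
    by (simp add: rhat_def divide_inverse algebra_simps)
qed

lemma partial_deriv_mode_vfield:
  assumes "(p has_vector_derivative p' (norm x)) (at (norm x))" "x \<noteq> 0"
  shows "partial_deriv i (mode p n) x = vfield p' (\<lambda>r. \<i> * of_int n * p r / of_real r) n i x"
  using partial_deriv_mode(2)[OF assms] by (simp add: vfield_def)

lemma norm_vfield_le:
  assumes "x \<noteq> 0"
  shows "cmod (vfield a b n i x) \<le> cmod (a (norm x)) + cmod (b (norm x))"
proof -
  have "cmod (vfield a b n i x) = cmod (a (norm x) * rhat i x + b (norm x) * ahat i x)"
    by (simp add: vfield_def norm_mult norm_emode[OF assms])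
  also have "\<dots> \<le> cmod (a (norm x)) * cmod (rhat i x) + cmod (b (norm x)) * cmod (ahat i x)"
    unfolding norm_mult[symmetric] by (rule norm_triangle_ineq)
  also have "\<dots> \<le> cmod (a (norm x)) * 1 + cmod (b (norm x)) * 1"
    by (intro add_mono mult_left_mono norm_rhat_le norm_ahat_le) auto
  finally show ?thesis by simp
qed

lemma continuous_on_vfield:
  assumes "continuous_on T a" "continuous_on T b" "\<And>x. x \<in> S \<Longrightarrow> norm x \<in> T \<and> x \<noteq> 0"
  shows "continuous_on S (vfield a b n i)"
proof -
  have "continuous_on S (rhat i)" "continuous_on S (ahat i)" "continuous_on S (emode n)"
    using assms(3) by (auto intro!: continuous_on_subset[OF Ck_on_continuous[OF Ck_on_rhat[of 0]]]
       continuous_on_subset[OF Ck_on_continuous[OF Ck_on_ahat[of 0]]] continuous_on_emode)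
  then show ?thesis unfolding vfield_def[abs_def]
    using assms by (intro continuous_intros continuous_on_compose2[OF assms(1)] continuous_on_compose2[OF assms(2)]) auto
qed

lemma continuous_on_mode:
  assumes "continuous_on T p" "\<And>x. x \<in> S \<Longrightarrow> norm x \<in> T \<and> x \<noteq> 0"
  shows "continuous_on S (mode p n)"
  unfolding mode_def[abs_def] using assms
  by (intro continuous_intros continuous_on_compose2[OF assms(1)] continuous_on_emode) auto

lemma Ck_line_bessel_sol:
  assumes p: "bessel_sol k R0 n p p'" and R0: "0 < R0"
  shows "Ck_line m {R0<..} p" "Ck_line m {R0<..} p'"
proof -
  note pD = bessel_solD[OF p]
  have inv: "Ck_line m {R0<..} (\<lambda>r. inverse (of_real r))" for m using R0 by (intro Ck_line_inverse) auto
  have "Ck_line m {R0<..} p \<and> Ck_line m {R0<..} p'" for m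
  proof (induction m)
    case 0
    show ?case using pD(1,2) by (auto intro: continuous_on_subset)
  next
    case (Suc m)
    have "Ck_line m {R0<..} (\<lambda>r. - (p' r * inverse (of_real r)) - (of_real k ^ 2 - of_int n ^ 2 * inverse (of_real r) ^ 2) * p r)"
      using Suc by (intro Ck_line_diff Ck_line_minus Ck_line_mult Ck_line_power Ck_line_const inv) auto
    then have "Ck_line m {R0<..} (bessel_rhs k n p p')"
      by (simp add: bessel_rhs_def[abs_def] divide_inverse power_inverse)
    then show ?case unfolding Ck_line.simps using Suc pD(3,4) by (meson greaterThan_iff)
  qed
  then show "Ck_line m {R0<..} p" "Ck_line m {R0<..} p'" by auto
qed

section \<open>Integral identities for weak solutions\<close>

lemma pairing_tends_to_zero:
  fixes f :: "nat \<Rightarrow> 'a \<Rightarrow> complex"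
  assumes fin: "finite_measure M"
    and m: "\<And>j. f j \<in> borel_measurable M" and i: "\<And>j. integrable M (\<lambda>x. (norm (f j x))\<^sup>2)"
    and lim: "(\<lambda>j. LINT x|M. (norm (f j x))\<^sup>2) \<longlonglongrightarrow> 0"
    and g: "g \<in> borel_measurable M" "\<And>x. x \<in> space M \<Longrightarrow> norm (g x) \<le> B"
  shows "(\<lambda>j. LINT x|M. f j x * g x) \<longlonglongrightarrow> 0"
proof -
  interpret finite_measure M by (rule fin)
  define a where "a j = (LINT x|M. (norm (f j x))\<^sup>2)" for j
  define t where "t j = sqrt (a j) + 1 / real (Suc j)" for j
  define C where "C = \<bar>B\<bar>"
  have a0: "a j \<ge> 0" for j by (simp add: a_def)
  have tp: "t j > 0" for j using a0[of j] by (simp add: t_def add_nonneg_pos)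
  have at: "a j \<le> t j * t j" for j
  proof -
    have "sqrt (a j) * sqrt (a j) \<le> t j * t j" unfolding t_def by (intro mult_mono) (use a0[of j] in auto)
    then show ?thesis using a0[of j] by simp
  qed
  have bnd: "norm (LINT x|M. f j x * g x) \<le> C * (t j * (measure M (space M) + 1))" for j
  proof -
    have pt: "norm (f j x) \<le> t j + (norm (f j x))\<^sup>2 / t j" for x
    proof (cases "norm (f j x) \<le> t j")
      case True
      moreover have "0 \<le> (norm (f j x))\<^sup>2 / t j" using tp[of j] by simp
      ultimately show ?thesis by linarith
    next
      case False
      then have "norm (f j x) * t j \<le> norm (f j x) * norm (f j x)" by (intro mult_left_mono) auto
      then have "norm (f j x) \<le> (norm (f j x))\<^sup>2 / t j" using tp[of j] by (simp add: field_simps power2_eq_square)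
      then show ?thesis using tp[of j] by linarith
    qed
    have I: "integrable M (\<lambda>x. t j + (norm (f j x))\<^sup>2 / t j)" using i[of j] by (intro Bochner_Integration.integrable_add) auto
    have If: "integrable M (f j)"
      by (rule Bochner_Integration.integrable_bound[OF I m]) (intro AE_I2, rule order_trans[OF pt], simp)
    have "norm (LINT x|M. f j x * g x) \<le> (LINT x|M. norm (f j x * g x))" by (rule integral_norm_bound)
    also have "\<dots> \<le> (LINT x|M. C * (t j + (norm (f j x))\<^sup>2 / t j))"
    proof (rule integral_mono)
      show "integrable M (\<lambda>x. norm (f j x * g x))"
        by (intro integrable_norm integrable_mult_bounded[OF If g])
      show "integrable M (\<lambda>x. C * (t j + (norm (f j x))\<^sup>2 / t j))" using I by (rule integrable_mult_right)
      fix x assume "x \<in> space M"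
      then have "norm (g x) \<le> C" using g(2) by (fastforce simp: C_def)
      then have "norm (f j x) * norm (g x) \<le> (t j + (norm (f j x))\<^sup>2 / t j) * C"
        using pt[of x] by (intro mult_mono) (auto intro: order_trans[OF norm_ge_zero])
      then show "norm (f j x * g x) \<le> C * (t j + (norm (f j x))\<^sup>2 / t j)" by (simp add: norm_mult mult.commute)
    qed
    also have "\<dots> = C * (t j * measure M (space M) + a j / t j)"
      using i[of j] by (simp add: a_def mult.commute)
    also have "\<dots> \<le> C * (t j * measure M (space M) + t j)"
      using at[of j] tp[of j] by (intro mult_left_mono add_left_mono) (simp_all add: C_def field_simps)
    finally show ?thesis by (simp add: algebra_simps)
  qed
  have "(\<lambda>j. C * (t j * (measure M (space M) + 1))) \<longlonglongrightarrow> C * (0 * (measure M (space M) + 1))"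
  proof (intro tendsto_mult tendsto_const)
    have "(\<lambda>j. sqrt (a j) + 1 / real (Suc j)) \<longlonglongrightarrow> sqrt 0 + 0"
      using lim LIMSEQ_Suc[OF lim_1_over_n] unfolding a_def by (intro tendsto_add tendsto_real_sqrt) auto
    then show "t \<longlonglongrightarrow> 0" by (simp add: t_def[abs_def])
  qed
  then have lim0: "(\<lambda>j. C * (t j * (measure M (space M) + 1))) \<longlonglongrightarrow> 0" by simp
  show ?thesis by (rule Lim_null_comparison[OF always_eventually[OF allI[OF bnd]] lim0])
qed

text \<open>The divergence of the field \<open>vfield a b n\<close>.\<close>

definition vdiv :: "(real \<Rightarrow> complex) \<Rightarrow> (real \<Rightarrow> complex) \<Rightarrow> (real \<Rightarrow> complex) \<Rightarrow> int \<Rightarrow> real^2 \<Rightarrow> complex" where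
  "vdiv a a' b n x = (a' (norm x) + a (norm x) / of_real (norm x) + \<i> * of_int n * b (norm x) / of_real (norm x)) * emode n x"

lemma continuous_on_vdiv:
  assumes "continuous_on T a" "continuous_on T a'" "continuous_on T b" "\<And>x. x \<in> S \<Longrightarrow> norm x \<in> T \<and> x \<noteq> 0"
  shows "continuous_on S (vdiv a a' b n)"
  unfolding vdiv_def[abs_def]
  using assms(4) by (intro continuous_intros continuous_on_compose2[OF assms(1)] continuous_on_compose2[OF assms(2)]
      continuous_on_compose2[OF assms(3)] continuous_on_emode) auto

text \<open>In polar coordinates the integrand is \<open>1/r\<close> times the sum of the radial derivative of \<open>r v a e\<^sup>i\<^sup>n\<^sup>\<omega>\<close> and the
  angular derivative of \<open>v b e\<^sup>i\<^sup>n\<^sup>\<omega>\<close>; the latter has integral zero over a period.\<close>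

lemma green_mode_field:
  fixes v :: "real^2 \<Rightarrow> complex"
  assumes R: "0 < R0" "R0 \<le> R" and U: "closed_annulus R0 R \<subseteq> U" and v: "Ck_on 1 U v"
    and a: "continuous_on {R0..R} a" "continuous_on {R0..R} a'" "\<And>r. R0 < r \<Longrightarrow> r < R \<Longrightarrow> (a has_vector_derivative a' r) (at r)"
    and b: "continuous_on {R0..R} b"
  shows "(LINT x|lebesgue_on (annulus R0 R). (\<Sum>i\<in>UNIV. partial_deriv i v x * vfield a b n i x) + v x * vdiv a a' b n x)
    = of_real R * a R * integral {0..2 * pi} (\<lambda>\<omega>. v (polar R \<omega>) * exp (\<i> * of_int n * of_real \<omega>))
     - of_real R0 * a R0 * integral {0..2 * pi} (\<lambda>\<omega>. v (polar R0 \<omega>) * exp (\<i> * of_int n * of_real \<omega>))"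
proof -
  let ?C = "closed_annulus R0 R" and ?e = "\<lambda>\<omega>. exp (\<i> * of_int n * of_real \<omega>)"
  let ?F = "\<lambda>x. (\<Sum>i\<in>UNIV. partial_deriv i v x * vfield a b n i x) + v x * vdiv a a' b n x"
  have CT: "norm x \<in> {R0..R} \<and> x \<noteq> 0" if "x \<in> ?C" for x using that R by (auto simp: closed_annulus_def)
  have cv: "continuous_on ?C v" "continuous_on ?C (partial_deriv i v)" for i
    using v Ck_on_continuous[OF v] U by (auto intro: continuous_on_subset)
  have cF: "continuous_on ?C ?F"
    by (intro continuous_intros cv continuous_on_vfield[OF a(1) b CT] continuous_on_vdiv[OF a(1,2) b CT])
  have polC: "polar r \<omega> \<in> ?C" if "r \<in> {R0..R}" for r \<omega> using that R by (auto simp: closed_annulus_def)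
  have dv: "v differentiable (at (polar r \<omega>))" if "r \<in> {R0..R}" for r \<omega>
    using v polC[OF that] U by auto
  define vr where "vr r \<omega> = of_real (cos \<omega>) * partial_deriv 1 v (polar r \<omega>) + of_real (sin \<omega>) * partial_deriv 2 v (polar r \<omega>)" for r \<omega>
  define vw where "vw r \<omega> = of_real (- r * sin \<omega>) * partial_deriv 1 v (polar r \<omega>) + of_real (r * cos \<omega>) * partial_deriv 2 v (polar r \<omega>)" for r \<omega>
  define f1 where "f1 r \<omega> = (of_real r * a r * vr r \<omega> + (of_real r * a' r + 1 * a r) * v (polar r \<omega>)) * ?e \<omega>" for r \<omega>
  define f2 where "f2 r \<omega> = b r * (v (polar r \<omega>) * (?e \<omega> * (\<i> * of_int n)) + vw r \<omega> * ?e \<omega>)" for r \<omega>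
  have split: "of_real r * ?F (polar r \<omega>) = f1 r \<omega> + f2 r \<omega>" if r: "r \<in> {R0..R}" for r \<omega>
  proof -
    have r0: "r > 0" using r R by auto
    then have rn: "complex_of_real r \<noteq> 0" by simp
    have nr: "norm (polar r \<omega>) = r" using r0 by simp
    show ?thesis unfolding sum_2 vfield_def vdiv_def nr rhat_polar[OF r0] ahat_polar[OF r0] emode_polar[OF r0] f1_def f2_def vr_def vw_def
      using rn by (simp add: field_simps)
  qed
  have cp: "continuous_on (cbox (R0, 0) (R, 2 * pi)) (\<lambda>z. g (polar (fst z) (snd z)))" if "continuous_on ?C g" for g :: "real^2 \<Rightarrow> complex"
    using polC by (intro continuous_on_compose2[OF that] continuous_intros) (auto simp: cbox_Pair_eq)
  have cr: "continuous_on (cbox (R0, 0) (R, 2 * pi)) (\<lambda>z. g (fst z))" if "continuous_on {R0..R} g" for g :: "real \<Rightarrow> complex"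
    by (intro continuous_on_compose2[OF that] continuous_intros) (auto simp: cbox_Pair_eq)
  have cf1: "continuous_on (cbox (R0, 0) (R, 2 * pi)) (\<lambda>(r, \<omega>). f1 r \<omega>)"
    unfolding f1_def vr_def split_beta by (intro continuous_intros cp cr cv a)
  have cf2: "continuous_on (cbox (R0, 0) (R, 2 * pi)) (\<lambda>(r, \<omega>). f2 r \<omega>)"
    unfolding f2_def vw_def split_beta by (intro continuous_intros cp cr cv b)
  have slice: "continuous_on {0..2 * pi} (\<lambda>\<omega>. g r \<omega>)" if "continuous_on (cbox (R0, 0) (R, 2 * pi)) (\<lambda>(r, \<omega>). g r \<omega>)" "r \<in> {R0..R}"
    for g :: "real \<Rightarrow> real \<Rightarrow> complex" and r
  proof -
    have "continuous_on {0..2 * pi} (\<lambda>\<omega>. (\<lambda>(r, \<omega>). g r \<omega>) (r, \<omega>))"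
      using that(2) by (intro continuous_on_compose2[OF that(1)] continuous_intros) (auto simp: cbox_Pair_eq)
    then show ?thesis by simp
  qed
  have de: "(?e has_vector_derivative ?e \<omega> * (\<i> * of_int n)) (at \<omega>)" for \<omega> :: real
  proof -
    have "((\<lambda>z. exp (\<i> * of_int n * z)) has_field_derivative exp (\<i> * of_int n * of_real \<omega>) * (\<i> * of_int n)) (at (of_real \<omega>))"
      by (auto intro!: derivative_eq_intros)
    from has_vector_derivative_real_field[OF this] show ?thesis .
  qed
  have int2: "integral {0..2 * pi} (f2 r) = 0" if r: "r \<in> {R0..R}" for r
  proof -
    have D: "((\<lambda>\<omega>. b r * (v (polar r \<omega>) * ?e \<omega>)) has_vector_derivative f2 r \<omega>) (at \<omega>)" for \<omega>
      unfolding f2_def vw_def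
      by (intro has_vector_derivative_mult_right has_vector_derivative_mult de has_vector_derivative_polar_angular dv r)
    have "(f2 r has_integral b r * (v (polar r (2 * pi)) * ?e (2 * pi)) - b r * (v (polar r 0) * ?e 0)) {0..2 * pi}"
      by (rule fundamental_theorem_of_calculus[OF _ has_vector_derivative_at_within[OF D]]) simp
    moreover have "?e (2 * pi) = 1" using exp_integer_2pi[of "of_int n"] by (simp add: mult_ac)
    moreover have "polar r (2 * pi) = polar r 0" by (simp add: vec2_eq_iff)
    ultimately show ?thesis by (simp add: integral_unique)
  qed
  have int1: "integral {R0..R} (\<lambda>r. f1 r \<omega>) = of_real R * a R * v (polar R \<omega>) * ?e \<omega> - of_real R0 * a R0 * v (polar R0 \<omega>) * ?e \<omega>" for \<omega>
  proof -
    have "((\<lambda>r. f1 r \<omega>) has_integral of_real R * a R * v (polar R \<omega>) * ?e \<omega> - of_real R0 * a R0 * v (polar R0 \<omega>) * ?e \<omega>) {R0..R}"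
    proof (rule fundamental_theorem_of_calculus_interior[OF R(2)])
      show "continuous_on {R0..R} (\<lambda>r. of_real r * a r * v (polar r \<omega>) * ?e \<omega>)"
        using polC by (intro continuous_intros a continuous_on_compose2[OF cv(1)]) auto
      fix r assume r: "r \<in> {R0<..<R}"
      have "((\<lambda>r. of_real r * a r * v (polar r \<omega>) * ?e \<omega>) has_vector_derivative
          (of_real r * a r * (of_real (cos \<omega>) * partial_deriv 1 v (polar r \<omega>) + of_real (sin \<omega>) * partial_deriv 2 v (polar r \<omega>))
            + (of_real r * a' r + 1 * a r) * v (polar r \<omega>)) * ?e \<omega>) (at r)"
        using r by (intro has_vector_derivative_mult_left has_vector_derivative_mult has_vector_derivative_complex_of_real
            has_vector_derivative_polar_radial a(3) dv) auto
      then show "((\<lambda>r. of_real r * a r * v (polar r \<omega>) * ?e \<omega>) has_vector_derivative f1 r \<omega>) (at r)"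
        by (simp add: f1_def vr_def)
    qed
    then show ?thesis by (rule integral_unique)
  qed
  have "(LINT x|lebesgue_on (annulus R0 R). ?F x) = integral {R0..R} (\<lambda>r. integral {0..2 * pi} (\<lambda>\<omega>. of_real r * ?F (polar r \<omega>)))"
    by (rule integral_annulus_polar(2)[OF R(1) cF])
  also have "\<dots> = integral {R0..R} (\<lambda>r. integral {0..2 * pi} (f1 r))"
  proof (rule integral_cong)
    fix r assume r: "r \<in> {R0..R}"
    have "integral {0..2 * pi} (\<lambda>\<omega>. of_real r * ?F (polar r \<omega>)) = integral {0..2 * pi} (\<lambda>\<omega>. f1 r \<omega> + f2 r \<omega>)"
      unfolding split[OF r] ..
    also have "\<dots> = integral {0..2 * pi} (f1 r) + integral {0..2 * pi} (f2 r)"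
      by (intro Henstock_Kurzweil_Integration.integral_add integrable_continuous_real slice[OF cf1 r] slice[OF cf2 r])
    finally show "integral {0..2 * pi} (\<lambda>\<omega>. of_real r * ?F (polar r \<omega>)) = integral {0..2 * pi} (f1 r)"
      unfolding int2[OF r] by simp
  qed
  also have "\<dots> = integral {0..2 * pi} (\<lambda>\<omega>. integral {R0..R} (\<lambda>r. f1 r \<omega>))"
    using integral_swap_continuous[OF cf1] by (simp add: cbox_interval)
  also have "\<dots> = integral {0..2 * pi} (\<lambda>\<omega>. of_real R * a R * (v (polar R \<omega>) * ?e \<omega>) - of_real R0 * a R0 * (v (polar R0 \<omega>) * ?e \<omega>))"
    unfolding int1 by (simp only: mult.assoc)
  also have "\<dots> = integral {0..2 * pi} (\<lambda>\<omega>. of_real R * a R * (v (polar R \<omega>) * ?e \<omega>))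
      - integral {0..2 * pi} (\<lambda>\<omega>. of_real R0 * a R0 * (v (polar R0 \<omega>) * ?e \<omega>))"
    using polC R by (intro Henstock_Kurzweil_Integration.integral_diff integrable_continuous_real continuous_intros continuous_on_compose2[OF cv(1)]) auto
  finally show ?thesis by (simp only: integral_mult_right)
qed

lemma finite_measure_annulus: "finite_measure (lebesgue_on (annulus R0 R))"
  by (rule finite_measure_lebesgue_on[OF annulus_lmeasurable])

lemma bounded_measurable_annulus:
  fixes g :: "real^2 \<Rightarrow> complex"
  assumes "continuous_on (closed_annulus R0 R) g"
  obtains B where "g \<in> borel_measurable (lebesgue_on (annulus R0 R))" "\<And>x. x \<in> annulus R0 R \<Longrightarrow> norm (g x) \<le> B"
proof -
  have "compact (g ` closed_annulus R0 R)" by (rule compact_continuous_image[OF assms compact_closed_annulus])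
  then obtain B where "\<And>x. x \<in> closed_annulus R0 R \<Longrightarrow> norm (g x) \<le> B" using compact_imp_bounded by (force simp: bounded_iff)
  then have "norm (g x) \<le> B" if "x \<in> annulus R0 R" for x using that annulus_subset_closed_annulus by blast
  moreover have "g \<in> borel_measurable (lebesgue_on (annulus R0 R))"
    by (rule continuous_imp_measurable_on_sets_lebesgue[OF continuous_on_subset[OF assms annulus_subset_closed_annulus] annulus_sets])
  ultimately show ?thesis by (rule that[rotated])
qed

lemma L2_I:
  assumes "f \<in> borel_measurable (lebesgue_on (annulus R0 R))" "\<And>x. x \<in> annulus R0 R \<Longrightarrow> norm (f x) \<le> B"
  shows "f \<in> L2 (annulus R0 R)"
proof -
  interpret finite_measure "lebesgue_on (annulus R0 R)" by (rule finite_measure_annulus)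
  have "integrable (lebesgue_on (annulus R0 R)) (\<lambda>x. (norm (f x))\<^sup>2)"
  proof (rule integrable_const_bound[where B="B\<^sup>2"])
    show "AE x in lebesgue_on (annulus R0 R). norm ((norm (f x))\<^sup>2) \<le> B\<^sup>2"
      by (intro AE_I2) (use assms(2) in \<open>auto intro!: power_mono\<close>)
  qed (use assms(1) in measurable)
  then show ?thesis using assms(1) by (simp add: L2_def)
qed

lemma integrable_L2_mult_bounded:
  assumes "f \<in> L2 (annulus R0 R)" "continuous_on (closed_annulus R0 R) g"
  shows "integrable (lebesgue_on (annulus R0 R)) (\<lambda>x. f x * g x)"
proof -
  obtain B where "g \<in> borel_measurable (lebesgue_on (annulus R0 R))" "\<And>x. x \<in> annulus R0 R \<Longrightarrow> norm (g x) \<le> B"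
    by (rule bounded_measurable_annulus[OF assms(2)]) blast
  then show ?thesis
    by (intro integrable_mult_bounded[where C=B] L2_imp_integrable[OF assms(1) annulus_lmeasurable]) auto
qed

text \<open>The trace is defined by approximation with functions smooth up to the boundary, to which the
  divergence theorem applies. Nothing is known about their boundary values on the outer circle, which is
  why the field must have no radial component there.\<close>

lemma green_trace:
  assumes R: "0 < R0" "R0 < R" and u: "u \<in> H1 (annulus R0 R)"
    and G: "has_weak_grad (annulus R0 R) u G" "\<And>i. (\<lambda>x. G x $ i) \<in> L2 (annulus R0 R)"
    and tr: "has_trace_on_circle (annulus R0 R) R0 u f" and f: "continuous_on {0..2 * pi} f"
    and a: "continuous_on {R0..R} a" "continuous_on {R0..R} a'" "\<And>r. R0 < r \<Longrightarrow> r < R \<Longrightarrow> (a has_vector_derivative a' r) (at r)"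
    and b: "continuous_on {R0..R} b" and aR: "a R = 0"
  shows "(LINT x|lebesgue_on (annulus R0 R). (\<Sum>i\<in>UNIV. G x $ i * vfield a b n i x) + u x * vdiv a a' b n x)
    = - (of_real R0 * a R0 * integral {0..2 * pi} (\<lambda>\<omega>. f \<omega> * exp (\<i> * of_int n * of_real \<omega>)))"
proof -
  let ?O = "annulus R0 R" and ?C = "closed_annulus R0 R" and ?e = "\<lambda>\<omega>. exp (\<i> * of_int n * of_real \<omega>)"
  let ?M = "lebesgue_on ?O" and ?I = "lebesgue_on {0..2 * pi}"
  obtain v where v: "\<And>j. v j \<in> H1 ?O" "\<And>j. \<exists>U. closure ?O \<subseteq> U \<and> smooth_on_open U (v j)"
    and vu: "(\<lambda>j. H1_norm ?O (\<lambda>x. v j x - u x)) \<longlonglongrightarrow> 0"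
    and vf: "(\<lambda>j. LINT \<omega>|?I. (norm (v j (polar R0 \<omega>) - f \<omega>))\<^sup>2) \<longlonglongrightarrow> 0"
    using tr unfolding has_trace_on_circle_def by blast
  have clo: "?C \<subseteq> closure ?O"
  proof
    fix x assume x: "x \<in> ?C"
    then have xn: "x \<noteq> 0" "R0 \<le> norm x" "norm x \<le> R" using R by (auto simp: closed_annulus_def)
    define m where "m = (R0 + R) / 2"
    define s where "s j = norm x + (m - norm x) / real (Suc (Suc j))" for j
    have "(\<lambda>j. (m - norm x) / real (Suc (Suc j))) \<longlonglongrightarrow> 0"
      by (intro LIMSEQ_Suc[OF LIMSEQ_Suc[OF lim_const_over_n]])
    then have "s \<longlonglongrightarrow> norm x + 0" unfolding s_def[abs_def] by (intro tendsto_intros)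
    then have "(\<lambda>j. (s j / norm x) *\<^sub>R x) \<longlonglongrightarrow> ((norm x + 0) / norm x) *\<^sub>R x"
      using xn by (intro tendsto_intros) auto
    then have lim: "(\<lambda>j. (s j / norm x) *\<^sub>R x) \<longlonglongrightarrow> x" using xn by simp
    have "(s j / norm x) *\<^sub>R x \<in> ?O" for j
    proof -
      define t where "t = 1 / real (Suc (Suc j))"
      have t: "0 < t" "t < 1" by (auto simp: t_def)
      have sj: "s j = (1 - t) * norm x + t * m" by (simp add: s_def t_def algebra_simps diff_divide_distrib)
      have "(1 - t) * R0 + t * R0 < (1 - t) * norm x + t * m"
        using t xn R by (intro add_le_less_mono mult_left_mono mult_strict_left_mono) (auto simp: m_def)
      moreover have "(1 - t) * norm x + t * m < (1 - t) * R + t * R"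
        using t xn R by (intro add_le_less_mono mult_left_mono mult_strict_left_mono) (auto simp: m_def)
      ultimately have "R0 < s j" "s j < R" unfolding sj by (simp_all add: algebra_simps)
      then show ?thesis using xn R by simp
    qed
    then show "x \<in> closure ?O" using lim unfolding closure_sequential
      by (intro exI[of _ "\<lambda>j. (s j / norm x) *\<^sub>R x"] conjI allI)
  qed
  have C1: "Ck_on 1 ?C (v j)" for j
  proof -
    obtain U where U: "closure ?O \<subseteq> U" "smooth_on_open U (v j)" using v(2)[of j] by blast
    have "Ck_on 1 U (v j)" using U(2) unfolding smooth_on_open_def by blast
    then show ?thesis by (rule Ck_on_subset) (use clo U(1) in blast)
  qed
  have C1O: "Ck_on 1 ?O (v j)" for j by (rule Ck_on_subset[OF C1 annulus_subset_closed_annulus])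
  have CT: "norm x \<in> {R0..R} \<and> x \<noteq> 0" if "x \<in> ?C" for x using that R by (auto simp: closed_annulus_def)
  have cV: "continuous_on ?C (vfield a b n i)" "continuous_on ?C (vdiv a a' b n)" for i
    by (rule continuous_on_vfield[OF a(1) b CT], assumption, rule continuous_on_vdiv[OF a(1,2) b CT], assumption)
  have cv: "continuous_on ?C (v j)" "continuous_on ?C (partial_deriv i (v j))" for i j
    using C1[of j] Ck_on_continuous[OF C1[of j]] by auto
  have L2v: "v j \<in> L2 ?O" "partial_deriv i (v j) \<in> L2 ?O" for i j
    by (rule bounded_measurable_annulus[OF cv(1)[of j]], rule L2_I, assumption, blast)
       (rule bounded_measurable_annulus[OF cv(2)[of i j]], rule L2_I, assumption, blast)
  have L2u: "u \<in> L2 ?O" using u by (simp add: H1_def)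
  have wg: "has_weak_grad ?O (\<lambda>x. v j x - u x) (\<lambda>x. (\<chi> i. partial_deriv i (v j) x) - G x)" for j
    by (intro has_weak_grad_diff open_annulus has_weak_grad_classical C1O G)
  define A where "A j = (LINT x|?M. (norm (v j x - u x))\<^sup>2)" for j
  define B where "B j i = (LINT x|?M. (norm (partial_deriv i (v j) x - G x $ i))\<^sup>2)" for j i
  have iB: "integrable ?M (\<lambda>x. (norm (partial_deriv i (v j) x - G x $ i))\<^sup>2)" "integrable ?M (\<lambda>x. (norm (v j x - u x))\<^sup>2)" for i j
    using L2_diff[OF L2v(2) G(2)] L2_diff[OF L2v(1) L2u] by (auto simp: L2_def)
  have sq: "(H1_norm ?O (\<lambda>x. v j x - u x))\<^sup>2 = A j + (B j 1 + B j 2)" for j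
  proof -
    have "(LINT x|?M. (norm ((\<chi> i. partial_deriv i (v j) x) - G x))\<^sup>2) = B j 1 + B j 2"
      unfolding norm_vec_power2 sum_2 B_def using iB(1) by (simp add: Bochner_Integration.integral_add)
    moreover have "A j \<ge> 0" "B j 1 \<ge> 0" "B j 2 \<ge> 0" by (simp_all add: A_def B_def)
    ultimately show ?thesis unfolding H1_norm_eq[OF open_annulus wg] A_def[symmetric] by simp
  qed
  have "(\<lambda>j. (H1_norm ?O (\<lambda>x. v j x - u x))\<^sup>2) \<longlonglongrightarrow> 0\<^sup>2" by (rule tendsto_power[OF vu])
  then have lim: "(\<lambda>j. A j + (B j 1 + B j 2)) \<longlonglongrightarrow> 0" unfolding sq by simp
  have nn: "A j \<ge> 0" "B j i \<ge> 0" for i j by (simp_all add: A_def B_def)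
  have A0: "A \<longlonglongrightarrow> 0"
    by (rule tendsto_sandwich[OF _ _ tendsto_const lim]) (use nn in \<open>auto intro!: always_eventually\<close>)
  have B0: "(\<lambda>j. B j i) \<longlonglongrightarrow> 0" for i
  proof (rule tendsto_sandwich[OF _ _ tendsto_const lim])
    show "\<forall>\<^sub>F j in sequentially. B j i \<le> A j + (B j 1 + B j 2)"
      using exhaust_2[of i] nn by (intro always_eventually allI) (auto intro: add_increasing add_increasing2)
  qed (use nn in auto)
  have limV: "(\<lambda>j. LINT x|?M. (partial_deriv i (v j) x - G x $ i) * vfield a b n i x) \<longlonglongrightarrow> 0" for i
  proof (rule bounded_measurable_annulus[OF cV(1)[of i]])
    fix K assume "vfield a b n i \<in> borel_measurable ?M" "\<And>x. x \<in> ?O \<Longrightarrow> cmod (vfield a b n i x) \<le> K"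
    then show ?thesis
      using L2_diff[OF L2v(2) G(2)] B0[of i] iB(1)
      by (intro pairing_tends_to_zero[OF finite_measure_annulus, where B=K]) (auto simp: B_def L2_def)
  qed
  have limD: "(\<lambda>j. LINT x|?M. (v j x - u x) * vdiv a a' b n x) \<longlonglongrightarrow> 0"
  proof (rule bounded_measurable_annulus[OF cV(2)])
    fix K assume "vdiv a a' b n \<in> borel_measurable ?M" "\<And>x. x \<in> ?O \<Longrightarrow> cmod (vdiv a a' b n x) \<le> K"
    then show ?thesis
      using L2_diff[OF L2v(1) L2u] A0 iB(2)
      by (intro pairing_tends_to_zero[OF finite_measure_annulus, where B=K]) (auto simp: A_def[abs_def] L2_def)
  qed
  let ?X = "\<lambda>G u. (LINT x|?M. (\<Sum>i\<in>UNIV. G i x * vfield a b n i x) + u x * vdiv a a' b n x)"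
  have Xdiff: "?X (\<lambda>i. partial_deriv i (v j)) (v j) - ?X (\<lambda>i x. G x $ i) u
     = (LINT x|?M. (partial_deriv 1 (v j) x - G x $ 1) * vfield a b n 1 x) + (LINT x|?M. (partial_deriv 2 (v j) x - G x $ 2) * vfield a b n 2 x)
      + (LINT x|?M. (v j x - u x) * vdiv a a' b n x)" for j
    unfolding sum_2 left_diff_distrib
    using integrable_L2_mult_bounded[OF L2v(2) cV(1)] integrable_L2_mult_bounded[OF L2v(1) cV(2)]
      integrable_L2_mult_bounded[OF G(2) cV(1)] integrable_L2_mult_bounded[OF L2u cV(2)]
    by simp
  have "(\<lambda>j. ?X (\<lambda>i. partial_deriv i (v j)) (v j) - ?X (\<lambda>i x. G x $ i) u) \<longlonglongrightarrow> 0 + 0 + 0"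
    unfolding Xdiff by (intro tendsto_add limV limD)
  then have lim1: "(\<lambda>j. ?X (\<lambda>i. partial_deriv i (v j)) (v j)) \<longlonglongrightarrow> ?X (\<lambda>i x. G x $ i) u"
    by (simp add: LIM_zero_iff)
  have Xv: "?X (\<lambda>i. partial_deriv i (v j)) (v j) = - (of_real R0 * a R0 * integral {0..2 * pi} (\<lambda>\<omega>. v j (polar R0 \<omega>) * ?e \<omega>))" for j
    using green_mode_field[OF R(1) less_imp_le[OF R(2)] order_refl C1 a b, of j n] by (simp add: aR)
  have cw: "continuous_on {0..2 * pi} (\<lambda>\<omega>. v j (polar R0 \<omega>))" for j
    using R by (intro continuous_on_compose2[OF cv(1)] continuous_intros) (auto simp: closed_annulus_def)
  have ce: "continuous_on {0..2 * pi} ?e" by (intro continuous_intros)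
  have LI: "(LINT \<omega>|?I. h \<omega>) = integral {0..2 * pi} h" "integrable ?I h" if "continuous_on {0..2 * pi} h" for h :: "real \<Rightarrow> complex"
    using continuous_imp_integrable_real[OF that] by (auto intro!: lebesgue_integral_eq_integral)
  have "(\<lambda>j. LINT \<omega>|?I. (v j (polar R0 \<omega>) - f \<omega>) * ?e \<omega>) \<longlonglongrightarrow> 0"
  proof (rule pairing_tends_to_zero[where B=1])
    show "finite_measure ?I" by (rule finite_measure_lebesgue_on) simp
    show "(\<lambda>\<omega>. v j (polar R0 \<omega>) - f \<omega>) \<in> borel_measurable ?I" for j
      by (rule borel_measurable_integrable[OF LI(2)]) (intro continuous_intros cw f)
    show "integrable ?I (\<lambda>\<omega>. (cmod (v j (polar R0 \<omega>) - f \<omega>))\<^sup>2)" for j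
      by (rule continuous_imp_integrable_real) (intro continuous_intros cw f)
    show "?e \<in> borel_measurable ?I" by (rule borel_measurable_integrable[OF LI(2)[OF ce]])
    show "cmod (?e \<omega>) \<le> 1" for \<omega> using norm_exp_i_times[of "of_int n * \<omega>"] by (simp add: mult.assoc)
  qed (rule vf)
  moreover have "(LINT \<omega>|?I. (v j (polar R0 \<omega>) - f \<omega>) * ?e \<omega>)
     = integral {0..2 * pi} (\<lambda>\<omega>. v j (polar R0 \<omega>) * ?e \<omega>) - integral {0..2 * pi} (\<lambda>\<omega>. f \<omega> * ?e \<omega>)" for j
    unfolding left_diff_distrib
    by (subst LI(1)) (intro continuous_intros cw f Henstock_Kurzweil_Integration.integral_diff integrable_continuous_real)+
  ultimately have "(\<lambda>j. integral {0..2 * pi} (\<lambda>\<omega>. v j (polar R0 \<omega>) * ?e \<omega>)) \<longlonglongrightarrow> integral {0..2 * pi} (\<lambda>\<omega>. f \<omega> * ?e \<omega>)"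
    by (simp add: LIM_zero_iff)
  then have "(\<lambda>j. ?X (\<lambda>i. partial_deriv i (v j)) (v j)) \<longlonglongrightarrow> - (of_real R0 * a R0 * integral {0..2 * pi} (\<lambda>\<omega>. f \<omega> * ?e \<omega>))"
    unfolding Xv by (intro tendsto_intros)
  from LIMSEQ_unique[OF lim1 this] show ?thesis .
qed

section \<open>Orthogonality of the difference of competitors\<close>

lemma flat_2_bound:
  assumes "0 < s" shows "(s + 1) * flat 2 s \<le> 2" "(s + 1) * flat 2 s \<le> inverse s + inverse s * inverse s"
proof -
  define x where "x = inverse s"
  have x: "x > 0" "s = inverse x" using assms by (simp_all add: x_def)
  have sx: "s * x = 1" using assms by (simp add: x_def)
  have "flat 2 s = x * x * exp (- x)" using assms by (simp add: flat_def x_def power2_eq_square)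
  then have "(s + 1) * flat 2 s = (s * x) * x * exp (- x) + x * x * exp (- x)" by (simp add: distrib_right)
  then have e: "(s + 1) * flat 2 s = (x + x * x) * exp (- x)" unfolding sx by (simp add: distrib_right)
  have "(x + x * x) \<le> 2 * exp x"
    using exp_lower_Taylor_quadratic[of x] x(1) by (simp add: power2_eq_square)
  then have "(x + x * x) * exp (- x) \<le> 2 * exp x * exp (- x)" by (intro mult_right_mono) auto
  also have "2 * exp x * exp (- x) = 2" by (simp only: mult.assoc exp_minus_inverse mult_1_right)
  finally show "(s + 1) * flat 2 s \<le> 2" unfolding e .
  have "(x + x * x) * exp (- x) \<le> (x + x * x) * 1" using x(1) by (intro mult_left_mono) auto
  then show "(s + 1) * flat 2 s \<le> inverse s + inverse s * inverse s" unfolding e by (simp add: x_def)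
qed

definition cutoff_deriv :: "real \<Rightarrow> real \<Rightarrow> nat \<Rightarrow> real \<Rightarrow> real" where
  "cutoff_deriv a b j t = real j * flat 2 (real j * (t - a) - 1) * flat 0 (real j * (b - t) - 1)
     - flat 0 (real j * (t - a) - 1) * (real j * flat 2 (real j * (b - t) - 1))"

lemma cutoff_has_derivative: "(cutoff a b j has_real_derivative cutoff_deriv a b j t) (at t)"
proof -
  have f: "(flat 0 has_real_derivative flat 2 s) (at s)" for s
    using flat_deriv[of 0 s] by (simp add: numeral_2_eq_2)
  have 1: "((\<lambda>t. real j * (t - a) - 1) has_real_derivative real j) (at t)"
    and 2: "((\<lambda>t. real j * (b - t) - 1) has_real_derivative - real j) (at t)"
    by (auto intro!: derivative_eq_intros)
  have "(cutoff a b j has_real_derivative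
      flat 2 (real j * (t - a) - 1) * real j * flat 0 (real j * (b - t) - 1)
      + flat 2 (real j * (b - t) - 1) * (- real j) * flat 0 (real j * (t - a) - 1)) (at t)"
    unfolding cutoff_def[abs_def] by (intro DERIV_mult DERIV_chain2[OF f 1] DERIV_chain2[OF f 2])
  then show ?thesis by (simp add: cutoff_deriv_def algebra_simps)
qed

lemma scaled_flat_2:
  assumes "d > 0"
  shows "real j * d * flat 2 (real j * d - 1) \<le> 2" "(\<lambda>j. real j * d * flat 2 (real j * d - 1)) \<longlonglongrightarrow> 0"
proof -
  show "real j * d * flat 2 (real j * d - 1) \<le> 2"
  proof (cases "real j * d - 1 > 0")
    case True
    then show ?thesis using flat_2_bound(1)[OF True] by simp
  next
    case False
    then show ?thesis by (simp add: flat_def)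
  qed
  have top: "filterlim (\<lambda>j. real j * d - 1) at_top sequentially" by (rule filterlim_const_mult_nat_at_top[OF assms])
  have i: "(\<lambda>j. inverse (real j * d - 1)) \<longlonglongrightarrow> 0" by (rule tendsto_inverse_0_at_top[OF top])
  show "(\<lambda>j. real j * d * flat 2 (real j * d - 1)) \<longlonglongrightarrow> 0"
  proof (rule tendsto_sandwich[OF _ _ tendsto_const])
    show "(\<lambda>j. inverse (real j * d - 1) + inverse (real j * d - 1) * inverse (real j * d - 1)) \<longlonglongrightarrow> 0"
      using tendsto_add[OF i tendsto_mult[OF i i]] by simp
    show "\<forall>\<^sub>F j in sequentially. 0 \<le> real j * d * flat 2 (real j * d - 1)"
      using assms by (intro always_eventually allI mult_nonneg_nonneg flat_nonneg) auto
    show "\<forall>\<^sub>F j in sequentially. real j * d * flat 2 (real j * d - 1) \<le> inverse (real j * d - 1) + inverse (real j * d - 1) * inverse (real j * d - 1)"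
      using filterlim_at_top_dense[THEN iffD1, OF top, rule_format, of 0]
    proof eventually_elim
      case (elim j)
      then show ?case using flat_2_bound(2)[OF elim] by simp
    qed
  qed
qed

text \<open>The mode of \<open>e\<close> extended by zero is only Lipschitz across the boundary and not a test function. It is cut off near
  both circles: the derivative of the cutoff is of the order of the inverse distance to the boundary,
  which the linear vanishing of \<open>e\<close> compensates, so dominated convergence applies.\<close>

lemma weak_helmholtz_vanishing_mode:
  assumes R: "0 < R0" "R0 < R" and h: "h \<in> L2 (annulus R0 R)" and H: "has_weak_grad (annulus R0 R) h H" "\<And>i. (\<lambda>x. H x $ i) \<in> L2 (annulus R0 R)"
    and wh: "weak_helmholtz k (annulus R0 R) h"
    and e: "\<And>m. Ck_line m {R0<..} e" "\<And>r. R0 < r \<Longrightarrow> (e has_vector_derivative e' r) (at r)"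
    and ec: "continuous_on {R0..R} e" "continuous_on {R0..R} e'" and e0: "e R0 = 0" "e R = 0"
  shows "(LINT x|lebesgue_on (annulus R0 R). (\<Sum>i\<in>UNIV. H x $ i * vfield e' (\<lambda>r. \<i> * of_int n * e r / of_real r) n i x)
      - of_real k ^ 2 * (h x * mode e n x)) = 0"
proof -
  let ?O = "annulus R0 R" and ?C = "closed_annulus R0 R"
  let ?M = "lebesgue_on ?O"
  obtain C where C: "\<And>r. r \<in> {R0..R} \<Longrightarrow> cmod (e' r) \<le> C"
    using compact_imp_bounded[OF compact_continuous_image[OF ec(2) compact_Icc]] by (force simp: bounded_iff)
  have C0: "C \<ge> 0" using order_trans[OF norm_ge_zero C[of R0]] R by simp
  have lip: "cmod (e r) \<le> C * (r - R0)" "cmod (e r) \<le> C * (R - r)" if r: "r \<in> {R0..R}" for r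
  proof -
    have "cmod (e r - e R0) \<le> C * (r - R0)"
      by (rule vector_derivative_bound[where f'=e']) (use r C e(2) in \<open>auto intro: continuous_on_subset[OF ec(1)]\<close>)
    then show "cmod (e r) \<le> C * (r - R0)" using e0 by simp
    have "cmod (e R - e r) \<le> C * (R - r)"
      by (rule vector_derivative_bound[where f'=e']) (use r C e(2) in \<open>auto intro: continuous_on_subset[OF ec(1)]\<close>)
    then show "cmod (e r) \<le> C * (R - r)" using e0 by simp
  qed
  define q where "q j r = of_real (cutoff R0 R j r) * e r" for j r
  define q' where "q' j r = of_real (cutoff R0 R j r) * e' r + of_real (cutoff_deriv R0 R j r) * e r" for j r
  have dq: "(q j has_vector_derivative q' j r) (at r)" if "R0 < r" for j r
    unfolding q_def[abs_def] q'_def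
    by (intro has_vector_derivative_mult has_vector_derivative_of_real cutoff_has_derivative e(2) that)
  have cd: "cmod (of_real (cutoff_deriv R0 R j r) * e r) \<le> C * (real j * (r - R0) * flat 2 (real j * (r - R0) - 1)
        + real j * (R - r) * flat 2 (real j * (R - r) - 1))" if r: "r \<in> {R0..R}" for j r
  proof -
    let ?s = "real j * (r - R0) - 1" and ?t = "real j * (R - r) - 1"
    have "\<bar>cutoff_deriv R0 R j r\<bar> \<le> \<bar>real j * flat 2 ?s * flat 0 ?t\<bar> + \<bar>flat 0 ?s * (real j * flat 2 ?t)\<bar>"
      unfolding cutoff_deriv_def by (rule abs_triangle_ineq4)
    also have "\<dots> = real j * flat 2 ?s * flat 0 ?t + flat 0 ?s * (real j * flat 2 ?t)"
      by (simp add: abs_mult flat_nonneg)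
    also have "\<dots> \<le> real j * flat 2 ?s * 1 + 1 * (real j * flat 2 ?t)"
      by (intro add_mono mult_mono flat_le_1 mult_nonneg_nonneg flat_nonneg order_refl) auto
    finally have b: "\<bar>cutoff_deriv R0 R j r\<bar> \<le> real j * flat 2 ?s + real j * flat 2 ?t" by simp
    have "cmod (of_real (cutoff_deriv R0 R j r) * e r) = \<bar>cutoff_deriv R0 R j r\<bar> * cmod (e r)" by (simp add: norm_mult)
    also have "\<dots> \<le> (real j * flat 2 ?s + real j * flat 2 ?t) * cmod (e r)" by (intro mult_right_mono b) auto
    also have "\<dots> = real j * flat 2 ?s * cmod (e r) + real j * flat 2 ?t * cmod (e r)" by (simp add: algebra_simps)
    also have "\<dots> \<le> real j * flat 2 ?s * (C * (r - R0)) + real j * flat 2 ?t * (C * (R - r))"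
      by (intro add_mono mult_left_mono lip r mult_nonneg_nonneg flat_nonneg) auto
    finally show ?thesis by (simp add: algebra_simps)
  qed
  have bq': "cmod (q' j r) \<le> 5 * C" if r: "R0 < r" "r < R" for j r
  proof -
    have rr: "r \<in> {R0..R}" using r by auto
    have "cmod (q' j r) \<le> cmod (of_real (cutoff R0 R j r) * e' r) + cmod (of_real (cutoff_deriv R0 R j r) * e r)"
      unfolding q'_def by (rule norm_triangle_ineq)
    also have "cmod (of_real (cutoff R0 R j r) * e' r) \<le> 1 * C"
      unfolding norm_mult norm_of_real using cutoff_bounds[of R0 R j r] C[OF rr] by (intro mult_mono) auto
    also have "cmod (of_real (cutoff_deriv R0 R j r) * e r) \<le> C * (2 + 2)"
      by (rule order_trans[OF cd[OF rr]]) (use r C0 in \<open>intro mult_left_mono add_mono scaled_flat_2; simp\<close>)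
    finally show ?thesis by simp
  qed
  have lq: "(\<lambda>j. q j r) \<longlonglongrightarrow> e r" "(\<lambda>j. q' j r) \<longlonglongrightarrow> e' r" if r: "R0 < r" "r < R" for r
  proof -
    have c1: "(\<lambda>j. complex_of_real (cutoff R0 R j r)) \<longlonglongrightarrow> 1"
      using tendsto_of_real[OF cutoff_tendsto[of R0 R r], where 'a=complex] r by simp
    show "(\<lambda>j. q j r) \<longlonglongrightarrow> e r" using tendsto_mult[OF c1 tendsto_const[of "e r"]] by (simp add: q_def)
    have "(\<lambda>j. of_real (cutoff_deriv R0 R j r) * e r) \<longlonglongrightarrow> 0"
    proof (rule Lim_null_comparison[OF always_eventually[OF allI[OF cd]]])
      have "(\<lambda>j. C * (real j * (r - R0) * flat 2 (real j * (r - R0) - 1) + real j * (R - r) * flat 2 (real j * (R - r) - 1))) \<longlonglongrightarrow> C * (0 + 0)"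
        using r by (intro tendsto_mult tendsto_const tendsto_add scaled_flat_2(2)) auto
      then show "(\<lambda>j. C * (real j * (r - R0) * flat 2 (real j * (r - R0) - 1) + real j * (R - r) * flat 2 (real j * (R - r) - 1))) \<longlonglongrightarrow> 0" by simp
    qed (use r in auto)
    from tendsto_add[OF tendsto_mult[OF c1 tendsto_const[of "e' r"]] this]
    show "(\<lambda>j. q' j r) \<longlonglongrightarrow> e' r" by (simp add: q'_def)
  qed
  have bq: "cmod (q j r) \<le> C * (R - R0)" if r: "R0 < r" "r < R" for j r
  proof -
    have "cmod (q j r) \<le> 1 * cmod (e r)"
      unfolding q_def norm_mult norm_of_real using cutoff_bounds[of R0 R j r] by (intro mult_right_mono) auto
    also have "\<dots> \<le> C * (r - R0)" using lip(1)[of r] r by simp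
    also have "\<dots> \<le> C * (R - R0)" using r C0 by (intro mult_left_mono) auto
    finally show ?thesis .
  qed
  define \<phi> where "\<phi> j = mode (q j) n" for j
  have S: "open {R0<..<R}" "{R0<..<R} \<subseteq> {0<..}" using R by auto
  have setO: "{x :: real^2. norm x \<in> {R0<..<R}} = ?O" by auto
  have \<phi>: "\<phi> j \<in> test_functions ?O" for j
  proof (rule test_functionsI[OF open_annulus order_refl])
    have "Ck_line m {R0<..<R} (q j)" for m
      unfolding q_def[abs_def] by (intro Ck_line_mult Ck_line_cutoff Ck_line_subset[OF e(1)]) auto
    then have "Ck_on m {x. norm x \<in> {R0<..<R}} (\<phi> j)" for m unfolding \<phi>_def by (intro Ck_on_mode S)
    then show "smooth_on_open ?O (\<phi> j)" unfolding setO by (simp add: smooth_on_open_def open_annulus)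
    let ?K = "if j = 0 then {} else closed_annulus (R0 + 1 / real j) (R - 1 / real j)"
    show "compact ?K" by (simp add: compact_closed_annulus)
    show "?K \<subseteq> ?O"
    proof (cases "j = 0")
      case False
      then have pos: "1 / real j > 0" by simp
      show ?thesis
      proof
        fix x :: "real^2" assume "x \<in> ?K"
        then have "R0 + 1 / real j \<le> norm x \<and> norm x \<le> R - 1 / real j"
          using False by (simp only: if_False closed_annulus_def mem_Collect_eq)
        then show "x \<in> ?O" unfolding mem_annulus using pos by linarith
      qed
    qed simp
    show "\<phi> j x = 0" if "x \<notin> ?K" for x
    proof -
      have "norm x \<notin> {R0 + 1 / real j..R - 1 / real j} \<or> j = 0" 
        using that by (cases "j = 0") (simp_all only: if_True if_False closed_annulus_def mem_Collect_eq atLeastAtMost_iff simp_thms)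
      from cutoff_zero[OF this] show ?thesis by (simp add: \<phi>_def mode_def q_def)
    qed
  qed
  have d\<phi>: "partial_deriv i (\<phi> j) x = vfield (q' j) (\<lambda>r. \<i> * of_int n * q j r / of_real r) n i x" if "x \<in> ?O" for i j x
    unfolding \<phi>_def using that R by (intro partial_deriv_mode_vfield dq) auto
  have Hl: "(\<lambda>x. H x $ i) \<in> L1_loc ?O" and hl: "h \<in> L1_loc ?O" for i using H(1) by (auto simp: has_weak_grad_def)
  have id: "(LINT x|?M. H x $ 1 * partial_deriv 1 (\<phi> j) x) + (LINT x|?M. H x $ 2 * partial_deriv 2 (\<phi> j) x) = of_real k ^ 2 * (LINT x|?M. h x * \<phi> j x)" for j
  proof -
    have t: "partial_deriv i (\<phi> j) \<in> test_functions ?O" for i by (rule test_functions_partial_deriv[OF \<phi> open_annulus])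
    have "(LINT x|?M. h x * partial_deriv i (partial_deriv i (\<phi> j)) x) = - (LINT x|?M. H x $ i * partial_deriv i (\<phi> j) x)" for i
      using H(1) t[of i] unfolding has_weak_grad_def by blast
    note p = this
    have "0 = (LINT x|?M. h x * (laplacian (\<phi> j) x + (of_real k)\<^sup>2 * \<phi> j x))"
      using wh \<phi>[of j] unfolding weak_helmholtz_def by simp
    also have "\<dots> = (LINT x|?M. h x * partial_deriv 1 (partial_deriv 1 (\<phi> j)) x + h x * partial_deriv 2 (partial_deriv 2 (\<phi> j)) x + of_real k ^ 2 * (h x * \<phi> j x))"
      by (simp add: laplacian_def sum_2 algebra_simps)
    also have "\<dots> = (LINT x|?M. h x * partial_deriv 1 (partial_deriv 1 (\<phi> j)) x) + (LINT x|?M. h x * partial_deriv 2 (partial_deriv 2 (\<phi> j)) x)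
        + of_real k ^ 2 * (LINT x|?M. h x * \<phi> j x)"
      using integrable_L1_loc_mult_test[OF hl open_annulus test_functions_partial_deriv[OF t open_annulus]]
        integrable_L1_loc_mult_test[OF hl open_annulus \<phi>]
      by (subst Bochner_Integration.integral_add | simp)+
    finally show ?thesis unfolding p by (simp add: algebra_simps)
  qed
  have CT: "norm x \<in> {R0..R} \<and> x \<noteq> 0" if "x \<in> ?C" for x using that R by (auto simp: closed_annulus_def)
  have cb: "continuous_on {R0..R} (\<lambda>r. \<i> * of_int n * e r / of_real r)" using R by (intro continuous_intros ec) auto
  let ?V = "vfield e' (\<lambda>r. \<i> * of_int n * e r / of_real r) n"
  have cV: "continuous_on ?C (?V i)" for i by (rule continuous_on_vfield[OF ec(2) cb CT])
  have cm: "continuous_on ?C (mode e n)" by (rule continuous_on_mode[OF ec(1) CT])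
  define B where "B = 5 * C + \<bar>of_int n\<bar> * (C * (R - R0)) / R0"
  have limH: "(\<lambda>j. LINT x|?M. H x $ i * partial_deriv i (\<phi> j) x) \<longlonglongrightarrow> (LINT x|?M. H x $ i * ?V i x)" for i
  proof (rule integral_dominated_convergence[where w="\<lambda>x. B * norm (H x $ i)"])
    show "(\<lambda>x. H x $ i * ?V i x) \<in> borel_measurable ?M"
      using integrable_L2_mult_bounded[OF H(2) cV] by auto
    show "(\<lambda>x. H x $ i * partial_deriv i (\<phi> j) x) \<in> borel_measurable ?M" for j
      using integrable_L1_loc_mult_test[OF Hl open_annulus test_functions_partial_deriv[OF \<phi> open_annulus]] by auto
    show "integrable ?M (\<lambda>x. B * norm (H x $ i))"
      using L2_imp_integrable[OF H(2) annulus_lmeasurable] by auto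
    show "AE x in ?M. (\<lambda>j. H x $ i * partial_deriv i (\<phi> j) x) \<longlonglongrightarrow> H x $ i * ?V i x"
    proof (rule AE_I2)
      fix x assume "x \<in> space ?M"
      then have x: "x \<in> ?O" by simp
      then have nx: "norm x > 0" "complex_of_real (norm x) \<noteq> 0" using R by auto
      show "(\<lambda>j. H x $ i * partial_deriv i (\<phi> j) x) \<longlonglongrightarrow> H x $ i * ?V i x"
        unfolding d\<phi>[OF x] vfield_def using x nx by (intro tendsto_intros lq) auto
    qed
    show "AE x in ?M. norm (H x $ i * partial_deriv i (\<phi> j) x) \<le> B * norm (H x $ i)" for j
    proof (rule AE_I2)
      fix x assume "x \<in> space ?M"
      then have x: "R0 < norm x" "norm x < R" "x \<in> ?O" by auto
      have "cmod (partial_deriv i (\<phi> j) x) \<le> cmod (q' j (norm x)) + cmod (\<i> * of_int n * q j (norm x) / of_real (norm x))"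
        unfolding d\<phi>[OF x(3)] by (rule norm_vfield_le) (use x R in auto)
      also have "cmod (\<i> * of_int n * q j (norm x) / of_real (norm x)) \<le> \<bar>of_int n\<bar> * (C * (R - R0)) / R0"
        unfolding norm_mult norm_divide using bq[OF x(1,2)] x R C0 by (simp only: norm_of_real norm_of_int norm_ii mult_1 abs_norm_cancel)
          (intro frac_le mult_left_mono mult_nonneg_nonneg; simp)
      finally have "cmod (partial_deriv i (\<phi> j) x) \<le> B" using bq'[OF x(1,2), of j] by (simp add: B_def)
      then show "norm (H x $ i * partial_deriv i (\<phi> j) x) \<le> B * norm (H x $ i)"
        unfolding norm_mult by (subst mult.commute) (intro mult_right_mono; simp)
    qed
  qed
  have limh: "(\<lambda>j. LINT x|?M. h x * \<phi> j x) \<longlonglongrightarrow> (LINT x|?M. h x * mode e n x)"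
  proof (rule integral_dominated_convergence[where w="\<lambda>x. (C * (R - R0)) * norm (h x)"])
    show "(\<lambda>x. h x * mode e n x) \<in> borel_measurable ?M"
      using integrable_L2_mult_bounded[OF h cm] by auto
    show "(\<lambda>x. h x * \<phi> j x) \<in> borel_measurable ?M" for j
      using integrable_L1_loc_mult_test[OF hl open_annulus \<phi>] by auto
    show "integrable ?M (\<lambda>x. C * (R - R0) * norm (h x))"
      using L2_imp_integrable[OF h annulus_lmeasurable] by auto
    show "AE x in ?M. (\<lambda>j. h x * \<phi> j x) \<longlonglongrightarrow> h x * mode e n x"
    proof (rule AE_I2)
      fix x assume "x \<in> space ?M"
      then have x: "x \<in> ?O" by simp
      show "(\<lambda>j. h x * \<phi> j x) \<longlonglongrightarrow> h x * mode e n x"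
        unfolding \<phi>_def mode_def using x by (intro tendsto_intros lq) auto
    qed
    show "AE x in ?M. norm (h x * \<phi> j x) \<le> C * (R - R0) * norm (h x)" for j
    proof (rule AE_I2)
      fix x assume "x \<in> space ?M"
      then have x: "R0 < norm x" "norm x < R" "x \<noteq> 0" using R by auto
      have "cmod (\<phi> j x) \<le> C * (R - R0)"
        unfolding \<phi>_def mode_def norm_mult norm_emode[OF x(3)] using bq[OF x(1,2)] by simp
      then show "norm (h x * \<phi> j x) \<le> C * (R - R0) * norm (h x)"
        unfolding norm_mult by (subst mult.commute) (intro mult_right_mono; simp)
    qed
  qed
  have "(\<lambda>j. (LINT x|?M. H x $ 1 * partial_deriv 1 (\<phi> j) x) + (LINT x|?M. H x $ 2 * partial_deriv 2 (\<phi> j) x))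
      \<longlonglongrightarrow> (LINT x|?M. H x $ 1 * ?V 1 x) + (LINT x|?M. H x $ 2 * ?V 2 x)"
    by (intro tendsto_add limH)
  moreover have "(\<lambda>j. of_real k ^ 2 * (LINT x|?M. h x * \<phi> j x)) \<longlonglongrightarrow> of_real k ^ 2 * (LINT x|?M. h x * mode e n x)"
    by (intro tendsto_mult tendsto_const limh)
  ultimately have "(LINT x|?M. H x $ 1 * ?V 1 x) + (LINT x|?M. H x $ 2 * ?V 2 x) = of_real k ^ 2 * (LINT x|?M. h x * mode e n x)"
    unfolding id by (rule LIMSEQ_unique)
  then show ?thesis
    unfolding sum_2 using integrable_L2_mult_bounded[OF H(2) cV] integrable_L2_mult_bounded[OF h cm] by simp
qed

lemma cnj_vfield:
  assumes "x \<noteq> 0"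
  shows "cnj (vfield a b n i x) = vfield (\<lambda>r. cnj (a r)) (\<lambda>r. cnj (b r)) (- n) i x"
  using assms by (simp add: vfield_def cnj_emode)

text \<open>The difference \<open>h\<close> of two competitors solves the Helmholtz equation and has zero trace on the inner
  circle, which is what \<open>green\<close> expresses. With \<open>g = cnj (p' - i k p)\<close> and \<open>e = r g + z\<close>, the conjugated
  flux field of the mode of \<open>p\<close> is split into the gradient of the mode of \<open>e\<close> and a remainder with components
  \<open>a\<close> and \<open>b\<close> whose divergence is \<open>k\<^sup>2 e - i k g\<close>. The gradient part is handled by the weak equation for \<open>h\<close>,
  as \<open>e\<close> vanishes on both circles; the remainder by \<open>green\<close>, as \<open>a\<close> vanishes at \<open>R\<close>.\<close>

lemma matched_mode_orthogonal:
  assumes R: "0 < R0" "R0 < R" and h: "h \<in> L2 (annulus R0 R)" and H: "has_weak_grad (annulus R0 R) h H" "\<And>i. (\<lambda>x. H x $ i) \<in> L2 (annulus R0 R)"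
    and wh: "weak_helmholtz k (annulus R0 R) h"
    and green: "\<And>a a' b m. continuous_on {R0..R} a \<Longrightarrow> continuous_on {R0..R} a' \<Longrightarrow>
        (\<And>r. R0 < r \<Longrightarrow> r < R \<Longrightarrow> (a has_vector_derivative a' r) (at r)) \<Longrightarrow> continuous_on {R0..R} b \<Longrightarrow> a R = 0 \<Longrightarrow>
        (LINT x|lebesgue_on (annulus R0 R). (\<Sum>i\<in>UNIV. H x $ i * vfield a b m i x) + h x * vdiv a a' b m x) = 0"
    and p: "bessel_sol k R0 n p p'" and z: "bessel_sol k R0 n z z'" and match: "adjoint_matched k R0 R n p p' z z'"
  shows "(LINT x|lebesgue_on (annulus R0 R). (\<Sum>i\<in>UNIV. (H x $ i - \<i> * of_real k * h x * rhat i x)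
      * cnj (vfield (\<lambda>r. p' r - \<i> * of_real k * p r) (\<lambda>r. \<i> * of_int n * p r / of_real r) n i x))) = 0"
proof -
  let ?O = "annulus R0 R" and ?C = "closed_annulus R0 R"
  let ?M = "lebesgue_on ?O"
  define P P1 where "P = (\<lambda>r. cnj (p r))" and "P1 = (\<lambda>r. cnj (p' r))"
  have P: "bessel_sol k R0 n P P1" unfolding P_def P1_def by (rule bessel_sol_cnj[OF p])
  note PD = bessel_solD[OF P] and zD = bessel_solD[OF z]
  let ?P2 = "bessel_rhs k n P P1" and ?z2 = "bessel_rhs k n z z'"
  define g where "g r = P1 r + \<i> * of_real k * P r" for r
  define dg where "dg r = ?P2 r + \<i> * of_real k * P1 r" for r
  define P3 where "P3 r = - (?P2 r / of_real r - P1 r / of_real r ^ 2) - ((of_real k ^ 2 - of_int n ^ 2 / of_real r ^ 2) * P1 r + 2 * of_int n ^ 2 / of_real r ^ 3 * P r)" for r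
  define ddg where "ddg r = P3 r + \<i> * of_real k * ?P2 r" for r
  define e where "e r = of_real r * g r + z r" for r
  define e' where "e' r = (of_real r * dg r + 1 * g r) + z' r" for r
  define a where "a r = - (of_real r * dg r + z' r)" for r
  define a' where "a' r = - ((of_real r * ddg r + 1 * dg r) + ?z2 r)" for r
  define b where "b r = \<i> * of_int n * (e r - P r) / of_real r" for r
  have rp: "r > 0" "complex_of_real r \<noteq> 0" if "R0 \<le> r" for r using that R by auto
  have d\<P>2: "(?P2 has_vector_derivative P3 r) (at r)" if r: "R0 < r" for r
  proof -
    have r0: "r \<noteq> 0" "complex_of_real r \<noteq> 0" using r R by auto
    have i1: "((\<lambda>r. 1 / r) has_real_derivative - (1 / r^2)) (at r)"
      using r0 by (auto intro!: derivative_eq_intros simp: power2_eq_square)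
    have i2: "((\<lambda>r. k^2 - of_int n ^ 2 / r^2) has_real_derivative 2 * of_int n ^ 2 / r^3) (at r)"
      using r0 by (auto intro!: derivative_eq_intros simp: power2_eq_square power3_eq_cube field_simps)
    have "((\<lambda>r. - (P1 r * complex_of_real (1 / r)) - complex_of_real (k^2 - of_int n ^ 2 / r^2) * P r) has_vector_derivative
        - (P1 r * of_real (- (1 / r^2)) + ?P2 r * of_real (1 / r))
        - (complex_of_real (k^2 - of_int n ^ 2 / r^2) * P1 r + of_real (2 * of_int n ^ 2 / r^3) * P r)) (at r)"
      by (intro has_vector_derivative_diff has_vector_derivative_minus has_vector_derivative_mult PD r
          has_vector_derivative_of_real i1 i2)
    moreover have "(\<lambda>r. - (P1 r * complex_of_real (1 / r)) - complex_of_real (k^2 - of_int n ^ 2 / r^2) * P r) = ?P2"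
      by (simp add: bessel_rhs_def fun_eq_iff)
    moreover have "- (P1 r * of_real (- (1 / r^2)) + ?P2 r * of_real (1 / r))
        - (complex_of_real (k^2 - of_int n ^ 2 / r^2) * P1 r + of_real (2 * of_int n ^ 2 / r^3) * P r) = P3 r"
      by (simp add: P3_def)
    ultimately show ?thesis by simp
  qed
  have dge: "(g has_vector_derivative dg r) (at r)" "(dg has_vector_derivative ddg r) (at r)" if r: "R0 < r" for r
    unfolding g_def[abs_def] dg_def[abs_def] ddg_def
    by (intro has_vector_derivative_add has_vector_derivative_mult_right PD d\<P>2 r)+
  have de: "(e has_vector_derivative e' r) (at r)" if r: "R0 < r" for r
    unfolding e_def[abs_def] e'_def
    by (intro has_vector_derivative_add has_vector_derivative_mult has_vector_derivative_complex_of_real dge zD r)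
  have da: "(a has_vector_derivative a' r) (at r)" if r: "R0 < r" for r
    unfolding a_def[abs_def] a'_def
    by (intro has_vector_derivative_minus has_vector_derivative_add has_vector_derivative_mult has_vector_derivative_complex_of_real dge zD r)
  have sub: "{R0..R} \<subseteq> {R0..}" by auto
  note c = continuous_on_subset[OF PD(1) sub] continuous_on_subset[OF PD(2) sub] continuous_on_subset[OF zD(1) sub] continuous_on_subset[OF zD(2) sub]
  have c2: "continuous_on {R0..R} (bessel_rhs k n y y')" if "continuous_on {R0..R} y" "continuous_on {R0..R} y'" for y y'
    unfolding bessel_rhs_def[abs_def] using R by (intro continuous_intros that) auto
  have cg: "continuous_on {R0..R} g" "continuous_on {R0..R} dg"
    unfolding g_def[abs_def] dg_def[abs_def] by (intro continuous_intros c c2)+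
  have cP3: "continuous_on {R0..R} P3" unfolding P3_def[abs_def] using R by (intro continuous_intros c c2) auto
  have cddg: "continuous_on {R0..R} ddg" unfolding ddg_def[abs_def] by (intro continuous_intros c c2 cP3)
  have ce: "continuous_on {R0..R} e" "continuous_on {R0..R} e'" "continuous_on {R0..R} a" "continuous_on {R0..R} a'"
    unfolding e_def[abs_def] e'_def[abs_def] a_def[abs_def] a'_def[abs_def] by (intro continuous_intros c c2 cg cddg)+
  have cbb: "continuous_on {R0..R} b" unfolding b_def[abs_def] using R by (intro continuous_intros ce c) auto
  have m: "z R = - of_real R * g R" "z' R = - of_real R * dg R" "z R0 = - of_real R0 * g R0"
    using match unfolding adjoint_matched_def g_def dg_def P_def P1_def bessel_rhs_cnj by (simp_all add: algebra_simps)
  have aR: "a R = 0" and eR: "e R = 0" "e R0 = 0" by (simp_all add: a_def e_def m)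
  have smooth: "Ck_line j {R0<..} e" for j
    unfolding e_def[abs_def] g_def
    by (intro Ck_line_add Ck_line_mult Ck_line_const Ck_line_of_real Ck_line_bessel_sol[OF P R(1)] Ck_line_bessel_sol[OF z R(1)])
  have W: "(LINT x|?M. (\<Sum>i\<in>UNIV. H x $ i * vfield e' (\<lambda>r. \<i> * of_int (- n) * e r / of_real r) (- n) i x) - of_real k ^ 2 * (h x * mode e (- n) x)) = 0"
    by (rule weak_helmholtz_vanishing_mode[OF R h H wh smooth de ce(1,2) eR(2,1)])
  have T: "(LINT x|?M. (\<Sum>i\<in>UNIV. H x $ i * vfield a b (- n) i x) + h x * vdiv a a' b (- n) x) = 0"
    by (rule green[OF ce(3,4) da cbb aR])
  have CT: "norm x \<in> {R0..R} \<and> x \<noteq> 0" if "x \<in> ?C" for x using that R by (auto simp: closed_annulus_def)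
  have cb2: "continuous_on {R0..R} (\<lambda>r. \<i> * of_int (- n) * e r / of_real r)" using R by (intro continuous_intros ce) auto
  have iT: "integrable ?M (\<lambda>x. (\<Sum>i\<in>UNIV. H x $ i * vfield a b (- n) i x) + h x * vdiv a a' b (- n) x)"
    by (intro Bochner_Integration.integrable_add Bochner_Integration.integrable_sum integrable_L2_mult_bounded h H
        continuous_on_vfield[OF ce(3) cbb CT] continuous_on_vdiv[OF ce(3,4) cbb CT])
  have iW: "integrable ?M (\<lambda>x. (\<Sum>i\<in>UNIV. H x $ i * vfield e' (\<lambda>r. \<i> * of_int (- n) * e r / of_real r) (- n) i x) - of_real k ^ 2 * (h x * mode e (- n) x))"
    by (intro Bochner_Integration.integrable_diff Bochner_Integration.integrable_sum integrable_mult_right integrable_L2_mult_bounded h H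
        continuous_on_vfield[OF ce(2) cb2 CT] continuous_on_mode[OF ce(1) CT])
  have pt: "(\<Sum>i\<in>UNIV. (H x $ i - \<i> * of_real k * h x * rhat i x)
      * cnj (vfield (\<lambda>r. p' r - \<i> * of_real k * p r) (\<lambda>r. \<i> * of_int n * p r / of_real r) n i x))
    = ((\<Sum>i\<in>UNIV. H x $ i * vfield a b (- n) i x) + h x * vdiv a a' b (- n) x)
      + ((\<Sum>i\<in>UNIV. H x $ i * vfield e' (\<lambda>r. \<i> * of_int (- n) * e r / of_real r) (- n) i x) - of_real k ^ 2 * (h x * mode e (- n) x))"
    if x: "x \<in> ?O" for x
  proof -
    let ?r = "norm x"
    have x0: "x \<noteq> 0" and r: "?r > 0" "complex_of_real ?r \<noteq> 0" using x R by auto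
    define E where "E = emode (- n) x"
    define B where "B = - \<i> * of_int n * P ?r / of_real ?r"
    have cn: "cnj (vfield (\<lambda>r. p' r - \<i> * of_real k * p r) (\<lambda>r. \<i> * of_int n * p r / of_real r) n i x) = (g ?r * rhat i x + B * ahat i x) * E" for i
      unfolding cnj_vfield[OF x0] by (simp add: vfield_def g_def B_def P_def P1_def E_def)
    have vab: "vfield a b (- n) i x + vfield e' (\<lambda>r. \<i> * of_int (- n) * e r / of_real r) (- n) i x = (g ?r * rhat i x + B * ahat i x) * E" for i
    proof -
      have "a ?r + e' ?r = g ?r" by (simp add: a_def e'_def)
      moreover have "b ?r + \<i> * of_int (- n) * e ?r / of_real ?r = B" by (simp add: b_def B_def diff_divide_distrib algebra_simps)
      moreover have "vfield a b (- n) i x + vfield e' (\<lambda>r. \<i> * of_int (- n) * e r / of_real r) (- n) i x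
         = ((a ?r + e' ?r) * rhat i x + (b ?r + \<i> * of_int (- n) * e ?r / of_real ?r) * ahat i x) * E"
        by (simp add: vfield_def E_def algebra_simps)
      ultimately show ?thesis by simp
    qed
    \<comment> \<open>the identity that makes \<open>r g\<close> a particular solution: \<open>z\<close> drops out because it solves the homogeneous equation\<close>
    have div: "vdiv a a' b (- n) x - of_real k ^ 2 * mode e (- n) x = - \<i> * of_real k * g ?r * E"
    proof -
      have "a' ?r + a ?r / of_real ?r + \<i> * of_int (- n) * b ?r / of_real ?r - of_real k ^ 2 * e ?r = - \<i> * of_real k * g ?r"
        unfolding a'_def a_def b_def e_def ddg_def P3_def dg_def g_def bessel_rhs_def
        using r by (simp add: field_simps power2_eq_square power3_eq_cube)
      from arg_cong[OF this, of "\<lambda>y. y * E"] show ?thesis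
        by (simp add: vdiv_def mode_def E_def algebra_simps)
    qed
    have rr: "(\<Sum>i\<in>UNIV. rhat i x * ((g ?r * rhat i x + B * ahat i x) * E)) = g ?r * E"
    proof -
      have "(\<Sum>i\<in>UNIV. rhat i x * ((g ?r * rhat i x + B * ahat i x) * E))
         = (g ?r * (rhat 1 x * rhat 1 x + rhat 2 x * rhat 2 x) + B * (rhat 1 x * ahat 1 x + rhat 2 x * ahat 2 x)) * E"
        unfolding sum_2 by (simp add: algebra_simps)
      then show ?thesis unfolding sum_rhat_ahat[OF x0] by simp
    qed
    have "(\<Sum>i\<in>UNIV. (H x $ i - \<i> * of_real k * h x * rhat i x) * ((g ?r * rhat i x + B * ahat i x) * E))
       = (\<Sum>i\<in>UNIV. H x $ i * ((g ?r * rhat i x + B * ahat i x) * E)) - \<i> * of_real k * h x * (\<Sum>i\<in>UNIV. rhat i x * ((g ?r * rhat i x + B * ahat i x) * E))"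
      unfolding sum_2 by (simp add: algebra_simps)
    also have "\<dots> = (\<Sum>i\<in>UNIV. H x $ i * ((g ?r * rhat i x + B * ahat i x) * E)) + h x * (vdiv a a' b (- n) x - of_real k ^ 2 * mode e (- n) x)"
      unfolding rr div by (simp add: algebra_simps)
    finally show ?thesis unfolding cn vab[symmetric] sum_2 by (simp add: algebra_simps)
  qed
  have "(LINT x|?M. (\<Sum>i\<in>UNIV. (H x $ i - \<i> * of_real k * h x * rhat i x)
      * cnj (vfield (\<lambda>r. p' r - \<i> * of_real k * p r) (\<lambda>r. \<i> * of_int n * p r / of_real r) n i x)))
    = (LINT x|?M. ((\<Sum>i\<in>UNIV. H x $ i * vfield a b (- n) i x) + h x * vdiv a a' b (- n) x)
      + ((\<Sum>i\<in>UNIV. H x $ i * vfield e' (\<lambda>r. \<i> * of_int (- n) * e r / of_real r) (- n) i x) - of_real k ^ 2 * (h x * mode e (- n) x)))"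
    by (intro Bochner_Integration.integral_cong refl pt) simp
  also have "\<dots> = 0" unfolding Bochner_Integration.integral_add[OF iT iW] T W by simp
  finally show ?thesis .
qed

section \<open>Finite sums of modes\<close>

lemma integral_inverse_norm_annulus:
  assumes R: "0 < R0" "R0 \<le> R"
  shows "integrable (lebesgue_on (annulus R0 R)) (\<lambda>x. 1 / norm x)" "(LINT x|lebesgue_on (annulus R0 R). 1 / norm x) = 2 * pi * (R - R0)"
proof -
  let ?F = "\<lambda>x :: real^2. complex_of_real (1 / norm x)"
  have c: "continuous_on (closed_annulus R0 R) ?F"
    using R by (intro continuous_intros) (auto simp: closed_annulus_def)
  have i: "integrable (lebesgue_on (annulus R0 R)) ?F" by (rule integral_annulus_polar(1)[OF R(1) c])
  from integrable_Re[OF i] show 1: "integrable (lebesgue_on (annulus R0 R)) (\<lambda>x. 1 / norm x)" by simp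
  have "(LINT x|lebesgue_on (annulus R0 R). ?F x) = integral {R0..R} (\<lambda>r. integral {0..2 * pi} (\<lambda>\<omega>. of_real r * ?F (polar r \<omega>)))"
    by (rule integral_annulus_polar(2)[OF R(1) c])
  also have "\<dots> = integral {R0..R} (\<lambda>r. complex_of_real (2 * pi))"
  proof (rule integral_cong)
    fix r assume "r \<in> {R0..R}"
    then have r: "r > 0" using R by auto
    have "(\<lambda>\<omega>. of_real r * ?F (polar r \<omega>)) = (\<lambda>_. 1)" using r by (simp add: fun_eq_iff)
    then show "integral {0..2 * pi} (\<lambda>\<omega>. of_real r * ?F (polar r \<omega>)) = complex_of_real (2 * pi)"
      by (simp add: scaleR_conv_of_real)
  qed
  also have "\<dots> = of_real (2 * pi * (R - R0))" using R by (simp add: scaleR_conv_of_real mult.commute)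
  finally have "complex_of_real (LINT x|lebesgue_on (annulus R0 R). 1 / norm x) = of_real (2 * pi * (R - R0))"
    by (simp only: integral_complex_of_real)
  then show "(LINT x|lebesgue_on (annulus R0 R). 1 / norm x) = 2 * pi * (R - R0)" by (simp only: of_real_eq_iff)
qed

definition modes :: "nat \<Rightarrow> (int \<Rightarrow> real \<Rightarrow> complex) \<Rightarrow> real^2 \<Rightarrow> complex" where
  "modes N q x = (\<Sum>n = - int N..int N. mode (q n) n x)"

lemma partial_deriv_sum:
  assumes "finite A" "\<And>a. a \<in> A \<Longrightarrow> f a differentiable (at x)"
  shows "(\<lambda>x. \<Sum>a\<in>A. f a x) differentiable (at x) \<and> partial_deriv i (\<lambda>x. \<Sum>a\<in>A. f a x) x = (\<Sum>a\<in>A. partial_deriv i (f a) x)"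
  using assms
proof (induction A)
  case (insert a A)
  have 1: "(\<lambda>x. \<Sum>a\<in>A. f a x) differentiable (at x)" and 2: "partial_deriv i (\<lambda>x. \<Sum>a\<in>A. f a x) x = (\<Sum>a\<in>A. partial_deriv i (f a) x)"
    using insert by auto
  have 3: "f a differentiable (at x)" using insert by simp
  show ?case using partial_deriv_add[OF 3 1, of i] differentiable_add[OF 3 1] insert 2 by simp
qed simp

lemma partial_deriv_modes:
  assumes "\<And>n. n \<in> {- int N..int N} \<Longrightarrow> (q n has_vector_derivative q' n (norm x)) (at (norm x))" "x \<noteq> 0"
  shows "partial_deriv i (modes N q) x = (\<Sum>n = - int N..int N. vfield (q' n) (\<lambda>r. \<i> * of_int n * q n r / of_real r) n i x)"
proof -
  have "partial_deriv i (\<lambda>x. \<Sum>n = - int N..int N. mode (q n) n x) x = (\<Sum>n = - int N..int N. partial_deriv i (mode (q n) n) x)"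
    using partial_deriv_sum[of "{- int N..int N}" "\<lambda>n. mode (q n) n" x i] partial_deriv_mode(1)[OF assms(1) assms(2)] by blast
  also have "\<dots> = (\<Sum>n = - int N..int N. vfield (q' n) (\<lambda>r. \<i> * of_int n * q n r / of_real r) n i x)"
    by (intro sum.cong refl partial_deriv_mode_vfield assms)
  finally show ?thesis by (simp add: modes_def[abs_def])
qed

definition modes_const :: "nat \<Rightarrow> real \<Rightarrow> real" where
  "modes_const N R0 = sqrt (2 * pi * ((2 * real N + 1)\<^sup>2 * (1 + 2 * (1 + real N / R0)\<^sup>2)))"

text \<open>Functions of size \<open>r\<^sup>-\<^sup>1\<^sup>/\<^sup>2\<close> have squares of size \<open>1/r\<close>, whose integral over the annulus grows like \<open>R\<close>.
  This is the source of the factor \<open>R\<^sup>1\<^sup>/\<^sup>2\<close> between the rates on the growing and on the fixed annulus.\<close>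

lemma modes_estimate:
  assumes R: "0 < R0" "R0 < R" and c: "0 \<le> c"
    and d: "\<And>n r. n \<in> {- int N..int N} \<Longrightarrow> R0 < r \<Longrightarrow> r < R \<Longrightarrow> (q n has_vector_derivative q' n r) (at r)"
    and q': "\<And>n. n \<in> {- int N..int N} \<Longrightarrow> continuous_on {R0<..<R} (q' n)"
    and b: "\<And>n r. n \<in> {- int N..int N} \<Longrightarrow> R0 < r \<Longrightarrow> r < R \<Longrightarrow> sqrt r * cmod (q n r) \<le> c"
      "\<And>n r. n \<in> {- int N..int N} \<Longrightarrow> R0 < r \<Longrightarrow> r < R \<Longrightarrow> sqrt r * cmod (q' n r) \<le> c"
  shows "has_weak_grad (annulus R0 R) (modes N q) (\<lambda>x. \<chi> i. partial_deriv i (modes N q) x)"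
    and "modes N q \<in> H1 (annulus R0 R)" and "modes N q \<in> L2 (annulus R0 R)" and "partial_deriv i (modes N q) \<in> L2 (annulus R0 R)"
    and "H1_norm (annulus R0 R) (modes N q) \<le> modes_const N R0 * c * sqrt R"
proof -
  let ?O = "annulus R0 R" and ?w = "modes N q"
  let ?M = "lebesgue_on ?O"
  have S: "open {R0<..<R}" "{R0<..<R} \<subseteq> {0<..}" using R by auto
  have setO: "{x :: real^2. norm x \<in> {R0<..<R}} = ?O" by auto
  have "Ck_line (Suc 0) {R0<..<R} (q n)" if "n \<in> {- int N..int N}" for n
    using d[OF that] q'[OF that] by (auto intro!: exI[of _ "q' n"])
  then have "Ck_on (Suc 0) ?O (mode (q n) n)" if "n \<in> {- int N..int N}" for n
    using Ck_on_mode[OF S, of "Suc 0" "q n" n] that unfolding setO by blast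
  then have C1: "Ck_on 1 ?O ?w" unfolding modes_def[abs_def] One_nat_def by (intro Ck_on_sum open_annulus)
  show wg: "has_weak_grad ?O ?w (\<lambda>x. \<chi> i. partial_deriv i ?w x)" by (rule has_weak_grad_classical[OF open_annulus C1])
  have card: "real (card {- int N..int N}) = 2 * real N + 1" by simp
  define A where "A = (2 * real N + 1) * c"
  define B where "B = (2 * real N + 1) * (c * (1 + real N / R0))"
  have AB: "A \<ge> 0" "B \<ge> 0" using c R by (simp_all add: A_def B_def)
  have div: "t \<le> c / sqrt r" if "sqrt r * t \<le> c" "r > 0" for t r using that by (simp add: field_simps)
  have bw: "cmod (?w x) \<le> A / sqrt (norm x)" if x: "x \<in> ?O" for x
  proof -
    have x0: "R0 < norm x" "norm x < R" "norm x > 0" "x \<noteq> 0" using x R by auto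
    have "cmod (?w x) \<le> (\<Sum>n = - int N..int N. cmod (mode (q n) n x))" unfolding modes_def by (rule norm_sum)
    also have "\<dots> \<le> (\<Sum>n = - int N..int N. c / sqrt (norm x))"
    proof (rule sum_mono)
      fix n assume n: "n \<in> {- int N..int N}"
      have "cmod (mode (q n) n x) = cmod (q n (norm x))" by (simp add: mode_def norm_mult norm_emode[OF x0(4)])
      then show "cmod (mode (q n) n x) \<le> c / sqrt (norm x)" using div[OF b(1)[OF n x0(1,2)] x0(3)] by simp
    qed
    also have "\<dots> = A / sqrt (norm x)" by (simp add: A_def)
    finally show ?thesis .
  qed
  have bd: "cmod (partial_deriv i ?w x) \<le> B / sqrt (norm x)" if x: "x \<in> ?O" for x i
  proof -
    have x0: "R0 < norm x" "norm x < R" "norm x > 0" "x \<noteq> 0" using x R by auto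
    have "partial_deriv i ?w x = (\<Sum>n = - int N..int N. vfield (q' n) (\<lambda>r. \<i> * of_int n * q n r / of_real r) n i x)"
      by (rule partial_deriv_modes) (use d x0 in auto)
    then have "cmod (partial_deriv i ?w x) \<le> (\<Sum>n = - int N..int N. cmod (vfield (q' n) (\<lambda>r. \<i> * of_int n * q n r / of_real r) n i x))"
      by (simp only: norm_sum)
    also have "\<dots> \<le> (\<Sum>n = - int N..int N. c / sqrt (norm x) * (1 + real N / R0))"
    proof (rule sum_mono)
      fix n assume n: "n \<in> {- int N..int N}"
      have 1: "cmod (q n (norm x)) \<le> c / sqrt (norm x)" "cmod (q' n (norm x)) \<le> c / sqrt (norm x)"
        using div[OF b(1)[OF n x0(1,2)] x0(3)] div[OF b(2)[OF n x0(1,2)] x0(3)] by auto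
      have nn: "real_of_int \<bar>n\<bar> \<le> real N" using n by auto
      have "cmod (\<i> * of_int n * q n (norm x) / of_real (norm x)) = (real_of_int \<bar>n\<bar> / norm x) * cmod (q n (norm x))"
        by (simp add: norm_mult norm_divide)
      also have "\<dots> \<le> (real N / R0) * (c / sqrt (norm x))"
        using nn 1 x0 R by (intro mult_mono frac_le) auto
      finally have "cmod (q' n (norm x)) + cmod (\<i> * of_int n * q n (norm x) / of_real (norm x)) \<le> c / sqrt (norm x) + (real N / R0) * (c / sqrt (norm x))"
        using 1(2) by linarith
      also have "\<dots> = c / sqrt (norm x) * (1 + real N / R0)" by (simp add: algebra_simps)
      finally show "cmod (vfield (q' n) (\<lambda>r. \<i> * of_int n * q n r / of_real r) n i x) \<le> c / sqrt (norm x) * (1 + real N / R0)"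
        using norm_vfield_le[OF x0(4), of "q' n" "\<lambda>r. \<i> * of_int n * q n r / of_real r" n i] by linarith
    qed
    also have "\<dots> = B / sqrt (norm x)" by (simp add: B_def)
    finally show ?thesis .
  qed
  have sq: "K / sqrt (norm x) \<le> K / sqrt R0" if "x \<in> ?O" "K \<ge> 0" for K and x :: "real^2"
    using that R by (intro divide_left_mono mult_pos_pos) (auto intro: less_trans[OF R(1)])
  have mw: "?w \<in> borel_measurable ?M" "partial_deriv i ?w \<in> borel_measurable ?M" for i
    using C1 Ck_on_continuous[OF C1] by (auto intro!: continuous_imp_measurable_on_sets_lebesgue annulus_sets)
  show L2w: "?w \<in> L2 ?O"
    by (rule L2_I[OF mw(1), where B="A / sqrt R0"]) (use bw sq AB order_trans in blast)
  have L2d: "partial_deriv i ?w \<in> L2 ?O" for i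
    by (rule L2_I[OF mw(2), where B="B / sqrt R0"]) (use bd sq AB order_trans in blast)
  then show "partial_deriv i ?w \<in> L2 ?O" .
  show "?w \<in> H1 ?O" unfolding H1_def using L2w wg L2d by (auto intro!: exI[of _ "\<lambda>x. \<chi> i. partial_deriv i ?w x"])
  have iw: "integrable ?M (\<lambda>x. (cmod (?w x))\<^sup>2)" and id: "integrable ?M (\<lambda>x. (cmod (partial_deriv i ?w x))\<^sup>2)" for i
    using L2w L2d[of i] by (auto simp: L2_def)
  have iG: "integrable ?M (\<lambda>x. (norm (\<chi> i. partial_deriv i ?w x))\<^sup>2)"
    unfolding norm_vec_power2 sum_2 using id by simp
  let ?E = "A\<^sup>2 + 2 * B\<^sup>2"
  have "(LINT x|?M. (cmod (?w x))\<^sup>2) + (LINT x|?M. (norm (\<chi> i. partial_deriv i ?w x))\<^sup>2)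
     = (LINT x|?M. (cmod (?w x))\<^sup>2 + (norm (\<chi> i. partial_deriv i ?w x))\<^sup>2)"
    using iw iG by simp
  also have "\<dots> \<le> (LINT x|?M. ?E * (1 / norm x))"
  proof (rule integral_mono)
    show "integrable ?M (\<lambda>x. (cmod (?w x))\<^sup>2 + (norm (\<chi> i. partial_deriv i ?w x))\<^sup>2)" using iw iG by simp
    show "integrable ?M (\<lambda>x. ?E * (1 / norm x))"
      by (intro integrable_mult_right integral_inverse_norm_annulus(1) R less_imp_le)
    fix x assume "x \<in> space ?M"
    then have x: "x \<in> ?O" by simp
    have sqd: "t\<^sup>2 \<le> K\<^sup>2 / norm x" if "t \<le> K / sqrt (norm x)" "0 \<le> t" for t K
    proof -
      have "t\<^sup>2 \<le> (K / sqrt (norm x))\<^sup>2" using that by (intro power_mono)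
      then show ?thesis by (simp add: power_divide)
    qed
    show "(cmod (?w x))\<^sup>2 + (norm (\<chi> i. partial_deriv i ?w x))\<^sup>2 \<le> ?E * (1 / norm x)"
      using sqd[OF bw[OF x]] sqd[OF bd[OF x, of 1]] sqd[OF bd[OF x, of 2]]
      unfolding norm_vec_power2 sum_2 by (simp add: add_divide_distrib)
  qed
  also have "\<dots> = ?E * (2 * pi * (R - R0))"
    unfolding integral_inverse_norm_annulus(2)[OF R(1) less_imp_le[OF R(2)], symmetric] by (rule integral_mult_right_zero)
  also have "\<dots> \<le> ?E * (2 * pi * R)" using R by (intro mult_left_mono) auto
  also have "\<dots> = (modes_const N R0 * c * sqrt R)\<^sup>2"
    using R by (simp add: modes_const_def A_def B_def power_mult_distrib real_sqrt_pow2) (simp add: algebra_simps)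
  finally have "H1_norm ?O ?w \<le> sqrt ((modes_const N R0 * c * sqrt R)\<^sup>2)"
    unfolding H1_norm_eq[OF open_annulus wg] by (rule real_sqrt_le_mono)
  also have "\<dots> = modes_const N R0 * c * sqrt R" using c R by (simp add: modes_const_def)
  finally show "H1_norm ?O ?w \<le> modes_const N R0 * c * sqrt R" .
qed

section \<open>The candidate minimizers\<close>

lemma bessel_modes_H1:
  assumes R: "0 < R0" "R0 < R" and k: "0 < k" and p: "\<And>n. bessel_sol k R0 n (p n) (p' n)"
  shows "has_weak_grad (annulus R0 R) (modes N p) (\<lambda>x. \<chi> i. partial_deriv i (modes N p) x)"
    and "modes N p \<in> H1 (annulus R0 R)" and "modes N p \<in> L2 (annulus R0 R)" and "partial_deriv i (modes N p) \<in> L2 (annulus R0 R)"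
proof -
  have "\<exists>C>0. (\<forall>r\<ge>R0. sqrt r * cmod (p n r) \<le> C) \<and> (\<forall>r\<ge>R0. sqrt r * cmod (p' n r) \<le> C)" for n
    using bessel_sol_bounded[OF p[of n] R(1) k] by metis
  then obtain C where C: "\<And>n. C n > 0" "\<And>n r. R0 \<le> r \<Longrightarrow> sqrt r * cmod (p n r) \<le> C n" "\<And>n r. R0 \<le> r \<Longrightarrow> sqrt r * cmod (p' n r) \<le> C n"
    by metis
  define c where "c = (\<Sum>n = - int N..int N. C n)"
  have Cc: "C n \<le> c" if "n \<in> {- int N..int N}" for n
    unfolding c_def using C(1) that by (intro member_le_sum) (auto intro: less_imp_le)
  have c0: "c \<ge> 0" unfolding c_def using C(1) by (intro sum_nonneg) (auto intro: less_imp_le)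
  note est = modes_estimate[OF R c0, of N p p']
  have 1: "(p n has_vector_derivative p' n r) (at r)" if "R0 < r" for n r using bessel_solD(3)[OF p that] .
  have 2: "continuous_on {R0<..<R} (p' n)" for n by (rule continuous_on_subset[OF bessel_solD(2)[OF p]]) auto
  have 3: "sqrt r * cmod (p n r) \<le> c" "sqrt r * cmod (p' n r) \<le> c" if "n \<in> {- int N..int N}" "R0 < r" for n r
    using C(2,3)[of r n] Cc[OF that(1)] that(2) by auto
  show "has_weak_grad (annulus R0 R) (modes N p) (\<lambda>x. \<chi> i. partial_deriv i (modes N p) x)"
    "modes N p \<in> H1 (annulus R0 R)" "modes N p \<in> L2 (annulus R0 R)" "partial_deriv i (modes N p) \<in> L2 (annulus R0 R)"
    by (rule est; use 1 2 3 in auto)+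
qed

lemma weak_helmholtz_bessel_mode:
  assumes R: "0 < R0" "R0 < R" and p: "bessel_sol k R0 n p p'" and \<phi>: "\<phi> \<in> test_functions (annulus R0 R)"
  shows "(LINT x|lebesgue_on (annulus R0 R). mode p n x * (laplacian \<phi> x + (of_real k)\<^sup>2 * \<phi> x)) = 0"
    and "integrable (lebesgue_on (annulus R0 R)) (\<lambda>x. mode p n x * (laplacian \<phi> x + (of_real k)\<^sup>2 * \<phi> x))"
proof -
  let ?O = "annulus R0 R"
  let ?M = "lebesgue_on ?O"
  note pD = bessel_solD[OF p]
  have S: "open {R0<..<R}" "{R0<..<R} \<subseteq> {0<..}" using R by auto
  have setO: "{x :: real^2. norm x \<in> {R0<..<R}} = ?O" by auto
  have "Ck_line 1 {R0<..<R} p" by (rule Ck_line_subset[OF Ck_line_bessel_sol(1)[OF p R(1)]]) auto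
  from Ck_on_mode[OF S this] have C1: "Ck_on 1 ?O (mode p n)" unfolding setO .
  note wg = has_weak_grad_classical[OF open_annulus C1]
  let ?b = "\<lambda>r. \<i> * of_int n * p r / of_real r"
  let ?V = "vfield p' ?b n"
  have dV: "partial_deriv i (mode p n) x = ?V i x" if "x \<in> ?O" for i x
    using that R pD(3) by (intro partial_deriv_mode_vfield) auto
  have t: "partial_deriv i \<phi> \<in> test_functions ?O" for i by (rule test_functions_partial_deriv[OF \<phi> open_annulus])
  have l1: "mode p n \<in> L1_loc ?O" "partial_deriv i (mode p n) \<in> L1_loc ?O" for i using wg by (auto simp: has_weak_grad_def)
  have ii: "integrable ?M (\<lambda>x. mode p n x * \<phi> x)" "integrable ?M (\<lambda>x. mode p n x * partial_deriv i (partial_deriv i \<phi>) x)"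
    "integrable ?M (\<lambda>x. partial_deriv i (mode p n) x * partial_deriv i \<phi> x)" for i
    by (intro integrable_L1_loc_mult_test[OF l1(1) open_annulus] integrable_L1_loc_mult_test[OF l1(2) open_annulus] \<phi> t test_functions_partial_deriv[OF t open_annulus])+
  have ibp: "(LINT x|?M. mode p n x * partial_deriv i (partial_deriv i \<phi>) x) = - (LINT x|?M. partial_deriv i (mode p n) x * partial_deriv i \<phi> x)" for i
    using wg t[of i] unfolding has_weak_grad_def by simp
  have split: "(\<lambda>x. mode p n x * (laplacian \<phi> x + (of_real k)\<^sup>2 * \<phi> x)) = (\<lambda>x. (mode p n x * partial_deriv 1 (partial_deriv 1 \<phi>) x
      + mode p n x * partial_deriv 2 (partial_deriv 2 \<phi>) x) + of_real k ^ 2 * (mode p n x * \<phi> x))"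
    by (simp add: laplacian_def sum_2 algebra_simps fun_eq_iff)
  show "integrable ?M (\<lambda>x. mode p n x * (laplacian \<phi> x + (of_real k)\<^sup>2 * \<phi> x))"
    unfolding split by (intro Bochner_Integration.integrable_add integrable_mult_right ii)
  have "(LINT x|?M. mode p n x * (laplacian \<phi> x + (of_real k)\<^sup>2 * \<phi> x))
      = - (LINT x|?M. partial_deriv 1 (mode p n) x * partial_deriv 1 \<phi> x) - (LINT x|?M. partial_deriv 2 (mode p n) x * partial_deriv 2 \<phi> x)
        + of_real k ^ 2 * (LINT x|?M. mode p n x * \<phi> x)"
    unfolding split using ii ibp by simp
  also have "\<dots> = - (LINT x|?M. (partial_deriv 1 (mode p n) x * partial_deriv 1 \<phi> x + partial_deriv 2 (mode p n) x * partial_deriv 2 \<phi> x)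
        - of_real k ^ 2 * (mode p n x * \<phi> x))"
    using ii by simp
  also have "(LINT x|?M. (partial_deriv 1 (mode p n) x * partial_deriv 1 \<phi> x + partial_deriv 2 (mode p n) x * partial_deriv 2 \<phi> x)
        - of_real k ^ 2 * (mode p n x * \<phi> x))
      = (LINT x|?M. (\<Sum>i\<in>UNIV. partial_deriv i \<phi> x * ?V i x) + \<phi> x * vdiv p' (bessel_rhs k n p p') ?b n x)"
  proof (rule Bochner_Integration.integral_cong[OF refl])
    fix x assume "x \<in> space ?M"
    then have x: "x \<in> ?O" by simp
    then have r: "complex_of_real (norm x) \<noteq> 0" using R by auto
    have "vdiv p' (bessel_rhs k n p p') ?b n x = - (of_real k ^ 2 * mode p n x)"
    proof -
      have "bessel_rhs k n p p' (norm x) + p' (norm x) / of_real (norm x) + \<i> * of_int n * ?b (norm x) / of_real (norm x) = - (of_real k ^ 2 * p (norm x))"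
        using r by (simp add: bessel_rhs_def field_simps power2_eq_square)
      then show ?thesis by (simp add: vdiv_def mode_def)
    qed
    then show "(partial_deriv 1 (mode p n) x * partial_deriv 1 \<phi> x + partial_deriv 2 (mode p n) x * partial_deriv 2 \<phi> x) - of_real k ^ 2 * (mode p n x * \<phi> x)
      = (\<Sum>i\<in>UNIV. partial_deriv i \<phi> x * ?V i x) + \<phi> x * vdiv p' (bessel_rhs k n p p') ?b n x"
      unfolding sum_2 dV[OF x] by (simp add: algebra_simps)
  qed
  also have "\<dots> = 0"
  proof -
    obtain K where K: "K \<subseteq> ?O" "\<And>x. x \<notin> K \<Longrightarrow> \<phi> x = 0" using test_functions_compact_support[OF \<phi>] by metis
    have z: "\<phi> (polar R \<omega>) = 0" "\<phi> (polar R0 \<omega>) = 0" for \<omega> using K R by (auto intro!: K(2))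
    have sub: "{R0..R} \<subseteq> {R0..}" by auto
    have cb: "continuous_on {R0..R} ?b" and crhs: "continuous_on {R0..R} (bessel_rhs k n p p')"
      unfolding bessel_rhs_def[abs_def] using R
      by (auto intro!: continuous_intros continuous_on_subset[OF pD(1) sub] continuous_on_subset[OF pD(2) sub])
    show ?thesis
      using green_mode_field[OF R(1) less_imp_le[OF R(2)] subset_UNIV test_functions_Ck[OF \<phi>]
          continuous_on_subset[OF pD(2) sub] crhs pD(4) cb, of n] z by simp
  qed
  finally show "(LINT x|?M. mode p n x * (laplacian \<phi> x + (of_real k)\<^sup>2 * \<phi> x)) = 0" by simp
qed

lemma weak_helmholtz_bessel_modes:
  assumes R: "0 < R0" "R0 < R" and k: "0 < k" and p: "\<And>n. bessel_sol k R0 n (p n) (p' n)"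
  shows "weak_helmholtz k (annulus R0 R) (modes N p)"
  unfolding weak_helmholtz_def
proof (intro conjI ballI)
  show "modes N p \<in> L1_loc (annulus R0 R)" using bessel_modes_H1(1)[OF R k p] by (simp add: has_weak_grad_def)
  fix \<phi> assume \<phi>: "\<phi> \<in> test_functions (annulus R0 R)"
  show "(LINT x|lebesgue_on (annulus R0 R). modes N p x * (laplacian \<phi> x + (of_real k)\<^sup>2 * \<phi> x)) = 0"
    unfolding modes_def sum_distrib_right
    using weak_helmholtz_bessel_mode[OF R p \<phi>] by (subst Bochner_Integration.integral_sum) auto
qed

lemma dilation_uniform:
  fixes G :: "real \<Rightarrow> real \<Rightarrow> complex"
  assumes "continuous_on ({1..2} \<times> {R0..R}) (\<lambda>(s, r). G s r)" "e > 0"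
  shows "\<forall>\<^sub>F j in sequentially. \<forall>r\<in>{R0..R}. cmod (G (1 + 1 / real (Suc j)) r - G 1 r) < e"
proof -
  have "uniformly_continuous_on ({1..2} \<times> {R0..R}) (\<lambda>(s, r). G s r)"
    by (rule compact_uniformly_continuous[OF assms(1)]) (intro compact_Times compact_Icc)
  then obtain d where d: "d > 0" "\<And>x y. x \<in> {1..2} \<times> {R0..R} \<Longrightarrow> y \<in> {1..2} \<times> {R0..R} \<Longrightarrow> dist y x < d \<Longrightarrow> dist (case y of (s, r) \<Rightarrow> G s r) (case x of (s, r) \<Rightarrow> G s r) < e"
    using assms(2) unfolding uniformly_continuous_on_def by metis
  have "\<forall>\<^sub>F j in sequentially. 1 / real (Suc j) < d"
    using LIMSEQ_Suc[OF lim_1_over_n] d(1) by (rule order_tendstoD(2))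
  then show ?thesis
  proof eventually_elim
    case (elim j)
    show ?case
    proof
      fix r assume r: "r \<in> {R0..R}"
      have "1 / real (Suc j) \<le> 1" by simp
      then have "dist (case (1 + 1 / real (Suc j), r) of (s, r) \<Rightarrow> G s r) (case (1, r) of (s, r) \<Rightarrow> G s r) < e"
        using r elim by (intro d(2)) (auto simp: dist_Pair_Pair dist_norm)
      then show "cmod (G (1 + 1 / real (Suc j)) r - G 1 r) < e" by (simp add: dist_norm)
    qed
  qed
qed

lemma modes_diff: "modes N q x - modes N p x = modes N (\<lambda>n r. q n r - p n r) x"
  by (simp add: modes_def mode_def sum_subtractf left_diff_distrib)

lemma modes_polar: "0 < r \<Longrightarrow> modes N p (polar r \<omega>) = trig_poly N (\<lambda>n. p n r) \<omega>"
  by (simp add: modes_def mode_def trig_poly_def emode_polar)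

lemma continuous_on_trig_poly: "continuous_on S (trig_poly N c)"
  unfolding trig_poly_def[abs_def] by (intro continuous_intros)

text \<open>The modes are smooth only outside the closed disc of radius \<open>R0\<close>. Their dilations
  \<open>x \<mapsto> v (l x)\<close> with \<open>l > 1\<close> are smooth in a neighbourhood of the closed annulus and converge to \<open>v\<close> in \<open>C\<^sup>1\<close>
  on the annulus as \<open>l \<rightarrow> 1\<close>.\<close>

lemma trace_bessel_modes:
  assumes R: "0 < R0" "R0 < R" and k: "0 < k" and p: "\<And>n. bessel_sol k R0 n (p n) (p' n)"
    and bc: "\<And>n. \<bar>n\<bar> \<le> int N \<Longrightarrow> p n R0 = c n"
  shows "has_trace_on_circle (annulus R0 R) R0 (modes N p) (trig_poly N c)"
proof -
  let ?O = "annulus R0 R" and ?I = "lebesgue_on {0..2 * pi}"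
  define l where "l j = 1 + 1 / real (Suc j)" for j
  have l: "1 < l j" "l j \<le> 2" "l j > 0" for j by (auto simp: l_def intro: add_pos_pos)
  define q where "q j n r = p n (l j * r)" for j n r
  define q' where "q' j n r = of_real (l j) * p' n (l j * r)" for j n r
  define v where "v j = modes N (q j)" for j
  have lr: "R0 < l j * r" if "R0 \<le> r" for j r
  proof -
    have "1 * r < l j * r" using l[of j] that R by (intro mult_strict_right_mono) auto
    then show ?thesis using that by simp
  qed
  have dq: "(q j n has_vector_derivative q' j n r) (at r)" if "R0 \<le> r" for j n r
  proof -
    have "((\<lambda>r. l j * r) has_vector_derivative l j) (at r)"
      by (auto simp: has_real_derivative_iff_has_vector_derivative[symmetric] intro!: derivative_eq_intros)
    from vector_diff_chain_at[OF this bessel_solD(3)[OF p lr[OF that]]]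
    show ?thesis by (simp add: q_def[abs_def] q'_def o_def scaleR_conv_of_real)
  qed
  have cq': "continuous_on {R0..R} (q' j n)" for j n
    unfolding q'_def[abs_def]
    by (intro continuous_intros continuous_on_compose2[OF bessel_solD(2)[OF p]]) (use lr in \<open>auto intro: less_imp_le\<close>)
  have "\<exists>C>0. (\<forall>r\<ge>R0. sqrt r * cmod (p n r) \<le> C) \<and> (\<forall>r\<ge>R0. sqrt r * cmod (p' n r) \<le> C)" for n
    using bessel_sol_bounded[OF p[of n] R(1) k] by metis
  then obtain C where C: "\<And>n. C n > 0" "\<And>n r. R0 \<le> r \<Longrightarrow> sqrt r * cmod (p n r) \<le> C n" "\<And>n r. R0 \<le> r \<Longrightarrow> sqrt r * cmod (p' n r) \<le> C n"
    by metis
  define c0 where "c0 = 2 * (\<Sum>n = - int N..int N. C n)"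
  have Cc: "2 * C n \<le> c0" "C n \<le> c0" if "n \<in> {- int N..int N}" for n
  proof -
    have "C n \<le> (\<Sum>n = - int N..int N. C n)" using C(1) that by (intro member_le_sum) (auto intro: less_imp_le)
    then show "2 * C n \<le> c0" "C n \<le> c0" using C(1)[of n] by (auto simp: c0_def)
  qed
  have c00: "c0 \<ge> 0" unfolding c0_def using C(1) by (intro mult_nonneg_nonneg sum_nonneg) (auto intro: less_imp_le)
  have vH1: "v j \<in> H1 ?O" for j
    unfolding v_def
  proof (rule modes_estimate(2)[OF R c00, where q'="q' j"])
    fix n r assume n: "n \<in> {- int N..int N}" and r: "R0 < r" "r < R"
    show "(q j n has_vector_derivative q' j n r) (at r)" by (rule dq) (use r in simp)
    have "sqrt r \<le> sqrt (l j * r)" using l[of j] r R by (intro real_sqrt_le_mono) (simp add: mult_right_le_one_le field_simps)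
    then have 1: "sqrt r * cmod t \<le> sqrt (l j * r) * cmod t" for t by (intro mult_right_mono) auto
    show "sqrt r * cmod (q j n r) \<le> c0"
    proof -
      have "sqrt r * cmod (p n (l j * r)) \<le> C n" using order_trans[OF 1 C(2)[OF less_imp_le[OF lr]]] r by simp
      then show ?thesis using Cc(2)[OF n] by (simp add: q_def)
    qed
    have "sqrt r * cmod (p' n (l j * r)) \<le> C n" using order_trans[OF 1 C(3)[OF less_imp_le[OF lr]]] r by simp
    then have "l j * (sqrt r * cmod (p' n (l j * r))) \<le> 2 * C n" using l[of j] r R by (intro mult_mono) auto
    then show "sqrt r * cmod (q' j n r) \<le> c0" using Cc[OF n] l[of j] by (simp add: q'_def norm_mult mult_ac)
  next
    fix n show "continuous_on {R0<..<R} (q' j n)" by (rule continuous_on_subset[OF cq']) auto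
  qed
  have vsm: "\<exists>U. closure ?O \<subseteq> U \<and> smooth_on_open U (v j)" for j
  proof (intro exI conjI)
    let ?S = "{R0 / l j<..}"
    have S: "open ?S" "?S \<subseteq> {0<..}" using R l[of j] by (auto intro: less_trans[OF divide_pos_pos])
    have U: "open {x :: real^2. norm x \<in> ?S}" by (rule open_radial[OF S(1)])
    have "closure ?O \<subseteq> closed_annulus R0 R"
      by (intro closure_minimal annulus_subset_closed_annulus compact_imp_closed compact_closed_annulus)
    moreover have "R0 / l j < R0" using R l[of j] by (simp add: field_simps)
    ultimately show "closure ?O \<subseteq> {x. norm x \<in> ?S}" by (force simp: closed_annulus_def)
    have "Ck_line m ?S (q j n)" for m n
      unfolding q_def[abs_def]
      using Ck_line_subset[OF Ck_line_affine[OF Ck_line_bessel_sol(1)[OF p R(1)], of m "l j" 0], of ?S] l[of j]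
      by (simp add: subset_iff field_simps)
    then have "Ck_on m {x. norm x \<in> ?S} (v j)" for m
      unfolding v_def modes_def[abs_def] by (intro Ck_on_sum U Ck_on_mode S)
    then show "smooth_on_open {x. norm x \<in> ?S} (v j)" using U by (simp add: smooth_on_open_def)
  qed
  have D0: "modes_const N R0 \<ge> 0" by (simp add: modes_const_def)
  have H1lim: "(\<lambda>j. H1_norm ?O (\<lambda>x. v j x - modes N p x)) \<longlonglongrightarrow> 0"
  proof (rule tendstoI)
    fix e :: real assume e: "e > 0"
    define d where "d = e / (2 * (modes_const N R0 * R + 1))"
    have den: "modes_const N R0 * R + 1 > 0" using D0 R by (simp add: add_nonneg_pos)
    have d: "d > 0" using e den by (simp add: d_def)
    have cG: "continuous_on ({1..2} \<times> {R0..R}) (\<lambda>(s, r). g (s * r))" if g: "continuous_on {R0..} g" for g :: "real \<Rightarrow> complex"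
    proof -
      have sr: "R0 \<le> s * r" if "1 \<le> s" "R0 \<le> r" for s r
        using mult_mono[of 1 s R0 r] that R by simp
      show ?thesis unfolding split_beta
        by (intro continuous_on_compose2[OF g] continuous_intros) (use sr in auto)
    qed
    have cG': "continuous_on ({1..2} \<times> {R0..R}) (\<lambda>(s, r). of_real s * g (s * r))" if g: "continuous_on {R0..} g" for g :: "real \<Rightarrow> complex"
      unfolding split_beta using cG[OF g, unfolded split_beta] by (intro continuous_on_mult continuous_intros) auto
    have ev: "\<forall>\<^sub>F j in sequentially. \<forall>n\<in>{- int N..int N}. (\<forall>r\<in>{R0..R}. cmod (q j n r - p n r) < d) \<and> (\<forall>r\<in>{R0..R}. cmod (q' j n r - p' n r) < d)"
    proof (rule eventually_ball_finite, simp, intro ballI)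
      fix n
      show "\<forall>\<^sub>F j in sequentially. (\<forall>r\<in>{R0..R}. cmod (q j n r - p n r) < d) \<and> (\<forall>r\<in>{R0..R}. cmod (q' j n r - p' n r) < d)"
        using dilation_uniform[OF cG[OF bessel_solD(1)[OF p[of n]]] d] dilation_uniform[OF cG'[OF bessel_solD(2)[OF p[of n]]] d]
        by eventually_elim (simp add: q_def q'_def l_def)
    qed
    then show "\<forall>\<^sub>F j in sequentially. dist (H1_norm ?O (\<lambda>x. v j x - modes N p x)) 0 < e"
    proof eventually_elim
      case (elim j)
      have "H1_norm ?O (modes N (\<lambda>n r. q j n r - p n r)) \<le> modes_const N R0 * (sqrt R * d) * sqrt R"
      proof (rule modes_estimate(5)[OF R, where q'="\<lambda>n r. q' j n r - p' n r"])
        show "0 \<le> sqrt R * d" using d R by simp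
        fix n r assume n: "n \<in> {- int N..int N}" and r: "R0 < r" "r < R"
        show "((\<lambda>r. q j n r - p n r) has_vector_derivative q' j n r - p' n r) (at r)"
          using r by (intro has_vector_derivative_diff dq bessel_solD(3)[OF p]) auto
        have "cmod (q j n r - p n r) < d" "cmod (q' j n r - p' n r) < d" using elim n r by auto
        then show "sqrt r * cmod (q j n r - p n r) \<le> sqrt R * d" "sqrt r * cmod (q' j n r - p' n r) \<le> sqrt R * d"
          using r R by (auto intro!: mult_mono)
      next
        fix n show "continuous_on {R0<..<R} (\<lambda>r. q' j n r - p' n r)"
          by (intro continuous_on_diff continuous_on_subset[OF cq'] continuous_on_subset[OF bessel_solD(2)[OF p]]) auto
      qed
      also have "\<dots> = modes_const N R0 * R * d" using R by (simp add: algebra_simps flip: power2_eq_square)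
      also have "\<dots> \<le> (modes_const N R0 * R + 1) * d" using d by (simp add: algebra_simps)
      also have "\<dots> = e / 2"
      proof -
        have "z * (e / (2 * z)) = e / 2" if "z > 0" for z :: real using that by simp
        from this[OF den] show ?thesis by (simp only: d_def)
      qed
      finally have "H1_norm ?O (modes N (\<lambda>n r. q j n r - p n r)) < e" using e by simp
      moreover have "(\<lambda>x. v j x - modes N p x) = modes N (\<lambda>n r. q j n r - p n r)"
        by (simp add: v_def modes_diff fun_eq_iff)
      moreover have "H1_norm ?O f \<ge> 0" for f by (simp add: H1_norm_def)
      ultimately show ?case by (simp add: dist_norm)
    qed
  qed
  have plim: "(\<lambda>j. q j n R0) \<longlonglongrightarrow> p n R0" for n
  proof -
    have "(\<lambda>j. l j * R0) \<longlonglongrightarrow> (1 + 0) * R0" unfolding l_def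
      by (intro tendsto_intros LIMSEQ_Suc[OF lim_1_over_n])
    then show ?thesis unfolding q_def
      by (intro continuous_on_tendsto_compose[OF bessel_solD(1)[OF p]]) (use lr[of R0] in \<open>auto intro!: always_eventually less_imp_le\<close>)
  qed
  define d where "d j = (\<Sum>n = - int N..int N. cmod (q j n R0 - c n))" for j
  have dlim: "d \<longlonglongrightarrow> 0"
  proof -
    have "(\<lambda>j. \<Sum>n = - int N..int N. cmod (q j n R0 - c n)) \<longlonglongrightarrow> (\<Sum>n = - int N..int N. cmod (p n R0 - c n))"
      by (intro tendsto_intros plim)
    moreover have "(\<Sum>n = - int N..int N. cmod (p n R0 - c n)) = 0" by (intro sum.neutral) (auto simp: bc)
    ultimately show ?thesis by (simp add: d_def[abs_def])
  qed
  have pt: "cmod (v j (polar R0 \<omega>) - trig_poly N c \<omega>) \<le> d j" for j \<omega>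
  proof -
    have "v j (polar R0 \<omega>) - trig_poly N c \<omega> = (\<Sum>n = - int N..int N. (q j n R0 - c n) * exp (\<i> * of_int n * of_real \<omega>))"
      unfolding v_def modes_polar[OF R(1)] trig_poly_def by (simp add: sum_subtractf left_diff_distrib)
    also have "cmod \<dots> \<le> (\<Sum>n = - int N..int N. cmod ((q j n R0 - c n) * exp (\<i> * of_int n * of_real \<omega>)))" by (rule norm_sum)
    also have "\<dots> = d j" unfolding d_def norm_mult using norm_exp_i_times[of "of_int n * \<omega>" for n] by (simp add: mult.assoc)
    finally show ?thesis .
  qed
  have "(\<lambda>j. LINT \<omega>|?I. (cmod (v j (polar R0 \<omega>) - trig_poly N c \<omega>))\<^sup>2) \<longlonglongrightarrow> 0"
  proof (rule tendsto_sandwich[OF _ _ tendsto_const])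
    show "\<forall>\<^sub>F j in sequentially. 0 \<le> (LINT \<omega>|?I. (cmod (v j (polar R0 \<omega>) - trig_poly N c \<omega>))\<^sup>2)" by simp
    show "(\<lambda>j. (d j)\<^sup>2 * (2 * pi)) \<longlonglongrightarrow> 0" using tendsto_mult[OF tendsto_power[OF dlim, of 2] tendsto_const[of "2 * pi"]] by simp
    show "\<forall>\<^sub>F j in sequentially. (LINT \<omega>|?I. (cmod (v j (polar R0 \<omega>) - trig_poly N c \<omega>))\<^sup>2) \<le> (d j)\<^sup>2 * (2 * pi)"
    proof (intro always_eventually allI)
      fix j
      have "(LINT \<omega>|?I. (cmod (v j (polar R0 \<omega>) - trig_poly N c \<omega>))\<^sup>2) \<le> (LINT \<omega>|?I. (d j)\<^sup>2)"
      proof (rule integral_mono)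
        show "integrable ?I (\<lambda>\<omega>. (cmod (v j (polar R0 \<omega>) - trig_poly N c \<omega>))\<^sup>2)"
          unfolding v_def modes_polar[OF R(1)] by (intro continuous_imp_integrable_real continuous_intros continuous_on_trig_poly)
        show "integrable ?I (\<lambda>\<omega>. (d j)\<^sup>2)" by (intro continuous_imp_integrable_real continuous_intros)
        show "(cmod (v j (polar R0 \<omega>) - trig_poly N c \<omega>))\<^sup>2 \<le> (d j)\<^sup>2" for \<omega> by (intro power_mono pt) auto
      qed
      also have "\<dots> = (d j)\<^sup>2 * (2 * pi)" by (simp add: measure_restrict_space)
      finally show "(LINT \<omega>|?I. (cmod (v j (polar R0 \<omega>) - trig_poly N c \<omega>))\<^sup>2) \<le> (d j)\<^sup>2 * (2 * pi)" .
    qed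
  qed
  then show ?thesis unfolding has_trace_on_circle_def using vH1 vsm H1lim by blast
qed

section \<open>Minimality\<close>

lemma partial_deriv_rhat:
  assumes "x \<noteq> 0"
  shows "partial_deriv i (rhat i) x = inverse (of_real (norm x)) - rhat i x * rhat i x * inverse (of_real (norm x))"
proof -
  have r: "norm x > 0" "complex_of_real (norm x) \<noteq> 0" using assms by auto
  have d1: "((\<lambda>r. complex_of_real r) has_vector_derivative 1) (at (x $ i))" by (rule has_vector_derivative_complex_of_real)
  have "((\<lambda>r. inverse r) has_real_derivative - (inverse (norm x) ^ Suc (Suc 0))) (at (norm x))"
    by (rule DERIV_inverse) (use r in simp)
  from has_vector_derivative_of_real[OF this, where 'a=complex]
  have d2: "((\<lambda>r. inverse (complex_of_real r)) has_vector_derivative - (inverse (of_real (norm x)) * inverse (of_real (norm x)))) (at (norm x))"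
    by simp
  have e: "rhat i = (\<lambda>x. complex_of_real (x $ i) * inverse (complex_of_real (norm x)))"
    by (simp add: rhat_def fun_eq_iff divide_inverse)
  have "partial_deriv i (rhat i) x = of_real (x $ i) * (- (inverse (of_real (norm x)) * inverse (of_real (norm x))) * of_real (x $ i) * inverse (of_real (norm x)))
      + (if i = i then 1 else 0) * inverse (of_real (norm x))"
    unfolding e partial_deriv_mult[OF partial_deriv_coordinate(1)[OF d1] partial_deriv_radial(1)[OF d2 assms]]
      partial_deriv_coordinate(2)[OF d1] partial_deriv_radial(2)[OF d2 assms] ..
  then show ?thesis by (simp add: rhat_def divide_inverse algebra_simps)
qed

text \<open>If \<open>\<nabla>h = i k h x/\<bar>x\<bar>\<close>, taking the divergence gives \<open>\<Delta>h = - k\<^sup>2 h + i k h/\<bar>x\<bar>\<close>, since the divergence of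
  \<open>x/\<bar>x\<bar>\<close> in the plane is \<open>1/\<bar>x\<bar>\<close>. Comparison with the Helmholtz equation leaves \<open>i k h/\<bar>x\<bar> = 0\<close>. The
  computation is carried out weakly with the test function \<open>\<bar>x\<bar> \<phi>0\<close>.\<close>

lemma outgoing_gradient_imp_zero:
  assumes R: "0 < R0" and k: "0 < k"
    and H: "has_weak_grad (annulus R0 R) h H" and wh: "weak_helmholtz k (annulus R0 R) h"
    and eq: "\<And>i. AE x in lebesgue_on (annulus R0 R). H x $ i = \<i> * of_real k * h x * rhat i x"
  shows "AE x in lebesgue_on (annulus R0 R). h x = 0"
proof (rule fundamental_lemma_calculus_of_variations[OF _ open_annulus])
  let ?O = "annulus R0 R"
  let ?M = "lebesgue_on ?O"
  show hl: "h \<in> L1_loc ?O" using H by (simp add: has_weak_grad_def)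
  fix \<phi>0 assume \<phi>0: "\<phi>0 \<in> test_functions ?O"
  have sub: "?O \<subseteq> {x. x \<noteq> 0}" using R by auto
  have "Ck_on m {x :: real^2. norm x \<in> {0<..}} (\<lambda>x. complex_of_real (norm x))" for m
    by (intro Ck_on_radial Ck_line_of_real) auto
  then have "Ck_on m ?O (\<lambda>x. complex_of_real (norm x))" for m
    by (rule Ck_on_subset) (use R in auto)
  then have nsm: "smooth_on_open ?O (\<lambda>x. complex_of_real (norm x))" by (simp add: smooth_on_open_def open_annulus)
  define \<phi> where "\<phi> x = of_real (norm x) * \<phi>0 x" for x
  have \<phi>: "\<phi> \<in> test_functions ?O" unfolding \<phi>_def by (rule test_functions_mult_smooth[OF open_annulus nsm \<phi>0])
  have rsm: "smooth_on_open ?O (rhat i)" for i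
    using Ck_on_subset[OF Ck_on_rhat sub] by (simp add: smooth_on_open_def open_annulus)
  have t: "partial_deriv i \<phi> \<in> test_functions ?O" for i by (rule test_functions_partial_deriv[OF \<phi> open_annulus])
  have r\<phi>: "(\<lambda>x. rhat i x * \<phi> x) \<in> test_functions ?O" for i by (rule test_functions_mult_smooth[OF open_annulus rsm \<phi>])
  have rt: "(\<lambda>x. rhat i x * partial_deriv i \<phi> x) \<in> test_functions ?O" for i by (rule test_functions_mult_smooth[OF open_annulus rsm t])
  have rr\<phi>: "(\<lambda>x. rhat i x * (rhat i x * \<phi> x)) \<in> test_functions ?O" for i by (rule test_functions_mult_smooth[OF open_annulus rsm r\<phi>])
  note I = integrable_L1_loc_mult_test[OF hl open_annulus]
  have subst: "(LINT x|?M. H x $ i * g x) = \<i> * of_real k * (LINT x|?M. h x * (rhat i x * g x))" for i g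
  proof -
    have "(LINT x|?M. H x $ i * g x) = (LINT x|?M. \<i> * of_real k * (h x * (rhat i x * g x)))"
      by (rule lebesgue_on_cong_AE(2)[OF annulus_sets]) (use eq[of i] in \<open>eventually_elim, simp add: mult_ac\<close>)
    then show ?thesis by (simp only: integral_mult_right_zero)
  qed
  have ibp: "(LINT x|?M. h x * partial_deriv i g x) = - (\<i> * of_real k * (LINT x|?M. h x * (rhat i x * g x)))"
    if "g \<in> test_functions ?O" for i g
  proof -
    have "(LINT x|?M. h x * partial_deriv i g x) = - (LINT x|?M. H x $ i * g x)"
      using H that unfolding has_weak_grad_def by blast
    then show ?thesis unfolding subst .
  qed
  let ?a = "\<lambda>i. LINT x|?M. h x * (rhat i x * partial_deriv i \<phi> x)"
  let ?m = "LINT x|?M. h x * \<phi> x"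
  have dr: "partial_deriv i (\<lambda>x. rhat i x * \<phi> x) x = rhat i x * partial_deriv i \<phi> x + (\<phi>0 x - rhat i x * (rhat i x * \<phi>0 x))" if x: "x \<in> ?O" for i x
  proof -
    have x0: "x \<noteq> 0" "complex_of_real (norm x) \<noteq> 0" using x R by auto
    have "Ck_on (Suc 0) {x. x \<noteq> 0} (rhat i)" "Ck_on (Suc 0) UNIV \<phi>" by (rule Ck_on_rhat, rule test_functions_Ck[OF \<phi>])
    then have d: "rhat i differentiable (at x)" "\<phi> differentiable (at x)" using x0 by auto
    have "inverse (of_real (norm x)) * \<phi> x = \<phi>0 x" using x0 by (simp add: \<phi>_def)
    then show ?thesis
      unfolding partial_deriv_mult[OF d] partial_deriv_rhat[OF x0(1)] left_diff_distrib by (simp add: mult.assoc)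
  qed
  have I0: "integrable ?M (\<lambda>x. h x * \<phi>0 x)" by (rule I[OF \<phi>0])
  have r\<phi>0: "(\<lambda>x. rhat i x * (rhat i x * \<phi>0 x)) \<in> test_functions ?O" for i
    by (intro test_functions_mult_smooth[OF open_annulus rsm] \<phi>0)
  have one: "?a i + (LINT x|?M. h x * \<phi>0 x) - (LINT x|?M. h x * (rhat i x * (rhat i x * \<phi>0 x)))
      = - (\<i> * of_real k * (LINT x|?M. h x * (rhat i x * (rhat i x * \<phi> x))))" for i
  proof -
    have "(LINT x|?M. h x * partial_deriv i (\<lambda>x. rhat i x * \<phi> x) x)
       = (LINT x|?M. h x * (rhat i x * partial_deriv i \<phi> x) + h x * \<phi>0 x - h x * (rhat i x * (rhat i x * \<phi>0 x)))"
    proof (rule Bochner_Integration.integral_cong[OF refl])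
      fix x assume "x \<in> space ?M"
      then have x: "x \<in> ?O" by simp
      show "h x * partial_deriv i (\<lambda>x. rhat i x * \<phi> x) x
          = h x * (rhat i x * partial_deriv i \<phi> x) + h x * \<phi>0 x - h x * (rhat i x * (rhat i x * \<phi>0 x))"
        unfolding dr[OF x] by (simp only: distrib_left right_diff_distrib add_diff_eq)
    qed
    also have "\<dots> = ?a i + (LINT x|?M. h x * \<phi>0 x) - (LINT x|?M. h x * (rhat i x * (rhat i x * \<phi>0 x)))"
      using I[OF rt] I0 I[OF r\<phi>0] by simp
    finally show ?thesis using ibp[OF r\<phi>] by simp
  qed
  have sumr: "(LINT x|?M. h x * (rhat 1 x * (rhat 1 x * g x))) + (LINT x|?M. h x * (rhat 2 x * (rhat 2 x * g x))) = (LINT x|?M. h x * g x)"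
    if g: "g \<in> test_functions ?O" for g
  proof -
    have rg: "(\<lambda>x. rhat i x * (rhat i x * g x)) \<in> test_functions ?O" for i
      by (intro test_functions_mult_smooth[OF open_annulus rsm] g)
    have "(LINT x|?M. h x * (rhat 1 x * (rhat 1 x * g x))) + (LINT x|?M. h x * (rhat 2 x * (rhat 2 x * g x)))
       = (LINT x|?M. h x * (rhat 1 x * (rhat 1 x * g x)) + h x * (rhat 2 x * (rhat 2 x * g x)))"
      using I[OF rg] by simp
    also have "\<dots> = (LINT x|?M. h x * g x)"
    proof (rule Bochner_Integration.integral_cong[OF refl])
      fix x assume "x \<in> space ?M"
      then have "x \<noteq> 0" using R by auto
      have "h x * (rhat 1 x * (rhat 1 x * g x)) + h x * (rhat 2 x * (rhat 2 x * g x)) = (rhat 1 x * rhat 1 x + rhat 2 x * rhat 2 x) * (h x * g x)"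
        by (simp add: algebra_simps)
      then show "h x * (rhat 1 x * (rhat 1 x * g x)) + h x * (rhat 2 x * (rhat 2 x * g x)) = h x * g x"
        unfolding sum_rhat_ahat[OF \<open>x \<noteq> 0\<close>] by simp
    qed
    finally show ?thesis .
  qed
  have add: "a1 + a2 = - (c * m) - m0"
    if "a1 + m0 - s1 = - (c * t1)" "a2 + m0 - s2 = - (c * t2)" "s1 + s2 = m0" "t1 + t2 = m" for a1 a2 c m m0 s1 s2 t1 t2 :: complex
    using that by algebra
  have A: "?a 1 + ?a 2 = - (\<i> * of_real k * ?m) - (LINT x|?M. h x * \<phi>0 x)"
    by (rule add[OF one one sumr[OF \<phi>0] sumr[OF \<phi>]])
  have "0 = (LINT x|?M. h x * (laplacian \<phi> x + (of_real k)\<^sup>2 * \<phi> x))"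
    using wh \<phi> unfolding weak_helmholtz_def by simp
  also have "\<dots> = (LINT x|?M. h x * partial_deriv 1 (partial_deriv 1 \<phi>) x + h x * partial_deriv 2 (partial_deriv 2 \<phi>) x + of_real k ^ 2 * (h x * \<phi> x))"
    by (simp add: laplacian_def sum_2 algebra_simps)
  also have "\<dots> = - (\<i> * of_real k * ?a 1) - \<i> * of_real k * ?a 2 + of_real k ^ 2 * ?m"
    using I[OF test_functions_partial_deriv[OF t open_annulus]] I[OF \<phi>] ibp[OF t] by simp
  also have "\<dots> = - \<i> * of_real k * (?a 1 + ?a 2) + of_real k ^ 2 * ?m" by (simp add: algebra_simps)
  also have "\<dots> = \<i> * of_real k * (LINT x|?M. h x * \<phi>0 x)" unfolding A by (simp add: algebra_simps power2_eq_square)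
  finally have "\<i> * of_real k * (LINT x|?M. h x * \<phi>0 x) = 0" by (rule sym)
  then show "(LINT x|?M. h x * \<phi>0 x) = 0" using k by simp
qed

lemma J_eq:
  assumes G: "has_weak_grad (annulus R0 R) u G"
  shows "J k R0 R u = (LINT x|lebesgue_on (annulus R0 R). (\<Sum>i\<in>UNIV. (cmod (G x $ i - \<i> * of_real k * u x * rhat i x))\<^sup>2))"
proof -
  have "J k R0 R u = (LINT x|lebesgue_on (annulus R0 R). (\<Sum>i\<in>UNIV. (cmod (weak_grad (annulus R0 R) u x $ i - \<i> * of_real k * u x * rhat i x))\<^sup>2))"
    unfolding J_def norm_vec_power2 by (simp add: rhat_def)
  also have "\<dots> = (LINT x|lebesgue_on (annulus R0 R). (\<Sum>i\<in>UNIV. (cmod (G x $ i - \<i> * of_real k * u x * rhat i x))\<^sup>2))"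
    by (rule lebesgue_on_cong_AE(2)[OF annulus_sets])
       (use weak_grad_AE_eq[OF open_annulus G] in \<open>eventually_elim, simp\<close>)
  finally show ?thesis .
qed

lemma L2_mult_bounded:
  assumes f: "f \<in> L2 (annulus R0 R)" and g: "g \<in> borel_measurable (lebesgue_on (annulus R0 R))" "\<And>x. x \<in> annulus R0 R \<Longrightarrow> cmod (g x) \<le> B"
  shows "(\<lambda>x. g x * f x) \<in> L2 (annulus R0 R)"
proof -
  have m: "f \<in> borel_measurable (lebesgue_on (annulus R0 R))" and i: "integrable (lebesgue_on (annulus R0 R)) (\<lambda>x. (cmod (f x))\<^sup>2)"
    using f by (auto simp: L2_def)
  have "integrable (lebesgue_on (annulus R0 R)) (\<lambda>x. (cmod (g x * f x))\<^sup>2)"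
  proof (rule Bochner_Integration.integrable_bound)
    show "integrable (lebesgue_on (annulus R0 R)) (\<lambda>x. B\<^sup>2 * (cmod (f x))\<^sup>2)" using i by (rule integrable_mult_right)
    show "(\<lambda>x. (cmod (g x * f x))\<^sup>2) \<in> borel_measurable (lebesgue_on (annulus R0 R))" using m g(1) by measurable
    show "AE x in lebesgue_on (annulus R0 R). norm ((cmod (g x * f x))\<^sup>2) \<le> norm (B\<^sup>2 * (cmod (f x))\<^sup>2)"
    proof (rule AE_I2)
      fix x assume "x \<in> space (lebesgue_on (annulus R0 R))"
      then have "(cmod (g x))\<^sup>2 \<le> B\<^sup>2" using g(2)[of x] by (intro power_mono) auto
      then have "(cmod (g x))\<^sup>2 * (cmod (f x))\<^sup>2 \<le> B\<^sup>2 * (cmod (f x))\<^sup>2" by (intro mult_right_mono) auto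
      then show "norm ((cmod (g x * f x))\<^sup>2) \<le> norm (B\<^sup>2 * (cmod (f x))\<^sup>2)"
        by (simp add: norm_mult power_mult_distrib)
    qed
  qed
  then show ?thesis using m g(1) by (simp add: L2_def)
qed

lemma cmod_add_power2: "(cmod (a + b))\<^sup>2 = (cmod b)\<^sup>2 + (cmod a)\<^sup>2 + 2 * Re (a * cnj b)"
  unfolding cmod_power2 by (simp add: power2_eq_square algebra_simps)

text \<open>Each mode of the competitor \<open>v\<close> is orthogonal to the difference \<open>h = u - v\<close> by
  \<open>matched_mode_orthogonal\<close>, so \<open>J u = J v + \<integral> \<bar>\<nabla>h - i k h x/\<bar>x\<bar>\<bar>\<^sup>2\<close>. As \<open>u\<close> is a minimizer the last integral is
  zero, and \<open>outgoing_gradient_imp_zero\<close> yields \<open>h = 0\<close>. Uniqueness of the minimizer is thus a by-product.\<close>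

lemma minimizer_eq_modes:
  assumes R: "0 < R0" "R0 < R" and k: "0 < k" and p: "\<And>n. bessel_sol k R0 n (p n) (p' n)"
    and bc: "\<And>n. \<bar>n\<bar> \<le> int N \<Longrightarrow> p n R0 = c n"
    and z: "\<And>n. n \<in> {- int N..int N} \<Longrightarrow> \<exists>z z'. bessel_sol k R0 n z z' \<and> adjoint_matched k R0 R n (p n) (p' n) z z'"
    and u: "is_minimizer k R0 R (trig_poly N c) u"
  shows "AE x in lebesgue_on (annulus R0 R). u x = modes N p x"
proof -
  let ?O = "annulus R0 R" and ?C = "closed_annulus R0 R" and ?v = "modes N p"
  let ?M = "lebesgue_on ?O"
  have ua: "u \<in> H1 ?O" "weak_helmholtz k ?O u" "has_trace_on_circle ?O R0 u (trig_poly N c)"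
    and umin: "\<And>w. w \<in> admissible k R0 R (trig_poly N c) \<Longrightarrow> J k R0 R u \<le> J k R0 R w"
    using u by (auto simp: is_minimizer_def admissible_def)
  note v = bessel_modes_H1[OF R k p, where N=N]
  have va: "?v \<in> admissible k R0 R (trig_poly N c)"
    unfolding admissible_def using v(2) weak_helmholtz_bessel_modes[OF R k p] trace_bessel_modes[OF R k p bc] by blast
  obtain G where G: "has_weak_grad ?O u G" "\<And>i. (\<lambda>x. G x $ i) \<in> L2 ?O" using ua(1) by (auto simp: H1_def)
  let ?Gv = "\<lambda>x. \<chi> i. partial_deriv i ?v x"
  have Gv: "\<And>i. (\<lambda>x. ?Gv x $ i) \<in> L2 ?O" using v(4) by simp
  define h where "h x = u x - ?v x" for x
  define H where "H x = G x - ?Gv x" for x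
  have uL2: "u \<in> L2 ?O" using ua(1) by (simp add: H1_def)
  have hL2: "h \<in> L2 ?O" unfolding h_def by (rule L2_diff[OF uL2 v(3)])
  have HL2: "(\<lambda>x. H x $ i) \<in> L2 ?O" for i unfolding H_def using L2_diff[OF G(2) Gv, of i] by simp
  have Hg: "has_weak_grad ?O h H" unfolding h_def H_def by (rule has_weak_grad_diff[OF open_annulus G(1) v(1)])
  have wh: "weak_helmholtz k ?O h"
    unfolding weak_helmholtz_def
  proof (intro conjI ballI)
    show "h \<in> L1_loc ?O" using Hg by (simp add: has_weak_grad_def)
    fix \<phi> assume \<phi>: "\<phi> \<in> test_functions ?O"
    have t: "partial_deriv i \<phi> \<in> test_functions ?O" for i by (rule test_functions_partial_deriv[OF \<phi> open_annulus])
    have l: "u \<in> L1_loc ?O" "?v \<in> L1_loc ?O" using G(1) v(1) by (auto simp: has_weak_grad_def)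
    have i: "integrable ?M (\<lambda>x. w x * (laplacian \<phi> x + (of_real k)\<^sup>2 * \<phi> x))" if w: "w \<in> L1_loc ?O" for w
    proof -
      note I = integrable_L1_loc_mult_test[OF w open_annulus]
      have "integrable ?M (\<lambda>x. (w x * partial_deriv 1 (partial_deriv 1 \<phi>) x + w x * partial_deriv 2 (partial_deriv 2 \<phi>) x) + of_real k ^ 2 * (w x * \<phi> x))"
        by (intro Bochner_Integration.integrable_add integrable_mult_right I \<phi> test_functions_partial_deriv[OF t open_annulus])
      then show ?thesis by (simp add: laplacian_def sum_2 algebra_simps)
    qed
    show "(LINT x|?M. h x * (laplacian \<phi> x + (of_real k)\<^sup>2 * \<phi> x)) = 0"
      unfolding h_def left_diff_distrib Bochner_Integration.integral_diff[OF i[OF l(1)] i[OF l(2)]]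
      using ua(2) weak_helmholtz_bessel_modes[OF R k p, where N=N] \<phi> by (simp add: weak_helmholtz_def)
  qed
  have CT: "norm x \<in> {R0..R} \<and> x \<noteq> 0" if "x \<in> ?C" for x using that R by (auto simp: closed_annulus_def)
  have green: "(LINT x|?M. (\<Sum>i\<in>UNIV. H x $ i * vfield a b m i x) + h x * vdiv a a' b m x) = 0"
    if a: "continuous_on {R0..R} a" "continuous_on {R0..R} a'" "\<And>r. R0 < r \<Longrightarrow> r < R \<Longrightarrow> (a has_vector_derivative a' r) (at r)"
      and b: "continuous_on {R0..R} b" and aR: "a R = 0" for a a' b m
  proof -
    let ?Z = "- (of_real R0 * a R0 * integral {0..2 * pi} (\<lambda>\<omega>. trig_poly N c \<omega> * exp (\<i> * of_int m * of_real \<omega>)))"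
    have cV: "continuous_on ?C (vfield a b m i)" "continuous_on ?C (vdiv a a' b m)" for i
      by (rule continuous_on_vfield[OF a(1) b CT], assumption, rule continuous_on_vdiv[OF a(1,2) b CT], assumption)
    have i: "integrable ?M (\<lambda>x. (\<Sum>i\<in>UNIV. F x $ i * vfield a b m i x) + w x * vdiv a a' b m x)"
      if "w \<in> L2 ?O" "\<And>i. (\<lambda>x. F x $ i) \<in> L2 ?O" for F :: "real^2 \<Rightarrow> complex^2" and w
      by (intro Bochner_Integration.integrable_add Bochner_Integration.integrable_sum integrable_L2_mult_bounded that cV)
    have "(LINT x|?M. (\<Sum>i\<in>UNIV. H x $ i * vfield a b m i x) + h x * vdiv a a' b m x)
       = (LINT x|?M. ((\<Sum>i\<in>UNIV. G x $ i * vfield a b m i x) + u x * vdiv a a' b m x)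
          - ((\<Sum>i\<in>UNIV. ?Gv x $ i * vfield a b m i x) + ?v x * vdiv a a' b m x))"
      unfolding H_def h_def sum_2 by (rule Bochner_Integration.integral_cong[OF refl]) (simp add: algebra_simps)
    also have "\<dots> = (LINT x|?M. ((\<Sum>i\<in>UNIV. G x $ i * vfield a b m i x) + u x * vdiv a a' b m x))
          - (LINT x|?M. ((\<Sum>i\<in>UNIV. ?Gv x $ i * vfield a b m i x) + ?v x * vdiv a a' b m x))"
      by (rule Bochner_Integration.integral_diff[OF i[OF uL2 G(2)] i[OF v(3) Gv]])
    also have "\<dots> = ?Z - ?Z"
    proof (rule arg_cong2[where f=minus])
      show "(LINT x|?M. ((\<Sum>i\<in>UNIV. G x $ i * vfield a b m i x) + u x * vdiv a a' b m x)) = ?Z"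
        by (rule green_trace[OF R ua(1) G ua(3) continuous_on_trig_poly a b aR])
      show "(LINT x|?M. ((\<Sum>i\<in>UNIV. ?Gv x $ i * vfield a b m i x) + ?v x * vdiv a a' b m x)) = ?Z"
        by (rule green_trace[OF R v(2) v(1) Gv trace_bessel_modes[OF R k p bc] continuous_on_trig_poly a b aR])
    qed
    also have "\<dots> = 0" by simp
    finally show ?thesis .
  qed
  define Lh where "Lh i x = H x $ i - \<i> * of_real k * h x * rhat i x" for i x
  define Lv where "Lv i x = ?Gv x $ i - \<i> * of_real k * ?v x * rhat i x" for i x
  have mr: "rhat i \<in> borel_measurable ?M" for i
    by (rule continuous_imp_measurable_on_sets_lebesgue[OF continuous_on_subset[OF Ck_on_continuous[OF Ck_on_rhat[of 0]]] annulus_sets])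
       (use R in auto)
  have krL2: "(\<lambda>x. \<i> * of_real k * w x * rhat i x) \<in> L2 ?O" if "w \<in> L2 ?O" for w i
  proof -
    have "(\<lambda>x. (\<i> * of_real k * rhat i x) * w x) \<in> L2 ?O"
      by (rule L2_mult_bounded[OF that, where B=k])
         (use mr k mult_left_le[OF norm_rhat_le, of k] in \<open>auto simp: norm_mult\<close>)
    then show ?thesis by (simp add: mult_ac)
  qed
  have L2Lh: "Lh i \<in> L2 ?O" and L2Lv: "Lv i \<in> L2 ?O" for i
    unfolding Lh_def[abs_def] Lv_def[abs_def]
    by (rule L2_diff[OF HL2 krL2[OF hL2]], rule L2_diff[OF Gv krL2[OF v(3)]])
  let ?W = "\<lambda>n. vfield (\<lambda>r. p' n r - \<i> * of_real k * p n r) (\<lambda>r. \<i> * of_int n * p n r / of_real r) n"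
  have Lv: "Lv i x = (\<Sum>n = - int N..int N. ?W n i x)" if x: "x \<in> ?O" for i x
  proof -
    have x0: "R0 < norm x" "x \<noteq> 0" using x R by auto
    have "Lv i x = (\<Sum>n = - int N..int N. vfield (p' n) (\<lambda>r. \<i> * of_int n * p n r / of_real r) n i x) - \<i> * of_real k * modes N p x * rhat i x"
      unfolding Lv_def using partial_deriv_modes[where q=p and q'=p', OF bessel_solD(3)[OF p x0(1)] x0(2)] by simp
    also have "\<dots> = (\<Sum>n = - int N..int N. vfield (p' n) (\<lambda>r. \<i> * of_int n * p n r / of_real r) n i x - \<i> * of_real k * mode (p n) n x * rhat i x)"
      by (simp add: modes_def sum_subtractf sum_distrib_left sum_distrib_right)
    also have "\<dots> = (\<Sum>n = - int N..int N. ?W n i x)"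
      by (intro sum.cong refl) (simp add: vfield_def mode_def algebra_simps)
    finally show ?thesis .
  qed
  have sub: "{R0..R} \<subseteq> {R0..}" by auto
  have cW: "continuous_on ?C (?W n i)" for n i
    by (rule continuous_on_vfield[OF _ _ CT])
       (use R in \<open>auto intro!: continuous_intros continuous_on_subset[OF bessel_solD(1)[OF p] sub] continuous_on_subset[OF bessel_solD(2)[OF p] sub]\<close>)
  have cWc: "continuous_on ?C (\<lambda>x. cnj (?W n i x))" for n i by (intro continuous_intros cW)
  have iW: "integrable ?M (\<lambda>x. (\<Sum>i\<in>UNIV. Lh i x * cnj (?W n i x)))" for n
    by (intro Bochner_Integration.integrable_sum integrable_L2_mult_bounded L2Lh cWc)
  have orth_n: "(LINT x|?M. (\<Sum>i\<in>UNIV. Lh i x * cnj (?W n i x))) = 0" if n: "n \<in> {- int N..int N}" for n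
  proof -
    obtain z z' where zz: "bessel_sol k R0 n z z'" "adjoint_matched k R0 R n (p n) (p' n) z z'" using z[OF n] by blast
    show ?thesis unfolding Lh_def
      by (rule matched_mode_orthogonal[OF R hL2 Hg HL2 wh green p zz])
  qed
  \<comment> \<open>the flux field of the candidate is the sum of the flux fields of its modes\<close>
  have pw: "(\<Sum>i\<in>UNIV. Lh i x * cnj (Lv i x)) = (\<Sum>n = - int N..int N. (\<Sum>i\<in>UNIV. Lh i x * cnj (?W n i x)))" if x: "x \<in> ?O" for x
    unfolding Lv[OF x] cnj_sum sum_distrib_left by (rule sum.swap)
  have iP: "integrable ?M (\<lambda>x. (\<Sum>i\<in>UNIV. Lh i x * cnj (Lv i x)))"
  proof -
    have "integrable ?M (\<lambda>x. \<Sum>n = - int N..int N. (\<Sum>i\<in>UNIV. Lh i x * cnj (?W n i x)))" by (intro Bochner_Integration.integrable_sum iW)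
    then show ?thesis by (subst Bochner_Integration.integrable_cong[OF refl pw]) auto
  qed
  have orth: "(LINT x|?M. (\<Sum>i\<in>UNIV. Lh i x * cnj (Lv i x))) = 0"
  proof -
    have "(LINT x|?M. (\<Sum>i\<in>UNIV. Lh i x * cnj (Lv i x))) = (LINT x|?M. (\<Sum>n = - int N..int N. (\<Sum>i\<in>UNIV. Lh i x * cnj (?W n i x))))"
      by (rule Bochner_Integration.integral_cong[OF refl]) (simp add: pw)
    also have "\<dots> = (\<Sum>n = - int N..int N. (LINT x|?M. (\<Sum>i\<in>UNIV. Lh i x * cnj (?W n i x))))"
      by (rule Bochner_Integration.integral_sum) (rule iW)
    also have "\<dots> = 0" using orth_n by simp
    finally show ?thesis .
  qed
  have iLh: "integrable ?M (\<lambda>x. \<Sum>i\<in>UNIV. (cmod (Lh i x))\<^sup>2)" and iLv: "integrable ?M (\<lambda>x. \<Sum>i\<in>UNIV. (cmod (Lv i x))\<^sup>2)"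
    using L2Lh L2Lv by (auto simp: L2_def intro!: Bochner_Integration.integrable_sum)
  have Ju: "J k R0 R u = J k R0 R ?v + (LINT x|?M. (\<Sum>i\<in>UNIV. (cmod (Lh i x))\<^sup>2))"
  proof -
    have "G x $ i - \<i> * of_real k * u x * rhat i x = Lh i x + Lv i x" for x i
      by (simp add: Lh_def Lv_def H_def h_def algebra_simps)
    then have "J k R0 R u = (LINT x|?M. (\<Sum>i\<in>UNIV. (cmod (Lh i x + Lv i x))\<^sup>2))"
      unfolding J_eq[OF G(1)] by simp
    also have "\<dots> = (LINT x|?M. ((\<Sum>i\<in>UNIV. (cmod (Lv i x))\<^sup>2) + (\<Sum>i\<in>UNIV. (cmod (Lh i x))\<^sup>2)) + 2 * Re (\<Sum>i\<in>UNIV. Lh i x * cnj (Lv i x)))"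
      unfolding cmod_add_power2 sum_2 by (simp only: Re_sum plus_complex.sel distrib_left add_ac)
    also have "\<dots> = (LINT x|?M. (\<Sum>i\<in>UNIV. (cmod (Lv i x))\<^sup>2)) + (LINT x|?M. (\<Sum>i\<in>UNIV. (cmod (Lh i x))\<^sup>2)) + 2 * (LINT x|?M. Re (\<Sum>i\<in>UNIV. Lh i x * cnj (Lv i x)))"
      using Bochner_Integration.integral_add[OF Bochner_Integration.integrable_add[OF iLv iLh] integrable_mult_right[OF integrable_Re[OF iP], of 2]]
        Bochner_Integration.integral_add[OF iLv iLh] by (simp only: integral_mult_right_zero)
    also have "(LINT x|?M. Re (\<Sum>i\<in>UNIV. Lh i x * cnj (Lv i x))) = 0"
      unfolding integral_Re[OF iP] orth by simp
    also have "(LINT x|?M. (\<Sum>i\<in>UNIV. (cmod (Lv i x))\<^sup>2)) = J k R0 R ?v"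
      unfolding J_eq[OF v(1)] Lv_def ..
    finally show ?thesis by simp
  qed
  have "(LINT x|?M. (\<Sum>i\<in>UNIV. (cmod (Lh i x))\<^sup>2)) \<le> 0" using umin[OF va] Ju by linarith
  moreover have "(LINT x|?M. (\<Sum>i\<in>UNIV. (cmod (Lh i x))\<^sup>2)) \<ge> 0" by (intro Bochner_Integration.integral_nonneg sum_nonneg) auto
  ultimately have "(LINT x|?M. (\<Sum>i\<in>UNIV. (cmod (Lh i x))\<^sup>2)) = 0" by linarith
  then have ae: "AE x in ?M. (\<Sum>i\<in>UNIV. (cmod (Lh i x))\<^sup>2) = 0"
    by (subst (asm) integral_nonneg_eq_0_iff_AE[OF iLh]) (auto intro!: AE_I2 sum_nonneg)
  have "AE x in ?M. H x $ i = \<i> * of_real k * h x * rhat i x" for i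
    using ae
  proof eventually_elim
    case (elim x)
    then have "(cmod (Lh i x))\<^sup>2 = 0" using sum_nonneg_eq_0_iff[of UNIV "\<lambda>i. (cmod (Lh i x))\<^sup>2"] by auto
    then show ?case by (simp add: Lh_def)
  qed
  from outgoing_gradient_imp_zero[OF R(1) k Hg wh this]
  show ?thesis by eventually_elim (simp add: h_def)
qed

lemma H1_cong:
  assumes "\<And>x. x \<in> \<Omega> \<Longrightarrow> u x = w x" "open \<Omega>" "w \<in> H1 \<Omega>"
  shows "u \<in> H1 \<Omega>"
proof -
  have sp: "u x = w x" if "x \<in> space (lebesgue_on \<Omega>)" for x using that assms(1) by simp
  have "u \<in> L2 \<Omega>" using assms(3) measurable_cong[of "lebesgue_on \<Omega>" u w borel, OF sp]
    Bochner_Integration.integrable_cong[of "lebesgue_on \<Omega>" "lebesgue_on \<Omega>" "\<lambda>x. (cmod (u x))\<^sup>2" "\<lambda>x. (cmod (w x))\<^sup>2"] sp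
    by (auto simp: H1_def L2_def)
  moreover have "AE x in lebesgue_on \<Omega>. u x = w x" by (rule AE_I2) (rule sp)
  then have "has_weak_grad \<Omega> u G" if "has_weak_grad \<Omega> w G" for G
    using has_weak_grad_cong_AE[OF _ _ that] assms(2) by auto
  ultimately show ?thesis using assms(3) unfolding H1_def by blast
qed

lemma H1_norm_cong_AE:
  assumes O: "open \<Omega>" and ae: "AE x in lebesgue_on \<Omega>. u x = w x" and G: "has_weak_grad \<Omega> w G"
  shows "H1_norm \<Omega> u = H1_norm \<Omega> w"
proof -
  have S: "\<Omega> \<in> sets lebesgue" using O by auto
  have "(LINT x|lebesgue_on \<Omega>. (norm (u x))\<^sup>2) = (LINT x|lebesgue_on \<Omega>. (norm (w x))\<^sup>2)"
    by (rule lebesgue_on_cong_AE(2)[OF S]) (use ae in \<open>eventually_elim, simp\<close>)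
  then show ?thesis
    unfolding H1_norm_eq[OF O G] H1_norm_eq[OF O has_weak_grad_cong_AE[OF ae S G]] by simp
qed

theorem theorem3p4:
  fixes k R0 Rstar :: real and N :: nat and c :: "int \<Rightarrow> complex"
    and \<psi> :: "real^2 \<Rightarrow> complex" and u :: "real \<Rightarrow> real^2 \<Rightarrow> complex"
  assumes "k > 0" and "R0 > 0" and "Rstar > R0"
    and "outgoing_solution k R0 (trig_poly N c) \<psi>"
    and "\<And>R. R > R0 \<Longrightarrow> is_minimizer k R0 R (trig_poly N c) (u R)"
  shows "(\<forall>R>R0. (\<lambda>x. \<psi> x - u R x) \<in> H1 (annulus R0 R)) \<and>
    (\<lambda>R. H1_norm (annulus R0 Rstar) (\<lambda>x. \<psi> x - u R x)) \<in> O[at_top](\<lambda>R. R powr (-1)) \<and>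
    (\<lambda>R. H1_norm (annulus R0 R) (\<lambda>x. \<psi> x - u R x)) \<in> O[at_top](\<lambda>R. R powr (-1/2))"
proof -
  note k = assms(1) and R0 = assms(2) and Rs = assms(3)
  obtain x x' where x: "\<And>n. bessel_sol k R0 n (x n) (x' n)" "\<And>n. outgoing k (x n) (x' n)"
    and xc: "\<And>n. \<bar>n\<bar> \<le> int N \<Longrightarrow> x n R0 = c n"
    and \<psi>: "\<And>y. R0 \<le> norm y \<Longrightarrow> \<psi> y = (\<Sum>n = - int N..int N. x n (norm y) * emode n y)"
  proof (rule outgoing_solution_expansion[OF R0 k assms(4)])
    fix x x' assume a: "\<And>n. bessel_sol k R0 n (x n) (x' n)" "\<And>n. outgoing k (x n) (x' n)"
      "\<And>n. \<bar>n\<bar> \<le> int N \<Longrightarrow> x n R0 = c n"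
      "\<And>y. R0 \<le> norm y \<Longrightarrow> \<psi> y = (\<Sum>n = - int N..int N. x n (norm y) * emode n y)"
    show thesis by (rule that[of x x', OF a])
  qed
  have \<psi>m: "\<psi> y = modes N x y" if "R0 \<le> norm y" for y using \<psi>[OF that] by (simp add: modes_def mode_def)
  define Q where "Q n f f' C R1 \<longleftrightarrow> bessel_sol k R0 n f f' \<and> f R0 = 0 \<and> R1 \<ge> R0 \<and> C > 0 \<and>
      (\<forall>r\<ge>R0. sqrt r * cmod (f r) \<le> C) \<and> (\<forall>r\<ge>R0. sqrt r * cmod (f' r) \<le> C) \<and>
      (\<forall>R\<ge>R1. \<exists>a z z'. cmod a \<le> C / R \<and> bessel_sol k R0 n z z' \<and>
        adjoint_matched k R0 R n (\<lambda>r. x n r - a * f r) (\<lambda>r. x' n r - a * f' r) z z')" for n f f' C R1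
  have "\<exists>f f' C R1. Q n f f' C R1" for n
  proof (rule corrector_exists[OF x(1)[of n] R0 k x(2)[of n]])
    fix f f' C R1
    assume a: "bessel_sol k R0 n f f'" "f R0 = 0" "R1 \<ge> R0" "C > 0"
      "\<And>r. R0 \<le> r \<Longrightarrow> sqrt r * cmod (f r) \<le> C" "\<And>r. R0 \<le> r \<Longrightarrow> sqrt r * cmod (f' r) \<le> C"
      "\<And>R. R1 \<le> R \<Longrightarrow> \<exists>a z z'. cmod a \<le> C / R \<and> bessel_sol k R0 n z z' \<and>
        adjoint_matched k R0 R n (\<lambda>r. x n r - a * f r) (\<lambda>r. x' n r - a * f' r) z z'"
    have "Q n f f' C R1" unfolding Q_def by (intro conjI allI impI a)
    then show ?thesis by blast
  qed
  then obtain f f' C R1 where Q: "\<And>n. Q n (f n) (f' n) (C n) (R1 n)" by metis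
  then have f: "\<And>n. bessel_sol k R0 n (f n) (f' n)" "\<And>n. f n R0 = 0" "\<And>n. R1 n \<ge> R0" "\<And>n. C n > 0"
      "\<And>n r. R0 \<le> r \<Longrightarrow> sqrt r * cmod (f n r) \<le> C n" "\<And>n r. R0 \<le> r \<Longrightarrow> sqrt r * cmod (f' n r) \<le> C n"
    by (simp_all add: Q_def)
  have fa: "\<exists>a z z'. cmod a \<le> C n / R \<and> bessel_sol k R0 n z z' \<and>
        adjoint_matched k R0 R n (\<lambda>r. x n r - a * f n r) (\<lambda>r. x' n r - a * f' n r) z z'" if "R1 n \<le> R" for n R
    using Q[of n] that unfolding Q_def by blast
  define K where "K = (\<Sum>n = - int N..int N. C n)"
  have CK: "C n \<le> K" if "n \<in> {- int N..int N}" for n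
    unfolding K_def using f(4) that by (intro member_le_sum) (auto intro: less_imp_le)
  have K0: "K > 0" using f(4)[of 0] CK[of 0] by simp
  define Rm where "Rm = Max (insert (max R0 Rstar + 1) (R1 ` {- int N..int N}))"
  have Rm: "max R0 Rstar + 1 \<le> Rm" "\<And>n. n \<in> {- int N..int N} \<Longrightarrow> R1 n \<le> Rm"
    unfolding Rm_def by (auto simp del: Max_insert intro!: Max_ge)
  define D where "D = modes_const N R0"
  have est: "H1_norm (annulus R0 R') (\<lambda>y. \<psi> y - u R y) \<le> D * (K * K / R) * sqrt R'"
    if R: "Rm \<le> R" and R': "R0 < R'" "R' \<le> R" for R R'
  proof -
    have Rp: "R0 < R" "R > 0" using R Rm(1) R0 by auto
    have "\<exists>a. cmod a \<le> C n / R \<and> (\<exists>z z'. bessel_sol k R0 n z z' \<and>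
        adjoint_matched k R0 R n (\<lambda>r. x n r - a * f n r) (\<lambda>r. x' n r - a * f' n r) z z')" if "n \<in> {- int N..int N}" for n
      using fa[OF order_trans[OF Rm(2)[OF that] R]] by blast
    then have "\<forall>n\<in>{- int N..int N}. \<exists>a. cmod a \<le> C n / R \<and> (\<exists>z z'. bessel_sol k R0 n z z' \<and>
        adjoint_matched k R0 R n (\<lambda>r. x n r - a * f n r) (\<lambda>r. x' n r - a * f' n r) z z')" by blast
    from bchoice[OF this] obtain a where a: "\<And>n. n \<in> {- int N..int N} \<Longrightarrow> cmod (a n) \<le> C n / R"
      and az: "\<And>n. n \<in> {- int N..int N} \<Longrightarrow> \<exists>z z'. bessel_sol k R0 n z z' \<and>
        adjoint_matched k R0 R n (\<lambda>r. x n r - a n * f n r) (\<lambda>r. x' n r - a n * f' n r) z z'" by blast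
    define p p' where "p = (\<lambda>n r. x n r - a n * f n r)" and "p' = (\<lambda>n r. x' n r - a n * f' n r)"
    have p: "bessel_sol k R0 n (p n) (p' n)" for n
      using bessel_sol_linear[OF x(1)[of n] f(1)[of n], of 1 "- a n"] by (simp add: p_def p'_def)
    have "AE y in lebesgue_on (annulus R0 R). u R y = modes N p y"
    proof (rule minimizer_eq_modes[OF R0 Rp(1) k p])
      show "p n R0 = c n" if "\<bar>n\<bar> \<le> int N" for n using xc[OF that] by (simp add: p_def f(2))
      show "\<exists>z z'. bessel_sol k R0 n z z' \<and> adjoint_matched k R0 R n (p n) (p' n) z z'" if "n \<in> {- int N..int N}" for n
        using az[OF that] by (simp add: p_def p'_def)
      show "is_minimizer k R0 R (trig_poly N c) (u R)" by (rule assms(5)[OF Rp(1)])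
    qed
    then have ae: "AE y in lebesgue_on (annulus R0 R'). u R y = modes N p y"
      by (rule AE_lebesgue_on_subset) (use R' in \<open>auto simp: annulus_sets\<close>)
    define q q' where "q = (\<lambda>n r. a n * f n r)" and "q' = (\<lambda>n r. a n * f' n r)"
    have ae': "AE y in lebesgue_on (annulus R0 R'). \<psi> y - u R y = modes N q y"
      using ae AE_space
    proof eventually_elim
      case (elim y)
      then have "R0 \<le> norm y" by simp
      then show ?case using elim(1) by (simp add: \<psi>m modes_diff p_def q_def)
    qed
    have KK: "0 \<le> K * K / R" using K0 Rp by simp
    have b: "sqrt r * cmod (a n * w) \<le> K * K / R" if n: "n \<in> {- int N..int N}" and w: "sqrt r * cmod w \<le> C n" for n r w
    proof -
      have "sqrt r * cmod (a n * w) = cmod (a n) * (sqrt r * cmod w)" by (simp add: norm_mult)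
      also have "\<dots> \<le> cmod (a n) * C n" using w by (intro mult_left_mono) auto
      also have "\<dots> \<le> (C n / R) * C n" using a[OF n] f(4)[of n] by (intro mult_right_mono) auto
      also have "\<dots> \<le> K / R * K" using CK[OF n] f(4)[of n] Rp by (intro mult_mono divide_right_mono) auto
      finally show ?thesis by simp
    qed
    note me = modes_estimate[OF R0 R'(1) KK, of N q q']
    have 1: "(q n has_vector_derivative q' n r) (at r)" if "R0 < r" for n r
      unfolding q_def q'_def by (intro has_vector_derivative_mult_right bessel_solD(3)[OF f(1)] that)
    have 2: "continuous_on {R0<..<R'} (q' n)" for n
      unfolding q'_def by (intro continuous_on_mult continuous_on_const continuous_on_subset[OF bessel_solD(2)[OF f(1)]]) auto
    have 3: "sqrt r * cmod (q n r) \<le> K * K / R" "sqrt r * cmod (q' n r) \<le> K * K / R" if "n \<in> {- int N..int N}" "R0 < r" for n r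
      unfolding q_def q'_def using that f(5,6)[of r n] by (auto intro!: b)
    have wg: "has_weak_grad (annulus R0 R') (modes N q) (\<lambda>x. \<chi> i. partial_deriv i (modes N q) x)"
      and "H1_norm (annulus R0 R') (modes N q) \<le> modes_const N R0 * (K * K / R) * sqrt R'"
      by (rule me; use 1 2 3 in auto)+
    then show ?thesis unfolding D_def H1_norm_cong_AE[OF open_annulus ae' wg] by simp
  qed
  have nn: "H1_norm \<Omega> w \<ge> 0" for \<Omega> :: "(real^2) set" and w by (simp add: H1_norm_def)
  have "(\<lambda>y. \<psi> y - u R y) \<in> H1 (annulus R0 R)" if R: "R > R0" for R
  proof -
    have "\<psi> \<in> H1 (annulus R0 R)"
      by (rule H1_cong[OF _ open_annulus bessel_modes_H1(2)[OF R0 R k x(1)]]) (simp add: \<psi>m)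
    moreover have "u R \<in> H1 (annulus R0 R)" using assms(5)[OF R] by (simp add: is_minimizer_def admissible_def)
    ultimately show ?thesis by (rule H1_diff[OF open_annulus])
  qed
  moreover have "(\<lambda>R. H1_norm (annulus R0 Rstar) (\<lambda>y. \<psi> y - u R y)) \<in> O[at_top](\<lambda>R. R powr (-1))"
  proof (rule bigoI[where c="D * (K * K) * sqrt Rstar"])
    show "\<forall>\<^sub>F R in at_top. norm (H1_norm (annulus R0 Rstar) (\<lambda>y. \<psi> y - u R y)) \<le> D * (K * K) * sqrt Rstar * norm (R powr (-1))"
      using eventually_ge_at_top[of Rm]
    proof eventually_elim
      case (elim R)
      then have R: "R > 0" "Rstar \<le> R" using Rm(1) R0 by auto
      have "R powr (-1) = 1 / R" using R by (simp add: powr_minus_divide)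
      then show ?case using est[OF elim Rs R(2)] nn R by simp
    qed
  qed
  moreover have "(\<lambda>R. H1_norm (annulus R0 R) (\<lambda>y. \<psi> y - u R y)) \<in> O[at_top](\<lambda>R. R powr (-1/2))"
  proof (rule bigoI[where c="D * (K * K)"])
    show "\<forall>\<^sub>F R in at_top. norm (H1_norm (annulus R0 R) (\<lambda>y. \<psi> y - u R y)) \<le> D * (K * K) * norm (R powr (-1/2))"
      using eventually_ge_at_top[of Rm]
    proof eventually_elim
      case (elim R)
      then have R: "R > 0" "R0 < R" using Rm(1) R0 by auto
      have "R powr (-1/2) = inverse (sqrt R)" using R by (simp add: powr_minus powr_half_sqrt)
      also have "\<dots> = sqrt R / R" using R by (simp add: field_simps)
      finally have "D * (K * K / R) * sqrt R = D * (K * K) * R powr (-1/2)" by simp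
      then show ?case using est[OF elim R(2) order_refl] nn by simp
    qed
  qed
  ultimately show ?thesis by blast
qed

end
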